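(* Let $g$ be a simple metric of revolution on the 2-sphere $\mathbb{S}$ that is generic, in the sense that its Weyl counting function satisfies $N(\lambda)=c\lambda^2+O(\lambda^{2/3})$. Let $U:=\mathbb{S}\setminus(\text{poles}\cup\text{equator})$ and let $K\subset U$ be compact. Then there exists a constant $C$ (which may depend on $K$ and on the metric $g$, but not on $\lambda$) such that $$\left\|P_{\lambda,\lambda^{-1/3}}\right\|_{L^2(\mathbb{S})\to L^\infty(K)}\leq C\,\lambda^{\frac12-\frac1{12}}\qquad\text{for all }\lambda>0 .$$
   Context: A metric of revolution $g$ on the 2-sphere $\mathbb{S}$ is called simple if it is smooth and, outside the two poles, it is written $g=a(s)^2\,d\theta^2+ds^2$ with $\theta\in\mathbb{R}/2\pi\mathbb{Z}$, $s\in(0,L)$, where $a:[0,L]\to[0,\infty)$ is a smooth function vanishing at $0$ and $L$ and having only one critical point, which is a non-degenerate maximum. The poles are the points $s=0$ and $s=L$; the equator is the circle $\{s=s_0\}$ where $s_0$ is the critical point of $a$. $\Delta$ denotes the Laplace-Beltrami operator of $(\mathbb{S},g)$. Let $0\leq\lambda_1^2\leq\lambda_2^2\leq\dots$ be the eigenvalues of $-\Delta$ counted with multiplicity ($\lambda_j\geq 0$), and $N(\lambda):=\#\{j\geq1:\lambda_j\leq\lambda\}$. For $\lambda,\delta>0$, $P_{\lambda,\delta}:=1_{[\lambda-\delta,\lambda+\delta]}(\sqrt{-\Delta})$, defined by functional calculus, where $1_{[\lambda-\delta,\lambda+\delta]}$ is the indicator function of the interval. The norm $\|P_{\lambda,\delta}\|_{L^2(\mathbb{S})\to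 L^\infty(K)}$ is the operator norm of $f\mapsto (P_{\lambda,\delta}f)|_K$.
   Formalization: The bound is proved for all λ ≥ Λ₀, for each Λ₀ > 0, with C depending also on Λ₀; a single C for all λ > 0 is impossible when K is nonempty, since for λ ≤ 1 the window contains the eigenvalue 0, so the norm is at least vol^(-1/2) while Cλ^(5/12) tends to 0. *)

theory Defs
  imports "HOL-Analysis.Analysis" "HOL-Library.Landau_Symbols"
begin

primrec times_differentiable ::
  "nat \<Rightarrow> 'a::real_normed_vector set \<Rightarrow> ('a \<Rightarrow> 'b::real_normed_vector) \<Rightarrow> bool" where
  "times_differentiable 0 W f \<longleftrightarrow> continuous_on W f"
| "times_differentiable (Suc k) W f \<longleftrightarrow>
     (\<exists>D. (\<forall>x\<in>W. (f has_derivative D x) (at x)) \<and>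
          (\<forall>v. times_differentiable k W (\<lambda>x. D x v)))"

text \<open>Smoothness on a set that need not be open (a closed interval, the sphere) means being the
  restriction of a smooth function on an open neighbourhood.\<close>

definition smooth_on ::
  "'a::real_normed_vector set \<Rightarrow> ('a \<Rightarrow> 'b::real_normed_vector) \<Rightarrow> bool" where
  "smooth_on A f \<longleftrightarrow>
     (\<exists>W F. open W \<and> A \<subseteq> W \<and> (\<forall>k. times_differentiable k W F) \<and> (\<forall>x\<in>A. F x = f x))"

definition partial_deriv ::
  "'n::finite \<Rightarrow> (real^'n \<Rightarrow> 'b::real_normed_vector) \<Rightarrow> real^'n \<Rightarrow> 'b" where
  "partial_deriv i f x = frechet_derivative f (at x) (axis i 1)"

abbreviation S2 :: "(real^3) set" where "S2 \<equiv> sphere 0 1"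

definition tangent_space :: "real^3 \<Rightarrow> (real^3) set" where
  "tangent_space p = {v. v \<bullet> p = 0}"

definition tangent_proj :: "real^3 \<Rightarrow> real^3 \<Rightarrow> real^3" where
  "tangent_proj p v = v - (v \<bullet> p) *\<^sub>R p"

type_synonym metric = "real^3 \<Rightarrow> real^3 \<Rightarrow> real^3 \<Rightarrow> real"

text \<open>Only the values \<open>g p u v\<close> with \<open>p\<close> on the sphere and \<open>u\<close>, \<open>v\<close> tangent at \<open>p\<close> matter; the
  projections extend \<open>g p\<close> to the whole of 3-space so that bilinearity and smooth dependence on
  \<open>p\<close> can be expressed with fixed vectors.\<close>

definition riemannian_metric :: "metric \<Rightarrow> bool" where
  "riemannian_metric g \<longleftrightarrow>
     (\<forall>p\<in>S2. bilinear (\<lambda>u v. g p (tangent_proj p u) (tangent_proj p v)) \<and>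
        (\<forall>u\<in>tangent_space p. \<forall>v\<in>tangent_space p. g p u v = g p v u) \<and>
        (\<forall>v\<in>tangent_space p. v \<noteq> 0 \<longrightarrow> g p v v > 0)) \<and>
     (\<forall>u v. smooth_on S2 (\<lambda>p. g p (tangent_proj p u) (tangent_proj p v)))"

definition sphere_chart :: "(real^2) set \<Rightarrow> (real^2 \<Rightarrow> real^3) \<Rightarrow> bool" where
  "sphere_chart W \<psi> \<longleftrightarrow> open W \<and> smooth_on W \<psi> \<and> inj_on \<psi> W \<and> \<psi> ` W \<subseteq> S2 \<and>
     (\<forall>x\<in>W. inj (frechet_derivative \<psi> (at x)))"

definition metric_matrix :: "metric \<Rightarrow> (real^2 \<Rightarrow> real^3) \<Rightarrow> real^2 \<Rightarrow> real^2^2" where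
  "metric_matrix g \<psi> x = (\<chi> i j. g (\<psi> x) (partial_deriv i \<psi> x) (partial_deriv j \<psi> x))"

definition coord_laplacian ::
  "(real^2 \<Rightarrow> real^2^2) \<Rightarrow> (real^2 \<Rightarrow> complex) \<Rightarrow> real^2 \<Rightarrow> complex" where
  "coord_laplacian G f x =
     (\<Sum>i\<in>UNIV. partial_deriv i
        (\<lambda>y. sqrt (det (G y)) *\<^sub>R (\<Sum>j\<in>UNIV. (matrix_inv (G y) $ i $ j) *\<^sub>R partial_deriv j f y)) x)
      /\<^sub>R sqrt (det (G x))"

text \<open>\<open>laplace_beltrami g u w\<close> says that the Laplace-Beltrami operator of the metric \<open>g\<close> maps the
  function \<open>u\<close> on the sphere to \<open>w\<close>.\<close>

definition laplace_beltrami :: "metric \<Rightarrow> (real^3 \<Rightarrow> complex) \<Rightarrow> (real^3 \<Rightarrow> complex) \<Rightarrow> bool" where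
  "laplace_beltrami g u w \<longleftrightarrow>
     (\<forall>W \<psi>. sphere_chart W \<psi> \<longrightarrow>
        (\<forall>x\<in>W. coord_laplacian (metric_matrix g \<psi>) (u \<circ> \<psi>) x = w (\<psi> x)))"

text \<open>Functions on the sphere are extended by 0. By elliptic regularity all \<open>L\<^sup>2\<close> eigenfunctions are
  smooth, so restricting to smooth functions loses nothing.\<close>

definition eigenspace :: "metric \<Rightarrow> real \<Rightarrow> (real^3 \<Rightarrow> complex) set" where
  "eigenspace g \<mu> = {u. smooth_on S2 u \<and> (\<forall>x. x \<notin> S2 \<longrightarrow> u x = 0) \<and>
     laplace_beltrami g u (\<lambda>p. - (\<mu>\<^sup>2 *\<^sub>R u p))}"

definition critical_point :: "real \<Rightarrow> (real \<Rightarrow> real) \<Rightarrow> real \<Rightarrow> bool" where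
  "critical_point L a s \<longleftrightarrow> s \<in> {0..L} \<and> (a has_real_derivative 0) (at s within {0..L})"

definition simple_profile :: "real \<Rightarrow> (real \<Rightarrow> real) \<Rightarrow> bool" where
  "simple_profile L a \<longleftrightarrow> 0 < L \<and> smooth_on {0..L} a \<and> (\<forall>s\<in>{0..L}. 0 \<le> a s) \<and> a 0 = 0 \<and> a L = 0 \<and>
     (\<exists>s0\<in>{0<..<L}. (\<forall>s. critical_point L a s \<longleftrightarrow> s = s0) \<and>
        (\<forall>s\<in>{0..L}. a s \<le> a s0) \<and> deriv (deriv a) s0 \<noteq> 0)"

definition poles :: "real \<Rightarrow> (real^2 \<Rightarrow> real^3) \<Rightarrow> (real^3) set" where
  "poles L \<Phi> = \<Phi> ` {x. x$1 = 0 \<or> x$1 = L}"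

definition equator :: "real \<Rightarrow> (real \<Rightarrow> real) \<Rightarrow> (real^2 \<Rightarrow> real^3) \<Rightarrow> (real^3) set" where
  "equator L a \<Phi> = \<Phi> ` {x. critical_point L a (x$1)}"

text \<open>\<open>\<Phi>\<close> sends the coordinates \<open>(s, \<theta>) = (x$1, x$2)\<close> to the point of the sphere with these
  coordinates; the angle ranges over the reals and \<open>\<Phi>\<close> is \<open>2\<pi>\<close>-periodic in it. The two boundary
  lines \<open>s = 0\<close> and \<open>s = L\<close> are collapsed to the two poles.\<close>

definition revolution_coordinates ::
  "metric \<Rightarrow> real \<Rightarrow> (real \<Rightarrow> real) \<Rightarrow> (real^2 \<Rightarrow> real^3) \<Rightarrow> bool" where
  "revolution_coordinates g L a \<Phi> \<longleftrightarrow>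
     smooth_on {x. 0 < x$1 \<and> x$1 < L} \<Phi> \<and>
     continuous_on {x. 0 \<le> x$1 \<and> x$1 \<le> L} \<Phi> \<and>
     (\<forall>x. \<Phi> (x + axis 2 (2 * pi)) = \<Phi> x) \<and>
     inj_on \<Phi> {x. 0 < x$1 \<and> x$1 < L \<and> 0 \<le> x$2 \<and> x$2 < 2 * pi} \<and>
     (\<exists>p q. p \<in> S2 \<and> q \<in> S2 \<and> p \<noteq> q \<and>
        (\<forall>x. x$1 = 0 \<longrightarrow> \<Phi> x = p) \<and> (\<forall>x. x$1 = L \<longrightarrow> \<Phi> x = q) \<and>
        \<Phi> ` {x. 0 < x$1 \<and> x$1 < L} = S2 - {p, q}) \<and>
     (\<forall>x. 0 < x$1 \<and> x$1 < L \<longrightarrow>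
        metric_matrix g \<Phi> x = vector [vector [1, 0], vector [0, (a (x$1))\<^sup>2]])"

definition simple_metric_of_revolution ::
  "metric \<Rightarrow> real \<Rightarrow> (real \<Rightarrow> real) \<Rightarrow> (real^2 \<Rightarrow> real^3) \<Rightarrow> bool" where
  "simple_metric_of_revolution g L a \<Phi> \<longleftrightarrow>
     riemannian_metric g \<and> simple_profile L a \<and> revolution_coordinates g L a \<Phi>"

text \<open>The Riemannian measure of \<open>g\<close>. The chart used covers the sphere up to a closed half-meridian,
  which is a null set. The measure lives on 3-space and is carried by the sphere.\<close>

definition riemannian_measure :: "metric \<Rightarrow> real \<Rightarrow> (real^2 \<Rightarrow> real^3) \<Rightarrow> (real^3) measure" where
  "riemannian_measure g L \<Phi> =
     distr (density (restrict_space lborel {x. 0 < x$1 \<and> x$1 < L \<and> 0 < x$2 \<and> x$2 < 2 * pi})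
              (\<lambda>x. ennreal (sqrt (det (metric_matrix g \<Phi> x)))))
       borel \<Phi>"

definition square_integrable :: "'a measure \<Rightarrow> ('a \<Rightarrow> complex) \<Rightarrow> bool" where
  "square_integrable M f \<longleftrightarrow> f \<in> borel_measurable M \<and> integrable M (\<lambda>x. (norm (f x))\<^sup>2)"

definition L2_inner :: "'a measure \<Rightarrow> ('a \<Rightarrow> complex) \<Rightarrow> ('a \<Rightarrow> complex) \<Rightarrow> complex" where
  "L2_inner M f h = (LINT x|M. f x * cnj (h x))"

text \<open>\<open>ev\<close> lists the square roots of the eigenvalues of minus the Laplacian in nondecreasing order,
  with multiplicity, and \<open>e\<close> is a corresponding \<open>L\<^sup>2\<close>-orthonormal family of eigenfunctions
  exhausting every eigenspace (indices start at 0). The finiteness clause records that the spectrum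
  is discrete, so that the cardinality in the counting function below is meaningful.\<close>

definition laplace_eigenbasis ::
  "metric \<Rightarrow> (real^3) measure \<Rightarrow> (nat \<Rightarrow> real) \<Rightarrow> (nat \<Rightarrow> real^3 \<Rightarrow> complex) \<Rightarrow> bool" where
  "laplace_eigenbasis g M ev e \<longleftrightarrow>
     (\<forall>j. 0 \<le> ev j) \<and> mono ev \<and> (\<forall>x. finite {j. ev j \<le> x}) \<and>
     (\<forall>i j. L2_inner M (e i) (e j) = (if i = j then 1 else 0)) \<and>
     (\<forall>\<mu>\<ge>0. eigenspace g \<mu> = range (\<lambda>c p. \<Sum>j | ev j = \<mu>. c j * e j p))"

definition weyl_count :: "(nat \<Rightarrow> real) \<Rightarrow> real \<Rightarrow> nat" where
  "weyl_count ev x = card {j. ev j \<le> x}"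

text \<open>In the functional calculus of the square root of minus the Laplacian, the operator given by a
  function \<open>F\<close> multiplies the eigenfunction \<open>e j\<close> by \<open>F (ev j)\<close>. Here \<open>F\<close> is the indicator function of
  a bounded interval, so the resulting orthogonal projection is a finite sum; it does not depend on
  the choice of \<open>e\<close>.\<close>

definition spectral_projector ::
  "'a measure \<Rightarrow> (nat \<Rightarrow> real) \<Rightarrow> (nat \<Rightarrow> 'a \<Rightarrow> complex) \<Rightarrow> real \<Rightarrow> real \<Rightarrow>
     ('a \<Rightarrow> complex) \<Rightarrow> 'a \<Rightarrow> complex" where
  "spectral_projector M ev e \<Lambda> \<delta> f =
     (\<lambda>p. \<Sum>j | ev j \<in> {\<Lambda> - \<delta>..\<Lambda> + \<delta>}. L2_inner M f (e j) * e j p)"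

text \<open>The operators considered have smooth values, so the norm on \<open>K\<close> is the pointwise supremum,
  which dominates the essential supremum and is also meaningful when \<open>K\<close> is a null set. The value
  is extended nonnegative real, hence infinite for unbounded operators.\<close>

definition norm_L2_to_Linf ::
  "'a measure \<Rightarrow> 'a set \<Rightarrow> (('a \<Rightarrow> complex) \<Rightarrow> 'a \<Rightarrow> complex) \<Rightarrow> ennreal" where
  "norm_L2_to_Linf M K T =
     (SUP f \<in> {f. square_integrable M f \<and> (LINT x|M. (norm (f x))\<^sup>2) \<le> 1}.
        SUP p \<in> K. ennreal (norm (T f p)))"

end

theory Submission
  imports Defs
begin

text \<open>
  Rotations about the axis are isometries, so they commute with the Laplacian and every spectral
  cluster \<open>h = \<Sum> d\<^sub>j e\<^sub>j\<close>, the sum running over the eigenvalues in the window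
  \<open>[l - \<delta>, l + \<delta>]\<close> with \<open>\<delta> = l\<^sup>-\<^sup>1\<^sup>/\<^sup>3\<close>, splits into angular modes \<open>h\<^sub>n\<close>, on which the rotation by
  \<open>t\<close> acts as multiplication by \<open>exp (i n t)\<close>. The Weyl law with remainder \<open>O (l\<^sup>2\<^sup>/\<^sup>3)\<close> puts only
  \<open>O (l\<^sup>2\<^sup>/\<^sup>3)\<close> eigenfunctions into the window. As distinct modes are orthogonal, at most that many
  \<open>n\<close> occur (\<open>active_modes\<close>, \<open>card_band\<close>).

  Along a meridian, and with the derivation \<open>D = a d/ds\<close>, a mode solves
  \<open>D\<^sup>2 u + l\<^sup>2 x u = a\<^sup>2 \<gamma>\<close>, where \<open>x = a\<^sup>2 - n\<^sup>2/l\<^sup>2\<close> and \<open>\<gamma>\<close> is the mode of \<open>\<Sum> (l\<^sup>2 - ev\<^sub>j\<^sup>2) d\<^sub>j e\<^sub>j\<close>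
  (\<open>mode_ode\<close>). The width of the window makes \<open>\<gamma>\<close> of size \<open>l\<^sup>2\<^sup>/\<^sup>3\<close>, which is smaller than
  \<open>l\<^sup>2\<close> by a factor \<open>l\<^sup>4\<^sup>/\<^sup>3\<close>. Away from the poles and the equator the profile is strictly monotone, so that \<open>x\<close> has at most one
  simple zero on each hemisphere, the caustic of the mode. Energy estimates then bound \<open>\<bar>u s\<bar>\<^sup>2\<close> by the mass
  of the mode times \<open>\<bar>x\<bar>\<^sup>-\<^sup>1\<^sup>/\<^sup>2\<close>, and by the mass times \<open>l\<^sup>1\<^sup>/\<^sup>3\<close> close to the caustic
  (\<open>mode_amplitude\<close>, with the bound called \<open>mode_bound\<close>). This is the size that the WKB and Airy
  approximations predict.

  For a fixed \<open>s\<close> the numbers \<open>x\<close> are spaced by about \<open>1/l\<close> as \<open>n\<close> varies, and only \<open>O (l\<^sup>2\<^sup>/\<^sup>3)\<close> of them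
  are used. The worst case is that all \<open>n\<close> are as close as possible to \<open>l a(s)\<close>, and then the
  bounds still add up to \<open>O (l\<^sup>5\<^sup>/\<^sup>6)\<close> (\<open>sum_mode_bound\<close>). The masses of the modes add up to the mass of \<open>h\<close>,
  by Bessel's inequality on each circle of latitude (\<open>mode_mass\<close>). So the Cauchy-Schwarz inequality applied to
  \<open>h = \<Sum> h\<^sub>n\<close> gives \<open>\<bar>h\<bar>\<^sup>2 = O (l\<^sup>5\<^sup>/\<^sup>6)\<close>, which is the assertion since \<open>5/12 = 1/2 - 1/12\<close>
  (\<open>band_estimate\<close>).

  The geometric part is that rotations map eigenfunctions to eigenfunctions (\<open>eigenspace_rotf\<close>). Smoothness of
  a rotation is clear from the coordinates except at the two poles. There it follows from the fact that a
  continuous map that is a smooth isometry off a line is smooth (\<open>smooth_across\<close>): the second derivatives of an isometry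
  are functions of the point and of the first derivatives.
\<close>


section \<open>Calculus of iterated differentiability\<close>

lemma times_differentiable_cong:
  assumes "open W" "\<And>x. x \<in> W \<Longrightarrow> f x = g x" "times_differentiable k W f"
  shows "times_differentiable k W g"
proof (cases k)
  case 0
  then show ?thesis using assms continuous_on_cong[of W W f g] by auto
next
  case (Suc n)
  with assms(3) obtain D where D: "\<forall>x\<in>W. (f has_derivative D x) (at x)"
      "\<forall>v. times_differentiable n W (\<lambda>x. D x v)" by auto
  have "\<forall>x\<in>W. (g has_derivative D x) (at x)"
    using D(1) assms(1,2) has_derivative_transform_within_open by blast
  with D(2) Suc show ?thesis by auto
qed

lemma times_differentiable_Suc_iff:
  assumes "open W"
  shows "times_differentiable (Suc k) W f \<longleftrightarrow> (\<forall>x\<in>W. f differentiable (at x)) \<and>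
    (\<forall>v. times_differentiable k W (\<lambda>x. frechet_derivative f (at x) v))"
proof
  assume "times_differentiable (Suc k) W f"
  then obtain D where D: "\<forall>x\<in>W. (f has_derivative D x) (at x)"
      "\<forall>v. times_differentiable k W (\<lambda>x. D x v)" by auto
  have "times_differentiable k W (\<lambda>x. frechet_derivative f (at x) v)" for v
    by (rule times_differentiable_cong[OF assms _ D(2)[rule_format, of v]])
      (use D(1) frechet_derivative_at in metis)
  then show "(\<forall>x\<in>W. f differentiable (at x)) \<and>
    (\<forall>v. times_differentiable k W (\<lambda>x. frechet_derivative f (at x) v))"
    using D(1) unfolding differentiable_def by auto
next
  assume "(\<forall>x\<in>W. f differentiable (at x)) \<and>
    (\<forall>v. times_differentiable k W (\<lambda>x. frechet_derivative f (at x) v))"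
  then show "times_differentiable (Suc k) W f"
    using frechet_derivative_works[of f] by (auto intro!: exI[of _ "\<lambda>x. frechet_derivative f (at x)"])
qed

lemma times_differentiable_SucI:
  assumes "\<And>x. x \<in> W \<Longrightarrow> (f has_derivative D x) (at x)"
    and "\<And>v. times_differentiable k W (\<lambda>x. D x v)"
  shows "times_differentiable (Suc k) W f"
  using assms by auto

lemma times_differentiable_mono:
  "times_differentiable (Suc k) W f \<Longrightarrow> times_differentiable k W f"
proof (induction k arbitrary: f)
  case 0
  then obtain D where D: "\<forall>x\<in>W. (f has_derivative D x) (at x)" by auto
  have "continuous_on W f"
    by (rule has_derivative_continuous_on[of W f D], rule has_derivative_at_withinI) (use D in simp)
  then show ?case by simp
next
  case (Suc k)
  then obtain D where D: "\<forall>x\<in>W. (f has_derivative D x) (at x)"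
      "\<forall>v. times_differentiable (Suc k) W (\<lambda>x. D x v)"
    using times_differentiable.simps(2)[of "Suc k" W f] by blast
  show ?case
  proof (rule times_differentiable_SucI)
    show "(f has_derivative D x) (at x)" if "x \<in> W" for x using D(1) that by blast
    show "times_differentiable k W (\<lambda>x. D x v)" for v by (rule Suc.IH) (rule D(2)[rule_format])
  qed
qed

lemma times_differentiable_imp_continuous_on:
  "times_differentiable k W f \<Longrightarrow> continuous_on W f"
proof (induction k)
  case (Suc k)
  then show ?case using times_differentiable_mono by blast
qed simp

lemma times_differentiable_subset:
  "times_differentiable k W f \<Longrightarrow> V \<subseteq> W \<Longrightarrow> times_differentiable k V f"
proof (induction k arbitrary: f)
  case 0
  then show ?case by (auto intro: continuous_on_subset)
next
  case (Suc k)
  then obtain D where D: "\<forall>x\<in>W. (f has_derivative D x) (at x)"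
      "\<forall>v. times_differentiable k W (\<lambda>x. D x v)" by auto
  show ?case
  proof (rule times_differentiable_SucI)
    show "(f has_derivative D x) (at x)" if "x \<in> V" for x using D(1) that Suc.prems(2) by blast
    show "times_differentiable k V (\<lambda>x. D x v)" for v by (rule Suc.IH[OF D(2)[rule_format] Suc.prems(2)])
  qed
qed

lemma times_differentiable_local:
  assumes "open W" "\<And>x. x \<in> W \<Longrightarrow> \<exists>V. open V \<and> x \<in> V \<and> V \<subseteq> W \<and> times_differentiable k V f"
  shows "times_differentiable k W f"
  using assms(2)
proof (induction k arbitrary: f)
  case 0
  have "isCont f x" if "x \<in> W" for x
    using 0[OF that] continuous_on_eq_continuous_at by auto
  then show ?case by (auto simp: continuous_at_imp_continuous_on)
next
  case (Suc k)
  have "f differentiable (at x)" if x: "x \<in> W" for x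
  proof -
    obtain V where V: "open V" "x \<in> V" "V \<subseteq> W" "times_differentiable (Suc k) V f"
      using Suc.prems[OF x] by blast
    then show ?thesis using times_differentiable_Suc_iff[OF V(1)] by blast
  qed
  moreover have "times_differentiable k W (\<lambda>x. frechet_derivative f (at x) v)" for v
  proof (rule Suc.IH)
    fix x assume "x \<in> W"
    then obtain V where V: "open V" "x \<in> V" "V \<subseteq> W" "times_differentiable (Suc k) V f"
      using Suc.prems by blast
    then show "\<exists>V. open V \<and> x \<in> V \<and> V \<subseteq> W \<and> times_differentiable k V (\<lambda>x. frechet_derivative f (at x) v)"
      using times_differentiable_Suc_iff[OF V(1)] by blast
  qed
  ultimately show ?case using times_differentiable_Suc_iff[OF assms(1)] by blast
qed

lemma times_differentiable_const: "times_differentiable k W (\<lambda>x. c)"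
proof (induction k arbitrary: c)
  case (Suc k)
  show ?case by (rule times_differentiable_SucI[where D="\<lambda>_ _. 0"]) (auto intro: Suc)
qed auto

lemma times_differentiable_linear:
  assumes "bounded_linear h" "times_differentiable k W f"
  shows "times_differentiable k W (\<lambda>x. h (f x))"
  using assms(2)
proof (induction k arbitrary: f)
  case 0
  then show ?case using bounded_linear.continuous_on[OF assms(1)] by auto
next
  case (Suc k)
  then obtain D where D: "\<forall>x\<in>W. (f has_derivative D x) (at x)"
      "\<forall>v. times_differentiable k W (\<lambda>x. D x v)" by auto
  show ?case
    by (rule times_differentiable_SucI[where D="\<lambda>x v. h (D x v)"])
      (use D in \<open>auto intro: Suc.IH bounded_linear.has_derivative[OF assms(1)]\<close>)
qed

lemma times_differentiable_id: "times_differentiable k W (\<lambda>x. x)"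
proof (cases k)
  case (Suc n)
  show ?thesis unfolding Suc
    by (rule times_differentiable_SucI[where D="\<lambda>_ v. v"]) (auto intro: times_differentiable_const)
qed auto

lemma times_differentiable_bounded_linear:
  "bounded_linear h \<Longrightarrow> times_differentiable k W h"
  using times_differentiable_linear[OF _ times_differentiable_id, of h] by simp

lemma times_differentiable_add:
  assumes "times_differentiable k W f" "times_differentiable k W g"
  shows "times_differentiable k W (\<lambda>x. f x + g x)"
  using assms
proof (induction k arbitrary: f g)
  case 0
  then show ?case by (auto intro: continuous_intros)
next
  case (Suc k)
  then obtain D D' where D: "\<forall>x\<in>W. (f has_derivative D x) (at x)"
      "\<forall>v. times_differentiable k W (\<lambda>x. D x v)" "\<forall>x\<in>W. (g has_derivative D' x) (at x)"
      "\<forall>v. times_differentiable k W (\<lambda>x. D' x v)" by auto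
  show ?case
    by (rule times_differentiable_SucI[where D="\<lambda>x v. D x v + D' x v"])
      (use D Suc.IH in \<open>auto intro!: has_derivative_add\<close>)
qed

lemma times_differentiable_sum:
  assumes "\<And>i. i \<in> I \<Longrightarrow> times_differentiable k W (f i)"
  shows "times_differentiable k W (\<lambda>x. \<Sum>i\<in>I. f i x)"
  using assms
  by (induction I rule: infinite_finite_induct)
    (auto intro: times_differentiable_const times_differentiable_add)

lemma times_differentiable_bilinear:
  assumes "bounded_bilinear bop" "times_differentiable k W f" "times_differentiable k W g"
  shows "times_differentiable k W (\<lambda>x. bop (f x) (g x))"
  using assms(2,3)
proof (induction k arbitrary: f g)
  case 0
  then show ?case using bounded_bilinear.continuous_on[OF assms(1)] by auto
next
  case (Suc k)
  then obtain D D' where D: "\<forall>x\<in>W. (f has_derivative D x) (at x)"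
      "\<forall>v. times_differentiable k W (\<lambda>x. D x v)" "\<forall>x\<in>W. (g has_derivative D' x) (at x)"
      "\<forall>v. times_differentiable k W (\<lambda>x. D' x v)" by auto
  have *: "times_differentiable k W f" "times_differentiable k W g"
    using Suc.prems times_differentiable_mono by auto
  show ?case
  proof (rule times_differentiable_SucI)
    show "((\<lambda>x. bop (f x) (g x)) has_derivative
        (\<lambda>v. bop (f x) (D' x v) + bop (D x v) (g x))) (at x)" if "x \<in> W" for x
      using D(1,3) that by (intro bounded_bilinear.FDERIV[OF assms(1)]) auto
    show "times_differentiable k W (\<lambda>x. bop (f x) (D' x v) + bop (D x v) (g x))" for v
      using D(2,4) * by (intro times_differentiable_add Suc.IH) auto
  qed
qed

lemmas times_differentiable_mult = times_differentiable_bilinear[OF bounded_bilinear_mult]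
lemmas times_differentiable_scaleR = times_differentiable_bilinear[OF bounded_bilinear_scaleR]
lemmas times_differentiable_inner = times_differentiable_bilinear[OF bounded_bilinear_inner]

lemma times_differentiable_uminus:
  fixes f :: "'a::real_normed_vector \<Rightarrow> 'b::real_normed_vector"
  shows "times_differentiable k W f \<Longrightarrow> times_differentiable k W (\<lambda>x. - f x)"
  using times_differentiable_linear[of uminus k W f] bounded_linear_minus[OF bounded_linear_ident]
  by auto

lemma times_differentiable_diff:
  assumes "times_differentiable k W f" "times_differentiable k W g"
  shows "times_differentiable k W (\<lambda>x. f x - g x)"
  using times_differentiable_add[OF assms(1) times_differentiable_uminus[OF assms(2)]] by simp

lemma times_differentiable_prod:
  fixes f :: "'i \<Rightarrow> 'a::real_normed_vector \<Rightarrow> real"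
  assumes "\<And>i. i \<in> I \<Longrightarrow> times_differentiable k W (f i)"
  shows "times_differentiable k W (\<lambda>x. \<Prod>i\<in>I. f i x)"
  using assms
  by (induction I rule: infinite_finite_induct)
    (auto intro: times_differentiable_const times_differentiable_mult)

lemma linear_eq_sum_Basis:
  fixes h :: "'a::euclidean_space \<Rightarrow> 'b::real_normed_vector"
  assumes "bounded_linear h"
  shows "h v = (\<Sum>b\<in>Basis. (v \<bullet> b) *\<^sub>R h b)"
proof -
  have "h v = h (\<Sum>b\<in>Basis. (v \<bullet> b) *\<^sub>R b)" by (simp add: euclidean_representation)
  then show ?thesis
    using assms by (simp add: bounded_linear.linear linear_sum linear_scale)
qed

lemma times_differentiable_compose:
  fixes f :: "'a::real_normed_vector \<Rightarrow> 'b::euclidean_space"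
    and g :: "'b \<Rightarrow> 'c::real_normed_vector"
  assumes "times_differentiable k W f" "times_differentiable k V g" "f ` W \<subseteq> V"
  shows "times_differentiable k W (\<lambda>x. g (f x))"
  using assms(1,2)
proof (induction k arbitrary: g)
  case 0
  then show ?case using assms(3) by (auto intro: continuous_on_compose2)
next
  case (Suc k)
  then obtain D D' where D: "\<forall>x\<in>W. (f has_derivative D x) (at x)"
      "\<forall>v. times_differentiable k W (\<lambda>x. D x v)" "\<forall>x\<in>V. (g has_derivative D' x) (at x)"
      "\<forall>v. times_differentiable k V (\<lambda>x. D' x v)" by auto
  have f: "times_differentiable k W f" using Suc.prems times_differentiable_mono by auto
  show ?case
  proof (rule times_differentiable_SucI)
    fix x assume x: "x \<in> W"
    then have fx: "f x \<in> V" using assms(3) by auto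
    have "((\<lambda>x. g (f x)) has_derivative (\<lambda>v. D' (f x) (D x v))) (at x)"
      using D(1,3) x fx has_derivative_compose by blast
    moreover have "D' (f x) (D x v) = (\<Sum>b\<in>Basis. (D x v \<bullet> b) *\<^sub>R D' (f x) b)" for v
      using D(3) fx linear_eq_sum_Basis has_derivative_bounded_linear by blast
    ultimately show "((\<lambda>x. g (f x)) has_derivative
        (\<lambda>v. \<Sum>b\<in>Basis. (D x v \<bullet> b) *\<^sub>R D' (f x) b)) (at x)" by simp
  next
    fix v
    show "times_differentiable k W (\<lambda>x. \<Sum>b\<in>Basis. (D x v \<bullet> b) *\<^sub>R D' (f x) b)"
      by (intro times_differentiable_sum times_differentiable_scaleR times_differentiable_inner
          times_differentiable_const Suc.IH f) (use D in auto)
  qed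
qed

lemma times_differentiable_inverse:
  fixes f :: "'a::real_normed_vector \<Rightarrow> real"
  assumes "times_differentiable k W f" "\<And>x. x \<in> W \<Longrightarrow> f x \<noteq> 0"
  shows "times_differentiable k W (\<lambda>x. inverse (f x))"
  using assms(1)
proof (induction k)
  case 0
  then show ?case using assms(2) by (auto intro!: continuous_intros)
next
  case (Suc k)
  then obtain D where D: "\<forall>x\<in>W. (f has_derivative D x) (at x)"
      "\<forall>v. times_differentiable k W (\<lambda>x. D x v)" by auto
  have *: "times_differentiable k W (\<lambda>x. inverse (f x))"
    using Suc times_differentiable_mono by blast
  show ?case
  proof (rule times_differentiable_SucI)
    show "((\<lambda>x. inverse (f x)) has_derivative (\<lambda>v. - (inverse (f x) * D x v * inverse (f x)))) (at x)"
      if "x \<in> W" for x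
      by (rule Deriv.has_derivative_inverse) (use D(1) that assms(2) in auto)
    show "times_differentiable k W (\<lambda>x. - (inverse (f x) * D x v * inverse (f x)))" for v
      using D(2) * by (intro times_differentiable_uminus times_differentiable_mult) auto
  qed
qed

lemma times_differentiable_norm:
  fixes W :: "'a::real_inner set"
  assumes "0 \<notin> W"
  shows "times_differentiable k W (\<lambda>x. norm x)"
proof (induction k)
  case 0
  then show ?case by (auto intro: continuous_intros)
next
  case (Suc k)
  have nz: "norm x \<noteq> 0" if "x \<in> W" for x using that assms by auto
  show ?case
  proof (rule times_differentiable_SucI[where D="\<lambda>x v. v \<bullet> x * inverse (norm x)"])
    fix x assume "x \<in> W"
    then have "x \<noteq> 0" using assms by auto
    then show "(norm has_derivative (\<lambda>v. v \<bullet> x * inverse (norm x))) (at x)"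
      using has_derivative_norm[of x] by (simp add: sgn_div_norm inner_commute field_simps)
  next
    fix v
    show "times_differentiable k W (\<lambda>x. v \<bullet> x * inverse (norm x))"
      by (intro times_differentiable_mult times_differentiable_inner times_differentiable_const
          times_differentiable_id times_differentiable_inverse Suc nz)
  qed
qed

lemma times_differentiable_vec:
  fixes f :: "'a::real_normed_vector \<Rightarrow> real^'n"
  assumes "\<And>i. times_differentiable k W (\<lambda>x. f x $ i)"
  shows "times_differentiable k W f"
proof -
  have "times_differentiable k W (\<lambda>x. \<Sum>i\<in>UNIV. f x $ i *\<^sub>R (axis i 1 :: real^'n))"
    by (intro times_differentiable_sum times_differentiable_scaleR assms times_differentiable_const)
  moreover have "(\<lambda>x. \<Sum>i\<in>UNIV. f x $ i *\<^sub>R (axis i 1 :: real^'n)) = f"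
    by (simp add: fun_eq_iff vec_eq_iff axis_def if_distrib cong: if_cong)
  ultimately show ?thesis by (simp only:)
qed

lemma times_differentiable_vec_nth:
  "times_differentiable k W f \<Longrightarrow> times_differentiable k W (\<lambda>x. f x $ i)"
  by (rule times_differentiable_linear[OF bounded_linear_vec_nth])

lemma times_differentiable_det:
  fixes A :: "'a::real_normed_vector \<Rightarrow> real^'n^'n"
  assumes "\<And>i j. times_differentiable k W (\<lambda>x. A x $ i $ j)"
  shows "times_differentiable k W (\<lambda>x. det (A x))"
  unfolding det_def
  by (intro times_differentiable_sum times_differentiable_mult times_differentiable_prod
      times_differentiable_const assms)

lemma matrix_inv_right:
  "invertible A \<Longrightarrow> A ** matrix_inv A = mat 1"
  unfolding invertible_def matrix_inv_def by (rule someI2_ex) auto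

lemma matrix_inv_left:
  "invertible A \<Longrightarrow> matrix_inv A ** A = mat 1"
  unfolding invertible_def matrix_inv_def by (rule someI2_ex) auto

lemma times_differentiable_matrix_inv:
  fixes A :: "'a::real_normed_vector \<Rightarrow> real^'n^'n"
  assumes "\<And>i j. times_differentiable k W (\<lambda>x. A x $ i $ j)" "open W"
    and "\<And>x. x \<in> W \<Longrightarrow> invertible (A x)"
  shows "times_differentiable k W (\<lambda>x. matrix_inv (A x) $ i $ j)"
proof -
  have eq: "matrix_inv (A x) $ i $ j =
      det (\<chi> p q. if q = i then (axis j 1 :: real^'n) $ p else A x $ p $ q) * inverse (det (A x))"
    if "x \<in> W" for x
  proof -
    have inv: "invertible (A x)" using assms(3) that by blast
    then have "det (A x) \<noteq> 0" by (simp add: invertible_det_nz)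
    moreover have "A x *v (matrix_inv (A x) *v axis j 1) = axis j 1"
      using matrix_inv_right[OF inv] by (simp add: matrix_vector_mul_assoc)
    ultimately have "matrix_inv (A x) *v axis j 1 =
      (\<chi> k. det (\<chi> p q. if q = k then (axis j 1 :: real^'n) $ p else A x $ p $ q) / det (A x))"
      by (subst (asm) cramer)
    then have "(matrix_inv (A x) *v axis j 1) $ i = 
        det (\<chi> p q. if q = i then (axis j 1 :: real^'n) $ p else A x $ p $ q) / det (A x)"
      by simp
    moreover have "(matrix_inv (A x) *v axis j 1) $ i = matrix_inv (A x) $ i $ j"
      by (simp add: matrix_vector_mult_basis column_def)
    ultimately show ?thesis by (simp add: divide_inverse)
  qed
  have nz: "det (A x) \<noteq> 0" if "x \<in> W" for x using assms(3)[OF that] by (simp add: invertible_det_nz)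
  have "times_differentiable k W (\<lambda>x. (\<chi> p q. if q = i then (axis j 1 :: real^'n) $ p else A x $ p $ q) $ p $ q)" for p q
    using assms(1) times_differentiable_const by (cases "q = i") auto
  then have "times_differentiable k W (\<lambda>x. det (\<chi> p q. if q = i then (axis j 1 :: real^'n) $ p else A x $ p $ q) * inverse (det (A x)))"
    by (intro times_differentiable_mult times_differentiable_det times_differentiable_inverse assms(1) nz)
  then show ?thesis
    by (rule times_differentiable_cong[OF assms(2), rotated]) (use eq in auto)
qed

text \<open>A singularity of the first derivative on a thin set \<open>Z\<close> is removable when the derivative extends
  continuously: the mean value inequality on a segment that meets \<open>Z\<close> at most in its end point \<open>x\<close> compares \<open>F\<close> with
  the linear map \<open>E x\<close>, and density of the complement of \<open>Z\<close> carries the estimate over to all increments.\<close>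

lemma has_derivative_extends_across_null_directions:
  fixes F :: "'a::euclidean_space \<Rightarrow> 'b::real_inner"
  assumes "open W" "x \<in> W" "continuous_on W F" "x \<in> Z"
    and der: "\<And>y. y \<in> W - Z \<Longrightarrow> (F has_derivative E y) (at y)"
    and lin: "\<And>y. y \<in> W \<Longrightarrow> bounded_linear (E y)"
    and cont: "\<And>v. continuous_on W (\<lambda>y. E y v)"
    and seg: "\<And>y. y \<in> W - Z \<Longrightarrow> open_segment x y \<inter> Z = {}"
    and dense: "W \<subseteq> closure (W - Z)"
  shows "(F has_derivative E x) (at x)"
proof (unfold has_derivative_within_alt, intro conjI allI impI)
  show "bounded_linear (E x)" using lin assms(2) .
  fix \<epsilon> :: real assume \<epsilon>: "0 < \<epsilon>"
  define \<delta> where "\<delta> = \<epsilon> / (1 + DIM('a))"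
  have \<delta>: "0 < \<delta>" using \<epsilon> by (simp add: \<delta>_def add_pos_nonneg)
  have "\<exists>d>0. ball x d \<subseteq> W \<and> (\<forall>y\<in>ball x d. norm (E y b - E x b) < \<delta>)" for b
  proof -
    have "continuous (at x within W) (\<lambda>y. E y b)"
      using cont assms(2) by (simp add: continuous_on_eq_continuous_within)
    then obtain d1 where d1: "d1 > 0" "\<forall>y\<in>W. dist y x < d1 \<longrightarrow> dist (E y b) (E x b) < \<delta>"
      using \<delta> unfolding continuous_within_eps_delta by blast
    obtain d2 where d2: "d2 > 0" "ball x d2 \<subseteq> W" using assms(1,2) openE by blast
    show ?thesis
      by (rule exI[of _ "min d1 d2"]) (use d1 d2 in \<open>auto simp: dist_norm norm_minus_commute subset_iff\<close>)
  qed
  then obtain d where d: "\<And>b. d b > 0" "\<And>b. ball x (d b) \<subseteq> W"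
      "\<And>b y. y \<in> ball x (d b) \<Longrightarrow> norm (E y b - E x b) < \<delta>" by metis
  define r where "r = Min (d ` Basis)"
  have r: "r > 0" "\<And>b. b \<in> Basis \<Longrightarrow> r \<le> d b" unfolding r_def using d(1) by auto
  have rW: "ball x r \<subseteq> W"
    using r(2)[OF SOME_Basis] d(2)[of "SOME i. i \<in> Basis"] by (meson subset_ball order_trans)
  have E: "norm (E y v - E x v) \<le> \<epsilon> * norm v" if y: "y \<in> ball x r" for y v
  proof -
    have yW: "y \<in> W" using y rW by auto
    have "E y v - E x v = (\<Sum>b\<in>Basis. (v \<bullet> b) *\<^sub>R (E y b - E x b))"
      by (subst (1 2) linear_eq_sum_Basis[OF lin]) (use yW assms(2) in \<open>auto simp: sum_subtractf scaleR_diff_right\<close>)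
    also have "norm \<dots> \<le> (\<Sum>b\<in>(Basis::'a set). norm v * \<delta>)"
    proof (rule sum_norm_le)
      fix b :: 'a assume b: "b \<in> Basis"
      have "norm (E y b - E x b) \<le> \<delta>" using d(3)[of y b] y r(2)[OF b] by auto
      then show "norm ((v \<bullet> b) *\<^sub>R (E y b - E x b)) \<le> norm v * \<delta>"
        by (auto intro!: mult_mono Basis_le_norm b)
    qed
    also have "\<dots> = DIM('a) * \<delta> * norm v" by simp
    also have "\<dots> \<le> \<epsilon> * norm v"
      by (intro mult_right_mono) (use \<epsilon> in \<open>auto simp: \<delta>_def field_simps\<close>)
    finally show ?thesis .
  qed
  have main: "norm (F y - F x - E x (y - x)) \<le> \<epsilon> * norm (y - x)" if y: "y \<in> ball x r - Z" for y
  proof -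
    have xy: "x \<noteq> y" using y assms(4) by auto
    define p where "p t = F (x + t *\<^sub>R (y - x)) - t *\<^sub>R E x (y - x)" for t
    have inb: "x + t *\<^sub>R (y - x) \<in> ball x r" if "0 \<le> t" "t \<le> 1" for t
    proof -
      have "norm (t *\<^sub>R (y - x)) \<le> norm (y - x)" using that by (simp add: mult_left_le_one_le)
      then show ?thesis using y by (auto simp: dist_norm norm_minus_commute)
    qed
    have c1: "continuous_on {0..1} (\<lambda>t. F (x + t *\<^sub>R (y - x)))"
      by (rule continuous_on_compose2[OF assms(3)]) (use inb rW in \<open>auto intro!: continuous_intros\<close>)
    have c: "continuous_on {0..1} p"
      unfolding p_def by (intro continuous_intros c1)
    have dp: "(p has_derivative (\<lambda>h. h *\<^sub>R (E (x + t *\<^sub>R (y - x)) (y - x) - E x (y - x)))) (at t)"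
      if t: "0 < t" "t < 1" for t
    proof -
      let ?z = "x + t *\<^sub>R (y - x)"
      have zs: "?z \<in> open_segment x y" using t xy by (auto simp: in_segment algebra_simps intro!: exI[of _ t])
      have z: "?z \<in> W - Z" using inb[of t] rW t seg[of y] y zs by (auto simp del: mem_ball)
      have "((\<lambda>t. x + t *\<^sub>R (y - x)) has_derivative (\<lambda>h. h *\<^sub>R (y - x))) (at t)"
        by (auto intro!: derivative_eq_intros)
      then have "((\<lambda>t. F (x + t *\<^sub>R (y - x))) has_derivative (\<lambda>h. E ?z (h *\<^sub>R (y - x)))) (at t)"
        by (rule has_derivative_compose) (rule der[OF z])
      moreover have "E ?z (h *\<^sub>R (y - x)) = h *\<^sub>R E ?z (y - x)" for h
        using lin z by (simp add: bounded_linear.linear linear_scale)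
      ultimately show ?thesis unfolding p_def
        by (auto intro!: derivative_eq_intros simp: scaleR_diff_right)
    qed
    obtain t where t: "0 < t" "t < 1" 
        "norm (p 1 - p 0) \<le> norm ((1 - 0) *\<^sub>R (E (x + t *\<^sub>R (y - x)) (y - x) - E x (y - x)))"
      using mvt_general[of 0 1 p "\<lambda>t h. h *\<^sub>R (E (x + t *\<^sub>R (y - x)) (y - x) - E x (y - x))"] c dp
      by auto
    have "norm (E (x + t *\<^sub>R (y - x)) (y - x) - E x (y - x)) \<le> \<epsilon> * norm (y - x)"
      using E inb t by auto
    then show ?thesis using t(3) by (simp add: p_def algebra_simps)
  qed
  have "norm (F y - F x - E x (y - x)) \<le> \<epsilon> * norm (y - x)" if y: "y \<in> ball x r" for y
  proof -
    define G where "G y = norm (F y - F x - E x (y - x)) - \<epsilon> * norm (y - x)" for y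
    have cE: "continuous_on UNIV (E x)" using lin[OF assms(2)] by (simp add: linear_continuous_on)
    have cG: "continuous_on (ball x r) G" unfolding G_def
      by (intro continuous_intros continuous_on_subset[OF assms(3) rW] continuous_on_compose2[OF cE]) auto
    have "y \<in> ball x r \<inter> closure (W - Z)" using dense y rW by auto
    then have "y \<in> closure (ball x r \<inter> (W - Z))"
      using open_Int_closure_subset[of "ball x r" "W - Z"] by blast
    moreover have "ball x r \<inter> (W - Z) \<subseteq> ball x r - Z" by auto
    ultimately have "y \<in> closure (ball x r - Z)" using closure_mono by blast
    then obtain f where f: "\<And>n. f n \<in> ball x r - Z" "f \<longlonglongrightarrow> y" using closure_sequential by blast
    have "(\<lambda>n. G (f n)) \<longlonglongrightarrow> G y"
      by (rule continuous_on_tendsto_compose[OF cG f(2) y]) (use f in auto)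
    then have "G y \<le> 0"
      by (rule LIMSEQ_le_const2) (use main f in \<open>auto simp: G_def\<close>)
    then show ?thesis by (simp add: G_def)
  qed
  then show "\<exists>d>0. \<forall>y\<in>UNIV. norm (y - x) < d \<longrightarrow> norm (F y - F x - E x (y - x)) \<le> \<epsilon> * norm (y - x)"
    using r(1) by (intro exI[of _ r]) (auto simp: dist_norm norm_minus_commute)
qed

lemma frechet_derivative_symmetric:
  fixes f :: "'a::real_normed_vector \<Rightarrow> real"
  assumes "open W" "x \<in> W" "times_differentiable 2 W f"
  shows "frechet_derivative (\<lambda>y. frechet_derivative f (at y) u) (at x) v =
         frechet_derivative (\<lambda>y. frechet_derivative f (at y) v) (at x) u"
proof -
  let ?D = "\<lambda>y. frechet_derivative f (at y)"
  let ?DD = "\<lambda>u v y. frechet_derivative (\<lambda>y. ?D y u) (at y) v"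
  have td1: "times_differentiable (Suc (Suc 0)) W f" using assms(3) by (simp add: numeral_2_eq_2)
  have d1: "(f has_derivative ?D y) (at y)" if "y \<in> W" for y
    using td1 that times_differentiable_Suc_iff[OF assms(1)] frechet_derivative_works by blast
  have td2: "times_differentiable (Suc 0) W (\<lambda>y. ?D y u)" for u
    using td1 times_differentiable_Suc_iff[OF assms(1)] by blast
  have d2: "((\<lambda>y. ?D y u) has_derivative (\<lambda>v. ?DD u v y)) (at y)" if "y \<in> W" for y u
    using td2[of u] that times_differentiable_Suc_iff[OF assms(1)] frechet_derivative_works by blast
  have cont: "continuous_on W (?DD u v)" for u v
  proof -
    have "times_differentiable 0 W (?DD u v)"
      using td2[of u] times_differentiable_Suc_iff[OF assms(1)] by blast
    then show ?thesis by simp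
  qed
  obtain r where r: "r > 0" "ball x r \<subseteq> W" using assms(1,2) openE by blast
  text \<open>The second difference quotient of side \<open>h\<close> equals a mixed derivative at a point near \<open>x\<close>.\<close>
  have quot: "\<exists>y. norm (y - x) \<le> h * (norm u + norm v) \<and>
      f (x + h *\<^sub>R u + h *\<^sub>R v) - f (x + h *\<^sub>R u) - f (x + h *\<^sub>R v) + f x = h\<^sup>2 * ?DD u v y"
    if h: "h > 0" "h * (norm u + norm v) < r" for h u v
  proof -
    have inW: "x + s *\<^sub>R u + t *\<^sub>R v \<in> W" "norm (s *\<^sub>R u + t *\<^sub>R v) \<le> h * (norm u + norm v)"
      if "0 \<le> s" "s \<le> h" "0 \<le> t" "t \<le> h" for s t
    proof -
      have "norm (s *\<^sub>R u + t *\<^sub>R v) \<le> s * norm u + t * norm v"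
        using that norm_triangle_ineq[of "s *\<^sub>R u" "t *\<^sub>R v"] by simp
      also have "\<dots> \<le> h * (norm u + norm v)"
        using that by (simp add: algebra_simps add_mono mult_right_mono)
      finally show "norm (s *\<^sub>R u + t *\<^sub>R v) \<le> h * (norm u + norm v)" .
      with h have "x + (s *\<^sub>R u + t *\<^sub>R v) \<in> ball x r"
        by (metis add_diff_cancel_left' dist_commute dist_norm mem_ball order_le_less_trans)
      then show "x + s *\<^sub>R u + t *\<^sub>R v \<in> W" using r(2) by (simp add: subset_iff add.assoc)
    qed
    define p where "p s = f (x + s *\<^sub>R u + h *\<^sub>R v) - f (x + s *\<^sub>R u)" for s
    have dp: "(p has_real_derivative (?D (x + s *\<^sub>R u + h *\<^sub>R v) u - ?D (x + s *\<^sub>R u) u)) (at s)"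
      if s: "0 \<le> s" "s \<le> h" for s
    proof -
      have a: "((\<lambda>s. f (x + s *\<^sub>R u + t *\<^sub>R v)) has_derivative (\<lambda>k. ?D (x + s *\<^sub>R u + t *\<^sub>R v) (k *\<^sub>R u))) (at s)"
        if "0 \<le> t" "t \<le> h" for t
        by (rule has_derivative_compose[OF _ d1]) (use inW s that in \<open>auto intro!: derivative_eq_intros\<close>)
      have c: "?D (x + s *\<^sub>R u + t *\<^sub>R v) (k *\<^sub>R u) = k * ?D (x + s *\<^sub>R u + t *\<^sub>R v) u" if "0 \<le> t" "t \<le> h" for t k
        using linear_scale[OF has_derivative_linear[OF d1[OF inW(1)]], of s t k u] s that by simp
      have b: "((\<lambda>s. f (x + s *\<^sub>R u + t *\<^sub>R v)) has_real_derivative ?D (x + s *\<^sub>R u + t *\<^sub>R v) u) (at s)"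
        if "0 \<le> t" "t \<le> h" for t
        by (rule has_derivative_imp_has_field_derivative[OF a]) (use that c in auto)
      show ?thesis unfolding p_def
        using DERIV_diff[OF b[of h] b[of 0]] h by simp
    qed
    obtain s where s: "0 < s" "s < h" "p h - p 0 = h * (?D (x + s *\<^sub>R u + h *\<^sub>R v) u - ?D (x + s *\<^sub>R u) u)"
      using MVT2[of 0 h p "\<lambda>s. ?D (x + s *\<^sub>R u + h *\<^sub>R v) u - ?D (x + s *\<^sub>R u) u"] dp h by auto
    define q where "q t = ?D (x + s *\<^sub>R u + t *\<^sub>R v) u" for t
    have dq: "(q has_real_derivative ?DD u v (x + s *\<^sub>R u + t *\<^sub>R v)) (at t)" if t: "0 \<le> t" "t \<le> h" for t
    proof -
      have a: "(q has_derivative (\<lambda>k. ?DD u (k *\<^sub>R v) (x + s *\<^sub>R u + t *\<^sub>R v))) (at t)"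
        unfolding q_def by (rule has_derivative_compose[OF _ d2]) (use inW s t in \<open>auto intro!: derivative_eq_intros\<close>)
      have "?DD u (k *\<^sub>R v) (x + s *\<^sub>R u + t *\<^sub>R v) = k * ?DD u v (x + s *\<^sub>R u + t *\<^sub>R v)" for k
        using linear_scale[OF has_derivative_linear[OF d2[OF inW(1)]], of s t u k v] s t by simp
      then show ?thesis by (intro has_derivative_imp_has_field_derivative[OF a]) auto
    qed
    obtain t where t: "0 < t" "t < h" "q h - q 0 = h * ?DD u v (x + s *\<^sub>R u + t *\<^sub>R v)"
      using MVT2[of 0 h q "\<lambda>t. ?DD u v (x + s *\<^sub>R u + t *\<^sub>R v)"] dq h by auto
    show ?thesis
    proof (intro exI conjI)
      show "norm (x + s *\<^sub>R u + t *\<^sub>R v - x) \<le> h * (norm u + norm v)"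
        using inW(2)[of s t] s t by (simp add: algebra_simps)
      have "p h - p 0 = h * (h * ?DD u v (x + s *\<^sub>R u + t *\<^sub>R v))"
        using s(3) t(3) by (simp add: q_def)
      then show "f (x + h *\<^sub>R u + h *\<^sub>R v) - f (x + h *\<^sub>R u) - f (x + h *\<^sub>R v) + f x = h\<^sup>2 * ?DD u v (x + s *\<^sub>R u + t *\<^sub>R v)"
        by (simp add: p_def power2_eq_square)
    qed
  qed
  define hh where "hh n = r / ((1 + norm u + norm v) * (real n + 2))" for n :: nat
  have hh: "hh n > 0" "hh n * (norm u + norm v) < r" for n
  proof -
    have pos: "1 + norm u + norm v > 0" by (simp add: add_pos_nonneg)
    show "hh n > 0" unfolding hh_def using r(1) pos by simp
    have "(norm u + norm v) \<le> (1 + norm u + norm v) * 1" by simp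
    also have "\<dots> < (1 + norm u + norm v) * (real n + 2)" using pos by (intro mult_strict_left_mono) auto
    finally have "(norm u + norm v) * r < (1 + norm u + norm v) * (real n + 2) * r"
      using r(1) by (intro mult_strict_right_mono)
    moreover have "0 < (1 + norm u + norm v) * (real n + 2)" using pos by simp
    ultimately have "(norm u + norm v) * r / ((1 + norm u + norm v) * (real n + 2)) < r"
      by (simp only: pos_divide_less_eq mult.commute[of r])
    then show "hh n * (norm u + norm v) < r" unfolding hh_def by (simp only: times_divide_eq_left mult.commute[of r])
  qed
  have hh0: "hh \<longlonglongrightarrow> 0"
  proof -
    have "(\<lambda>n. (r / (1 + norm u + norm v)) * inverse (real (n + 2))) \<longlonglongrightarrow> (r / (1 + norm u + norm v)) * 0"
      by (intro tendsto_mult tendsto_const LIMSEQ_ignore_initial_segment[OF lim_inverse_n])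
    moreover have "hh = (\<lambda>n. (r / (1 + norm u + norm v)) * inverse (real (n + 2)))"
      by (simp add: hh_def fun_eq_iff divide_inverse mult.assoc)
    ultimately show ?thesis by simp
  qed
  have lim: "(\<lambda>n. ?DD u v (y n)) \<longlonglongrightarrow> ?DD u v x"
    if y: "\<And>n. norm (y n - x) \<le> hh n * (norm u + norm v)" for y :: "nat \<Rightarrow> 'a" and u v
  proof (rule continuous_on_tendsto_compose[OF cont _ assms(2)])
    have "(\<lambda>n. y n - x) \<longlonglongrightarrow> 0"
      by (rule Lim_null_comparison[OF always_eventually tendsto_mult_left_zero[OF hh0, of "norm u + norm v"]])
        (simp add: y)
    then show "y \<longlonglongrightarrow> x" using LIM_zero_iff by blast
    then have "\<forall>\<^sub>F n in sequentially. y n \<in> ball x r"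
      by (rule topological_tendstoD) (use r in auto)
    then show "\<forall>\<^sub>F n in sequentially. y n \<in> W" by eventually_elim (use r in auto)
  qed
  obtain y where y: "\<And>n. norm (y n - x) \<le> hh n * (norm u + norm v)"
    "\<And>n. f (x + hh n *\<^sub>R u + hh n *\<^sub>R v) - f (x + hh n *\<^sub>R u) - f (x + hh n *\<^sub>R v) + f x = (hh n)\<^sup>2 * ?DD u v (y n)"
    using quot[OF hh] by metis
  have "hh n * (norm v + norm u) < r" for n using hh by (simp add: add.commute)
  from quot[OF hh(1) this] obtain z where z: "\<And>n. norm (z n - x) \<le> hh n * (norm v + norm u)"
    "\<And>n. f (x + hh n *\<^sub>R v + hh n *\<^sub>R u) - f (x + hh n *\<^sub>R v) - f (x + hh n *\<^sub>R u) + f x = (hh n)\<^sup>2 * ?DD v u (z n)"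
    by metis
  have "(hh n)\<^sup>2 * ?DD u v (y n) = (hh n)\<^sup>2 * ?DD v u (z n)" for n
    unfolding y(2)[symmetric] z(2)[symmetric] by (simp add: add_ac)
  then have "?DD u v (y n) = ?DD v u (z n)" for n using hh(1)[of n] by (metis mult_cancel_left power_not_zero less_irrefl)
  moreover have "(\<lambda>n. ?DD u v (y n)) \<longlonglongrightarrow> ?DD u v x" using lim y(1) by blast
  moreover have "(\<lambda>n. ?DD v u (z n)) \<longlonglongrightarrow> ?DD v u x"
    by (rule lim) (use z(1) in \<open>simp add: add.commute\<close>)
  ultimately show ?thesis using LIMSEQ_unique by simp
qed


section \<open>Isometries are smooth across a line\<close>

lemma dense_in_open_minus_subspace:
  fixes B :: "(real^3) set"
  assumes "open B" "subspace Z" "dim Z < 3"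
  shows "B \<subseteq> closure (B - Z)"
proof
  fix x assume x: "x \<in> B"
  have "closure (UNIV - Z) = (UNIV :: (real^3) set)"
    by (rule dense_complement_subspace) (use assms(2,3) in \<open>auto\<close>)
  then have "x \<in> B \<inter> closure (UNIV - Z)" using x by auto
  then have "x \<in> closure (B \<inter> (UNIV - Z))"
    using open_Int_closure_subset[OF assms(1)] by blast
  moreover have "B \<inter> (UNIV - Z) = B - Z" by auto
  ultimately show "x \<in> closure (B - Z)" by simp
qed

text \<open>Two points off a line can be joined by a segment that avoids the line after an arbitrarily small
  perturbation of one of them, because the plane through the line and the other point is nowhere dense in
  3-space. So a bounded derivative off the line yields a Lipschitz bound.\<close>

lemma lipschitz_off_line:
  fixes F :: "real^3 \<Rightarrow> 'b::real_normed_vector"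
  assumes "open B" "convex B" and Z: "Z = span {p}"
    and der: "\<And>y. y \<in> B - Z \<Longrightarrow> (F has_derivative F' y) (at y)"
    and bnd: "\<And>y. y \<in> B - Z \<Longrightarrow> onorm (F' y) \<le> L" and L: "0 \<le> L"
  shows "L-lipschitz_on (B - Z) F"
proof (rule lipschitz_onI)
  fix x y assume x: "x \<in> B - Z" and y: "y \<in> B - Z"
  have oB: "open (B - Z)" using assms(1) Z closed_subspace[OF subspace_span] by (auto intro: open_Diff)
  let ?P = "span {x, p}"
  have "dim ?P < 3" using dim_le_card[of "?P" "{x,p}"] card_insert_le_m1[of 2 "{p}" x] by (simp add: dim_span)
  then have "B - Z \<subseteq> closure (B - Z - ?P)"
    by (intro dense_in_open_minus_subspace oB) (auto simp: dim_span)
  then obtain f where f: "\<And>n. f n \<in> B - Z - ?P" "f \<longlonglongrightarrow> y" using y closure_sequential by blast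
  have main: "norm (F (f n) - F x) \<le> L * norm (f n - x)" for n
  proof (rule differentiable_bound[where S="closed_segment x (f n)"])
    show "convex (closed_segment x (f n))" by simp
    fix z assume z: "z \<in> closed_segment x (f n)"
    then obtain t where t: "0 \<le> t" "t \<le> 1" "z = (1 - t) *\<^sub>R x + t *\<^sub>R f n"
      by (auto simp: in_segment)
    have "z \<in> B" using z x f(1)[of n] assms(2) closed_segment_subset by blast
    moreover have "z \<notin> Z"
    proof
      assume zZ: "z \<in> Z"
      show False
      proof (cases "t = 0")
        case True
        then show False using t zZ x by simp
      next
        case False
        have "z \<in> ?P" using zZ unfolding Z by (meson span_mono subsetD subset_insertI)
        moreover have "x \<in> ?P" by (simp add: span_base)
        ultimately have "(1 / t) *\<^sub>R (z - (1 - t) *\<^sub>R x) \<in> ?P"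
          by (intro span_scale span_diff)
        moreover have "(1 / t) *\<^sub>R (z - (1 - t) *\<^sub>R x) = f n" using False t(3) by simp
        ultimately show False using f(1)[of n] by simp
      qed
    qed
    ultimately have zz: "z \<in> B - Z" by blast
    show "(F has_derivative F' z) (at z within closed_segment x (f n))"
      using der[OF zz] by (rule has_derivative_at_withinI)
    show "onorm (F' z) \<le> L" using bnd[OF zz] .
  qed auto
  have "isCont F y" using der[OF y] has_derivative_continuous by blast
  then have "(\<lambda>n. F (f n)) \<longlonglongrightarrow> F y" using f(2) isCont_tendsto_compose by blast
  then have "norm (F y - F x) \<le> L * norm (y - x)"
    by (intro LIMSEQ_le[OF _ _ exI[of _ 0], of "\<lambda>n. norm (F (f n) - F x)" _ "\<lambda>n. L * norm (f n - x)"]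
        tendsto_intros f(2)) (use main in auto)
  then show "dist (F x) (F y) \<le> L * dist x y" by (simp add: dist_norm norm_minus_commute)
qed (rule L)

definition bdd_on :: "'a set \<Rightarrow> ('a \<Rightarrow> 'b::real_normed_vector) \<Rightarrow> bool" where
  "bdd_on S f \<longleftrightarrow> (\<exists>M. \<forall>x\<in>S. norm (f x) \<le> M)"

lemma bdd_onI: "(\<And>x. x \<in> S \<Longrightarrow> norm (f x) \<le> M) \<Longrightarrow> bdd_on S f"
  unfolding bdd_on_def by blast

lemma bdd_on_const: "bdd_on S (\<lambda>x. c)"
  unfolding bdd_on_def by blast

lemma bdd_on_add: "bdd_on S f \<Longrightarrow> bdd_on S g \<Longrightarrow> bdd_on S (\<lambda>x. f x + g x)"
proof -
  assume "bdd_on S f" "bdd_on S g"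
  then obtain M N where "\<forall>x\<in>S. norm (f x) \<le> M" "\<forall>x\<in>S. norm (g x) \<le> N" unfolding bdd_on_def by auto
  then show ?thesis by (intro bdd_onI[of _ _ "M + N"]) (meson add_mono norm_triangle_le)
qed

lemma bdd_on_uminus: "bdd_on S f \<Longrightarrow> bdd_on S (\<lambda>x. - f x)"
  unfolding bdd_on_def by simp

lemma bdd_on_diff: "bdd_on S f \<Longrightarrow> bdd_on S g \<Longrightarrow> bdd_on S (\<lambda>x. f x - g x)"
  using bdd_on_add[OF _ bdd_on_uminus, of S f g] by simp

lemma bdd_on_sum: "(\<And>i. i \<in> I \<Longrightarrow> bdd_on S (f i)) \<Longrightarrow> bdd_on S (\<lambda>x. \<Sum>i\<in>I. f i x)"
  by (induction I rule: infinite_finite_induct) (auto intro: bdd_on_const bdd_on_add)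

lemma bdd_on_scaleR: 
  assumes "bdd_on S f" "bdd_on S g"
  shows "bdd_on S (\<lambda>x. f x *\<^sub>R g x)"
proof -
  obtain M N where MN: "\<forall>x\<in>S. norm (f x) \<le> M" "\<forall>x\<in>S. norm (g x) \<le> N"
    using assms unfolding bdd_on_def by auto
  show ?thesis
  proof (rule bdd_onI)
    fix x assume "x \<in> S"
    then have "norm (f x) \<le> M" "norm (g x) \<le> N" using MN by auto
    then have "norm (f x) * norm (g x) \<le> M * N"
      by (intro mult_mono) (auto intro: order_trans[OF norm_ge_zero])
    then show "norm (f x *\<^sub>R g x) \<le> M * N" by simp
  qed
qed

lemma bdd_on_mult: "bdd_on S f \<Longrightarrow> bdd_on S g \<Longrightarrow> bdd_on S (\<lambda>x. f x * g x :: real)"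
  using bdd_on_scaleR[of S f g] by simp

lemma bdd_on_compact:
  assumes "compact S" "continuous_on S f" "B \<subseteq> S"
  shows "bdd_on B f"
proof -
  have "bounded (f ` S)" using assms compact_continuous_image compact_imp_bounded by blast
  then obtain M where "\<forall>y\<in>f ` S. norm y \<le> M" using bounded_iff by blast
  then show ?thesis using assms(3) unfolding bdd_on_def by blast
qed

lemma bdd_on_compose: "bdd_on (f ` S) g \<Longrightarrow> bdd_on S (\<lambda>x. g (f x))"
  unfolding bdd_on_def by auto

definition mform :: "real^3^3 \<Rightarrow> real^3 \<Rightarrow> real^3 \<Rightarrow> real" where
  "mform A u v = (\<Sum>i\<in>UNIV. \<Sum>j\<in>UNIV. u $ i * A $ i $ j * v $ j)"

lemma mform_linear: "linear (\<lambda>u. mform A u v)" "linear (mform A u)"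
  unfolding mform_def
  by (auto intro!: linearI simp: algebra_simps sum.distrib sum_distrib_left)

lemma mform_axis: "mform A (axis i 1) (axis j 1) = A $ i $ j"
  by (simp add: mform_def axis_def if_distrib[of "\<lambda>x. x * _"] if_distrib[of "\<lambda>x. _ * x"] cong: if_cong)

text \<open>A map \<open>R\<close> that is continuous on \<open>B\<close>, and off the line \<open>Z\<close> a smooth isometry for the metric with
  Gram matrix \<open>G\<close>. The compact set \<open>S\<close> serves to bound the coefficients of \<open>G\<close> and their derivatives both at \<open>x\<close> and at \<open>R x\<close>.\<close>

locale singular_isometry =
  fixes R :: "real^3 \<Rightarrow> real^3" and G :: "real^3 \<Rightarrow> real^3^3" and B S \<Omega> :: "(real^3) set"
    and p :: "real^3" and Z and c C :: real
  assumes B: "open B" "convex B" and \<Omega>: "open \<Omega>" and S: "compact S" "S \<subseteq> \<Omega>"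
    and BS: "B \<subseteq> S" "R ` B \<subseteq> S" and Z: "Z = span {p}"
    and smoothG: "\<And>k i j. times_differentiable k \<Omega> (\<lambda>x. G x $ i $ j)"
    and symG: "\<And>x i j. x \<in> \<Omega> \<Longrightarrow> G x $ i $ j = G x $ j $ i"
    and c: "0 < c" "0 \<le> C"
    and lower: "\<And>x v. x \<in> \<Omega> \<Longrightarrow> c * (norm v)\<^sup>2 \<le> mform (G x) v v"
    and upper: "\<And>x v. x \<in> \<Omega> \<Longrightarrow> mform (G x) v v \<le> C * (norm v)\<^sup>2"
    and contR: "continuous_on B R"
    and smoothR: "\<And>k. times_differentiable k (B - Z) R"
    and isometry: "\<And>x u v. x \<in> B - Z \<Longrightarrow>
      mform (G (R x)) (frechet_derivative R (at x) u) (frechet_derivative R (at x) v) = mform (G x) u v"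
begin

abbreviation "D i x \<equiv> frechet_derivative R (at x) (axis i 1)"
abbreviation "DG m i j y \<equiv> frechet_derivative (\<lambda>z. G z $ i $ j) (at y) (axis m 1)"

text \<open>Differentiating the isometry relation in direction \<open>m\<close> leaves the terms that contain second derivatives of
  \<open>R\<close> on one side. \<open>cc\<close> is the other side, which involves only first derivatives of \<open>R\<close>. \<open>T\<close> is the
  Koszul combination of the three permutations of \<open>cc\<close>, and \<open>Y\<close> raises the index: it is the expression of the
  second derivative of \<open>R\<close> through the first ones.\<close>

definition cc where
  "cc m i j x = DG m i j x - (\<Sum>q\<in>UNIV. \<Sum>r\<in>UNIV. \<Sum>p\<in>UNIV. DG p q r (R x) * D m x $ p * D i x $ q * D j x $ r)"

definition T where "T i m j x = (cc m i j x + cc i m j x - cc j m i x) / 2"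

definition Y where
  "Y i m x = (\<Sum>p\<in>UNIV. \<Sum>q\<in>UNIV. (matrix_inv (G x) $ p $ q * T i m q x) *\<^sub>R D p x)"

lemma oBZ: "open (B - Z)"
  using B Z closed_subspace[OF subspace_span] by (auto intro: open_Diff)

lemma B\<Omega>: "x \<in> B \<Longrightarrow> x \<in> \<Omega>" "x \<in> B \<Longrightarrow> R x \<in> \<Omega>"
  using BS S by auto

lemma invG: "x \<in> \<Omega> \<Longrightarrow> invertible (G x)"
proof -
  assume x: "x \<in> \<Omega>"
  have "v = 0" if "G x *v v = 0" for v
  proof -
    have "mform (G x) v v = (\<Sum>i\<in>UNIV. v $ i * (G x *v v) $ i)"
      by (simp add: mform_def matrix_vector_mult_def sum_distrib_left mult.assoc)
    with that have "c * (norm v)\<^sup>2 \<le> 0" using lower[OF x, of v] by simp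
    then show "v = 0" using c(1) by (simp add: mult_le_0_iff)
  qed
  then show ?thesis using invertible_left_inverse matrix_left_invertible_ker by blast
qed

lemma derR: "x \<in> B - Z \<Longrightarrow> (R has_derivative frechet_derivative R (at x)) (at x)"
  using smoothR[of "Suc 0"] times_differentiable_Suc_iff[OF oBZ, of 0 R] frechet_derivative_works by blast

lemma smoothD: "times_differentiable k (B - Z) (D i)"
  using smoothR[of "Suc k"] times_differentiable_Suc_iff[OF oBZ, of k R] by blast

lemma derD: "x \<in> B - Z \<Longrightarrow> (D i has_derivative frechet_derivative (D i) (at x)) (at x)"
  using smoothD[of "Suc 0" i] times_differentiable_Suc_iff[OF oBZ, of 0 "D i"] frechet_derivative_works by blast

lemma derG: "y \<in> \<Omega> \<Longrightarrow> ((\<lambda>z. G z $ i $ j) has_derivative frechet_derivative (\<lambda>z. G z $ i $ j) (at y)) (at y)"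
  using smoothG[of "Suc 0" i j] times_differentiable_Suc_iff[OF \<Omega>, of 0 "\<lambda>z. G z $ i $ j"] frechet_derivative_works by blast

lemma smoothDG: "times_differentiable k \<Omega> (DG m i j)"
  using smoothG[of "Suc k" i j] times_differentiable_Suc_iff[OF \<Omega>, of k "\<lambda>z. G z $ i $ j"] by blast

lemma derR_eq: 
  assumes "x \<in> B - Z" shows "frechet_derivative R (at x) v = (\<Sum>i\<in>UNIV. v $ i *\<^sub>R D i x)"
proof -
  have "frechet_derivative R (at x) (\<Sum>i\<in>UNIV. v $ i *\<^sub>R axis i 1) = (\<Sum>i\<in>UNIV. v $ i *\<^sub>R D i x)"
    using has_derivative_linear[OF derR[OF assms]] by (simp add: linear_sum linear_scale)
  moreover have "(\<Sum>i\<in>UNIV. v $ i *\<^sub>R axis i 1) = v"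
    by (simp add: vec_eq_iff axis_def if_distrib cong: if_cong)
  ultimately show ?thesis by simp
qed

lemma D_commute:
  assumes "x \<in> B - Z"
  shows "frechet_derivative (D i) (at x) (axis m 1) = frechet_derivative (D m) (at x) (axis i 1)"
proof -
  have *: "frechet_derivative (\<lambda>y. h y $ k) (at y) u = frechet_derivative h (at y) u $ k"
    if "(h has_derivative frechet_derivative h (at y)) (at y)" for h :: "real^3 \<Rightarrow> real^3" and k y u
    using frechet_derivative_at[OF bounded_linear.has_derivative[OF bounded_linear_vec_nth that, of k]] by (simp add: fun_eq_iff)
  have "frechet_derivative (D i) (at x) (axis m 1) $ k = frechet_derivative (D m) (at x) (axis i 1) $ k" for k
  proof -
    have eq: "frechet_derivative (D i) (at x) (axis m 1) $ k =
       frechet_derivative (\<lambda>y. frechet_derivative (\<lambda>y. R y $ k) (at y) (axis i 1)) (at x) (axis m 1)" for i m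
    proof -
      have "((\<lambda>y. frechet_derivative (\<lambda>y. R y $ k) (at y) (axis i 1)) has_derivative (\<lambda>h. frechet_derivative (D i) (at x) h $ k)) (at x)"
        by (rule has_derivative_transform_within_open[OF bounded_linear.has_derivative[OF bounded_linear_vec_nth derD[OF assms]] oBZ assms])
          (use * derR in auto)
      from frechet_derivative_at[OF this] show ?thesis by (simp add: fun_eq_iff)
    qed
    show ?thesis unfolding eq
      by (rule frechet_derivative_symmetric[OF oBZ assms]) (rule times_differentiable_vec_nth[OF smoothR])
  qed
  then show ?thesis by (simp add: vec_eq_iff)
qed

lemma differentiated_isometry:
  assumes x: "x \<in> B - Z"
  shows "mform (G (R x)) (frechet_derivative (D i) (at x) (axis m 1)) (D j x)
    + mform (G (R x)) (D i x) (frechet_derivative (D j) (at x) (axis m 1)) = cc m i j x"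
proof -
  let ?X = "\<lambda>i. frechet_derivative (D i) (at x)"
  let ?dG = "\<lambda>q r. frechet_derivative (\<lambda>z. G z $ q $ r) (at (R x))"
  have Rx: "R x \<in> \<Omega>" "x \<in> \<Omega>" using x B\<Omega> by auto
  have 1: "((\<lambda>y. D i y $ q) has_derivative (\<lambda>h. ?X i h $ q)) (at x)" for i q
    by (rule bounded_linear.has_derivative[OF bounded_linear_vec_nth derD[OF x]])
  have 2: "((\<lambda>y. G (R y) $ q $ r) has_derivative (\<lambda>h. ?dG q r (frechet_derivative R (at x) h))) (at x)" for q r
    by (rule has_derivative_compose[OF derR[OF x] derG[OF Rx(1)]])
  have a: "((\<lambda>y. \<Sum>q\<in>UNIV. \<Sum>r\<in>UNIV. D i y $ q * G (R y) $ q $ r * D j y $ r) has_derivative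
    (\<lambda>h. \<Sum>q\<in>UNIV. \<Sum>r\<in>UNIV. D i x $ q * G (R x) $ q $ r * ?X j h $ r +
       (D i x $ q * ?dG q r (frechet_derivative R (at x) h) + ?X i h $ q * G (R x) $ q $ r) * D j x $ r)) (at x)"
    by (intro has_derivative_sum has_derivative_mult 1 2)
  have b: "((\<lambda>y. \<Sum>q\<in>UNIV. \<Sum>r\<in>UNIV. D i y $ q * G (R y) $ q $ r * D j y $ r) has_derivative
     frechet_derivative (\<lambda>z. G z $ i $ j) (at x)) (at x)"
    by (rule has_derivative_transform_within_open[OF derG[OF Rx(2)] oBZ x])
      (use isometry in \<open>simp add: mform_def[symmetric] mform_axis\<close>)
  have eq: "(\<Sum>q\<in>UNIV. \<Sum>r\<in>UNIV. D i x $ q * G (R x) $ q $ r * ?X j (axis m 1) $ r +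
       (D i x $ q * ?dG q r (D m x) + ?X i (axis m 1) $ q * G (R x) $ q $ r) * D j x $ r) = DG m i j x"
    using fun_cong[OF has_derivative_unique[OF a b], of "axis m 1"] .
  have exp: "?dG q r (D m x) = (\<Sum>p\<in>UNIV. D m x $ p * DG p q r (R x))" for q r
  proof -
    have "?dG q r (\<Sum>p\<in>UNIV. D m x $ p *\<^sub>R axis p 1) = (\<Sum>p\<in>UNIV. D m x $ p * DG p q r (R x))"
      using has_derivative_linear[OF derG[OF Rx(1)]] by (simp add: linear_sum linear_scale)
    moreover have "(\<Sum>p\<in>UNIV. D m x $ p *\<^sub>R axis p 1) = D m x"
      by (simp add: vec_eq_iff axis_def if_distrib cong: if_cong)
    ultimately show ?thesis by simp
  qed
  show ?thesis unfolding cc_def eq[symmetric] exp mform_def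
    by (simp add: sum.distrib sum_distrib_left sum_distrib_right algebra_simps)
qed

lemma mform_sym: "x \<in> \<Omega> \<Longrightarrow> mform (G x) u v = mform (G x) v u"
  unfolding mform_def by (subst sum.swap) (use symG in \<open>auto intro!: sum.cong\<close>)

text \<open>As for the Levi-Civita connection, the symmetry of second derivatives lets one solve the three
  permuted equations of \<open>differentiated_isometry\<close> for a single term.\<close>

lemma koszul:
  assumes x: "x \<in> B - Z"
  shows "mform (G (R x)) (frechet_derivative (D i) (at x) (axis m 1)) (D j x) = T i m j x"
proof -
  let ?t = "\<lambda>i m j. mform (G (R x)) (frechet_derivative (D i) (at x) (axis m 1)) (D j x)"
  have Rx: "R x \<in> \<Omega>" using x B\<Omega> by auto
  have s: "?t i m j = ?t m i j" for i m j using D_commute[OF x] by simp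
  have c: "?t i m j + ?t j m i = cc m i j x" for i m j
    using differentiated_isometry[OF x, of i m j] mform_sym[OF Rx] by simp
  have aux: "a = (p + q - r) / 2"
    if "a + b = p" "a' + c = q" "b' + c' = r" "a = a'" "b = b'" "c = c'" for a b c a' b' c' p q r :: real
    using that by simp
  show ?thesis unfolding T_def
    by (rule aux[OF c[of i m j] c[of m i j] c[of m j i] s[of i m j] s[of j m i] s[of j i m]])
qed

lemma derivative_D_eq_Y:
  assumes x: "x \<in> B - Z"
  shows "frechet_derivative (D i) (at x) (axis m 1) = Y i m x"
proof -
  let ?X = "frechet_derivative (D i) (at x) (axis m 1)"
  have Rx: "R x \<in> \<Omega>" "x \<in> \<Omega>" using x B\<Omega> by auto
  have iso: "mform (G (R x)) (D p x) (D k x) = G x $ p $ k" for p k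
    using isometry[OF x] by (simp add: mform_axis)
  have "mform (G (R x)) (Y i m x) (D k x) = T i m k x" for k
  proof -
    have "mform (G (R x)) (Y i m x) (D k x) =
      (\<Sum>p\<in>UNIV. \<Sum>q\<in>UNIV. (matrix_inv (G x) $ p $ q * T i m q x) * G x $ p $ k)"
      unfolding Y_def by (simp add: linear_sum[OF mform_linear(1)] linear_scale[OF mform_linear(1)] iso)
    also have "\<dots> = (\<Sum>q\<in>UNIV. (\<Sum>p\<in>UNIV. G x $ k $ p * matrix_inv (G x) $ p $ q) * T i m q x)"
    proof (subst sum.swap, rule sum.cong[OF refl])
      fix q
      have "matrix_inv (G x) $ p $ q * T i m q x * G x $ p $ k = G x $ k $ p * matrix_inv (G x) $ p $ q * T i m q x" for p
        by (subst symG[OF Rx(2), of p k]) (simp only: mult_ac)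
      then show "(\<Sum>p\<in>UNIV. matrix_inv (G x) $ p $ q * T i m q x * G x $ p $ k)
          = (\<Sum>p\<in>UNIV. G x $ k $ p * matrix_inv (G x) $ p $ q) * T i m q x"
        by (simp only: sum_distrib_right)
    qed
    also have "\<dots> = (\<Sum>q\<in>UNIV. (G x ** matrix_inv (G x)) $ k $ q * T i m q x)"
      by (simp add: matrix_matrix_mult_def)
    also have "\<dots> = T i m k x"
      by (simp add: matrix_inv_right[OF invG[OF Rx(2)]] mat_def if_distrib[of "\<lambda>x. x * _"] cong: if_cong)
    finally show ?thesis .
  qed
  then have ort: "mform (G (R x)) (?X - Y i m x) (D k x) = 0" for k
    using koszul[OF x] by (simp add: linear_diff[OF mform_linear(1)])
  let ?f = "frechet_derivative R (at x)"
  have lin: "linear ?f" using has_derivative_linear[OF derR[OF x]] .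
  have "v = 0" if "?f v = 0" for v
  proof -
    have "mform (G x) v v = mform (G (R x)) (?f v) (?f v)" using isometry[OF x] by simp
    also have "\<dots> = 0" using that linear_0[OF mform_linear(2)] by simp
    finally have "c * (norm v)\<^sup>2 \<le> 0" using lower[OF Rx(2), of v] by simp
    then show "v = 0" using c(1) by (simp add: mult_le_0_iff)
  qed
  then have "inj ?f" using lin by (simp add: linear_injective_0)
  then have "surj ?f" using lin linear_injective_imp_surjective by blast
  then obtain z where z: "?X - Y i m x = ?f z" by (metis surjD)
  have "mform (G (R x)) (?X - Y i m x) (?X - Y i m x) = mform (G (R x)) (?X - Y i m x) (\<Sum>k\<in>UNIV. z $ k *\<^sub>R D k x)"
    using z derR_eq[OF x, of z] by simp
  also have "\<dots> = 0"
    using ort by (simp add: linear_sum[OF mform_linear(2)] linear_scale[OF mform_linear(2)])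
  finally have "c * (norm (?X - Y i m x))\<^sup>2 \<le> 0" using lower[OF Rx(1), of "?X - Y i m x"] by simp
  then show ?thesis using c(1) by (simp add: mult_le_0_iff)
qed

lemma bdd_D: "bdd_on (B - Z) (D i)"
proof (rule bdd_onI)
  fix x assume x: "x \<in> B - Z"
  then have Rx: "R x \<in> \<Omega>" "x \<in> \<Omega>" using B\<Omega> by auto
  have "c * (norm (D i x))\<^sup>2 \<le> mform (G (R x)) (D i x) (D i x)" using lower Rx by blast
  also have "\<dots> = mform (G x) (axis i 1) (axis i 1)" by (rule isometry[OF x])
  also have "\<dots> \<le> C * (norm (axis i 1 :: real^3))\<^sup>2" using upper Rx by blast
  finally have "(norm (D i x))\<^sup>2 \<le> C / c" using c by (simp add: field_simps)
  then show "norm (D i x) \<le> sqrt (C / c)" by (rule real_le_rsqrt)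
qed

lemma bdd_Y: "bdd_on (B - Z) (Y i m)"
proof -
  have dG: "bdd_on (B - Z) (DG m i j)" for m i j
    by (rule bdd_on_compact[OF S(1) continuous_on_subset[OF times_differentiable_imp_continuous_on[OF smoothDG] S(2)]])
      (use BS in auto)
  have dGR: "bdd_on (B - Z) (\<lambda>x. DG m i j (R x))" for m i j
    by (rule bdd_on_compose, rule bdd_on_compact[OF S(1) continuous_on_subset[OF times_differentiable_imp_continuous_on[OF smoothDG] S(2)]])
      (use BS in auto)
  have inv: "bdd_on (B - Z) (\<lambda>x. matrix_inv (G x) $ p $ q)" for p q
    by (rule bdd_on_compact[OF S(1) continuous_on_subset[OF times_differentiable_imp_continuous_on[OF 
          times_differentiable_matrix_inv[OF smoothG \<Omega> invG]] S(2)]])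
      (use BS in auto)
  have D: "bdd_on (B - Z) (\<lambda>x. D i x $ q)" for i q
  proof -
    obtain M where M: "\<forall>x\<in>B - Z. norm (D i x) \<le> M" using bdd_D[of i] unfolding bdd_on_def by blast
    show ?thesis
    proof (rule bdd_onI)
      fix x assume "x \<in> B - Z"
      then have "norm (D i x) \<le> M" using M by blast
      then show "norm (D i x $ q) \<le> M" using component_le_norm_cart[of "D i x" q] by simp
    qed
  qed
  show ?thesis unfolding Y_def T_def cc_def divide_inverse
    by (intro bdd_on_sum bdd_on_scaleR bdd_on_mult bdd_on_add bdd_on_diff bdd_on_const dG dGR inv D bdd_D)
qed

lemma times_differentiable_Y:
  assumes "times_differentiable (Suc k) B R"
  shows "times_differentiable k B (Y i m)"
proof -
  have D: "times_differentiable k B (D i)" for i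
    using assms times_differentiable_Suc_iff[OF B(1)] by blast
  have R: "times_differentiable k B R" using assms by (rule times_differentiable_mono)
  have B': "B \<subseteq> \<Omega>" "R ` B \<subseteq> \<Omega>" using BS S by auto
  have 1: "times_differentiable k B (\<lambda>x. DG m i j (R x))" for m i j
    by (rule times_differentiable_compose[OF R smoothDG B'(2)])
  have 2: "times_differentiable k B (\<lambda>x. DG m i j x)" for m i j
    by (rule times_differentiable_subset[OF smoothDG B'(1)])
  have 3: "times_differentiable k B (\<lambda>x. matrix_inv (G x) $ p $ q)" for p q
    by (rule times_differentiable_subset[OF times_differentiable_matrix_inv[OF smoothG \<Omega> invG] B'(1)])
  show ?thesis unfolding Y_def T_def cc_def divide_inverse
    by (intro times_differentiable_sum times_differentiable_scaleR times_differentiable_mult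
       times_differentiable_add times_differentiable_diff times_differentiable_const 1 2 3 D
       times_differentiable_vec_nth)
qed

lemma dimZ: "dim Z < 3"
  unfolding Z dim_span using dim_le_card'[of "{p}"] by simp

lemma has_derivative_across:
  fixes F :: "real^3 \<Rightarrow> real^3"
  assumes "continuous_on B F"
    and "\<And>y. y \<in> B - Z \<Longrightarrow> (F has_derivative (\<lambda>v. \<Sum>i\<in>UNIV. v $ i *\<^sub>R E i y)) (at y)"
    and "\<And>i. continuous_on B (E i)" "x \<in> B"
  shows "(F has_derivative (\<lambda>v. \<Sum>i\<in>UNIV. v $ i *\<^sub>R E i x)) (at x)"
proof (cases "x \<in> Z")
  case True
  show ?thesis
  proof (rule has_derivative_extends_across_null_directions[OF B(1) assms(4,1) True assms(2)])
    show "bounded_linear (\<lambda>v. \<Sum>i\<in>UNIV. v $ i *\<^sub>R E i y)" for y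
      by (intro bounded_linear_sum bounded_linear_scaleR_const bounded_linear_vec_nth)
    show "continuous_on B (\<lambda>y. \<Sum>i\<in>UNIV. v $ i *\<^sub>R E i y)" for v :: "real^3"
      by (intro continuous_intros assms)
    show "open_segment x y \<inter> Z = {}" if y: "y \<in> B - Z" for y
    proof -
      have "z \<notin> Z" if "z \<in> open_segment x y" for z
      proof
        assume zZ: "z \<in> Z"
        obtain t where t: "0 < t" "z = (1 - t) *\<^sub>R x + t *\<^sub>R y"
          using \<open>z \<in> open_segment x y\<close> by (auto simp: in_segment)
        have "(1 / t) *\<^sub>R (z - (1 - t) *\<^sub>R x) \<in> Z"
          using zZ True unfolding Z by (intro span_scale span_diff) auto
        moreover have "(1 / t) *\<^sub>R (z - (1 - t) *\<^sub>R x) = y" using t by simp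
        ultimately show False using y by simp
      qed
      then show ?thesis by blast
    qed
    show "B \<subseteq> closure (B - Z)"
      using dense_in_open_minus_subspace[OF B(1) _ dimZ] Z by auto
  qed
qed (use assms in blast)

text \<open>Isometry bounds the first derivatives \<open>D\<close>, hence the second derivatives \<open>Y\<close>, which are smooth functions of
  \<open>x\<close>, \<open>R x\<close> and \<open>D\<close>. So \<open>D\<close> is Lipschitz off the line and extends continuously to it, and \<open>R\<close> is
  continuously differentiable by \<open>has_derivative_across\<close>. The relation between \<open>D\<close> and \<open>Y\<close> now bootstraps to all orders.\<close>

theorem smooth_across: "times_differentiable k B R"
proof -
  have dD: "(D i has_derivative (\<lambda>v. \<Sum>m\<in>UNIV. v $ m *\<^sub>R Y i m x)) (at x)" if x: "x \<in> B - Z" for i x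
  proof -
    have "frechet_derivative (D i) (at x) v = (\<Sum>m\<in>UNIV. v $ m *\<^sub>R Y i m x)" for v
    proof -
      have "frechet_derivative (D i) (at x) (\<Sum>m\<in>UNIV. v $ m *\<^sub>R axis m 1) = (\<Sum>m\<in>UNIV. v $ m *\<^sub>R Y i m x)"
        using has_derivative_linear[OF derD[OF x]] derivative_D_eq_Y[OF x] by (simp add: linear_sum linear_scale)
      moreover have "(\<Sum>i\<in>UNIV. v $ i *\<^sub>R axis i 1) = v"
        by (simp add: vec_eq_iff axis_def if_distrib cong: if_cong)
      ultimately show ?thesis by simp
    qed
    then have "frechet_derivative (D i) (at x) = (\<lambda>v. \<Sum>m\<in>UNIV. v $ m *\<^sub>R Y i m x)" by (simp add: fun_eq_iff)
    then show ?thesis using derD[OF x, of i] by simp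
  qed
  have ex: "\<exists>E. continuous_on B E \<and> (\<forall>x\<in>B - Z. E x = D i x)" for i
  proof -
    have "\<forall>m. \<exists>M. \<forall>x\<in>B - Z. norm (Y i m x) \<le> M" using bdd_Y unfolding bdd_on_def by blast
    then obtain M where M: "\<And>m x. x \<in> B - Z \<Longrightarrow> norm (Y i m x) \<le> M m" by metis
    define L where "L = (\<Sum>m\<in>UNIV. \<bar>M m\<bar>)"
    have L0: "0 \<le> L" unfolding L_def by (simp add: sum_nonneg)
    have "L-lipschitz_on (B - Z) (D i)"
    proof (rule lipschitz_off_line[OF B Z dD _ L0])
      fix y assume y: "y \<in> B - Z"
      show "onorm (\<lambda>v. \<Sum>m\<in>UNIV. v $ m *\<^sub>R Y i m y) \<le> L"
      proof (rule onorm_le)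
        fix v :: "real^3"
        have "norm (\<Sum>m\<in>UNIV. v $ m *\<^sub>R Y i m y) \<le> (\<Sum>m\<in>UNIV. \<bar>M m\<bar> * norm v)"
        proof (rule sum_norm_le)
          fix m :: 3
          have "norm (v $ m *\<^sub>R Y i m y) = \<bar>v $ m\<bar> * norm (Y i m y)" by simp
          also have "\<dots> \<le> norm v * \<bar>M m\<bar>"
            using M[OF y, of m] by (intro mult_mono component_le_norm_cart) auto
          finally show "norm (v $ m *\<^sub>R Y i m y) \<le> \<bar>M m\<bar> * norm v" by (simp add: mult.commute)
        qed
        then show "norm (\<Sum>m\<in>UNIV. v $ m *\<^sub>R Y i m y) \<le> L * norm v"
          unfolding L_def by (simp add: sum_distrib_right)
      qed
    qed
    then obtain E where E: "L-lipschitz_on (closure (B - Z)) E" "\<forall>x\<in>B - Z. E x = D i x"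
      using lipschitz_extend_closure by blast
    have "B \<subseteq> closure (B - Z)"
      using dense_in_open_minus_subspace[OF B(1) _ dimZ] Z by auto
    then show ?thesis using E lipschitz_on_continuous_on continuous_on_subset by blast
  qed
  define E where "E i = (SOME E. continuous_on B E \<and> (\<forall>x\<in>B - Z. E x = D i x))" for i
  have E: "continuous_on B (E i)" "x \<in> B - Z \<Longrightarrow> E i x = D i x" for i x
    using someI_ex[OF ex[of i]] unfolding E_def by blast+
  have R1: "(R has_derivative (\<lambda>v. \<Sum>i\<in>UNIV. v $ i *\<^sub>R E i x)) (at x)" if "x \<in> B" for x
  proof (rule has_derivative_across[OF contR _ E(1) that])
    fix y assume y: "y \<in> B - Z"
    have "frechet_derivative R (at y) = (\<lambda>v. \<Sum>i\<in>UNIV. v $ i *\<^sub>R E i y)"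
      by (rule ext, subst derR_eq[OF y]) (simp only: E(2)[OF y])
    then show "(R has_derivative (\<lambda>v. \<Sum>i\<in>UNIV. v $ i *\<^sub>R E i y)) (at y)"
      using derR[OF y] by simp
  qed
  have "times_differentiable (Suc k) B R" for k
  proof (induction k)
    case 0
    show ?case
      by (rule times_differentiable_SucI[OF R1]) (auto intro!: continuous_intros E(1))
  next
    case (Suc k)
    have td: "times_differentiable k B (Y i m)" for i m by (rule times_differentiable_Y[OF Suc])
    have tD: "times_differentiable k B (D i)" for i
      using Suc times_differentiable_Suc_iff[OF B(1)] by blast
    have D1: "(D i has_derivative (\<lambda>v. \<Sum>m\<in>UNIV. v $ m *\<^sub>R Y i m x)) (at x)" if "x \<in> B" for i x
      by (rule has_derivative_across[OF times_differentiable_imp_continuous_on[OF tD] dD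
            times_differentiable_imp_continuous_on[OF td] that])
    have D2: "times_differentiable (Suc k) B (D i)" for i
      by (rule times_differentiable_SucI[OF D1])
        (assumption, intro times_differentiable_sum times_differentiable_scaleR times_differentiable_const td)
    have R2: "(R has_derivative (\<lambda>v. \<Sum>i\<in>UNIV. v $ i *\<^sub>R D i x)) (at x)" if "x \<in> B" for x
    proof -
      have "D i x = E i x" for i
      proof -
        have "D i x = (\<Sum>j\<in>UNIV. axis i 1 $ j *\<^sub>R E j x)"
          using frechet_derivative_at[OF R1[OF that]] by (simp add: fun_eq_iff)
        also have "\<dots> = E i x" by (simp add: axis_def if_distrib[of "\<lambda>x. x *\<^sub>R _"] cong: if_cong)
        finally show ?thesis .
      qed
      then show ?thesis using R1[OF that] by simp
    qed
    show ?case
      by (rule times_differentiable_SucI[OF R2])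
        (assumption, intro times_differentiable_sum times_differentiable_scaleR times_differentiable_const D2)
  qed
  then show ?thesis by (rule times_differentiable_mono)
qed

end


section \<open>The metric as a metric on punctured space\<close>

lemma frechet_derivative_cong_open:
  assumes "open W" "x \<in> W" "\<And>y. y \<in> W \<Longrightarrow> f y = h y"
  shows "frechet_derivative f (at x) = frechet_derivative h (at x)"
proof -
  have "(f has_derivative D) (at x) \<longleftrightarrow> (h has_derivative D) (at x)" for D
    using has_derivative_transform_within_open[of f D x UNIV W h]
      has_derivative_transform_within_open[of h D x UNIV W f] assms by auto
  then show ?thesis unfolding frechet_derivative_def by simp
qed

lemma smooth_on_open:
  assumes "open U" "smooth_on U f"
  shows "times_differentiable k U f"
proof -
  obtain W F where W: "open W" "U \<subseteq> W" "\<forall>k. times_differentiable k W F" "\<forall>x\<in>U. F x = f x"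
    using assms(2) unfolding smooth_on_def by auto
  show ?thesis
    by (rule times_differentiable_cong[OF assms(1) _ times_differentiable_subset[OF W(3)[rule_format] W(2)]])
      (use W(4) in auto)
qed

lemma times_differentiable_derivI:
  assumes "open W" "times_differentiable (Suc k) W f"
  shows "times_differentiable k W (\<lambda>x. frechet_derivative f (at x) v)"
    and "x \<in> W \<Longrightarrow> (f has_derivative frechet_derivative f (at x)) (at x)"
  using assms times_differentiable_Suc_iff[OF assms(1), of k f] frechet_derivative_works by blast+

text \<open>The degree 0 homogeneous extension of the metric from the sphere to 3-space without the origin, with the
  radial direction orthogonal to the sphere and of unit length. It replaces charts of the sphere by the
  coordinates of 3-space.\<close>

definition ghat :: "metric \<Rightarrow> real^3 \<Rightarrow> real^3 \<Rightarrow> real^3 \<Rightarrow> real" where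
  "ghat g x u v = g (x /\<^sub>R norm x) (tangent_proj (x /\<^sub>R norm x) u) (tangent_proj (x /\<^sub>R norm x) v)
     + ((x /\<^sub>R norm x) \<bullet> u) * ((x /\<^sub>R norm x) \<bullet> v)"

definition gmat :: "metric \<Rightarrow> real^3 \<Rightarrow> real^3^3" where
  "gmat g x = (\<chi> i j. ghat g x (axis i 1) (axis j 1))"

lemma tangent_proj_tangent: "p \<in> S2 \<Longrightarrow> tangent_proj p u \<in> tangent_space p"
  by (simp add: tangent_proj_def tangent_space_def inner_diff_left dot_square_norm)

lemma tangent_proj_id: "v \<bullet> p = 0 \<Longrightarrow> tangent_proj p v = v"
  by (simp add: tangent_proj_def)

lemma unit_S2: "x \<noteq> 0 \<Longrightarrow> x /\<^sub>R norm x \<in> S2"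
  by simp

locale sphere_metric =
  fixes g :: metric
  assumes riem: "riemannian_metric g"
begin

lemma ghat_bilinear: "x \<noteq> 0 \<Longrightarrow> bilinear (ghat g x)"
proof -
  assume "x \<noteq> 0"
  then have b: "bilinear (\<lambda>u v. g (x /\<^sub>R norm x) (tangent_proj (x /\<^sub>R norm x) u) (tangent_proj (x /\<^sub>R norm x) v))"
    using riem unit_S2 unfolding riemannian_metric_def by blast
  have l: "linear (\<lambda>v. k * (w \<bullet> v))" "linear (\<lambda>v. (w \<bullet> v) * k)" for k and w :: "real^3"
    by (auto intro!: linearI simp: inner_add_right algebra_simps)
  show ?thesis
    unfolding bilinear_def ghat_def
  proof (intro conjI allI linear_compose_add l)
    fix u
    show "linear (\<lambda>v. g (x /\<^sub>R norm x) (tangent_proj (x /\<^sub>R norm x) u) (tangent_proj (x /\<^sub>R norm x) v))"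
      "linear (\<lambda>v. g (x /\<^sub>R norm x) (tangent_proj (x /\<^sub>R norm x) v) (tangent_proj (x /\<^sub>R norm x) u))"
      using b unfolding bilinear_def by blast+
  qed
qed

lemma ghat_sym: "x \<noteq> 0 \<Longrightarrow> ghat g x u v = ghat g x v u"
  using riem unit_S2[of x] tangent_proj_tangent[OF unit_S2, of x] unfolding riemannian_metric_def ghat_def
  by (simp add: mult.commute)

lemma mform_gmat:
  assumes "x \<noteq> 0" shows "mform (gmat g x) u v = ghat g x u v"
proof -
  have l: "linear (ghat g x w)" "linear (\<lambda>w'. ghat g x w' w)" for w
    using ghat_bilinear[OF assms] unfolding bilinear_def by auto
  have e: "w = (\<Sum>i\<in>UNIV. w $ i *\<^sub>R axis i 1)" for w :: "real^3"
    by (simp add: vec_eq_iff axis_def if_distrib cong: if_cong)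
  have "ghat g x u v = ghat g x (\<Sum>i\<in>UNIV. u $ i *\<^sub>R axis i 1) (\<Sum>j\<in>UNIV. v $ j *\<^sub>R axis j 1)"
    using e by metis
  also have "\<dots> = (\<Sum>j\<in>UNIV. v $ j * (\<Sum>i\<in>UNIV. u $ i * ghat g x (axis i 1) (axis j 1)))"
    by (simp only: linear_sum[OF l(2)] linear_scale[OF l(2)] linear_sum[OF l(1)] linear_scale[OF l(1)] real_scaleR_def)
  also have "\<dots> = mform (gmat g x) u v"
    unfolding mform_def by (subst sum.swap) (simp add: gmat_def sum_distrib_left mult_ac)
  finally show ?thesis by simp
qed

lemma ghat_pos: "x \<noteq> 0 \<Longrightarrow> v \<noteq> 0 \<Longrightarrow> 0 < ghat g x v v"
proof -
  assume x: "x \<noteq> 0" and v: "v \<noteq> 0"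
  let ?p = "x /\<^sub>R norm x"
  have p: "?p \<in> S2" using x unit_S2 by blast
  show ?thesis
  proof (cases "tangent_proj ?p v = 0")
    case True
    then have "v = (v \<bullet> ?p) *\<^sub>R ?p" by (simp add: tangent_proj_def)
    with v have "v \<bullet> ?p \<noteq> 0" by (metis scaleR_zero_left)
    then have "0 < (?p \<bullet> v) * (?p \<bullet> v)" by (metis inner_commute not_real_square_gt_zero)
    moreover have "bilinear (\<lambda>u v. g ?p (tangent_proj ?p u) (tangent_proj ?p v))"
      using riem p unfolding riemannian_metric_def by blast
    then have "g ?p (tangent_proj ?p 0) (tangent_proj ?p v) = 0" using bilinear_lzero by blast
    ultimately show ?thesis using True by (simp add: ghat_def tangent_proj_def)
  next
    case False
    then have "0 < g ?p (tangent_proj ?p v) (tangent_proj ?p v)"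
      using riem p tangent_proj_tangent[OF p] unfolding riemannian_metric_def by blast
    moreover have "0 \<le> (?p \<bullet> v) * (?p \<bullet> v)" by simp
    ultimately show ?thesis unfolding ghat_def by linarith
  qed
qed

lemma times_differentiable_unit: "0 \<notin> W \<Longrightarrow> times_differentiable k W (\<lambda>x::real^3. x /\<^sub>R norm x)"
  by (intro times_differentiable_scaleR times_differentiable_inverse times_differentiable_norm times_differentiable_id)
    auto

lemma times_differentiable_ghat: "times_differentiable k (- {0}) (\<lambda>x. ghat g x u v)"
proof -
  have "smooth_on S2 (\<lambda>p. g p (tangent_proj p u) (tangent_proj p v))"
    using riem unfolding riemannian_metric_def by blast
  then obtain W F where W: "open W" "S2 \<subseteq> W" "\<forall>k. times_differentiable k W F"
      "\<forall>x\<in>S2. F x = g x (tangent_proj x u) (tangent_proj x v)" unfolding smooth_on_def by auto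
  have un: "times_differentiable k (- {0}) (\<lambda>x::real^3. x /\<^sub>R norm x)"
    by (rule times_differentiable_unit) simp
  have "times_differentiable k (- {0}) (\<lambda>x. F (x /\<^sub>R norm x))"
    by (rule times_differentiable_compose[OF un W(3)[rule_format]]) (use W(2) unit_S2 in blast)
  then have "times_differentiable k (- {0}) (\<lambda>x. F (x /\<^sub>R norm x) + ((x /\<^sub>R norm x) \<bullet> u) * ((x /\<^sub>R norm x) \<bullet> v))"
    by (intro times_differentiable_add times_differentiable_mult times_differentiable_inner un
        times_differentiable_const)
  then show ?thesis
    by (rule times_differentiable_cong[rotated 2]) (use W(4) in \<open>auto simp: ghat_def\<close>)
qed

lemma times_differentiable_gmat: "times_differentiable k (- {0}) (\<lambda>x. gmat g x $ i $ j)"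
  using times_differentiable_ghat unfolding gmat_def by simp

lemma ghat_bounds:
  obtains c C where "0 < c" "0 \<le> C"
    "\<And>x v. x \<noteq> 0 \<Longrightarrow> c * (norm v)\<^sup>2 \<le> mform (gmat g x) v v"
    "\<And>x v. x \<noteq> 0 \<Longrightarrow> mform (gmat g x) v v \<le> C * (norm v)\<^sup>2"
proof -
  define f where "f z = mform (gmat g (fst z)) (snd z) (snd z)" for z :: "(real^3) \<times> (real^3)"
  have "continuous_on (- {0}) (\<lambda>x. gmat g x $ i $ j)" for i j
    using times_differentiable_imp_continuous_on[OF times_differentiable_gmat] .
  then have cg: "continuous_on (S2 \<times> S2) (\<lambda>z::(real^3) \<times> (real^3). gmat g (fst z) $ i $ j)" for i j
    by (rule continuous_on_compose2) (auto intro!: continuous_intros)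
  have cf: "continuous_on (S2 \<times> S2) f" unfolding f_def mform_def
    by (intro continuous_intros cg)
  have comp: "compact (S2 \<times> S2)" by (intro compact_Times) auto
  have "axis 1 1 \<in> S2" by simp
  then have ne: "S2 \<times> S2 \<noteq> {}" by auto
  obtain z0 where z0: "z0 \<in> S2 \<times> S2" "\<And>z. z \<in> S2 \<times> S2 \<Longrightarrow> f z0 \<le> f z"
    using continuous_attains_inf[OF comp ne cf] by blast
  obtain z1 where z1: "z1 \<in> S2 \<times> S2" "\<And>z. z \<in> S2 \<times> S2 \<Longrightarrow> f z \<le> f z1"
    using continuous_attains_sup[OF comp ne cf] by blast
  have fpos: "0 < f z" if "z \<in> S2 \<times> S2" for z
  proof -
    have "fst z \<noteq> 0" "snd z \<noteq> 0" using that by (auto simp: mem_Times_iff)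
    then show ?thesis unfolding f_def using mform_gmat ghat_pos by simp
  qed
  have scale: "mform (gmat g x) v v = (norm v)\<^sup>2 * f (x /\<^sub>R norm x, v /\<^sub>R norm v)" "(x /\<^sub>R norm x, v /\<^sub>R norm v) \<in> S2 \<times> S2"
    if "x \<noteq> 0" "v \<noteq> 0" for x v
  proof -
    have "gmat g (x /\<^sub>R norm x) = gmat g x" using that by (simp add: gmat_def ghat_def)
    moreover have "mform A (k *\<^sub>R w) (k *\<^sub>R w) = k\<^sup>2 * mform A w w" for A k w
      by (simp add: mform_def sum_distrib_left power2_eq_square mult_ac)
    from this[of _ "norm v" "v /\<^sub>R norm v"]
    have "mform A (norm v *\<^sub>R (v /\<^sub>R norm v)) (norm v *\<^sub>R (v /\<^sub>R norm v)) = 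
        (norm v)\<^sup>2 * mform A (v /\<^sub>R norm v) (v /\<^sub>R norm v)" for A .
    moreover have "norm v *\<^sub>R (v /\<^sub>R norm v) = v" using that by simp
    ultimately show "mform (gmat g x) v v = (norm v)\<^sup>2 * f (x /\<^sub>R norm x, v /\<^sub>R norm v)"
      by (simp add: f_def)
    show "(x /\<^sub>R norm x, v /\<^sub>R norm v) \<in> S2 \<times> S2" using that by simp
  qed
  have z: "mform A 0 0 = 0" for A using linear_0[OF mform_linear(2)] .
  show ?thesis
  proof (rule that[of "f z0" "f z1"])
    show "0 < f z0" using fpos z0 by blast
    show "0 \<le> f z1" using fpos z1 less_imp_le by blast
    show "f z0 * (norm v)\<^sup>2 \<le> mform (gmat g x) v v" if "x \<noteq> 0" for x v
    proof (cases "v = 0")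
      case True then show ?thesis by (simp add: z)
    next
      case False
      have "f z0 \<le> f (x /\<^sub>R norm x, v /\<^sub>R norm v)" using z0(2)[OF scale(2)[OF that False]] .
      then show ?thesis unfolding scale(1)[OF that False] by (metis mult.commute mult_right_mono zero_le_power2)
    qed
    show "mform (gmat g x) v v \<le> f z1 * (norm v)\<^sup>2" if "x \<noteq> 0" for x v
    proof (cases "v = 0")
      case True then show ?thesis by (simp add: z)
    next
      case False
      have "f (x /\<^sub>R norm x, v /\<^sub>R norm v) \<le> f z1" using z1(2)[OF scale(2)[OF that False]] .
      then show ?thesis unfolding scale(1)[OF that False] by (metis mult.commute mult_right_mono zero_le_power2)
    qed
  qed
qed

end

section \<open>Rotations of a surface of revolution\<close>

abbreviation "pt s \<theta> \<equiv> (vector [s, \<theta>] :: real^2)"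

lemma pt_eta: "x = pt (x $ 1) (x $ 2)"
  by (simp add: vec_eq_iff forall_2)

locale revolution =
  fixes g :: metric and L :: real and a :: "real \<Rightarrow> real" and \<Phi> :: "real^2 \<Rightarrow> real^3"
  assumes rev: "simple_metric_of_revolution g L a \<Phi>"

sublocale revolution \<subseteq> sphere_metric g
  using rev unfolding simple_metric_of_revolution_def by unfold_locales auto

context revolution
begin

definition strip :: "(real^2) set" where "strip = {x. 0 < x$1 \<and> x$1 < L}"
definition cstrip :: "(real^2) set" where "cstrip = {x. 0 \<le> x$1 \<and> x$1 \<le> L}"

lemma profile: "simple_profile L a" and coords: "revolution_coordinates g L a \<Phi>"
  using rev unfolding simple_metric_of_revolution_def by auto

lemma L_pos: "0 < L" using profile unfolding simple_profile_def by auto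

lemma open_strip: "open strip"
  unfolding strip_def by (intro open_Collect_conj open_Collect_less continuous_intros)

lemma strip_cstrip: "strip \<subseteq> cstrip" unfolding strip_def cstrip_def by auto

lemma a_nonneg: "s \<in> {0..L} \<Longrightarrow> 0 \<le> a s"
  using profile unfolding simple_profile_def by auto

lemma smooth_a: "times_differentiable k {0<..<L} a"
proof (rule smooth_on_open)
  show "smooth_on {0<..<L} a"
    using profile unfolding simple_profile_def smooth_on_def
    by (meson greaterThanLessThan_subseteq_atLeastAtMost_iff order_refl subset_trans subsetD)
qed simp

lemma a_pos:
  assumes s: "0 < s" "s < L"
  shows "0 < a s"
proof (rule ccontr)
  assume "\<not> 0 < a s"
  then have as: "a s = 0" using a_nonneg[of s] s by auto
  obtain s0 where s0: "s0 \<in> {0<..<L}" "\<And>s. critical_point L a s \<longleftrightarrow> s = s0" "\<And>s. s \<in> {0..L} \<Longrightarrow> a s \<le> a s0"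
    using profile unfolding simple_profile_def by blast
  have dd: "\<exists>d. (a has_real_derivative d) (at r)" if "r \<in> {0<..<L}" for r
  proof -
    have "(a has_derivative frechet_derivative a (at r)) (at r)"
      by (rule times_differentiable_derivI(2)[OF _ smooth_a]) (use that in auto)
    then have "a differentiable (at r)" by (rule differentiableI)
    then show ?thesis unfolding real_differentiable_def .
  qed
  obtain d where d: "(a has_real_derivative d) (at s)" using dd[of s] s by auto
  have "d = 0"
    by (rule DERIV_local_min[OF d, of "min s (L - s)"]) (use s as in \<open>auto simp: abs_if split: if_splits intro!: a_nonneg\<close>)
  then have "critical_point L a s"
    using d s unfolding critical_point_def by (auto intro: has_field_derivative_at_within)
  then have "s = s0" using s0 by simp
  then have z: "a r = 0" if "r \<in> {0..L}" for r using s0(3)[OF that] as a_nonneg[OF that] by simp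
  have "critical_point L a r" if "r \<in> {0<..<L}" for r
  proof -
    have "((\<lambda>_. 0) has_real_derivative 0) (at r within {0..L})" by simp
    then have "(a has_real_derivative 0) (at r within {0..L})"
      by (rule has_field_derivative_transform_within[of _ _ _ _ 1]) (use z that in auto)
    then show ?thesis using that unfolding critical_point_def by auto
  qed
  then have "r = s0" if "r \<in> {0<..<L}" for r using s0(2) that by blast
  from this[of "L/2"] this[of "L/3"] show False using L_pos by auto
qed

lemma smooth_Phi: "times_differentiable k strip \<Phi>"
  by (rule smooth_on_open[OF open_strip]) (use coords in \<open>auto simp: revolution_coordinates_def strip_def\<close>)

lemma cont_Phi: "continuous_on cstrip \<Phi>"
  using coords by (auto simp: revolution_coordinates_def cstrip_def)

lemma Phi_periodic_nat: "\<Phi> (x + axis 2 (2 * pi * real k)) = \<Phi> x"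
proof (induction k)
  case (Suc k)
  have "x + axis 2 (2 * pi * real (Suc k)) = (x + axis 2 (2 * pi * real k)) + axis 2 (2 * pi)"
    by (simp add: vec_eq_iff axis_def algebra_simps)
  then show ?case using Suc coords unfolding revolution_coordinates_def by metis
next
  case 0
  have z: "axis 2 0 = (0::real^2)" by (simp add: vec_eq_iff axis_def)
  show ?case by (simp only: of_nat_0 mult_zero_right z add_0_right)
qed

lemma Phi_periodic: "\<Phi> (x + axis 2 (2 * pi * of_int k)) = \<Phi> x"
proof (cases "k \<ge> 0")
  case True
  then show ?thesis using Phi_periodic_nat[of x "nat k"] by simp
next
  case False
  then have k: "of_int k = - real (nat (- k))" by simp
  have "x = (x + axis 2 (2 * pi * of_int k)) + axis 2 (2 * pi * real (nat (- k)))"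
    unfolding k by (simp add: vec_eq_iff axis_def)
  then show ?thesis using Phi_periodic_nat by metis
qed

lemma Phi_periodic_pt: "\<Phi> (pt s (\<theta> + 2 * pi * of_int k)) = \<Phi> (pt s \<theta>)"
proof -
  have "pt s (\<theta> + 2 * pi * of_int k) = pt s \<theta> + axis 2 (2 * pi * of_int k)"
    by (simp add: vec_eq_iff forall_2 axis_def)
  then show ?thesis using Phi_periodic by simp
qed

lemma reduce_angle: "0 \<le> \<theta> + 2 * pi * of_int (- \<lfloor>\<theta> / (2 * pi)\<rfloor>)" "\<theta> + 2 * pi * of_int (- \<lfloor>\<theta> / (2 * pi)\<rfloor>) < 2 * pi"
proof -
  have "of_int \<lfloor>\<theta> / (2 * pi)\<rfloor> * (2 * pi) \<le> \<theta>"
    by (rule iffD1[OF pos_le_divide_eq]) auto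
  moreover have "\<theta> < (of_int \<lfloor>\<theta> / (2 * pi)\<rfloor> + 1) * (2 * pi)"
    by (rule iffD1[OF pos_divide_less_eq]) (use floor_correct[of "\<theta> / (2 * pi)"] in auto)
  ultimately show "0 \<le> \<theta> + 2 * pi * of_int (- \<lfloor>\<theta> / (2 * pi)\<rfloor>)" "\<theta> + 2 * pi * of_int (- \<lfloor>\<theta> / (2 * pi)\<rfloor>) < 2 * pi"
    by (simp_all add: algebra_simps)
qed

lemma Phi_eq_strip:
  assumes x: "x \<in> strip" and y: "y \<in> strip" and eq: "\<Phi> x = \<Phi> y"
  shows "x $ 1 = y $ 1 \<and> (\<exists>k::int. x $ 2 = y $ 2 + 2 * pi * of_int k)"
proof -
  define m where "m z = - \<lfloor>z $ 2 / (2 * pi)\<rfloor>" for z :: "real^2"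
  define r where "r z = pt (z $ 1) (z $ 2 + 2 * pi * of_int (m z))" for z :: "real^2"
  have rP: "\<Phi> (r z) = \<Phi> z" for z
    unfolding r_def Phi_periodic_pt by (simp add: pt_eta[symmetric])
  have "r z \<in> {x. 0 < x$1 \<and> x$1 < L \<and> 0 \<le> x$2 \<and> x$2 < 2 * pi}" if "z \<in> strip" for z
    using that reduce_angle[of "z $ 2"] by (auto simp: r_def strip_def m_def)
  moreover have "inj_on \<Phi> {x. 0 < x$1 \<and> x$1 < L \<and> 0 \<le> x$2 \<and> x$2 < 2 * pi}"
    using coords unfolding revolution_coordinates_def by blast
  ultimately have "r x = r y" using x y eq rP by (metis (no_types, lifting) inj_onD)
  then have "x $ 1 = y $ 1" "x $ 2 + 2 * pi * of_int (m x) = y $ 2 + 2 * pi * of_int (m y)"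
    unfolding r_def by (simp_all add: vec_eq_iff forall_2)
  then have "x $ 1 = y $ 1 \<and> x $ 2 = y $ 2 + 2 * pi * of_int (m y - m x)"
    by (simp add: algebra_simps)
  then show ?thesis by blast
qed

definition north where "north = \<Phi> (pt 0 0)"
definition south where "south = \<Phi> (pt L 0)"

lemma poles: "x $ 1 = 0 \<Longrightarrow> \<Phi> x = north" "x $ 1 = L \<Longrightarrow> \<Phi> x = south" 
    "north \<noteq> south" "north \<in> S2" "south \<in> S2" "\<Phi> ` strip = S2 - {north, south}"
proof -
  obtain p q where pq: "p \<in> S2" "q \<in> S2" "p \<noteq> q" "\<forall>x. x$1 = 0 \<longrightarrow> \<Phi> x = p" "\<forall>x. x$1 = L \<longrightarrow> \<Phi> x = q"
        "\<Phi> ` strip = S2 - {p, q}"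
    using coords unfolding revolution_coordinates_def strip_def by blast
  then have "north = p" "south = q" unfolding north_def south_def by auto
  then show "x $ 1 = 0 \<Longrightarrow> \<Phi> x = north" "x $ 1 = L \<Longrightarrow> \<Phi> x = south" 
    "north \<noteq> south" "north \<in> S2" "south \<in> S2" "\<Phi> ` strip = S2 - {north, south}" using pq by auto
qed

lemma cstrip_cases: "x \<in> cstrip \<Longrightarrow> x $ 1 = 0 \<or> x $ 1 = L \<or> x \<in> strip"
  unfolding cstrip_def strip_def by auto

lemma Phi_S2: "x \<in> cstrip \<Longrightarrow> \<Phi> x \<in> S2"
proof -
  assume "x \<in> cstrip"
  then consider "x $ 1 = 0" | "x $ 1 = L" | "x \<in> strip" using cstrip_cases by blast
  then show ?thesis
  proof cases
    case 3
    then have "\<Phi> x \<in> \<Phi> ` strip" by (rule imageI)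
    then show ?thesis unfolding poles(6) by (rule DiffD1)
  qed (use poles(1,2,4,5) in simp_all)
qed

lemma Phi_eq_cstrip:
  assumes x: "x \<in> cstrip" and y: "y \<in> cstrip" and eq: "\<Phi> x = \<Phi> y"
  shows "x $ 1 = y $ 1 \<and> (x $ 1 = 0 \<or> x $ 1 = L \<or> (\<exists>k::int. x $ 2 = y $ 2 + 2 * pi * of_int k))"
proof -
  have ns: "\<Phi> z \<noteq> north" "\<Phi> z \<noteq> south" if z: "z \<in> strip" for z
  proof -
    have "\<Phi> z \<in> \<Phi> ` strip" using z by (rule imageI)
    then show "\<Phi> z \<noteq> north" "\<Phi> z \<noteq> south" unfolding poles(6) by auto
  qed
  show ?thesis
    using cstrip_cases[OF x] cstrip_cases[OF y] eq poles(1)[of x] poles(2)[of x] poles(1)[of y] poles(2)[of y]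
      poles(3) ns[of x] ns[of y] Phi_eq_strip[OF _ _ eq] by metis
qed

lemma Phi_surj:
  assumes "P \<in> S2" obtains x where "x \<in> cstrip" "0 \<le> x $ 2" "x $ 2 \<le> 2 * pi" "\<Phi> x = P"
proof -
  have *: "\<exists>x\<in>cstrip. \<Phi> x = P"
  proof (cases "P \<in> {north, south}")
    case True
    moreover have "pt 0 0 \<in> cstrip" "pt L 0 \<in> cstrip" using L_pos by (auto simp: cstrip_def)
    ultimately show ?thesis unfolding north_def south_def by blast
  next
    case False
    then have "P \<in> \<Phi> ` strip" using assms poles(6) by simp
    then show ?thesis using strip_cstrip by auto
  qed
  then obtain x where x: "x \<in> cstrip" "\<Phi> x = P" by blast
  let ?y = "pt (x $ 1) (x $ 2 + 2 * pi * of_int (- \<lfloor>x $ 2 / (2 * pi)\<rfloor>))"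
  show ?thesis
  proof (rule that[of ?y])
    show "\<Phi> ?y = P" unfolding Phi_periodic_pt using x by (simp add: pt_eta[symmetric])
  qed (use reduce_angle[of "x $ 2"] x(1) in \<open>auto simp: cstrip_def\<close>)
qed

text \<open>Translation by \<open>t\<close> in the angular coordinate. The choice of coordinates of \<open>P\<close> does not matter by
  \<open>rot_Phi\<close>. The poles are fixed points.\<close>

definition rot :: "real \<Rightarrow> real^3 \<Rightarrow> real^3" where
  "rot t P = \<Phi> ((SOME x. x \<in> cstrip \<and> \<Phi> x = P) + axis 2 t)"

lemma rot_Phi:
  assumes "x \<in> cstrip" shows "rot t (\<Phi> x) = \<Phi> (x + axis 2 t)"
proof -
  define y where "y = (SOME y. y \<in> cstrip \<and> \<Phi> y = \<Phi> x)"
  have y: "y \<in> cstrip" "\<Phi> y = \<Phi> x" unfolding y_def using someI[of "\<lambda>y. y \<in> cstrip \<and> \<Phi> y = \<Phi> x" x] assms by auto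
  have a1: "(z + axis 2 t) $ 1 = z $ 1" for z :: "real^2" by (simp add: axis_def)
  have "\<Phi> (y + axis 2 t) = \<Phi> (x + axis 2 t)"
    using Phi_eq_cstrip[OF y(1) assms y(2)]
  proof (elim conjE disjE exE)
    fix k :: int assume "y $ 1 = x $ 1" "y $ 2 = x $ 2 + 2 * pi * of_int k"
    then have "y + axis 2 t = (x + axis 2 t) + axis 2 (2 * pi * of_int k)"
      by (simp add: vec_eq_iff forall_2 axis_def)
    then show ?thesis by (simp only: Phi_periodic)
  next
    assume "y $ 1 = x $ 1" "y $ 1 = 0"
    then show ?thesis using poles(1) a1 by simp
  next
    assume "y $ 1 = x $ 1" "y $ 1 = L"
    then show ?thesis using poles(2) a1 by simp
  qed
  then show ?thesis unfolding rot_def y_def[symmetric] .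
qed

lemma cstrip_shift: "x + axis 2 t \<in> cstrip \<longleftrightarrow> x \<in> cstrip" "x + axis 2 t \<in> strip \<longleftrightarrow> x \<in> strip"
  by (auto simp: cstrip_def strip_def axis_def)

lemma rot_S2: "P \<in> S2 \<Longrightarrow> rot t P \<in> S2"
proof -
  assume "P \<in> S2"
  then obtain x where "x \<in> cstrip" "\<Phi> x = P" using Phi_surj[of P] by blast
  then show ?thesis using rot_Phi[of x t] Phi_S2 cstrip_shift(1)[of x t] by auto
qed

lemma axis2_add: "x + axis 2 s + axis 2 t = (x + axis 2 (s + t) :: real^2)"
  by (simp add: vec_eq_iff axis_def)

lemma rot_add: "P \<in> S2 \<Longrightarrow> rot s (rot t P) = rot (t + s) P"
proof -
  assume "P \<in> S2"
  then obtain x where x: "x \<in> cstrip" "\<Phi> x = P" using Phi_surj[of P] by blast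
  show ?thesis
    unfolding x(2)[symmetric] rot_Phi[OF x(1)] rot_Phi[OF iffD2[OF cstrip_shift(1) x(1)]] axis2_add ..
qed

lemma rot_0: "P \<in> S2 \<Longrightarrow> rot 0 P = P"
proof -
  assume "P \<in> S2"
  then obtain x where "x \<in> cstrip" "\<Phi> x = P" using Phi_surj[of P] by blast
  moreover have z: "axis 2 0 = (0::real^2)" by (simp add: vec_eq_iff axis_def)
  ultimately show ?thesis using rot_Phi[of x 0] unfolding z add_0_right by simp
qed

text \<open>The sphere has the quotient topology of a compact rectangle in the coordinate plane.\<close>

lemma cont_from_coords:
  fixes F :: "real^3 \<Rightarrow> 'b::metric_space"
  assumes "continuous_on cstrip (\<lambda>x. F (\<Phi> x))"
  shows "continuous_on S2 F"
proof (subst continuous_on_closed_vimage, goal_cases)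
  case 2
  show ?case
  proof (intro allI impI)
  have sq: "S2 = \<Phi> ` {x \<in> cstrip. 0 \<le> x $ 2 \<and> x $ 2 \<le> 2 * pi}" (is "_ = \<Phi> ` ?Q")
  proof
    show "S2 \<subseteq> \<Phi> ` ?Q"
    proof
      fix P :: "real^3" assume "P \<in> S2"
      then obtain x where "x \<in> cstrip" "0 \<le> x $ 2" "x $ 2 \<le> 2 * pi" "\<Phi> x = P" using Phi_surj[of P] by blast
      then show "P \<in> \<Phi> ` ?Q" by blast
    qed
    show "\<Phi> ` ?Q \<subseteq> S2" using Phi_S2 by blast
  qed
  have Q: "?Q = cbox (pt 0 0) (pt L (2 * pi))"
    by (auto simp: cstrip_def mem_box_cart forall_2)
  have cQ: "closed ?Q" unfolding Q by (rule closed_cbox)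
  fix C :: "'b set" assume C: "closed C"
  have "closed (?Q \<inter> (\<lambda>x. F (\<Phi> x)) -` C)"
    using C cQ by (intro continuous_closed_preimage continuous_on_subset[OF assms]) auto
  then have "compact (?Q \<inter> (\<lambda>x. F (\<Phi> x)) -` C)"
    unfolding Q by (meson bounded_Int bounded_cbox compact_eq_bounded_closed)
  then have "compact (\<Phi> ` (?Q \<inter> (\<lambda>x. F (\<Phi> x)) -` C))"
    by (rule compact_continuous_image[rotated]) (auto intro: continuous_on_subset[OF cont_Phi])
  moreover have "F -` C \<inter> S2 = \<Phi> ` (?Q \<inter> (\<lambda>x. F (\<Phi> x)) -` C)" unfolding sq by auto
  ultimately show "closed (F -` C \<inter> S2)" using compact_imp_closed by simp
  qed
qed simp

lemma cont_rot: "continuous_on S2 (rot t)"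
proof (rule cont_from_coords)
  have "continuous_on cstrip (\<lambda>x. \<Phi> (x + axis 2 t))"
    by (rule continuous_on_compose2[OF cont_Phi]) (auto intro!: continuous_intros simp: cstrip_shift)
  then show "continuous_on cstrip (\<lambda>x. rot t (\<Phi> x))"
    by (rule continuous_on_eq) (simp add: rot_Phi)
qed

end


section \<open>Rotations are smooth isometries\<close>

context revolution
begin

abbreviation "d1 y \<equiv> partial_deriv 1 \<Phi> y"
abbreviation "d2 y \<equiv> partial_deriv 2 \<Phi> y"

lemma has_derivative_Phi: "y \<in> strip \<Longrightarrow> (\<Phi> has_derivative frechet_derivative \<Phi> (at y)) (at y)"
  by (rule times_differentiable_derivI(2)[OF open_strip smooth_Phi])

lemma frechet_Phi: "y \<in> strip \<Longrightarrow> frechet_derivative \<Phi> (at y) h = h $ 1 *\<^sub>R d1 y + h $ 2 *\<^sub>R d2 y"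
proof -
  assume y: "y \<in> strip"
  have "h = h $ 1 *\<^sub>R axis 1 1 + h $ 2 *\<^sub>R axis 2 1"
    by (simp add: vec_eq_iff forall_2 axis_def)
  then have "frechet_derivative \<Phi> (at y) h = frechet_derivative \<Phi> (at y) (h $ 1 *\<^sub>R axis 1 1 + h $ 2 *\<^sub>R axis 2 1)"
    by simp
  also have "\<dots> = h $ 1 *\<^sub>R d1 y + h $ 2 *\<^sub>R d2 y"
    using has_derivative_linear[OF has_derivative_Phi[OF y]]
    by (simp only: linear_add linear_scale partial_deriv_def)
  finally show ?thesis .
qed

lemma norm_Phi: "y \<in> cstrip \<Longrightarrow> norm (\<Phi> y) = 1"
  using Phi_S2[of y] by simp

lemma Phi_orth: "y \<in> strip \<Longrightarrow> \<Phi> y \<bullet> partial_deriv i \<Phi> y = 0"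
proof -
  assume y: "y \<in> strip"
  have "((\<lambda>x. \<Phi> x \<bullet> \<Phi> x) has_derivative (\<lambda>h. \<Phi> y \<bullet> frechet_derivative \<Phi> (at y) h + frechet_derivative \<Phi> (at y) h \<bullet> \<Phi> y)) (at y)"
    by (intro has_derivative_inner has_derivative_Phi y)
  moreover have "((\<lambda>x. \<Phi> x \<bullet> \<Phi> x) has_derivative (\<lambda>h. 0)) (at y)"
    by (rule has_derivative_transform_within_open[OF has_derivative_const[of 1] open_strip y])
      (use norm_Phi strip_cstrip in \<open>auto simp: dot_square_norm\<close>)
  ultimately have "(\<lambda>h. \<Phi> y \<bullet> frechet_derivative \<Phi> (at y) h + frechet_derivative \<Phi> (at y) h \<bullet> \<Phi> y) = (\<lambda>h. 0)"
    by (rule has_derivative_unique)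
  from fun_cong[OF this, of "axis i 1"] show ?thesis
    by (simp add: partial_deriv_def inner_commute)
qed

lemma metric_Phi:
  assumes "y \<in> strip"
  shows "g (\<Phi> y) (d1 y) (d1 y) = 1" "g (\<Phi> y) (d1 y) (d2 y) = 0" 
    "g (\<Phi> y) (d2 y) (d1 y) = 0" "g (\<Phi> y) (d2 y) (d2 y) = (a (y $ 1))\<^sup>2"
proof -
  have "metric_matrix g \<Phi> y = vector [vector [1, 0], vector [0, (a (y$1))\<^sup>2]]"
    using coords assms unfolding revolution_coordinates_def strip_def by blast
  then have "metric_matrix g \<Phi> y $ i $ j = (vector [vector [1, 0], vector [0, (a (y$1))\<^sup>2]] :: real^2^2) $ i $ j" for i j
    by simp
  then have "g (\<Phi> y) (partial_deriv i \<Phi> y) (partial_deriv j \<Phi> y) = (vector [vector [1, 0], vector [0, (a (y$1))\<^sup>2]] :: real^2^2) $ i $ j" for i j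
    by (simp add: metric_matrix_def)
  from this[of 1 1] this[of 1 2] this[of 2 1] this[of 2 2]
  show "g (\<Phi> y) (d1 y) (d1 y) = 1" "g (\<Phi> y) (d1 y) (d2 y) = 0" 
    "g (\<Phi> y) (d2 y) (d1 y) = 0" "g (\<Phi> y) (d2 y) (d2 y) = (a (y $ 1))\<^sup>2" by simp_all
qed

lemma ghat_unit: "norm p = 1 \<Longrightarrow> u \<bullet> p = 0 \<Longrightarrow> v \<bullet> p = 0 \<Longrightarrow> ghat g p u v = g p u v"
  by (simp add: ghat_def tangent_proj_id inner_commute)

text \<open>Spherical coordinates \<open>z = (r, s, \<theta>)\<close> of 3-space: \<open>Psi\<close> maps them to the point at distance
  \<open>r\<close> from the origin in direction \<open>\<Phi> (s, \<theta>)\<close>, and \<open>DPsi\<close> is its derivative. In these coordinates \<open>ghat\<close> is diagonal.\<close>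

definition dom3 :: "(real^3) set" where "dom3 = {z. 0 < z $ 1 \<and> 0 < z $ 2 \<and> z $ 2 < L}"
definition ang :: "real^3 \<Rightarrow> real^2" where "ang z = pt (z $ 2) (z $ 3)"
definition Psi where "Psi z = z $ 1 *\<^sub>R \<Phi> (ang z)"
definition DPsi :: "real^3 \<Rightarrow> real^3 \<Rightarrow> real^3" where "DPsi z h = h $ 1 *\<^sub>R \<Phi> (ang z) + z $ 1 *\<^sub>R (h $ 2 *\<^sub>R d1 (ang z) + h $ 3 *\<^sub>R d2 (ang z))"

lemma open_dom3: "open dom3"
  unfolding dom3_def by (intro open_Collect_conj open_Collect_less continuous_intros)

lemma ang_nth: "ang z $ 1 = z $ 2" "ang z $ 2 = z $ 3"
  by (simp_all add: ang_def)

lemma ang_strip: "z \<in> dom3 \<Longrightarrow> ang z \<in> strip"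
  by (simp add: dom3_def ang_def strip_def)

lemma bounded_linear_ang: "bounded_linear ang"
  unfolding linear_conv_bounded_linear[symmetric] ang_def
  by (auto intro!: linearI simp: vec_eq_iff forall_2)

lemma smooth_Psi: "times_differentiable k dom3 Psi"
  unfolding Psi_def
proof (intro times_differentiable_scaleR times_differentiable_vec_nth times_differentiable_id)
  show "times_differentiable k dom3 (\<lambda>z. \<Phi> (ang z))"
    by (rule times_differentiable_compose[OF times_differentiable_bounded_linear[OF bounded_linear_ang] smooth_Phi])
      (use ang_strip in auto)
qed

lemma has_derivative_Psi:
  assumes z: "z \<in> dom3" shows "(Psi has_derivative DPsi z) (at z)"
proof -
  have A: "(ang has_derivative ang) (at z)" by (rule bounded_linear_imp_has_derivative[OF bounded_linear_ang])
  have 1: "((\<lambda>z. \<Phi> (ang z)) has_derivative (\<lambda>h. frechet_derivative \<Phi> (at (ang z)) (ang h))) (at z)"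
    by (rule has_derivative_compose[OF A has_derivative_Phi[OF ang_strip[OF z]]])
  have 2: "((\<lambda>z. z $ 1) has_derivative (\<lambda>h. h $ 1)) (at z)"
    by (rule bounded_linear_imp_has_derivative[OF bounded_linear_vec_nth])
  have "(Psi has_derivative (\<lambda>h. z $ 1 *\<^sub>R frechet_derivative \<Phi> (at (ang z)) (ang h) + h $ 1 *\<^sub>R \<Phi> (ang z))) (at z)"
    unfolding Psi_def by (rule has_derivative_scaleR[OF 2 1])
  moreover have "(\<lambda>h. z $ 1 *\<^sub>R frechet_derivative \<Phi> (at (ang z)) (ang h) + h $ 1 *\<^sub>R \<Phi> (ang z)) = DPsi z"
    by (simp add: fun_eq_iff DPsi_def frechet_Phi[OF ang_strip[OF z]] ang_nth add.commute)
  ultimately show ?thesis by simp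
qed

lemma frechet_Psi: "z \<in> dom3 \<Longrightarrow> frechet_derivative Psi (at z) = DPsi z"
  using frechet_derivative_at[OF has_derivative_Psi] by simp

lemma norm_Psi: "z \<in> dom3 \<Longrightarrow> norm (Psi z) = z $ 1" and Psi_unit: "z \<in> dom3 \<Longrightarrow> Psi z /\<^sub>R norm (Psi z) = \<Phi> (ang z)"
  and Psi_nz: "z \<in> dom3 \<Longrightarrow> Psi z \<noteq> 0"
proof -
  assume z: "z \<in> dom3"
  then have n: "norm (\<Phi> (ang z)) = 1" using norm_Phi ang_strip strip_cstrip by blast
  then show 1: "norm (Psi z) = z $ 1" using z by (simp add: Psi_def dom3_def)
  then show "Psi z /\<^sub>R norm (Psi z) = \<Phi> (ang z)" "Psi z \<noteq> 0"
    using z by (auto simp: Psi_def dom3_def)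
qed

lemma ghat_DPsi:
  assumes z: "z \<in> dom3"
  shows "ghat g (Psi z) (DPsi z h) (DPsi z k) = h $ 1 * k $ 1 + (z $ 1)\<^sup>2 * (h $ 2 * k $ 2 + (a (z $ 2))\<^sup>2 * (h $ 3 * k $ 3))"
proof -
  let ?y = "ang z" let ?p = "\<Phi> ?y"
  have y: "?y \<in> strip" using ang_strip[OF z] .
  have n: "norm ?p = 1" using norm_Phi y strip_cstrip by blast
  then have p0: "?p \<noteq> 0" by auto
  have "ghat g (Psi z) = ghat g ?p"
    using Psi_unit[OF z] n by (simp add: fun_eq_iff ghat_def)
  moreover have b: "bilinear (ghat g ?p)" by (rule ghat_bilinear[OF p0])
  have o: "d1 ?y \<bullet> ?p = 0" "d2 ?y \<bullet> ?p = 0" using Phi_orth[OF y] by (simp_all add: inner_commute)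
  have b0: "bilinear (\<lambda>u v. g ?p (tangent_proj ?p u) (tangent_proj ?p v))"
    using riem n unfolding riemannian_metric_def by simp
  have tp: "tangent_proj ?p ?p = 0" using n by (simp add: tangent_proj_def dot_square_norm)
  have tz: "tangent_proj ?p 0 = 0" by (simp add: tangent_proj_def)
  have z0: "g ?p 0 (tangent_proj ?p v) = 0" "g ?p (tangent_proj ?p v) 0 = 0" "g ?p 0 0 = 0" for v
    using bilinear_lzero[OF b0, of v] bilinear_rzero[OF b0, of v] bilinear_lzero[OF b0, of 0] tz by simp_all
  have e: "ghat g ?p ?p ?p = 1" "ghat g ?p ?p (d1 ?y) = 0" "ghat g ?p ?p (d2 ?y) = 0"
     "ghat g ?p (d1 ?y) ?p = 0" "ghat g ?p (d2 ?y) ?p = 0"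
    using n o z0 by (simp_all add: ghat_def tp dot_square_norm inner_commute)
  have e2: "ghat g ?p (d1 ?y) (d1 ?y) = 1" "ghat g ?p (d1 ?y) (d2 ?y) = 0" "ghat g ?p (d2 ?y) (d1 ?y) = 0"
     "ghat g ?p (d2 ?y) (d2 ?y) = (a (z $ 2))\<^sup>2"
    using metric_Phi[OF y] by (simp_all add: ghat_unit[OF n] o ang_nth)
  ultimately show ?thesis
    unfolding DPsi_def
    by (simp add: bilinear_ladd[OF b] bilinear_radd[OF b] bilinear_lmul[OF b] bilinear_rmul[OF b] e e2
        power2_eq_square algebra_simps)
qed

text \<open>The inverse of \<open>DPsi z\<close>: the three columns of \<open>DPsi z\<close> are orthogonal for \<open>ghat\<close>, so that coordinates are
  inner products with them, divided by their squared lengths.\<close>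

definition GI :: "real^3 \<Rightarrow> real^3 \<Rightarrow> real^3" where "GI z v = (vector [ghat g (Psi z) v (DPsi z (axis 1 1)), 
    ghat g (Psi z) v (DPsi z (axis 2 1)) * inverse (z $ 1 * z $ 1), 
    ghat g (Psi z) v (DPsi z (axis 3 1)) * inverse (z $ 1 * z $ 1 * (a (z $ 2) * a (z $ 2)))] :: real^3)"

lemma GI_DPsi: "z \<in> dom3 \<Longrightarrow> GI z (DPsi z h) = h"
proof -
  assume z: "z \<in> dom3"
  then have "z $ 1 > 0" "a (z $ 2) > 0" using a_pos by (auto simp: dom3_def)
  then show ?thesis
    by (simp add: GI_def ghat_DPsi[OF z] vec_eq_iff forall_3 axis_def power2_eq_square field_simps)
qed

lemma DPsi_GI: "z \<in> dom3 \<Longrightarrow> DPsi z (GI z v) = v"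
proof -
  assume z: "z \<in> dom3"
  have l: "linear (DPsi z)" using has_derivative_linear[OF has_derivative_Psi[OF z]] .
  have "inj (DPsi z)" using GI_DPsi[OF z] by (rule inj_on_inverseI)
  then have "surj (DPsi z)" using l linear_injective_imp_surjective by blast
  then obtain h where "v = DPsi z h" by (metis surjD)
  then show ?thesis using GI_DPsi[OF z] by simp
qed

lemma local_inverse:
  assumes z: "z \<in> dom3"
  obtains V q where "open V" "Psi z \<in> V" "\<And>y. y \<in> V \<Longrightarrow> q y \<in> dom3" "\<And>y. y \<in> V \<Longrightarrow> Psi (q y) = y"
    "\<And>k. times_differentiable k V q"
proof -
  define D where "D = dom3 \<inter> {w. z $ 3 - pi < w $ 3 \<and> w $ 3 < z $ 3 + pi}"
  have D: "open D" "D \<subseteq> dom3" "z \<in> D"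
    unfolding D_def using z pi_gt_zero
    by (auto intro!: open_Int open_dom3 open_Collect_conj open_Collect_less continuous_intros)
  have inj: "inj_on Psi D"
  proof (rule inj_onI)
    fix x y assume xy: "x \<in> D" "y \<in> D" "Psi x = Psi y"
    then have d: "x \<in> dom3" "y \<in> dom3" using D by auto
    have 1: "x $ 1 = y $ 1" using norm_Psi[OF d(1)] norm_Psi[OF d(2)] xy(3) by simp
    have "\<Phi> (ang x) = \<Phi> (ang y)" using Psi_unit[OF d(1)] Psi_unit[OF d(2)] xy(3) by simp
    then obtain k :: int where k: "x $ 2 = y $ 2" "x $ 3 = y $ 3 + 2 * pi * of_int k"
      using Phi_eq_strip[OF ang_strip[OF d(1)] ang_strip[OF d(2)]] by (auto simp: ang_def)
    have "\<bar>x $ 3 - y $ 3\<bar> < 2 * pi" using xy unfolding D_def by (auto simp: abs_if)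
    then have "\<bar>of_int k\<bar> * (2 * pi) < 1 * (2 * pi)" using k(2) by (simp add: abs_mult)
    then have "\<bar>of_int k :: real\<bar> < 1" by (simp only: mult_less_cancel_right) auto
    then have "k = 0" by linarith
    then show "x = y" using 1 k by (simp add: vec_eq_iff forall_3)
  qed
  define q where "q = inv_into D Psi"
  define V where "V = Psi ` D"
  have cP: "continuous_on D Psi"
    using times_differentiable_imp_continuous_on[OF smooth_Psi] D(2) continuous_on_subset by blast
  have V: "open V" unfolding V_def by (rule invariance_of_domain[OF cP D(1) inj])
  have q: "q y \<in> D" "Psi (q y) = y" if "y \<in> V" for y
    using that unfolding V_def q_def by (auto intro: inv_into_into f_inv_into_f)
  have dq: "(q has_derivative GI (q y)) (at y)" if y: "y \<in> V" for y
  proof -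
    have qd: "q y \<in> dom3" using q(1)[OF y] D by auto
    have "(q has_derivative GI (q y)) (at (Psi (q y)))"
    proof (rule has_derivative_inverse_strong[OF D(1) q(1)[OF y] cP])
      show "q (Psi x) = x" if "x \<in> D" for x unfolding q_def using inj that by (rule inv_into_f_f)
      show "(Psi has_derivative DPsi (q y)) (at (q y))" by (rule has_derivative_Psi[OF qd])
      show "DPsi (q y) \<circ> GI (q y) = id" using DPsi_GI[OF qd] by (simp add: fun_eq_iff)
    qed
    then show ?thesis using q(2)[OF y] by simp
  qed
  have "times_differentiable k V q" for k
  proof (induction k)
    case 0
    show ?case using has_derivative_continuous_on[of V q "\<lambda>y. GI (q y)"] dq
      by (simp add: has_derivative_at_withinI)
  next
    case (Suc k)
    have qD: "q ` V \<subseteq> dom3" using q D by auto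
    have nz: "q y $ 1 * q y $ 1 \<noteq> 0" "q y $ 1 * q y $ 1 * (a (q y $ 2) * a (q y $ 2)) \<noteq> 0" if "y \<in> V" for y
    proof -
      have "q y \<in> dom3" using qD that by blast
      then have "0 < q y $ 1" "0 < a (q y $ 2)" using a_pos by (auto simp: dom3_def)
      then show "q y $ 1 * q y $ 1 \<noteq> 0" "q y $ 1 * q y $ 1 * (a (q y $ 2) * a (q y $ 2)) \<noteq> 0" by auto
    qed
    have V0: "V \<subseteq> - {0}" unfolding V_def using Psi_nz D by auto
    have dP: "times_differentiable k V (\<lambda>y. DPsi (q y) h)" for h
    proof -
      have "times_differentiable k dom3 (\<lambda>z. DPsi z h)"
        by (rule times_differentiable_cong[OF open_dom3 _ times_differentiable_derivI(1)[OF open_dom3 smooth_Psi]])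
          (simp add: frechet_Psi)
      then show ?thesis by (rule times_differentiable_compose[OF Suc _ qD])
    qed
    have gh: "times_differentiable k V (\<lambda>y. ghat g (Psi (q y)) v (DPsi (q y) h))" for v h
    proof -
      have "times_differentiable k V (\<lambda>y. \<Sum>i\<in>UNIV. DPsi (q y) h $ i * ghat g y v (axis i 1))"
        by (intro times_differentiable_sum times_differentiable_mult times_differentiable_vec_nth dP
            times_differentiable_subset[OF times_differentiable_ghat V0])
      then show ?thesis
      proof (rule times_differentiable_cong[OF V, rotated])
        fix y assume y: "y \<in> V"
        have y0: "y \<noteq> 0" using y V0 by auto
        have l: "linear (ghat g y v)" using ghat_bilinear[OF y0] unfolding bilinear_def by blast
        have e: "(\<Sum>i\<in>UNIV. w $ i *\<^sub>R axis i 1) = w" for w :: "real^3"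
          by (simp add: vec_eq_iff axis_def if_distrib cong: if_cong)
        have "ghat g y v (\<Sum>i\<in>UNIV. w $ i *\<^sub>R axis i 1) = (\<Sum>i\<in>UNIV. w $ i * ghat g y v (axis i 1))" for w
          by (simp only: linear_sum[OF l] linear_scale[OF l] real_scaleR_def)
        from this[of "DPsi (q y) h", unfolded e]
        show "(\<Sum>i\<in>UNIV. DPsi (q y) h $ i * ghat g y v (axis i 1)) = ghat g (Psi (q y)) v (DPsi (q y) h)"
          unfolding q(2)[OF y] by (rule sym)
      qed
    qed
    have ta: "times_differentiable k V (\<lambda>y. a (q y $ 2))"
      by (rule times_differentiable_compose[OF times_differentiable_vec_nth[OF Suc] smooth_a])
        (use qD in \<open>auto simp: dom3_def\<close>)
    show ?case
    proof (rule times_differentiable_SucI[OF dq])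
      fix v
      show "times_differentiable k V (\<lambda>y. GI (q y) v)"
      proof (rule times_differentiable_vec)
        fix i :: 3
        consider "i = 1" | "i = 2" | "i = 3" using exhaust_3[of i] by auto
        then show "times_differentiable k V (\<lambda>y. GI (q y) v $ i)"
          by cases (simp_all only: GI_def vector_3, 
             (intro times_differentiable_mult times_differentiable_inverse gh times_differentiable_vec_nth Suc ta nz; assumption)+)
      qed
    qed
  qed
  then show ?thesis using that[of V q] V q D V_def by blast
qed

text \<open>The rotation of 3-space that extends the rotation of the sphere.\<close>

definition Rh where "Rh t x = norm x *\<^sub>R rot t (x /\<^sub>R norm x)"

lemma norm_Rh: "norm (Rh t x) = norm x"
  using rot_S2[OF unit_S2, of x t] by (cases "x = 0") (auto simp: Rh_def)

lemma shift_dom3: "z + axis 3 t \<in> dom3 \<longleftrightarrow> z \<in> dom3"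
  by (simp add: dom3_def axis_def)

lemma Rh_Psi: "z \<in> dom3 \<Longrightarrow> Rh t (Psi z) = Psi (z + axis 3 t)"
proof -
  assume z: "z \<in> dom3"
  have "ang z \<in> cstrip" using ang_strip[OF z] strip_cstrip by auto
  then have "rot t (\<Phi> (ang z)) = \<Phi> (ang z + axis 2 t)" by (rule rot_Phi)
  moreover have "ang z + axis 2 t = ang (z + axis 3 t)" by (simp add: ang_def vec_eq_iff forall_2 axis_def)
  moreover have "Rh t (Psi z) = norm (Psi z) *\<^sub>R rot t (\<Phi> (ang z))"
    unfolding Rh_def Psi_unit[OF z] ..
  ultimately show ?thesis using norm_Psi[OF z] by (simp add: Psi_def) (simp add: axis_def)
qed

lemma continuous_Rh: "continuous_on (- {0}) (Rh t)"
proof -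
  have "continuous_on (- {0}) (\<lambda>x::real^3. x /\<^sub>R norm x)"
    by (intro continuous_intros) auto
  then have "continuous_on (- {0}) (\<lambda>x. rot t (x /\<^sub>R norm x))"
    by (rule continuous_on_compose2[OF cont_rot]) (use unit_S2 in blast)
  then show ?thesis unfolding Rh_def by (intro continuous_intros)
qed

definition offpoles :: "(real^3) set" where "offpoles = - (span {north} \<union> span {south})"

lemma open_offpoles: "open offpoles"
  unfolding offpoles_def by (auto intro!: open_Compl closed_Un closed_subspace)

lemma offpoles_Psi:
  assumes "x \<in> offpoles" obtains z where "z \<in> dom3" "Psi z = x"
proof -
  have x0: "x \<noteq> 0" using assms span_0 unfolding offpoles_def by auto
  have np: "x /\<^sub>R norm x \<noteq> p" if "p \<in> {north, south}" for p
  proof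
    assume "x /\<^sub>R norm x = p"
    then have "x = norm x *\<^sub>R p" using x0 by auto
    then have "x \<in> span {p}" by (metis span_base span_scale singletonI)
    then show False using assms that unfolding offpoles_def by auto
  qed
  have "x /\<^sub>R norm x \<in> S2 - {north, south}" using unit_S2[OF x0] np by blast
  then obtain y where y: "y \<in> strip" "\<Phi> y = x /\<^sub>R norm x" unfolding poles(6)[symmetric] by auto
  let ?z = "vector [norm x, y $ 1, y $ 2] :: real^3"
  have "ang ?z = y" by (simp add: ang_def vec_eq_iff forall_2)
  then have "Psi ?z = x" using y x0 by (simp add: Psi_def)
  moreover have "?z \<in> dom3" using y x0 by (simp add: dom3_def strip_def)
  ultimately show ?thesis using that by blast
qed

lemma smooth_Rh_offpoles: "times_differentiable k offpoles (Rh t)"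
proof (rule times_differentiable_local[OF open_offpoles])
  fix x assume x: "x \<in> offpoles"
  obtain z where z: "z \<in> dom3" "Psi z = x" using offpoles_Psi[OF x] .
  obtain V q where V: "open V" "Psi z \<in> V" "\<And>y. y \<in> V \<Longrightarrow> q y \<in> dom3" "\<And>y. y \<in> V \<Longrightarrow> Psi (q y) = y"
    "\<And>k. times_differentiable k V q" using local_inverse[OF z(1)] by metis
  have "times_differentiable k V (\<lambda>y. Psi (q y + axis 3 t))"
    by (rule times_differentiable_compose[OF times_differentiable_add[OF V(5) times_differentiable_const] smooth_Psi])
      (use V(3) shift_dom3 in auto)
  then have "times_differentiable k V (Rh t)"
  proof (rule times_differentiable_cong[OF V(1), rotated])
    fix y assume "y \<in> V"
    then show "Psi (q y + axis 3 t) = Rh t y" using Rh_Psi[OF V(3), of y t] V(4)[of y] by simp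
  qed
  then show "\<exists>V. open V \<and> x \<in> V \<and> V \<subseteq> offpoles \<and> times_differentiable k V (Rh t)"
    using V(1,2) z(2) x open_offpoles
    by (intro exI[of _ "V \<inter> offpoles"]) (auto intro: times_differentiable_subset)
qed

lemma isometry_offpoles:
  assumes x: "x \<in> offpoles"
  shows "mform (gmat g (Rh t x)) (frechet_derivative (Rh t) (at x) u) (frechet_derivative (Rh t) (at x) v)
    = mform (gmat g x) u v"
proof -
  obtain z where z: "z \<in> dom3" "Psi z = x" using offpoles_Psi[OF x] .
  let ?z = "z + axis 3 t"
  have z': "?z \<in> dom3" using z shift_dom3 by simp
  have dR: "(Rh t has_derivative frechet_derivative (Rh t) (at x)) (at x)"
    by (rule times_differentiable_derivI(2)[OF open_offpoles smooth_Rh_offpoles x])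
  have A: "((\<lambda>w. Rh t (Psi w)) has_derivative (\<lambda>h. frechet_derivative (Rh t) (at x) (DPsi z h))) (at z)"
    by (rule has_derivative_compose[OF has_derivative_Psi[OF z(1)]]) (use dR z(2) in simp)
  have B: "((\<lambda>w. Rh t (Psi w)) has_derivative DPsi ?z) (at z)"
  proof (rule has_derivative_transform_within_open[OF _ open_dom3 z(1)])
    have "((\<lambda>w. w + axis 3 t) has_derivative (\<lambda>h. h)) (at z)" by (auto intro!: derivative_eq_intros)
    then show "((\<lambda>w. Psi (w + axis 3 t)) has_derivative DPsi ?z) (at z)"
      by (rule has_derivative_compose[where g=Psi and g'="DPsi ?z"]) (rule has_derivative_Psi[OF z'])
  qed (simp add: Rh_Psi)
  have eq: "frechet_derivative (Rh t) (at x) (DPsi z h) = DPsi ?z h" for h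
    by (rule fun_cong[OF has_derivative_unique[OF A B]])
  have R: "Rh t x = Psi ?z" using Rh_Psi[OF z(1)] z(2) by simp
  have "mform (gmat g (Psi ?z)) (DPsi ?z h) (DPsi ?z k) = mform (gmat g (Psi z)) (DPsi z h) (DPsi z k)" for h k
    unfolding mform_gmat[OF Psi_nz[OF z']] mform_gmat[OF Psi_nz[OF z(1)]] ghat_DPsi[OF z'] ghat_DPsi[OF z(1)]
    by (simp add: axis_def)
  from this[of "GI z u" "GI z v"] show ?thesis
    unfolding R eq[symmetric] DPsi_GI[OF z(1)] z(2) .
qed

lemma punctured_ball_offpoles:
  assumes "x \<noteq> 0"
  obtains r where "0 < r" "r \<le> norm x / 2" "ball x r - span {x} \<subseteq> offpoles"
proof -
  have "\<exists>r>0. ball x r - span {x} \<subseteq> - span {p}" for p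
  proof (cases "x \<in> span {p}")
    case True
    then obtain k where k: "x = k *\<^sub>R p" by (auto simp: span_singleton)
    then have "p = (1 / k) *\<^sub>R x" using assms by auto
    then have "p \<in> span {x}" by (metis span_base span_scale singletonI)
    then have "span {p} \<subseteq> span {x}" by (simp add: span_minimal subspace_span)
    then show ?thesis by (intro exI[of _ 1]) auto
  next
    case False
    have "open (- span {p})" by (auto intro!: open_Compl closed_subspace)
    then obtain r where "r > 0" "ball x r \<subseteq> - span {p}" using False openE by blast
    then show ?thesis by auto
  qed
  then obtain r1 r2 where r: "r1 > 0" "r2 > 0" "ball x r1 - span {x} \<subseteq> - span {north}" "ball x r2 - span {x} \<subseteq> - span {south}"
    by meson
  show ?thesis
  proof (rule that[of "min (norm x / 2) (min r1 r2)"])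
    show "ball x (min (norm x / 2) (min r1 r2)) - span {x} \<subseteq> offpoles"
      using r(3,4) unfolding offpoles_def by auto
  qed (use r assms in auto)
qed

text \<open>Near a point on the axis through a pole the extended rotation is smooth off this line, where \<open>Psi\<close> is a
  coordinate system. There it is an isometry of \<open>ghat\<close>, hence smooth across the line.\<close>

lemma smooth_Rh: "times_differentiable k (- {0}) (Rh t)"
proof (rule times_differentiable_local)
  fix x :: "real^3" assume "x \<in> - {0}"
  then have x0: "x \<noteq> 0" by simp
  obtain r where r: "0 < r" "r \<le> norm x / 2" "ball x r - span {x} \<subseteq> offpoles"
    using punctured_ball_offpoles[OF x0] .
  obtain c C where cC: "0 < c" "0 \<le> C"
    "\<And>x v. x \<noteq> 0 \<Longrightarrow> c * (norm v)\<^sup>2 \<le> mform (gmat g x) v v"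
    "\<And>x v. x \<noteq> 0 \<Longrightarrow> mform (gmat g x) v v \<le> C * (norm v)\<^sup>2" using ghat_bounds by metis
  define S :: "(real^3) set" where "S = cball 0 (2 * norm x) - ball 0 (norm x / 2)"
  have bn: "norm x / 2 \<le> norm y \<and> norm y \<le> 2 * norm x" if "y \<in> ball x r" for y
  proof -
    have "norm (y - x) < norm x / 2" using that r(2) by (simp add: dist_norm norm_minus_commute)
    then show ?thesis using norm_triangle_ineq2[of x y] norm_triangle_ineq2[of y x] by (simp add: norm_minus_commute)
  qed
  have bz: "ball x r \<subseteq> - {0}"
  proof
    fix y assume "y \<in> ball x r"
    then show "y \<in> - {0}" using bn[of y] x0 by auto
  qed
  interpret si: singular_isometry "Rh t" "gmat g" "ball x r" S "- {0}" x "span {x}" c C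
  proof
    show "compact S" unfolding S_def by (intro compact_diff) auto
    show "S \<subseteq> - {0}" unfolding S_def using x0 by auto
    show "ball x r \<subseteq> S" "Rh t ` ball x r \<subseteq> S" using bn unfolding S_def by (fastforce simp: norm_Rh)+
    show "gmat g y $ i $ j = gmat g y $ j $ i" if "y \<in> - {0}" for y i j
      using ghat_sym[of y] that by (simp add: gmat_def)
    show "continuous_on (ball x r) (Rh t)" using continuous_Rh continuous_on_subset bz by blast
    show "times_differentiable k (ball x r - span {x}) (Rh t)" for k
      by (rule times_differentiable_subset[OF smooth_Rh_offpoles r(3)])
    show "mform (gmat g (Rh t y)) (frechet_derivative (Rh t) (at y) u) (frechet_derivative (Rh t) (at y) v) = mform (gmat g y) u v"
      if "y \<in> ball x r - span {x}" for y u v using isometry_offpoles r(3) that by blast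
  qed (use cC times_differentiable_gmat in auto)
  show "\<exists>V. open V \<and> x \<in> V \<and> V \<subseteq> - {0} \<and> times_differentiable k V (Rh t)"
    using si.smooth_across r(1) bz by (intro exI[of _ "ball x r"]) auto
qed auto

lemma isometry_Rh:
  assumes x: "x \<noteq> 0"
  shows "ghat g (Rh t x) (frechet_derivative (Rh t) (at x) u) (frechet_derivative (Rh t) (at x) v) = ghat g x u v"
proof -
  let ?D = "\<lambda>x u. frechet_derivative (Rh t) (at x) u"
  have Rnz: "Rh t y \<noteq> 0" if "y \<noteq> 0" for y using norm_Rh[of t y] that by auto
  obtain r where r: "0 < r" "r \<le> norm x / 2" "ball x r - span {x} \<subseteq> offpoles"
    using punctured_ball_offpoles[OF x] .
  have "dim (span {x}) < 3" unfolding dim_span using dim_le_card'[of "{x}"] by simp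
  then have "ball x r \<subseteq> closure (ball x r - span {x})"
    by (intro dense_in_open_minus_subspace) auto
  then have "x \<in> closure (ball x r - span {x})" using r(1) by auto
  then obtain f where f: "\<And>n. f n \<in> ball x r - span {x}" "f \<longlonglongrightarrow> x" unfolding closure_sequential by blast
  have fo: "f n \<in> offpoles" for n using f(1) r(3) by blast
  have f0: "f n \<in> - {0}" for n using fo[of n] span_0[of "{north}"] unfolding offpoles_def by auto
  have cD: "continuous_on (- {0}) (\<lambda>y. ?D y u $ i)" for u i
    by (rule times_differentiable_imp_continuous_on[OF times_differentiable_vec_nth[OF times_differentiable_derivI(1)[OF _ smooth_Rh]]]) auto
  have cG: "continuous_on (- {0}) (\<lambda>y. gmat g y $ i $ j)" for i j
    by (rule times_differentiable_imp_continuous_on[OF times_differentiable_gmat])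
  have im: "Rh t ` (- {0}) \<subseteq> - {0}"
  proof (rule image_subsetI)
    fix y :: "real^3" assume "y \<in> - {0}"
    then show "Rh t y \<in> - {0}" using Rnz[of y] by simp
  qed
  have cGR: "continuous_on (- {0}) (\<lambda>y. gmat g (Rh t y) $ i $ j)" for i j
    by (rule continuous_on_compose2[OF cG continuous_Rh im])
  have 1: "continuous_on (- {0}) (\<lambda>y. mform (gmat g (Rh t y)) (?D y u) (?D y v) - mform (gmat g y) u v)"
    unfolding mform_def
    by (intro continuous_on_diff continuous_on_sum continuous_on_mult continuous_on_const cD cG cGR)
  have "(\<lambda>n. mform (gmat g (Rh t (f n))) (?D (f n) u) (?D (f n) v) - mform (gmat g (f n)) u v) 
      \<longlonglongrightarrow> mform (gmat g (Rh t x)) (?D x u) (?D x v) - mform (gmat g x) u v"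
    by (rule continuous_on_tendsto_compose[OF 1 f(2)]) (use x f0 in auto)
  moreover have "(\<lambda>n. mform (gmat g (Rh t (f n))) (?D (f n) u) (?D (f n) v) - mform (gmat g (f n)) u v) = (\<lambda>n. 0)"
    using isometry_offpoles[OF fo] by simp
  ultimately have "mform (gmat g (Rh t x)) (?D x u) (?D x v) - mform (gmat g x) u v = 0"
    by (simp add: LIMSEQ_const_iff)
  then show ?thesis using mform_gmat x Rnz by simp
qed

lemma frechet_Rh_inj:
  assumes x: "x \<noteq> 0" and v: "frechet_derivative (Rh t) (at x) v = 0"
  shows "v = 0"
proof (rule ccontr)
  assume "v \<noteq> 0"
  then have "0 < ghat g x v v" using ghat_pos x by blast
  moreover have "Rh t x \<noteq> 0" using norm_Rh[of t x] x by auto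
  then have "ghat g (Rh t x) 0 0 = 0" using ghat_bilinear bilinear_lzero by blast
  ultimately show False using isometry_Rh[OF x, of t v v] v by simp
qed

lemma Rh_S2: "P \<in> S2 \<Longrightarrow> Rh t P = rot t P"
  by (simp add: Rh_def)

lemma chart_orth:
  assumes "sphere_chart W \<psi>" "x \<in> W"
  shows "partial_deriv i \<psi> x \<bullet> \<psi> x = 0" "(\<psi> has_derivative frechet_derivative \<psi> (at x)) (at x)"
proof -
  have W: "open W" "\<psi> ` W \<subseteq> S2" "\<And>k. times_differentiable k W \<psi>"
    using assms(1) smooth_on_open unfolding sphere_chart_def by blast+
  show d: "(\<psi> has_derivative frechet_derivative \<psi> (at x)) (at x)"
    by (rule times_differentiable_derivI(2)[OF W(1) W(3) assms(2)])
  have "((\<lambda>x. \<psi> x \<bullet> \<psi> x) has_derivative (\<lambda>h. \<psi> x \<bullet> frechet_derivative \<psi> (at x) h + frechet_derivative \<psi> (at x) h \<bullet> \<psi> x)) (at x)"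
    by (intro has_derivative_inner d)
  moreover have "((\<lambda>x. \<psi> x \<bullet> \<psi> x) has_derivative (\<lambda>h. 0)) (at x)"
    by (rule has_derivative_transform_within_open[OF has_derivative_const[of 1] W(1) assms(2)])
      (use W(2) in \<open>auto simp: dot_square_norm\<close>)
  ultimately have "(\<lambda>h. \<psi> x \<bullet> frechet_derivative \<psi> (at x) h + frechet_derivative \<psi> (at x) h \<bullet> \<psi> x) = (\<lambda>h. 0)"
    by (rule has_derivative_unique)
  from fun_cong[OF this, of "axis i 1"] show "partial_deriv i \<psi> x \<bullet> \<psi> x = 0"
    by (simp add: partial_deriv_def inner_commute)
qed

lemma frechet_rot_chart:
  assumes c: "sphere_chart W \<psi>" and x: "x \<in> W"
  shows "frechet_derivative (rot t \<circ> \<psi>) (at x) = (\<lambda>h. frechet_derivative (Rh t) (at (\<psi> x)) (frechet_derivative \<psi> (at x) h))"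
proof -
  have W: "open W" "\<psi> ` W \<subseteq> S2" using c unfolding sphere_chart_def by auto
  have "\<psi> x \<in> S2" using W(2) x by blast
  then have nz: "\<psi> x \<in> - {0}" by auto
  have "(Rh t has_derivative frechet_derivative (Rh t) (at (\<psi> x))) (at (\<psi> x))"
    by (rule times_differentiable_derivI(2)[OF _ smooth_Rh]) (use nz in auto)
  then have "((\<lambda>x. Rh t (\<psi> x)) has_derivative (\<lambda>h. frechet_derivative (Rh t) (at (\<psi> x)) (frechet_derivative \<psi> (at x) h))) (at x)"
    by (rule has_derivative_compose[OF chart_orth(2)[OF c x]])
  then have "((rot t \<circ> \<psi>) has_derivative (\<lambda>h. frechet_derivative (Rh t) (at (\<psi> x)) (frechet_derivative \<psi> (at x) h))) (at x)"
    by (rule has_derivative_transform_within_open[OF _ W(1) x]) (use W(2) Rh_S2 in auto)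
  then show ?thesis by (rule frechet_derivative_at[symmetric])
qed

lemma rot_chart:
  assumes c: "sphere_chart W \<psi>"
  shows "sphere_chart W (rot t \<circ> \<psi>)"
proof -
  have W: "open W" "\<psi> ` W \<subseteq> S2" "inj_on \<psi> W" "\<And>k. times_differentiable k W \<psi>" "\<And>x. x \<in> W \<Longrightarrow> inj (frechet_derivative \<psi> (at x))"
    using assms(1) smooth_on_open unfolding sphere_chart_def by blast+
  have "times_differentiable k W (\<lambda>x. Rh t (\<psi> x))" for k
    by (rule times_differentiable_compose[OF W(4) smooth_Rh]) (use W(2) in auto)
  then have "times_differentiable k W (rot t \<circ> \<psi>)" for k
    by (rule times_differentiable_cong[OF W(1), rotated]) (use W(2) Rh_S2 in auto)
  then have "smooth_on W (rot t \<circ> \<psi>)" unfolding smooth_on_def using W(1) by blast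
  moreover have "inj_on (rot t \<circ> \<psi>) W"
  proof (rule inj_onI)
    fix x y assume xy: "x \<in> W" "y \<in> W" "(rot t \<circ> \<psi>) x = (rot t \<circ> \<psi>) y"
    have s: "\<psi> x \<in> S2" "\<psi> y \<in> S2" using xy W(2) by auto
    have "rot (- t) (rot t (\<psi> x)) = rot (- t) (rot t (\<psi> y))" using xy(3) by simp
    then have "\<psi> x = \<psi> y" using rot_add s rot_0 by simp
    then show "x = y" using W(3) xy by (meson inj_onD)
  qed
  moreover have "(rot t \<circ> \<psi>) ` W \<subseteq> S2" using W(2) rot_S2 by (auto simp del: mem_sphere_0)
  moreover have "inj (frechet_derivative (rot t \<circ> \<psi>) (at x))" if x: "x \<in> W" for x
  proof -
    have "\<psi> x \<in> S2" using W(2) x by blast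
    then have nz: "\<psi> x \<noteq> 0" by auto
    have "(Rh t has_derivative frechet_derivative (Rh t) (at (\<psi> x))) (at (\<psi> x))"
      by (rule times_differentiable_derivI(2)[OF _ smooth_Rh]) (use nz in auto)
    then have "linear (frechet_derivative (Rh t) (at (\<psi> x)))" by (rule has_derivative_linear)
    then have "inj (frechet_derivative (Rh t) (at (\<psi> x)))"
      using frechet_Rh_inj[OF nz] by (simp add: linear_injective_0)
    from inj_compose[OF this W(5)[OF x]] show ?thesis
      unfolding frechet_rot_chart[OF c x] by (simp add: comp_def)
  qed
  ultimately show ?thesis unfolding sphere_chart_def using W(1) by blast
qed

lemma metric_matrix_rot:
  assumes c: "sphere_chart W \<psi>" and x: "x \<in> W"
  shows "metric_matrix g (rot t \<circ> \<psi>) x = metric_matrix g \<psi> x"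
proof -
  have W: "\<psi> ` W \<subseteq> S2" using c unfolding sphere_chart_def by blast
  then have s: "\<psi> x \<in> S2" using x by blast
  then have nz: "\<psi> x \<noteq> 0" and n1: "norm (\<psi> x) = 1" "norm ((rot t \<circ> \<psi>) x) = 1" using rot_S2[OF s, of t] by auto
  let ?d = "\<lambda>i. partial_deriv i \<psi> x"
  have e: "partial_deriv i (rot t \<circ> \<psi>) x = frechet_derivative (Rh t) (at (\<psi> x)) (?d i)" for i
    unfolding partial_deriv_def frechet_rot_chart[OF c x] ..
  have "g ((rot t \<circ> \<psi>) x) (partial_deriv i (rot t \<circ> \<psi>) x) (partial_deriv j (rot t \<circ> \<psi>) x) = g (\<psi> x) (?d i) (?d j)" for i j
  proof -
    have "g ((rot t \<circ> \<psi>) x) (partial_deriv i (rot t \<circ> \<psi>) x) (partial_deriv j (rot t \<circ> \<psi>) x) =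
      ghat g ((rot t \<circ> \<psi>) x) (partial_deriv i (rot t \<circ> \<psi>) x) (partial_deriv j (rot t \<circ> \<psi>) x)"
      by (intro ghat_unit[OF n1(2), symmetric] chart_orth(1)[OF rot_chart[OF c] x])
    also have "\<dots> = ghat g (\<psi> x) (?d i) (?d j)"
      by (simp only: e o_apply Rh_S2[OF s, symmetric] isometry_Rh[OF nz])
    also have "\<dots> = g (\<psi> x) (?d i) (?d j)"
      by (intro ghat_unit[OF n1(1)] chart_orth(1)[OF c x])
    finally show ?thesis .
  qed
  then show ?thesis by (simp add: metric_matrix_def vec_eq_iff)
qed

end

lemma coord_laplacian_cong:
  assumes "open W" "x \<in> W" "\<And>y. y \<in> W \<Longrightarrow> G y = G' y" "\<And>y. y \<in> W \<Longrightarrow> f y = f' y"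
  shows "coord_laplacian G f x = coord_laplacian G' f' x"
proof -
  have 1: "partial_deriv j f y = partial_deriv j f' y" if "y \<in> W" for j y
    unfolding partial_deriv_def using frechet_derivative_cong_open[OF assms(1) that assms(4)] by simp
  have "partial_deriv i (\<lambda>y. sqrt (det (G y)) *\<^sub>R (\<Sum>j\<in>UNIV. (matrix_inv (G y) $ i $ j) *\<^sub>R partial_deriv j f y)) x
     = partial_deriv i (\<lambda>y. sqrt (det (G' y)) *\<^sub>R (\<Sum>j\<in>UNIV. (matrix_inv (G' y) $ i $ j) *\<^sub>R partial_deriv j f' y)) x" for i
    unfolding partial_deriv_def[of i]
    by (rule arg_cong[OF frechet_derivative_cong_open[OF assms(1,2)], of _ _ "\<lambda>D. D (axis i 1)"])
      (simp add: 1 assms(3))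
  then show ?thesis unfolding coord_laplacian_def using assms(2,3) by simp
qed

context revolution
begin

definition rotf :: "real \<Rightarrow> (real^3 \<Rightarrow> complex) \<Rightarrow> real^3 \<Rightarrow> complex" where
  "rotf t u P = (if P \<in> S2 then u (rot t P) else 0)"

text \<open>A rotation composed with a chart is again a chart, with the same metric matrix. So the eigenvalue equation in
  the rotated chart is the equation for the rotated function in the given chart.\<close>

theorem eigenspace_rotf:
  assumes u: "u \<in> eigenspace g \<mu>"
  shows "rotf t u \<in> eigenspace g \<mu>"
proof -
  obtain W F where W: "open W" "S2 \<subseteq> W" "\<And>k. times_differentiable k W F" "\<And>x. x \<in> S2 \<Longrightarrow> F x = u x"
    using u unfolding eigenspace_def smooth_on_def by blast
  have lb: "laplace_beltrami g u (\<lambda>p. - (\<mu>\<^sup>2 *\<^sub>R u p))" using u unfolding eigenspace_def by blast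
  have Rn: "Rh t x \<noteq> 0" if "x \<noteq> 0" for x using norm_Rh[of t x] that by auto
  have im: "Rh t ` (- {0}) \<subseteq> - {0}"
  proof (rule image_subsetI)
    fix y :: "real^3" assume "y \<in> - {0}"
    then show "Rh t y \<in> - {0}" using Rn[of y] by simp
  qed
  have "times_differentiable k (- {0}) (\<lambda>x. F (Rh t x /\<^sub>R norm (Rh t x)))" for k
  proof (rule times_differentiable_compose[OF _ W(3)])
    show "times_differentiable k (- {0}) (\<lambda>x. Rh t x /\<^sub>R norm (Rh t x))"
      by (rule times_differentiable_compose[OF smooth_Rh times_differentiable_unit[of "- {0}"] im]) simp
    show "(\<lambda>x. Rh t x /\<^sub>R norm (Rh t x)) ` (- {0}) \<subseteq> W"
    proof (rule image_subsetI)
      fix x :: "real^3" assume "x \<in> - {0}"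
      then show "Rh t x /\<^sub>R norm (Rh t x) \<in> W" using unit_S2[OF Rn[of x]] W(2) by blast
    qed
  qed
  moreover have "F (Rh t x /\<^sub>R norm (Rh t x)) = rotf t u x" if "x \<in> S2" for x
  proof -
    have "norm x = 1" "norm (rot t x) = 1" using that rot_S2[OF that, of t] by auto
    then show ?thesis using that Rh_S2[OF that] W(4)[OF rot_S2[OF that]] by (simp add: rotf_def)
  qed
  ultimately have "smooth_on S2 (rotf t u)"
    unfolding smooth_on_def by (intro exI[of _ "- {0}"] exI[of _ "\<lambda>x. F (Rh t x /\<^sub>R norm (Rh t x))"]) auto
  moreover have "laplace_beltrami g (rotf t u) (\<lambda>p. - (\<mu>\<^sup>2 *\<^sub>R rotf t u p))"
    unfolding laplace_beltrami_def
  proof (intro allI impI ballI)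
    fix W \<psi> x assume c: "sphere_chart W \<psi>" and x: "x \<in> W"
    have oW: "open W" and WS: "\<And>y. y \<in> W \<Longrightarrow> \<psi> y \<in> S2" using c unfolding sphere_chart_def by blast+
    have "coord_laplacian (metric_matrix g \<psi>) (rotf t u \<circ> \<psi>) x =
        coord_laplacian (metric_matrix g (rot t \<circ> \<psi>)) (u \<circ> (rot t \<circ> \<psi>)) x"
      by (rule coord_laplacian_cong[OF oW x]) (use metric_matrix_rot[OF c] WS in \<open>auto simp: rotf_def\<close>)
    also have "\<dots> = - (\<mu>\<^sup>2 *\<^sub>R u ((rot t \<circ> \<psi>) x))"
      using lb rot_chart[OF c] x unfolding laplace_beltrami_def by blast
    finally show "coord_laplacian (metric_matrix g \<psi>) (rotf t u \<circ> \<psi>) x = - (\<mu>\<^sup>2 *\<^sub>R rotf t u (\<psi> x))"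
      using WS[OF x] by (simp add: rotf_def)
  qed
  ultimately show ?thesis unfolding eigenspace_def by (auto simp: rotf_def)
qed

end


section \<open>Separation of variables\<close>

lemma has_derivative_mode:
  fixes h :: "real \<Rightarrow> complex" and y :: "real^2"
  assumes "(h has_vector_derivative h') (at (y $ 1))"
  shows "((\<lambda>y. cis (n * y $ 2) * h (y $ 1)) has_derivative
    (\<lambda>k. k $ 1 *\<^sub>R (cis (n * y $ 2) * h') + k $ 2 *\<^sub>R (of_real n * \<i> * cis (n * y $ 2) * h (y $ 1)))) (at y)"
proof -
  have p: "((\<lambda>y::real^2. y $ i) has_derivative (\<lambda>k. k $ i)) (at y)" for i
    by (rule bounded_linear_imp_has_derivative[OF bounded_linear_vec_nth])
  have 1: "((\<lambda>y. h (y $ 1)) has_derivative (\<lambda>k. k $ 1 *\<^sub>R h')) (at y)"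
    by (rule has_derivative_compose[OF p]) (use assms in \<open>simp add: has_vector_derivative_def\<close>)
  have 2: "((\<lambda>y. cis (n * y $ 2)) has_derivative (\<lambda>k. (n * k $ 2) *\<^sub>R (\<i> * cis (n * y $ 2)))) (at y)"
    by (intro has_derivative_cis has_derivative_mult_right p)
  have "((\<lambda>y. cis (n * y $ 2) * h (y $ 1)) has_derivative
    (\<lambda>k. cis (n * y $ 2) * (k $ 1 *\<^sub>R h') + (n * k $ 2) *\<^sub>R (\<i> * cis (n * y $ 2)) * h (y $ 1))) (at y)"
    by (rule has_derivative_mult[OF 2 1])
  then show ?thesis by (rule has_derivative_eq_rhs) (simp add: fun_eq_iff scaleR_conv_of_real algebra_simps)
qed

lemma partial_deriv_mode:
  fixes h :: "real \<Rightarrow> complex" and y :: "real^2"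
  assumes "open W" "y \<in> W" "(h has_vector_derivative h') (at (y $ 1))"
    and "\<And>y. y \<in> W \<Longrightarrow> H y = cis (n * y $ 2) * h (y $ 1)"
  shows "partial_deriv 1 H y = cis (n * y $ 2) * h'"
    and "partial_deriv 2 H y = of_real n * \<i> * cis (n * y $ 2) * h (y $ 1)"
proof -
  have "(H has_derivative
    (\<lambda>k. k $ 1 *\<^sub>R (cis (n * y $ 2) * h') + k $ 2 *\<^sub>R (of_real n * \<i> * cis (n * y $ 2) * h (y $ 1)))) (at y)"
    by (rule has_derivative_transform_within_open[OF has_derivative_mode[OF assms(3)] assms(1,2)]) (simp add: assms(4))
  from frechet_derivative_at[OF this, symmetric]
  show "partial_deriv 1 H y = cis (n * y $ 2) * h'"
    "partial_deriv 2 H y = of_real n * \<i> * cis (n * y $ 2) * h (y $ 1)"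
    by (simp_all add: partial_deriv_def axis_def)
qed

lemma matrix_inv_eqI:
  fixes A B :: "real^'n^'n"
  assumes "A ** B = mat 1" shows "matrix_inv A = B"
proof -
  have "B ** A = mat 1" using assms matrix_left_right_inverse by blast
  then have i: "invertible A" using assms unfolding invertible_def by blast
  have "matrix_inv A = matrix_inv A ** (A ** B)" using assms by simp
  also have "\<dots> = B" by (simp add: matrix_mul_assoc matrix_inv_left[OF i])
  finally show ?thesis .
qed

context revolution
begin

definition pchart :: "(real^2) set" where "pchart = {x. 0 < x$1 \<and> x$1 < L \<and> - pi < x$2 \<and> x$2 < pi}"

lemma pchart_strip: "pchart \<subseteq> strip" unfolding pchart_def strip_def by auto

lemma polar_chart: "sphere_chart pchart \<Phi>"
proof -
  have "open pchart" unfolding pchart_def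
    by (intro open_Collect_conj open_Collect_less continuous_intros)
  moreover have "smooth_on pchart \<Phi>" unfolding smooth_on_def
    using open_strip pchart_strip smooth_Phi by blast
  moreover have "inj_on \<Phi> pchart"
  proof (rule inj_onI)
    fix x y assume xy: "x \<in> pchart" "y \<in> pchart" "\<Phi> x = \<Phi> y"
    then have s: "x \<in> strip" "y \<in> strip" using pchart_strip by auto
    obtain k :: int where k: "x $ 1 = y $ 1" "x $ 2 = y $ 2 + 2 * pi * of_int k"
      using Phi_eq_strip[OF s xy(3)] by auto
    have "\<bar>x $ 2 - y $ 2\<bar> < 2 * pi" using xy unfolding pchart_def by (auto simp: abs_if)
    then have "\<bar>of_int k\<bar> * (2 * pi) < 1 * (2 * pi)" using k(2) by (simp add: abs_mult)
    then have "\<bar>of_int k :: real\<bar> < 1" by (simp only: mult_less_cancel_right) auto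
    then have "k = 0" by linarith
    then show "x = y" using k by (simp add: vec_eq_iff forall_2)
  qed
  moreover have "\<Phi> ` pchart \<subseteq> S2"
  proof (rule image_subsetI)
    fix x assume "x \<in> pchart"
    then have "x \<in> cstrip" using pchart_strip strip_cstrip by blast
    then show "\<Phi> x \<in> S2" by (rule Phi_S2)
  qed
  moreover have "inj (frechet_derivative \<Phi> (at y))" if "y \<in> pchart" for y
  proof -
    have y: "y \<in> strip" using that pchart_strip by blast
    have l: "linear (frechet_derivative \<Phi> (at y))" using has_derivative_linear[OF has_derivative_Phi[OF y]] .
    have "h = 0" if h: "frechet_derivative \<Phi> (at y) h = 0" for h
    proof -
      let ?z = "vector [1, y $ 1, y $ 2] :: real^3" and ?h = "vector [0, h $ 1, h $ 2] :: real^3"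
      have z: "?z \<in> dom3" using y by (simp add: dom3_def strip_def)
      have "ang ?z = y" by (simp add: ang_def vec_eq_iff forall_2)
      then have "DPsi ?z ?h = 0" using h frechet_Phi[OF y, of h] by (simp add: DPsi_def)
      then have "GI ?z 0 = ?h" using GI_DPsi[OF z, of ?h] by simp
      moreover have "DPsi ?z 0 = 0" by (simp add: DPsi_def)
      then have "GI ?z 0 = 0" using GI_DPsi[OF z, of 0] by simp
      ultimately show "h = 0" by (simp add: vec_eq_iff forall_2 forall_3)
    qed
    then show ?thesis using l by (simp add: linear_injective_0)
  qed
  ultimately show ?thesis unfolding sphere_chart_def by blast
qed

lemma metric_matrix_Phi: "y \<in> strip \<Longrightarrow> metric_matrix g \<Phi> y = vector [vector [1, 0], vector [0, (a (y$1))\<^sup>2]]"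
  using coords unfolding revolution_coordinates_def strip_def by blast

lemma sqrt_det_Phi: "y \<in> strip \<Longrightarrow> sqrt (det (metric_matrix g \<Phi> y)) = a (y $ 1)"
  using a_nonneg[of "y $ 1"] by (simp add: metric_matrix_Phi det_2 strip_def)

lemma inv_metric_Phi: "y \<in> strip \<Longrightarrow> matrix_inv (metric_matrix g \<Phi> y) = vector [vector [1, 0], vector [0, 1 / (a (y$1))\<^sup>2]]"
  using a_pos[of "y $ 1"]
  by (intro matrix_inv_eqI) (simp add: metric_matrix_Phi strip_def matrix_matrix_mult_def mat_def vec_eq_iff forall_2 sum_2)

lemma smooth_coords:
  assumes "smooth_on S2 u" shows "times_differentiable k strip (\<lambda>x. u (\<Phi> x))"
proof -
  obtain W F where W: "open W" "S2 \<subseteq> W" "\<And>k. times_differentiable k W F" "\<And>x. x \<in> S2 \<Longrightarrow> F x = u x"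
    using assms unfolding smooth_on_def by blast
  have PS: "\<Phi> x \<in> S2" if "x \<in> strip" for x using that strip_cstrip Phi_S2 by blast
  have "times_differentiable k strip (\<lambda>x. F (\<Phi> x))"
    by (rule times_differentiable_compose[OF smooth_Phi W(3)]) (use PS W(2) in blast)
  then show ?thesis
    by (rule times_differentiable_cong[OF open_strip, rotated]) (use PS W(4) in blast)
qed

lemma d1_bounded: obtains B where "\<And>y. y \<in> strip \<Longrightarrow> norm (d1 y) \<le> B" "0 \<le> B"
proof -
  obtain c C where cC: "0 < c" "0 \<le> C"
    "\<And>x v. x \<noteq> 0 \<Longrightarrow> c * (norm v)\<^sup>2 \<le> mform (gmat g x) v v"
    "\<And>x v. x \<noteq> 0 \<Longrightarrow> mform (gmat g x) v v \<le> C * (norm v)\<^sup>2" using ghat_bounds by metis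
  have "norm (d1 y) \<le> sqrt (1 / c)" if y: "y \<in> strip" for y
  proof -
    have n: "norm (\<Phi> y) = 1" using norm_Phi y strip_cstrip by blast
    then have nz: "\<Phi> y \<noteq> 0" by auto
    have "mform (gmat g (\<Phi> y)) (d1 y) (d1 y) = 1"
      unfolding mform_gmat[OF nz] using metric_Phi(1)[OF y] Phi_orth[OF y]
      by (subst ghat_unit[OF n]) (simp_all add: inner_commute)
    then have "c * (norm (d1 y))\<^sup>2 \<le> 1" using cC(3)[OF nz, of "d1 y"] by simp
    then have "(norm (d1 y))\<^sup>2 \<le> 1 / c" using cC(1) by (simp add: field_simps)
    then show ?thesis by (rule real_le_rsqrt)
  qed
  moreover have "0 \<le> sqrt (1 / c)" using cC by simp
  ultimately show ?thesis using that by blast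
qed

lemma smooth_on_S2_bounded:
  assumes "smooth_on S2 (u :: real^3 \<Rightarrow> complex)"
  obtains B where "0 \<le> B" "\<And>P. P \<in> S2 \<Longrightarrow> norm (u P) \<le> B" 
    "\<And>y. y \<in> strip \<Longrightarrow> norm (partial_deriv 1 (\<lambda>x. u (\<Phi> x)) y) \<le> B"
proof -
  obtain W F where W: "open W" "S2 \<subseteq> W" "\<And>k. times_differentiable k W F" "\<And>x. x \<in> S2 \<Longrightarrow> F x = u x"
    using assms unfolding smooth_on_def by blast
  have cF: "continuous_on S2 F" using times_differentiable_imp_continuous_on[OF W(3)] W(2) continuous_on_subset by blast
  have cD: "continuous_on S2 (\<lambda>x. frechet_derivative F (at x) v)" for v
    using times_differentiable_imp_continuous_on[OF times_differentiable_derivI(1)[OF W(1) W(3)]] W(2) continuous_on_subset by blast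
  have "bdd_on S2 F" by (rule bdd_on_compact[OF _ cF]) auto
  then obtain B0 where B0: "\<And>P. P \<in> S2 \<Longrightarrow> norm (F P) \<le> B0" unfolding bdd_on_def by blast
  have "\<exists>M. \<forall>P\<in>S2. norm (frechet_derivative F (at P) b) \<le> M" for b
    using bdd_on_compact[OF _ cD subset_refl] unfolding bdd_on_def by auto
  then obtain M where M: "\<And>b P. P \<in> S2 \<Longrightarrow> norm (frechet_derivative F (at P) b) \<le> M b" by metis
  obtain D where D: "\<And>y. y \<in> strip \<Longrightarrow> norm (d1 y) \<le> D" "0 \<le> D" using d1_bounded by blast
  define B1 where "B1 = (\<Sum>b\<in>(Basis::(real^3) set). D * \<bar>M b\<bar>)"
  have 1: "norm (partial_deriv 1 (\<lambda>x. u (\<Phi> x)) y) \<le> B1" if y: "y \<in> strip" for y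
  proof -
    have PS: "\<Phi> x \<in> S2" if "x \<in> strip" for x using that strip_cstrip Phi_S2 by blast
    have PW: "\<Phi> y \<in> W" using PS[OF y] W(2) by blast
    have dF: "(F has_derivative frechet_derivative F (at (\<Phi> y))) (at (\<Phi> y))"
      by (rule times_differentiable_derivI(2)[OF W(1) W(3) PW])
    have "((\<lambda>x. F (\<Phi> x)) has_derivative (\<lambda>h. frechet_derivative F (at (\<Phi> y)) (frechet_derivative \<Phi> (at y) h))) (at y)"
      by (rule has_derivative_compose[OF has_derivative_Phi[OF y] dF])
    then have "((\<lambda>x. u (\<Phi> x)) has_derivative (\<lambda>h. frechet_derivative F (at (\<Phi> y)) (frechet_derivative \<Phi> (at y) h))) (at y)"
      by (rule has_derivative_transform_within_open[OF _ open_strip y]) (use PS W(4) in blast)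
    from frechet_derivative_at[OF this, symmetric]
    have "partial_deriv 1 (\<lambda>x. u (\<Phi> x)) y = frechet_derivative F (at (\<Phi> y)) (d1 y)"
      by (simp add: partial_deriv_def)
    also have "\<dots> = (\<Sum>b\<in>Basis. (d1 y \<bullet> b) *\<^sub>R frechet_derivative F (at (\<Phi> y)) b)"
      by (rule linear_eq_sum_Basis[OF has_derivative_bounded_linear[OF dF]])
    also have "norm \<dots> \<le> B1" unfolding B1_def
    proof (rule sum_norm_le)
      fix b :: "real^3" assume b: "b \<in> Basis"
      have "\<bar>d1 y \<bullet> b\<bar> \<le> D" using Basis_le_norm[OF b, of "d1 y"] D(1)[OF y] by simp
      moreover have "norm (frechet_derivative F (at (\<Phi> y)) b) \<le> \<bar>M b\<bar>" using M[OF PS[OF y], of b] by simp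
      ultimately show "norm ((d1 y \<bullet> b) *\<^sub>R frechet_derivative F (at (\<Phi> y)) b) \<le> D * \<bar>M b\<bar>"
        by (auto intro!: mult_mono D)
    qed
    finally show ?thesis .
  qed
  show ?thesis
  proof (rule that[of "\<bar>B0\<bar> + \<bar>B1\<bar>"])
    show "norm (u P) \<le> \<bar>B0\<bar> + \<bar>B1\<bar>" if "P \<in> S2" for P using B0[OF that] W(4)[OF that] by simp
    show "norm (partial_deriv 1 (\<lambda>x. u (\<Phi> x)) y) \<le> \<bar>B0\<bar> + \<bar>B1\<bar>" if "y \<in> strip" for y using 1[OF that] by simp
  qed simp
qed

text \<open>For a function \<open>exp (i n \<theta>) w(s)\<close> the Laplacian in polar coordinates is
  \<open>a\<^sup>-\<^sup>1 (a w')' - n\<^sup>2 a\<^sup>-\<^sup>2 w\<close>, and \<open>V = a w'\<close> turns the eigenvalue equation into a first-order system. The bound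
  \<open>\<bar>V\<bar> \<le> B a\<close> holds because \<open>w\<close> comes from a smooth function on the sphere; it says that no flux leaves
  through the poles.\<close>

theorem mode_ode:
  assumes u: "u \<in> eigenspace g \<mu>" and mode: "\<And>P t. P \<in> S2 \<Longrightarrow> u (rot t P) = cis (of_int n * t) * u P"
  defines "w \<equiv> \<lambda>s. u (\<Phi> (pt s 0))"
  obtains V B where "\<And>s. s \<in> {0<..<L} \<Longrightarrow> (w has_vector_derivative V s /\<^sub>R a s) (at s)"
    "\<And>s. s \<in> {0<..<L} \<Longrightarrow> (V has_vector_derivative (((of_int n)\<^sup>2 - \<mu>\<^sup>2 * (a s)\<^sup>2) / a s) *\<^sub>R w s) (at s)"
    "0 \<le> B" "\<And>s. s \<in> {0<..<L} \<Longrightarrow> norm (w s) \<le> B" "\<And>s. s \<in> {0<..<L} \<Longrightarrow> norm (V s) \<le> B * a s"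
proof -
  have su: "smooth_on S2 u" and lb: "laplace_beltrami g u (\<lambda>p. - (\<mu>\<^sup>2 *\<^sub>R u p))"
    using u unfolding eigenspace_def by auto
  let ?F = "\<lambda>x. u (\<Phi> x)" and ?n = "of_int n :: real"
  have F: "?F y = cis (?n * y $ 2) * w (y $ 1)" if "y \<in> strip" for y
  proof -
    have p: "pt (y $ 1) 0 \<in> cstrip" using that strip_cstrip by (auto simp: strip_def cstrip_def)
    have "y = pt (y $ 1) 0 + axis 2 (y $ 2)" by (simp add: vec_eq_iff forall_2 axis_def)
    then have "\<Phi> y = rot (y $ 2) (\<Phi> (pt (y $ 1) 0))" using rot_Phi[OF p] by simp
    then show ?thesis using mode[OF Phi_S2[OF p]] by (simp add: w_def)
  qed
  have lin: "bounded_linear (\<lambda>s. s *\<^sub>R axis 1 1 :: real^2)" by (rule bounded_linear_scaleR_left)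
  have ptl: "pt s 0 = s *\<^sub>R axis 1 1" for s by (simp add: vec_eq_iff forall_2 axis_def)
  have tw: "times_differentiable k {0<..<L} w" for k
    unfolding w_def ptl
    by (rule times_differentiable_compose[OF times_differentiable_bounded_linear[OF lin] smooth_coords[OF su]])
      (auto simp: strip_def axis_def)
  define w' where "w' s = frechet_derivative w (at s) 1" for s
  have hv: "(f has_vector_derivative frechet_derivative f (at s) 1) (at s)"
    if "times_differentiable (Suc 0) {0<..<L} f" "s \<in> {0<..<L}" for f :: "real \<Rightarrow> complex" and s
  proof -
    have d: "(f has_derivative frechet_derivative f (at s)) (at s)"
      by (rule times_differentiable_derivI(2)[OF _ that]) simp
    have "frechet_derivative f (at s) x = x *\<^sub>R frechet_derivative f (at s) 1" for x
      using linear_scale[OF has_derivative_linear[OF d], of x 1] by simp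
    then show ?thesis using d unfolding has_vector_derivative_def by (metis (no_types, lifting) ext)
  qed
  have dw: "(w has_vector_derivative w' s) (at s)" if "s \<in> {0<..<L}" for s
    unfolding w'_def by (rule hv[OF tw that])
  have tw': "times_differentiable k {0<..<L} w'" for k
    unfolding w'_def by (rule times_differentiable_derivI(1)[OF _ tw]) simp
  define V where "V s = a s *\<^sub>R w' s" for s
  have tV: "times_differentiable k {0<..<L} V" for k
    unfolding V_def by (intro times_differentiable_scaleR smooth_a tw')
  define V' where "V' s = frechet_derivative V (at s) 1" for s
  have dV: "(V has_vector_derivative V' s) (at s)" if "s \<in> {0<..<L}" for s
    unfolding V'_def by (rule hv[OF tV that])
  have pd: "partial_deriv 1 ?F y = cis (?n * y $ 2) * w' (y $ 1)"
    "partial_deriv 2 ?F y = of_real ?n * \<i> * cis (?n * y $ 2) * w (y $ 1)" if "y \<in> strip" for y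
    using partial_deriv_mode[OF open_strip that dw F] that by (auto simp: strip_def)
  have eq: "V' s = ((?n\<^sup>2 - \<mu>\<^sup>2 * (a s)\<^sup>2) / a s) *\<^sub>R w s" if s: "s \<in> {0<..<L}" for s
  proof -
    let ?x = "pt s 0"
    have x: "?x \<in> pchart" using s by (simp add: pchart_def)
    then have xs: "?x \<in> strip" using pchart_strip by blast
    have as: "a s > 0" using a_pos s by simp
    let ?G = "metric_matrix g \<Phi>"
    let ?H = "\<lambda>i y. sqrt (det (?G y)) *\<^sub>R (\<Sum>j\<in>UNIV. (matrix_inv (?G y) $ i $ j) *\<^sub>R partial_deriv j ?F y)"
    have H1: "?H 1 y = cis (?n * y $ 2) * V (y $ 1)" if y: "y \<in> strip" for y
      using sqrt_det_Phi[OF y] inv_metric_Phi[OF y] pd[OF y] by (simp add: sum_2 V_def)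
    have H2: "?H 2 y = cis (?n * y $ 2) * ((?n / a (y $ 1)) *\<^sub>R (\<i> * w (y $ 1)))" if y: "y \<in> strip" for y
      using sqrt_det_Phi[OF y] inv_metric_Phi[OF y] pd[OF y] a_pos[of "y $ 1"] y
      by (simp add: sum_2 strip_def scaleR_conv_of_real power2_eq_square field_simps)
    have d2: "\<exists>D. ((\<lambda>s. (?n / a s) *\<^sub>R (\<i> * w s)) has_vector_derivative D) (at (?x $ 1))"
    proof -
      have "times_differentiable (Suc 0) {0<..<L} (\<lambda>s. (?n * inverse (a s)) *\<^sub>R (\<i> * w s))"
        by (intro times_differentiable_scaleR times_differentiable_mult times_differentiable_const
            times_differentiable_inverse smooth_a tw) (use a_pos in force)
      from hv[OF this s] show ?thesis by (auto simp: divide_inverse)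
    qed
    then obtain D where D: "((\<lambda>s. (?n / a s) *\<^sub>R (\<i> * w s)) has_vector_derivative D) (at (?x $ 1))" ..
    have 1: "partial_deriv 1 (?H 1) ?x = V' s"
      using partial_deriv_mode(1)[OF open_strip xs dV[of "?x $ 1"] H1] s by simp
    have 2: "partial_deriv 2 (?H 2) ?x = of_real ?n * \<i> * ((?n / a s) *\<^sub>R (\<i> * w s))"
      using partial_deriv_mode(2)[OF open_strip xs D H2] by simp
    have "coord_laplacian ?G (u \<circ> \<Phi>) ?x = - (\<mu>\<^sup>2 *\<^sub>R w s)"
      using lb polar_chart x unfolding laplace_beltrami_def w_def by blast
    moreover have "coord_laplacian ?G (u \<circ> \<Phi>) ?x = (partial_deriv 1 (?H 1) ?x + partial_deriv 2 (?H 2) ?x) /\<^sub>R a s"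
      unfolding coord_laplacian_def sqrt_det_Phi[OF xs] comp_def by (simp add: sum_2[of "\<lambda>i. partial_deriv i (?H i) ?x"])
    ultimately have "(V' s + of_real ?n * \<i> * ((?n / a s) *\<^sub>R (\<i> * w s))) /\<^sub>R a s = - (\<mu>\<^sup>2 *\<^sub>R w s)"
      unfolding 1 2 by simp
    then have "V' s + of_real ?n * \<i> * ((?n / a s) *\<^sub>R (\<i> * w s)) = a s *\<^sub>R (- (\<mu>\<^sup>2 *\<^sub>R w s))"
      using as by (metis divideR_right less_irrefl)
    moreover have ii: "c * \<i> * (c * (\<i> * z)) = - (c * c * z)" for c z :: complex
      by (simp add: complex_eq_iff algebra_simps)
    have "of_real ?n * \<i> * ((?n / a s) *\<^sub>R (\<i> * w s)) = - ((?n\<^sup>2 / a s) *\<^sub>R w s)"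
      by (simp add: scaleR_conv_of_real power2_eq_square ii)
    ultimately have "V' s = (?n\<^sup>2 / a s) *\<^sub>R w s - (a s * \<mu>\<^sup>2) *\<^sub>R w s" by (simp add: algebra_simps)
    also have "\<dots> = ((?n\<^sup>2 - \<mu>\<^sup>2 * (a s)\<^sup>2) / a s) *\<^sub>R w s"
      using as by (simp add: scaleR_diff_left[symmetric] field_simps power2_eq_square)
    finally show ?thesis .
  qed
  obtain B where B: "0 \<le> B" "\<And>P. P \<in> S2 \<Longrightarrow> norm (u P) \<le> B" "\<And>y. y \<in> strip \<Longrightarrow> norm (partial_deriv 1 ?F y) \<le> B"
    using smooth_on_S2_bounded[OF su] by blast
  show ?thesis
  proof (rule that[of V B])
    fix s assume s: "s \<in> {0<..<L}"
    have as: "a s > 0" using a_pos s by simp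
    have xs: "pt s 0 \<in> strip" using s by (simp add: strip_def)
    show "(w has_vector_derivative V s /\<^sub>R a s) (at s)" using dw[OF s] as by (simp add: V_def)
    show "(V has_vector_derivative ((?n\<^sup>2 - \<mu>\<^sup>2 * (a s)\<^sup>2) / a s) *\<^sub>R w s) (at s)"
      using dV[OF s] eq[OF s] by simp
    have "\<Phi> (pt s 0) \<in> S2" using xs strip_cstrip Phi_S2 by blast
    then show "norm (w s) \<le> B" unfolding w_def by (rule B(2))
    have "norm (w' s) \<le> B" using B(3)[OF xs] pd(1)[OF xs] by simp
    then show "norm (V s) \<le> B * a s" using as by (simp add: V_def mult.commute mult_right_mono)
  qed (rule B(1))
qed

end


section \<open>Integration over the surface\<close>

lemma box_real_prod: "box (a, c) (b, d) = {a<..<b::real} \<times> {c<..<d::real}"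
  by (auto simp: box_def Basis_prod_def)

lemma lborel_real2: "(lborel :: (real^2) measure) = distr lborel borel (\<lambda>z. pt (fst z) (snd z))"
proof (rule lborel_eqI)
  have lin: "bounded_linear (\<lambda>z::real \<times> real. pt (fst z) (snd z))"
    unfolding linear_conv_bounded_linear[symmetric]
    by (auto intro!: linearI simp: vec_eq_iff forall_2)
  have cont: "continuous_on UNIV (\<lambda>z::real \<times> real. pt (fst z) (snd z))"
    by (rule linear_continuous_on[OF lin])
  have m [measurable]: "(\<lambda>z::real \<times> real. pt (fst z) (snd z)) \<in> borel_measurable borel"
    by (rule borel_measurable_continuous_onI[OF cont])
  fix l u :: "real^2" assume lu: "\<And>b. b \<in> Basis \<Longrightarrow> l \<bullet> b \<le> u \<bullet> b"
  have B: "Basis = {axis 1 1, axis 2 1 :: real^2}"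
    by (auto simp: Basis_vec_def UNIV_2)
  have ne: "axis 1 1 \<noteq> (axis 2 1 :: real^2)" by (simp add: axis_eq_axis)
  have l: "l $ 1 \<le> u $ 1" "l $ 2 \<le> u $ 2" using lu[of "axis 1 1"] lu[of "axis 2 1"] by (auto simp: B inner_axis)
  have pre: "(\<lambda>z. pt (fst z) (snd z)) -` box l u = box (l $ 1, l $ 2) (u $ 1, u $ 2)"
    by (auto simp: mem_box_cart forall_2 box_real_prod)
  have "emeasure (distr lborel borel (\<lambda>z. pt (fst z) (snd z))) (box l u) = emeasure lborel (box (l $ 1, l $ 2) (u $ 1, u $ 2))"
    by (subst emeasure_distr) (auto simp: pre)
  also have "\<dots> = emeasure (lborel \<Otimes>\<^sub>M lborel) ({l $ 1<..<u $ 1} \<times> {l $ 2<..<u $ 2})"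
    by (simp add: lborel_prod box_real_prod)
  also have "\<dots> = ennreal (u $ 1 - l $ 1) * ennreal (u $ 2 - l $ 2)"
    using l by (subst lborel.emeasure_pair_measure_Times) auto
  also have "\<dots> = (\<Prod>b\<in>Basis. (u - l) \<bullet> b)"
    using ne l by (simp add: B inner_axis ennreal_mult')
  finally show "emeasure (distr lborel borel (\<lambda>z. pt (fst z) (snd z))) (box l u) = (\<Prod>b\<in>Basis. (u - l) \<bullet> b)" .
qed simp

lemma integral_rectangle:
  fixes H :: "real^2 \<Rightarrow> 'b::euclidean_space"
  assumes "continuous_on (cbox (pt 0 0) (pt L M)) H" 
  shows "integrable lborel (\<lambda>x. indicator (box (pt 0 0) (pt L M)) x *\<^sub>R H x)"
    and "(LINT x|lborel. indicator (box (pt 0 0) (pt L M)) x *\<^sub>R H x) =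
      integral {0..L} (\<lambda>s. integral {0..M} (\<lambda>\<theta>. H (pt s \<theta>)))"
proof -
  let ?C = "cbox (pt 0 0) (pt L M)" and ?B = "box (pt 0 0) (pt L M)"
  have "integrable lborel (\<lambda>x. indicator ?C x *\<^sub>R H x)"
    by (rule borel_integrable_compact[OF compact_cbox assms])
  then have "set_integrable lborel ?C H" unfolding set_integrable_def .
  then have sB: "set_integrable lborel ?B H"
    by (rule set_integrable_subset) (auto intro: box_subset_cbox[THEN subsetD])
  then show i: "integrable lborel (\<lambda>x. indicator ?B x *\<^sub>R H x)" unfolding set_integrable_def .
  have lin: "bounded_linear (\<lambda>z::real \<times> real. pt (fst z) (snd z))"
    unfolding linear_conv_bounded_linear[symmetric]
    by (auto intro!: linearI simp: vec_eq_iff forall_2)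
  have cont: "continuous_on UNIV (\<lambda>z::real \<times> real. pt (fst z) (snd z))"
    by (rule linear_continuous_on[OF lin])
  have m [measurable]: "(\<lambda>z::real \<times> real. pt (fst z) (snd z)) \<in> borel_measurable borel"
    by (rule borel_measurable_continuous_onI[OF cont])
  let ?h = "\<lambda>z. H (pt (fst z) (snd z))" and ?D = "box (0, 0) (L, M)"
  have ind: "indicator ?B (pt (fst z) (snd z)) = (indicator ?D z :: real)" for z
    by (cases z) (auto simp: indicator_def mem_box_cart forall_2 box_real_prod)
  have mf: "(\<lambda>x. indicator ?B x *\<^sub>R H x) \<in> borel_measurable borel"
    using borel_measurable_integrable[OF i] by simp
  have ch: "continuous_on (cbox (0, 0) (L, M)) ?h"
    by (rule continuous_on_compose2[OF assms continuous_on_subset[OF cont]])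
      (auto simp: mem_box_cart forall_2 cbox_Pair_eq)
  have "(LINT x|lborel. indicator ?B x *\<^sub>R H x) = (LINT z|lborel. indicator ?D z *\<^sub>R ?h z)"
    by (subst lborel_real2, subst integral_distr) (auto simp: ind mf)
  also have "\<dots> = integral ?D ?h"
  proof -
    have "set_integrable lborel (cbox (0, 0) (L, M)) ?h" unfolding set_integrable_def
      by (rule borel_integrable_compact[OF compact_cbox ch])
    then have "set_integrable lborel ?D ?h"
      by (rule set_integrable_subset[OF _ _ box_subset_cbox]) simp
    from set_borel_integral_eq_integral(2)[OF this] show ?thesis unfolding set_lebesgue_integral_def .
  qed
  also have "\<dots> = integral (cbox (0, 0) (L, M)) ?h" by (rule integral_open_interval)
  also have "\<dots> = integral {0..L} (\<lambda>s. integral {0..M} (\<lambda>\<theta>. H (pt s \<theta>)))"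
    using integral_prod_continuous[OF ch] by simp
  finally show "(LINT x|lborel. indicator ?B x *\<^sub>R H x) = \<dots>" .
qed

context revolution
begin

abbreviation "MM \<equiv> riemannian_measure g L \<Phi>"

lemma continuous_a: "continuous_on {0..L} a"
proof -
  obtain W F where W: "{0..L} \<subseteq> W" "\<And>k. times_differentiable k W F" "\<And>x. x \<in> {0..L} \<Longrightarrow> F x = a x"
    using profile unfolding simple_profile_def smooth_on_def by blast
  have "continuous_on {0..L} F" using times_differentiable_imp_continuous_on[OF W(2)] W(1) continuous_on_subset by blast
  then show ?thesis using W(3) continuous_on_cong by (metis (no_types, lifting))
qed

lemma cont_coords:
  assumes "continuous_on S2 F" shows "continuous_on cstrip (\<lambda>x. F (\<Phi> x))"
  by (rule continuous_on_compose2[OF assms cont_Phi]) (use Phi_S2 in blast)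

text \<open>The Riemannian measure has density \<open>a\<close> in the coordinates \<open>(s, \<theta>)\<close>, and Fubini's theorem applies.\<close>

theorem surface_integral:
  fixes F :: "real^3 \<Rightarrow> 'b::euclidean_space"
  assumes mF: "F \<in> borel_measurable borel" and cF: "continuous_on S2 F"
  shows "integrable MM F"
    and "(LINT P|MM. F P) = integral {0..L} (\<lambda>s. a s *\<^sub>R integral {0..2 * pi} (\<lambda>\<theta>. F (\<Phi> (pt s \<theta>))))"
proof -
  let ?S = "{x::real^2. 0 < x$1 \<and> x$1 < L \<and> 0 < x$2 \<and> x$2 < 2 * pi}"
  let ?d = "\<lambda>x. sqrt (det (metric_matrix g \<Phi> x))"
  let ?R = "restrict_space lborel ?S"
  have S: "?S = box (pt 0 0) (pt L (2 * pi))" by (auto simp: mem_box_cart forall_2)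
  have oS: "open ?S" unfolding S by (rule open_box)
  then have bS: "?S \<inter> space lborel \<in> sets lborel" by simp
  have d: "?d x = a (x $ 1)" if "x \<in> ?S" for x
    using a_nonneg[of "x $ 1"] that coords unfolding revolution_coordinates_def by (simp add: det_2)
  have setsR: "sets ?R = sets (restrict_space borel ?S)" by (simp add: sets_restrict_space)
  have ca: "continuous_on ?S (\<lambda>x. a (x $ 1))"
    by (rule continuous_on_compose2[OF continuous_a]) (auto intro!: continuous_intros)
  have "?S \<subseteq> cstrip" by (auto simp: cstrip_def)
  then have cP: "continuous_on ?S \<Phi>" using cont_Phi continuous_on_subset by blast
  have mP: "\<Phi> \<in> measurable ?R borel"
    using borel_measurable_continuous_on_restrict[OF cP] measurable_cong_sets[OF setsR refl] by blast
  have "(\<lambda>x. a (x $ 1)) \<in> borel_measurable ?R"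
    using borel_measurable_continuous_on_restrict[OF ca] measurable_cong_sets[OF setsR refl] by blast
  then have md: "?d \<in> borel_measurable ?R"
    by (rule measurable_cong[THEN iffD2, rotated]) (use d in \<open>auto simp: space_restrict_space\<close>)
  have nn: "AE x in ?R. 0 \<le> ?d x"
    by (rule AE_I2) (use d a_nonneg in \<open>auto simp: space_restrict_space\<close>)
  have mP': "\<Phi> \<in> measurable (density ?R ?d) borel" using mP by simp
  have mFP: "(\<lambda>x. F (\<Phi> x)) \<in> borel_measurable ?R" by (rule measurable_compose[OF mP mF])
  define H where "H x = a (x $ 1) *\<^sub>R F (\<Phi> x)" for x
  have cH: "continuous_on (cbox (pt 0 0) (pt L (2 * pi))) H"
    unfolding H_def
  proof (rule continuous_on_scaleR)
    show "continuous_on (cbox (pt 0 0) (pt L (2 * pi))) (\<lambda>x. a (x $ 1))"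
      by (rule continuous_on_compose2[OF continuous_a]) (auto intro!: continuous_intros simp: mem_box_cart forall_2)
    show "continuous_on (cbox (pt 0 0) (pt L (2 * pi))) (\<lambda>x. F (\<Phi> x))"
      by (rule continuous_on_subset[OF cont_coords[OF cF]]) (auto simp: mem_box_cart forall_2 cstrip_def)
  qed
  have ind: "indicator ?S x *\<^sub>R (?d x *\<^sub>R F (\<Phi> x)) = indicator ?S x *\<^sub>R H x" for x
    using d[of x] by (simp add: indicator_def H_def)
  have "integrable MM F \<longleftrightarrow> integrable (density ?R ?d) (\<lambda>x. F (\<Phi> x))"
    unfolding riemannian_measure_def by (rule integrable_distr_eq[OF mP' mF])
  also have "\<dots> \<longleftrightarrow> integrable ?R (\<lambda>x. ?d x *\<^sub>R F (\<Phi> x))"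
    by (rule integrable_density[OF mFP md nn])
  also have "\<dots> \<longleftrightarrow> integrable lborel (\<lambda>x. indicator ?S x *\<^sub>R H x)"
    unfolding integrable_restrict_space[OF bS] ind ..
  finally show "integrable MM F" using integral_rectangle(1)[OF cH] unfolding S by blast
  have "(LINT P|MM. F P) = integral\<^sup>L (density ?R ?d) (\<lambda>x. F (\<Phi> x))"
    unfolding riemannian_measure_def by (rule integral_distr[OF mP' mF])
  also have "\<dots> = integral\<^sup>L ?R (\<lambda>x. ?d x *\<^sub>R F (\<Phi> x))"
    by (rule integral_density[OF mFP md nn])
  also have "\<dots> = integral\<^sup>L lborel (\<lambda>x. indicator ?S x *\<^sub>R H x)"
    unfolding integral_restrict_space[OF bS] ind ..
  also have "\<dots> = integral {0..L} (\<lambda>s. integral {0..2 * pi} (\<lambda>\<theta>. H (pt s \<theta>)))"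
    unfolding S by (rule integral_rectangle(2)[OF cH])
  also have "\<dots> = integral {0..L} (\<lambda>s. a s *\<^sub>R integral {0..2 * pi} (\<lambda>\<theta>. F (\<Phi> (pt s \<theta>))))"
    by (simp add: H_def)
  finally show "(LINT P|MM. F P) = \<dots>" .
qed

end


section \<open>Fourier series\<close>

definition fourier :: "(real \<Rightarrow> complex) \<Rightarrow> int \<Rightarrow> complex" where
  "fourier f n = integral {0..2 * pi} (\<lambda>t. f t * cis (- (of_int n * t))) / of_real (2 * pi)"

lemma integral_cis:
  "integral {0..2 * pi} (\<lambda>t. cis (of_int n * t)) = (if n = 0 then of_real (2 * pi) else 0)"
proof (cases "n = 0")
  case False
  have d: "((\<lambda>t. cis (of_int n * t) / (\<i> * of_int n)) has_vector_derivative cis (of_int n * t)) (at t within {0..2 * pi})" for t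
  proof -
    have "((\<lambda>t. cis (of_int n * t)) has_derivative (\<lambda>k. (of_int n * k) *\<^sub>R (\<i> * cis (of_int n * t)))) (at t within {0..2 * pi})"
      by (intro has_derivative_cis has_derivative_mult_right has_derivative_ident)
    then have "((\<lambda>t. cis (of_int n * t)) has_vector_derivative of_int n *\<^sub>R (\<i> * cis (of_int n * t))) (at t within {0..2 * pi})"
      unfolding has_vector_derivative_def by (rule has_derivative_eq_rhs) (simp add: fun_eq_iff mult.commute)
    from has_vector_derivative_divide[OF this, of "\<i> * of_int n"] show ?thesis
      using False by (simp add: scaleR_conv_of_real)
  qed
  have "((\<lambda>t. cis (of_int n * t)) has_integral (cis (of_int n * (2 * pi)) / (\<i> * of_int n) - cis (of_int n * 0) / (\<i> * of_int n))) {0..2 * pi}"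
    by (rule fundamental_theorem_of_calculus) (use d in auto)
  moreover have "cis (of_int n * (2 * pi)) = 1"
    using cis_multiple_2pi[of "of_int n"] by (simp add: mult_ac)
  ultimately show ?thesis using False by (simp add: integral_unique)
next
  case True
  then show ?thesis by (simp add: scaleR_conv_of_real)
qed

lemma fourier_cis: "fourier (\<lambda>t. cis (of_int m * t)) n = (if m = n then 1 else 0)"
proof -
  have "(\<lambda>t. cis (of_int m * t) * cis (- (of_int n * t))) = (\<lambda>t. cis (of_int (m - n) * t))"
    by (simp add: cis_mult algebra_simps fun_eq_iff)
  then show ?thesis unfolding fourier_def by (simp only: integral_cis) simp
qed

lemma cont_fourier_integrand:
  "continuous_on S f \<Longrightarrow> continuous_on S (\<lambda>t. f t * cis (- (of_int n * t)))"
  unfolding cis_conv_exp by (intro continuous_intros)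

lemma integral_lincomb:
  fixes p :: "'i \<Rightarrow> real \<Rightarrow> complex"
  assumes "finite I" "\<And>i. i \<in> I \<Longrightarrow> continuous_on {r..s} (p i)"
  shows "integral {r..s} (\<lambda>t. \<Sum>i\<in>I. c i * p i t) = (\<Sum>i\<in>I. c i * integral {r..s} (p i))"
proof -
  have "(\<lambda>t. c i * p i t) integrable_on {r..s}" if "i \<in> I" for i
    by (intro integrable_continuous_real continuous_intros assms that)
  then have "integral {r..s} (\<lambda>t. \<Sum>i\<in>I. c i * p i t) = (\<Sum>i\<in>I. integral {r..s} (\<lambda>t. c i * p i t))"
    by (rule Henstock_Kurzweil_Integration.integral_sum[OF assms(1)])
  then show ?thesis by simp
qed

lemma cmod_diff_square: "(cmod (u - v))\<^sup>2 = (cmod u)\<^sup>2 - 2 * Re (u * cnj v) + (cmod v)\<^sup>2"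
  unfolding cmod_power2 by (simp add: power2_eq_square algebra_simps)

lemma fourier_add_scale:
  assumes "continuous_on {0..2 * pi} f" "\<And>i. i \<in> I \<Longrightarrow> continuous_on {0..2 * pi} (h i)" "finite I"
  shows "fourier (\<lambda>t. f t - (\<Sum>i\<in>I. c i * h i t)) n = fourier f n - (\<Sum>i\<in>I. c i * fourier (h i) n)"
proof -
  have i1: "(\<lambda>t. f t * cis (- (of_int n * t))) integrable_on {0..2 * pi}"
    by (intro integrable_continuous_real cont_fourier_integrand assms)
  have i2: "(\<lambda>t. h i t * cis (- (of_int n * t))) integrable_on {0..2 * pi}" if "i \<in> I" for i
    by (intro integrable_continuous_real cont_fourier_integrand assms that)
  have "(\<lambda>t. (f t - (\<Sum>i\<in>I. c i * h i t)) * cis (- (of_int n * t))) =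
    (\<lambda>t. f t * cis (- (of_int n * t)) - (\<Sum>i\<in>I. c i * (h i t * cis (- (of_int n * t)))))"
    by (simp add: fun_eq_iff left_diff_distrib sum_distrib_right mult.assoc)
  moreover have "integral {0..2 * pi} (\<lambda>t. f t * cis (- (of_int n * t)) - (\<Sum>i\<in>I. c i * (h i t * cis (- (of_int n * t))))) =
    integral {0..2 * pi} (\<lambda>t. f t * cis (- (of_int n * t))) - (\<Sum>i\<in>I. c i * integral {0..2 * pi} (\<lambda>t. h i t * cis (- (of_int n * t))))"
    by (subst Henstock_Kurzweil_Integration.integral_diff)
      (intro i1 integrable_sum assms(3) integrable_on_mult_right i2 integral_lincomb cont_fourier_integrand assms(2)
        | simp add: integral_lincomb[OF assms(3) cont_fourier_integrand[OF assms(2)]])+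
  ultimately show ?thesis unfolding fourier_def by (simp add: diff_divide_distrib sum_divide_distrib)
qed

text \<open>The integral of the square of \<open>f\<close> minus its orthogonal projection to the span of the exponentials with \<open>n \<in> S\<close> is nonnegative.\<close>

lemma bessel_fourier:
  assumes c: "continuous_on {0..2 * pi} f" and S: "finite S"
  shows "(\<Sum>n\<in>S. 2 * pi * (cmod (fourier f n))^2) \<le> integral {0..2 * pi} (\<lambda>t. (cmod (f t))^2)"
proof -
  let ?I = "integral {0..2 * pi}"
  define g where "g t = (\<Sum>n\<in>S. fourier f n * cis (of_int n * t))" for t
  have cg: "continuous_on {0..2 * pi} g" unfolding g_def cis_conv_exp by (intro continuous_intros)
  have cz: "(of_real ((cmod z)^2) :: complex) = z * cnj z" for z by (rule complex_norm_square)
  have fg: "?I (\<lambda>t. f t * cnj (g t)) = (\<Sum>n\<in>S. of_real (2 * pi * (cmod (fourier f n))^2))"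
  proof -
    have "(\<lambda>t. f t * cnj (g t)) = (\<lambda>t. \<Sum>n\<in>S. cnj (fourier f n) * (f t * cis (- (of_int n * t))))"
      by (simp add: g_def fun_eq_iff sum_distrib_left cis_cnj mult_ac)
    then have "?I (\<lambda>t. f t * cnj (g t)) = (\<Sum>n\<in>S. cnj (fourier f n) * ?I (\<lambda>t. f t * cis (- (of_int n * t))))"
      by (simp only: integral_lincomb[OF S cont_fourier_integrand[OF c]])
    also have "\<dots> = (\<Sum>n\<in>S. cnj (fourier f n) * (of_real (2 * pi) * fourier f n))"
      by (simp add: fourier_def)
    also have "\<dots> = (\<Sum>n\<in>S. of_real (2 * pi * (cmod (fourier f n))^2))"
      by (intro sum.cong refl) (simp only: of_real_mult cz mult_ac)
    finally show ?thesis .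
  qed
  have fn: "fourier g n = (if n \<in> S then fourier f n else 0)" for n
  proof -
    have "fourier (\<lambda>t. 0 - (\<Sum>m\<in>S. (- fourier f m) * cis (of_int m * t))) n = fourier (\<lambda>t. 0) n - (\<Sum>m\<in>S. (- fourier f m) * fourier (\<lambda>t. cis (of_int m * t)) n)"
      by (rule fourier_add_scale) (auto simp: cis_conv_exp S intro!: continuous_intros)
    moreover have "(\<lambda>t. 0 - (\<Sum>m\<in>S. (- fourier f m) * cis (of_int m * t))) = g"
      by (simp add: g_def fun_eq_iff sum_negf)
    moreover have "fourier (\<lambda>t. 0) n = 0" by (simp add: fourier_def)
    moreover have "(\<Sum>m\<in>S. (- fourier f m) * fourier (\<lambda>t. cis (of_int m * t)) n) = - (if n \<in> S then fourier f n else 0)"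
      by (simp add: fourier_cis sum_negf if_distrib[of "\<lambda>x. _ * x"] S cong: if_cong)
    ultimately show ?thesis by simp
  qed
  have gg: "?I (\<lambda>t. g t * cnj (g t)) = (\<Sum>n\<in>S. of_real (2 * pi * (cmod (fourier f n))^2))"
  proof -
    have "(\<lambda>t. g t * cnj (g t)) = (\<lambda>t. \<Sum>n\<in>S. cnj (fourier f n) * (g t * cis (- (of_int n * t))))"
      by (subst (2) g_def) (simp add: fun_eq_iff sum_distrib_left cis_cnj mult_ac)
    then have "?I (\<lambda>t. g t * cnj (g t)) = (\<Sum>n\<in>S. cnj (fourier f n) * ?I (\<lambda>t. g t * cis (- (of_int n * t))))"
      by (simp only: integral_lincomb[OF S cont_fourier_integrand[OF cg]])
    also have "\<dots> = (\<Sum>n\<in>S. cnj (fourier f n) * (of_real (2 * pi) * fourier g n))"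
      by (simp add: fourier_def)
    also have "\<dots> = (\<Sum>n\<in>S. of_real (2 * pi * (cmod (fourier f n))^2))"
      by (intro sum.cong refl) (simp only: fn if_True of_real_mult cz mult_ac)
    finally show ?thesis .
  qed
  let ?s = "\<Sum>n\<in>S. 2 * pi * (cmod (fourier f n))^2"
  have int: "(\<lambda>t. (cmod (f t))^2) integrable_on {0..2*pi}" "(\<lambda>t. (cmod (g t))^2) integrable_on {0..2*pi}"
     "(\<lambda>t. Re (f t * cnj (g t))) integrable_on {0..2*pi}" "(\<lambda>t. f t * cnj (g t)) integrable_on {0..2*pi}"
     "(\<lambda>t. g t * cnj (g t)) integrable_on {0..2*pi}"
    by (intro integrable_continuous_real continuous_intros c cg)+
  have r1: "?I (\<lambda>t. Re (f t * cnj (g t))) = ?s"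
    using integral_linear[OF int(4) bounded_linear_Re] fg by (simp add: comp_def flip: of_real_sum)
  have r2: "?I (\<lambda>t. (cmod (g t))^2) = ?s"
  proof -
    have "(\<lambda>t. (cmod (g t))^2) = (\<lambda>t. Re (g t * cnj (g t)))" by (simp add: fun_eq_iff cz[symmetric] del: of_real_power)
    then show ?thesis
      using integral_linear[OF int(5) bounded_linear_Re] gg by (simp add: comp_def flip: of_real_sum)
  qed
  have "0 \<le> ?I (\<lambda>t. (cmod (f t - g t))^2)" by (rule integral_nonneg) (auto intro!: integrable_continuous_real continuous_intros c cg)
  also have "(\<lambda>t. (cmod (f t - g t))^2) = (\<lambda>t. (cmod (f t))^2 - 2 * Re (f t * cnj (g t)) + (cmod (g t))^2)"
    by (simp only: cmod_diff_square)
  also have "?I \<dots> = ?I (\<lambda>t. (cmod (f t))^2) - 2 * ?I (\<lambda>t. Re (f t * cnj (g t))) + ?I (\<lambda>t. (cmod (g t))^2)"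
  proof -
    have "?I (\<lambda>t. p t - 2 * q t + r t) = ?I p - 2 * ?I q + ?I r"
      if "p integrable_on {0..2*pi}" "q integrable_on {0..2*pi}" "r integrable_on {0..2*pi}" for p q r :: "real \<Rightarrow> real"
      using that by (simp add: Henstock_Kurzweil_Integration.integral_add Henstock_Kurzweil_Integration.integral_diff
        integrable_diff)
    from this[OF int(1,3,2)] show ?thesis .
  qed
  finally show ?thesis unfolding r1 r2 by simp
qed

text \<open>Trigonometric polynomials contain the coordinate functions of the circle and are closed under sums
  and products. This makes the Stone-Weierstrass theorem available for \<open>fourier_unique\<close>.\<close>

lemma real_polynomial_trigonometric:
  assumes "real_polynomial_function (p :: complex \<Rightarrow> real)"
  shows "\<exists>S c. finite S \<and> (\<forall>t. of_real (p (cis t)) = (\<Sum>n\<in>S. c n * cis (of_int n * t)))"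
  using assms
proof induction
  case (linear f)
  have l: "linear f" using linear by (rule bounded_linear.linear)
  have "of_real (f (cis t)) = (\<Sum>n\<in>{1, -1::int}. (if n = 1 then (of_real (f 1) - \<i> * of_real (f \<i>)) / 2
      else (of_real (f 1) + \<i> * of_real (f \<i>)) / 2) * cis (of_int n * t))" for t
  proof -
    have "cis t = cos t *\<^sub>R 1 + sin t *\<^sub>R \<i>" by (simp add: complex_eq_iff)
    then have "f (cis t) = cos t * f 1 + sin t * f \<i>"
      by (simp only: linear_add[OF l] linear_scale[OF l] real_scaleR_def)
    then show ?thesis by (simp add: complex_eq_iff algebra_simps diff_divide_distrib add_divide_distrib)
  qed
  then have "\<forall>t. of_real (f (cis t)) = (\<Sum>n\<in>{1, -1::int}. (if n = 1 then (of_real (f 1) - \<i> * of_real (f \<i>)) / 2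
      else (of_real (f 1) + \<i> * of_real (f \<i>)) / 2) * cis (of_int n * t))" by (rule allI)
  then show ?case by (intro exI conjI; assumption?) simp
next
  case (const c)
  show ?case by (rule exI[of _ "{0}"]) auto
next
  case (add f g)
  obtain S c where S1: "finite S" "\<And>t. of_real (f (cis t)) = (\<Sum>n\<in>S. c n * cis (of_int n * t))"
    using add.IH(1) by (elim exE conjE) (rule that, auto)
  obtain S' c' where S2: "finite S'" "\<And>t. of_real (g (cis t)) = (\<Sum>n\<in>S'. c' n * cis (of_int n * t))"
    using add.IH(2) by (elim exE conjE) (rule that, auto)
  note S = S1 S2
  have e: "(\<Sum>n\<in>A. d n * cis (of_int n * t)) = (\<Sum>n\<in>S \<union> S'. (if n \<in> A then d n else 0) * cis (of_int n * t))"
    if "A \<subseteq> S \<union> S'" for A d t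
    by (rule sum.mono_neutral_cong_left) (use S that in auto)
  show ?case
    by (rule exI[of _ "S \<union> S'"], rule exI[of _ "\<lambda>n. (if n \<in> S then c n else 0) + (if n \<in> S' then c' n else 0)"])
      (use S e[of S c] e[of S' c'] in \<open>simp add: distrib_right sum.distrib\<close>)
next
  case (mult f g)
  obtain S c where S1: "finite S" "\<And>t. of_real (f (cis t)) = (\<Sum>n\<in>S. c n * cis (of_int n * t))"
    using mult.IH(1) by (elim exE conjE) (rule that, auto)
  obtain S' c' where S2: "finite S'" "\<And>t. of_real (g (cis t)) = (\<Sum>n\<in>S'. c' n * cis (of_int n * t))"
    using mult.IH(2) by (elim exE conjE) (rule that, auto)
  note S = S1 S2
  define T where "T = (\<lambda>(m, n). m + n) ` (S \<times> S')"
  have "of_real (f (cis t) * g (cis t)) = (\<Sum>k\<in>T. (\<Sum>z\<in>{z \<in> S \<times> S'. fst z + snd z = k}. c (fst z) * c' (snd z)) * cis (of_int k * t))" for t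
  proof -
    have "of_real (f (cis t) * g (cis t)) = (\<Sum>z\<in>S \<times> S'. c (fst z) * c' (snd z) * cis (of_int (fst z + snd z) * t))"
    proof -
      have "of_real (f (cis t) * g (cis t)) = (\<Sum>z\<in>S \<times> S'. (c (fst z) * cis (of_int (fst z) * t)) * (c' (snd z) * cis (of_int (snd z) * t)))"
        by (simp only: of_real_mult S sum_product sum.cartesian_product case_prod_unfold)
      then show ?thesis by (simp add: cis_mult[symmetric] ring_distribs mult_ac)
    qed
    also have "\<dots> = (\<Sum>k\<in>T. \<Sum>z\<in>{z \<in> S \<times> S'. fst z + snd z = k}. c (fst z) * c' (snd z) * cis (of_int (fst z + snd z) * t))"
      by (rule sum.group[symmetric]) (use S in \<open>auto simp: T_def\<close>)
    also have "\<dots> = (\<Sum>k\<in>T. (\<Sum>z\<in>{z \<in> S \<times> S'. fst z + snd z = k}. c (fst z) * c' (snd z)) * cis (of_int k * t))"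
      unfolding sum_distrib_right by (intro sum.cong refl) auto
    finally show ?thesis .
  qed
  moreover have "finite T" using S by (simp add: T_def)
  ultimately show ?case by (intro exI conjI allI)
qed

theorem fourier_unique:
  assumes c: "continuous_on (sphere 0 1) (F :: complex \<Rightarrow> real)" and z: "\<And>n. fourier (\<lambda>t. of_real (F (cis t))) n = 0"
  shows "F (cis t) = 0"
proof -
  let ?f = "\<lambda>t. F (cis t)"
  have cf: "continuous_on A ?f" for A
    by (rule continuous_on_compose2[OF c]) (auto simp: cis_conv_exp intro!: continuous_intros)
  have z0: "integral {0..2 * pi} (\<lambda>t. of_real (?f t) * cis (of_int n * t)) = 0" for n
    using z[of "- n"] by (simp add: fourier_def)
  obtain B where B: "\<And>w. w \<in> sphere 0 1 \<Longrightarrow> \<bar>F w\<bar> \<le> B"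
  proof -
    have "bounded (F ` sphere 0 1)" by (rule compact_imp_bounded[OF compact_continuous_image[OF c compact_sphere]])
    then obtain B where "\<forall>y\<in>F ` sphere 0 1. norm y \<le> B" unfolding bounded_iff by (elim exE)
    then show ?thesis by (intro that[of B]) auto
  qed
  have B0: "0 \<le> B" using B[of 1] by auto
  have "integral {0..2 * pi} (\<lambda>t. ?f t ^ 2) \<le> 2 * pi * B * e" if e: "0 < e" for e
  proof -
    obtain p where p: "real_polynomial_function p" "\<And>w. w \<in> sphere 0 1 \<Longrightarrow> \<bar>F w - p w\<bar> < e"
      using Stone_Weierstrass_real_polynomial_function[OF compact_sphere c e] by blast
    obtain S d where S: "finite S" "\<And>t. of_real (p (cis t)) = (\<Sum>n\<in>S. d n * cis (of_int n * t))"
      using real_polynomial_trigonometric[OF p(1)] by (elim exE conjE) (rule that, auto)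
    have cp: "continuous_on A (\<lambda>t. p (cis t))" for A
      by (rule continuous_on_compose2[of UNIV p])
        (auto simp: cis_conv_exp intro!: continuous_intros continuous_at_imp_continuous_on continuous_real_polymonial_function p)
    have ci: "continuous_on A (\<lambda>t. of_real (?f t) * cis (of_int n * t))" for A n
      unfolding cis_conv_exp[of "of_int n * _"] by (intro continuous_intros cf)
    have "of_real (integral {0..2*pi} (\<lambda>t. ?f t * p (cis t))) = integral {0..2*pi} (\<lambda>t. of_real (?f t * p (cis t)) :: complex)"
      by (rule integral_linear[OF integrable_continuous_real[OF continuous_on_mult[OF cf cp]] bounded_linear_of_real,
          unfolded comp_def, symmetric])
    also have "(\<lambda>t. of_real (?f t * p (cis t)) :: complex) = (\<lambda>t. \<Sum>n\<in>S. d n * (of_real (?f t) * cis (of_int n * t)))"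
      by (simp add: fun_eq_iff S sum_distrib_left mult_ac)
    also have "integral {0..2*pi} \<dots> = 0"
      unfolding integral_lincomb[OF S(1) ci] z0 by simp
    finally have fp: "integral {0..2*pi} (\<lambda>t. ?f t * p (cis t)) = 0" by simp
    have "integral {0..2*pi} (\<lambda>t. ?f t ^ 2) = integral {0..2*pi} (\<lambda>t. ?f t * (?f t - p (cis t)) + ?f t * p (cis t))"
      by (simp add: power2_eq_square algebra_simps)
    also have "\<dots> = integral {0..2*pi} (\<lambda>t. ?f t * (?f t - p (cis t)))"
      by (subst Henstock_Kurzweil_Integration.integral_add)
        (auto intro!: integrable_continuous_real continuous_intros cf cp simp: fp)
    also have "\<dots> \<le> integral {0..2*pi} (\<lambda>t. B * e)"
    proof (rule integral_le)
      fix t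
      have "?f t * (?f t - p (cis t)) \<le> \<bar>?f t\<bar> * \<bar>?f t - p (cis t)\<bar>" by (simp flip: abs_mult)
      also have "\<dots> \<le> B * e" using B[of "cis t"] p(2)[of "cis t"] B0 by (intro mult_mono) auto
      finally show "?f t * (?f t - p (cis t)) \<le> B * e" .
    qed (auto intro!: integrable_continuous_real continuous_intros cf cp)
    finally show ?thesis by (simp add: mult_ac)
  qed
  then have "integral {0..2 * pi} (\<lambda>t. ?f t ^ 2) \<le> 0 + e" if "0 < e" for e
  proof -
    have "2 * pi * B * (e / (2 * pi * B + 1)) \<le> e" 
    proof -
      have p: "0 < 2 * pi * B + 1" using B0 by (simp add: add_nonneg_pos)
      have "2 * pi * B * (e / (2 * pi * B + 1)) = e * (2 * pi * B / (2 * pi * B + 1))" by simp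
      also have "\<dots> \<le> e * 1" using p that by (intro mult_left_mono) (simp_all add: divide_le_eq_1_pos)
      finally show ?thesis by simp
    qed
    then show ?thesis using \<open>\<And>e. 0 < e \<Longrightarrow> integral {0..2 * pi} (\<lambda>t. ?f t ^ 2) \<le> 2 * pi * B * e\<close>[of "e / (2 * pi * B + 1)"] that B0
      by (simp add: add_nonneg_pos)
  qed
  then have "integral {0..2 * pi} (\<lambda>t. ?f t ^ 2) \<le> 0" by (rule field_le_epsilon)
  moreover have "0 \<le> integral {0..2 * pi} (\<lambda>t. ?f t ^ 2)"
    by (rule integral_nonneg) (auto intro!: integrable_continuous_real continuous_intros cf)
  ultimately have i0: "integral (cbox 0 (2 * pi)) (\<lambda>t. ?f t ^ 2) = 0" by simp
  have zero: "?f t = 0" if "t \<in> {0..2*pi}" for t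
  proof -
    have "((\<lambda>t. ?f t ^ 2) has_integral 0) (cbox 0 (2*pi))"
      using i0 integrable_integral[OF integrable_continuous[of 0 "2*pi" "\<lambda>t. ?f t ^ 2", OF continuous_on_power[OF cf]]] by simp
    then have "?f t ^ 2 = 0"
      by (rule has_integral_0_cbox_imp_0[rotated 2]) (use that pi_gt_zero in \<open>auto intro!: continuous_intros cf simp: not_le simp del: pi_gt_zero\<close>)
    then show ?thesis by simp
  qed
  have "\<exists>s\<in>{0..2*pi}. cis s = cis t"
  proof -
    have "cis (Arg2pi (cis t)) = cis t" using Arg2pi_eq[of "cis t"] by (simp add: cis_conv_exp)
    moreover have "Arg2pi (cis t) \<in> {0..2*pi}" using Arg2pi[of "cis t"] by auto
    ultimately show ?thesis by blast
  qed
  then show ?thesis using zero by metis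
qed


text \<open>A continuous surjection from a compact space is a quotient map.\<close>

lemma continuous_on_quotient:
  fixes q :: "'a::metric_space \<Rightarrow> 'b::metric_space" and F :: "'b \<Rightarrow> 'c::metric_space"
  assumes "compact K" "continuous_on K q" "continuous_on K (\<lambda>x. F (q x))"
  shows "continuous_on (q ` K) F"
proof (subst continuous_on_closed_vimage, goal_cases)
  case 1
  show ?case using assms compact_continuous_image compact_imp_closed by blast
next
  case 2
  show ?case
  proof (intro allI impI)
    fix C :: "'c set" assume C: "closed C"
    have "compact (K \<inter> (\<lambda>x. F (q x)) -` C)"
    proof -
      have "closed (K \<inter> (\<lambda>x. F (q x)) -` C)"
        by (rule continuous_closed_preimage[OF assms(3) compact_imp_closed[OF assms(1)] C])
      then have "compact (K \<inter> (K \<inter> (\<lambda>x. F (q x)) -` C))" by (rule compact_Int_closed[OF assms(1)])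
      then show ?thesis by (simp add: Int_absorb1)
    qed
    then have "compact (q ` (K \<inter> (\<lambda>x. F (q x)) -` C))"
      by (rule compact_continuous_image[rotated]) (auto intro: continuous_on_subset[OF assms(2)])
    moreover have "F -` C \<inter> q ` K = q ` (K \<inter> (\<lambda>x. F (q x)) -` C)" by auto
    ultimately show "closed (F -` C \<inter> q ` K)" using compact_imp_closed by simp
  qed
qed

lemma fourier_Re:
  assumes c: "continuous_on {0..2 * pi} f" and z: "\<And>n. fourier f n = 0"
  shows "fourier (\<lambda>t. of_real (Re (f t))) n = 0"
proof -
  let ?i = "\<lambda>n t. f t * cis (- (of_int n * t))"
  have z0: "integral {0..2 * pi} (?i n) = 0" for n using z[of n] by (simp add: fourier_def)
  have i: "?i n integrable_on {0..2 * pi}" for n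
    by (intro integrable_continuous_real cont_fourier_integrand c)
  have i': "(\<lambda>t. cnj (?i n t)) integrable_on {0..2 * pi}" for n
    using integrable_linear[OF i bounded_linear_cnj] by (simp add: comp_def)
  have "(\<lambda>t. of_real (Re (f t)) * cis (- (of_int n * t))) = (\<lambda>t. (?i n t + cnj (?i (- n) t)) / 2)"
    by (simp add: fun_eq_iff complex_eq_iff algebra_simps add_divide_distrib diff_divide_distrib)
  moreover have "integral {0..2 * pi} (\<lambda>t. ?i n t + cnj (?i (- n) t)) =
      integral {0..2 * pi} (?i n) + integral {0..2 * pi} (\<lambda>t. cnj (?i (- n) t))"
    by (rule Henstock_Kurzweil_Integration.integral_add[OF i i'])
  moreover have "integral {0..2 * pi} (\<lambda>t. cnj (?i (- n) t)) = cnj (integral {0..2 * pi} (?i (- n)))"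
    by (rule Henstock_Kurzweil_Integration.integral_cnj[symmetric])
  ultimately show ?thesis unfolding fourier_def by (simp only: z0 integral_divide complex_cnj_zero add_0 div_0)
qed

theorem fourier_unique_periodic:
  fixes f :: "real \<Rightarrow> complex"
  assumes c: "continuous_on UNIV f" and p: "\<And>t. f (t + 2 * pi) = f t" and z: "\<And>n. fourier f n = 0"
  shows "f 0 = 0"
proof -
  have sph: "sphere 0 1 = cis ` {0..2 * pi}"
  proof
    show "sphere 0 1 \<subseteq> cis ` {0..2 * pi}"
    proof
      fix w :: complex assume w: "w \<in> sphere 0 1"
      have "cis (Arg2pi w) = w" using Arg2pi_eq[of w] w by (simp add: cis_conv_exp)
      moreover have "Arg2pi w \<in> {0..2*pi}" using Arg2pi[of w] by auto
      ultimately show "w \<in> cis ` {0..2 * pi}" by (metis imageI)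
    qed
  qed auto
  have cc: "continuous_on A cis" for A unfolding cis_conv_exp by (intro continuous_intros)
  have key: "Re (h 0) = 0" if ch: "continuous_on UNIV h" and ph: "\<And>t. h (t + 2 * pi) = h t"
    and zh: "\<And>n. fourier h n = 0" for h :: "real \<Rightarrow> complex"
  proof -
    define F where "F w = Re (h (Arg2pi w))" for w
    have F: "F (cis t) = Re (h t)" if "t \<in> {0..2 * pi}" for t
    proof (cases "t = 2 * pi")
      case True
      then show ?thesis using ph[of 0] Arg2pi_unique[of 1 0 1] by (simp add: F_def)
    next
      case False
      then have "Arg2pi (cis t) = t" using that by (intro Arg2pi_unique[of 1]) (auto simp: cis_conv_exp)
      then show ?thesis by (simp add: F_def)
    qed
    have "continuous_on (sphere 0 1) F"
      unfolding sph
    proof (rule continuous_on_quotient[OF compact_Icc cc])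
      have "continuous_on {0..2 * pi} (\<lambda>t. Re (h t))"
        by (intro continuous_intros continuous_on_subset[OF ch]) auto
      then show "continuous_on {0..2 * pi} (\<lambda>t. F (cis t))" by (rule continuous_on_eq) (simp add: F)
    qed
    moreover have "fourier (\<lambda>t. of_real (F (cis t))) n = 0" for n
    proof -
      have "fourier (\<lambda>t. of_real (F (cis t))) n = fourier (\<lambda>t. of_real (Re (h t))) n"
        unfolding fourier_def by (intro arg_cong[of _ _ "\<lambda>x. x / _"] Henstock_Kurzweil_Integration.integral_cong) (simp add: F)
      then show ?thesis using fourier_Re[OF continuous_on_subset[OF ch subset_UNIV] zh] by simp
    qed
    ultimately have "F (cis 0) = 0" by (rule fourier_unique)
    then show ?thesis using F[of 0] by simp
  qed
  have "Re (f 0) = 0" by (rule key[OF c p z])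
  moreover have "Re (- \<i> * f 0) = 0"
  proof (rule key)
    show "continuous_on UNIV (\<lambda>t. - \<i> * f t)" by (intro continuous_intros c)
    show "fourier (\<lambda>t. - \<i> * f t) n = 0" for n using z[of n] by (simp add: fourier_def mult.assoc)
  qed (simp add: p)
  ultimately show ?thesis by (simp add: complex_eq_iff)
qed


section \<open>The amplitude of a mode: oscillating region\<close>

lemma le_plus_integral:
  fixes f f' k :: "real \<Rightarrow> real"
  assumes "p \<le> q" and "\<And>t. t \<in> {p..q} \<Longrightarrow> (f has_real_derivative f' t) (at t)"
    and "\<And>t. t \<in> {p..q} \<Longrightarrow> - k t \<le> f' t" and "continuous_on {p..q} k"
  shows "f p \<le> f q + integral {p..q} k"
proof -
  have "(f' has_integral (f q - f p)) {p..q}"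
    using assms(1,2) by (intro fundamental_theorem_of_calculus)
      (auto simp: has_real_derivative_iff_has_vector_derivative[symmetric] intro: has_field_derivative_at_within)
  moreover have "((\<lambda>t. - k t) has_integral - integral {p..q} k) {p..q}"
    by (intro has_integral_neg integrable_integral integrable_continuous_real assms)
  ultimately have "- integral {p..q} k \<le> f q - f p" using assms(3) has_integral_le by blast
  then show ?thesis by simp
qed

text \<open>\<open>F\<close> is the value at \<open>t\<close> of \<open>a f'\<close>, the derivative of \<open>f\<close> with respect to the variable in which the mode equation
  has no first-order term.\<close>

definition DD :: "(real \<Rightarrow> real) \<Rightarrow> real \<Rightarrow> (real \<Rightarrow> real) \<Rightarrow> real \<Rightarrow> bool" where
  "DD a t f F \<longleftrightarrow> (f has_real_derivative F / a t) (at t)"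

lemma DD_cong: "DD a t f F \<Longrightarrow> F = F' \<Longrightarrow> DD a t f F'" by simp

lemma DD_const: "DD a t (\<lambda>_. c) 0" by (simp add: DD_def)

lemma DD_add: "DD a t f F \<Longrightarrow> DD a t g G \<Longrightarrow> DD a t (\<lambda>s. f s + g s) (F + G)"
  unfolding DD_def add_divide_distrib by (rule DERIV_add)

lemma DD_diff: "DD a t f F \<Longrightarrow> DD a t g G \<Longrightarrow> DD a t (\<lambda>s. f s - g s) (F - G)"
  unfolding DD_def diff_divide_distrib by (rule DERIV_diff)

lemma DD_mult: "DD a t f F \<Longrightarrow> DD a t g G \<Longrightarrow> DD a t (\<lambda>s. f s * g s) (F * g t + f t * G)"
  unfolding DD_def using DERIV_mult[of f "F / a t" t UNIV g "G / a t"] by (simp add: add_divide_distrib mult.commute)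

lemma DD_cmult: "DD a t f F \<Longrightarrow> DD a t (\<lambda>s. c * f s) (c * F)"
  unfolding DD_def using DERIV_cmult[of f "F / a t" t UNIV c] by simp

lemma DD_power: "DD a t f F \<Longrightarrow> DD a t (\<lambda>s. f s ^ k) (real k * f t ^ (k - 1) * F)"
  unfolding DD_def using DERIV_power[of f "F / a t" t UNIV k] by (simp add: mult_ac)

lemma DD_inverse_sqrt:
  assumes "DD a t x b" "0 < x t + h"
  shows "DD a t (\<lambda>s. 1 / sqrt (x s + h)) (- (1/2) * b * (1 / sqrt (x t + h)) ^ 3)"
proof -
  have 1: "((\<lambda>s. x s + h) has_real_derivative b / a t) (at t)"
    using assms(1) unfolding DD_def by (auto intro!: derivative_eq_intros)
  have "((\<lambda>y. 1 / sqrt y) has_real_derivative - (1/2) * (1 / sqrt (x t + h)) ^ 3) (at (x t + h))"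
    using assms(2) by (auto intro!: derivative_eq_intros simp: field_simps power3_eq_cube)
  from DERIV_chain2[OF this 1] show ?thesis unfolding DD_def by (simp add: mult_ac)
qed

text \<open>The derivative of the quadratic form in \<open>(u, U)\<close> with multiplier \<open>\<phi>\<close>. The first line of the form is the
  classical one that satisfies a closed equation: up to the source \<open>G\<close>, its derivative is a multiple of \<open>u\<^sup>2\<close>, with a
  coefficient that vanishes when \<open>\<phi>\<close> is a product of two solutions. The second line adds \<open>\<phi>\<^sup>2 U\<^sup>2\<close>, which absorbs
  the terms that are linear in \<open>U\<close>.\<close>

lemma DD_multiplier:
  assumes "DD a t \<phi> (\<phi>1 t)" "DD a t \<phi>1 (\<phi>2 t)" "DD a t \<phi>2 \<phi>3" "DD a t P P1"
    and "DD a t u (U t)" "DD a t U (G - P t * u t)"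
  shows "DD a t (\<lambda>s. \<phi> s * (U s ^ 2 + P s * u s ^ 2) - \<phi>1 s * (u s * U s) + (1/2) * (\<phi>2 s * u s ^ 2)
      + (\<phi> s ^ 2 * (u s * U s) - \<phi> s * \<phi>1 s * u s ^ 2))
    ((\<phi> t * P1 + 2 * \<phi>1 t * P t + \<phi>3 / 2) * u t ^ 2 + 2 * \<phi> t * U t * G - \<phi>1 t * u t * G
      + \<phi> t ^ 2 * U t ^ 2 + \<phi> t ^ 2 * u t * G - \<phi> t ^ 2 * P t * u t ^ 2 - (\<phi>1 t ^ 2 + \<phi> t * \<phi>2 t) * u t ^ 2)"
proof -
  show ?thesis
    by (rule DD_cong, (rule DD_add DD_diff DD_cmult DD_mult DD_power assms)+)
      (simp add: power2_eq_square algebra_simps)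
qed

lemma multiplier_lower:
  fixes \<phi> \<phi>1 \<phi>2 \<phi>3 P P1 u U G C l :: real
  assumes "- (C * l^2) \<le> \<phi> * P1 + 2 * \<phi>1 * P + \<phi>3 / 2" "\<phi>1^2 \<le> C * l^2" "\<phi>^4 \<le> C * l^2"
    "\<phi>^2 * P \<le> C * l^2" "\<bar>\<phi> * \<phi>2\<bar> \<le> C * l^2" 
  shows "- (6 * C * l^2 * u^2 + 2 * G^2) \<le> (\<phi> * P1 + 2 * \<phi>1 * P + \<phi>3 / 2) * u ^ 2 + 2 * \<phi> * U * G - \<phi>1 * u * G
      + \<phi> ^ 2 * U ^ 2 + \<phi> ^ 2 * u * G - \<phi> ^ 2 * P * u ^ 2 - (\<phi>1 ^ 2 + \<phi> * \<phi>2) * u ^ 2"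
proof -
  let ?u = "u ^ 2"
  have u: "0 \<le> ?u" by simp
  have 1: "- (C * l^2 * ?u) \<le> (\<phi> * P1 + 2 * \<phi>1 * P + \<phi>3 / 2) * ?u"
    using mult_right_mono[OF assms(1) u] by simp
  have 2: "\<phi>1^2 * ?u \<le> C * l^2 * ?u" by (rule mult_right_mono[OF assms(2) u])
  have 3: "\<phi>^4 * ?u \<le> C * l^2 * ?u" by (rule mult_right_mono[OF assms(3) u])
  have 4: "\<phi>^2 * P * ?u \<le> C * l^2 * ?u" by (rule mult_right_mono[OF assms(4) u])
  have "\<phi> * \<phi>2 \<le> C * l^2" using assms(5) by linarith
  then have 5: "\<phi> * \<phi>2 * ?u \<le> C * l^2 * ?u" by (rule mult_right_mono[OF _ u])
  have 6: "- (G^2) \<le> 2 * \<phi> * U * G + \<phi>^2 * U^2" 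
    using zero_le_power2[of "\<phi> * U + G"] by (simp add: power2_eq_square algebra_simps)
  have 7: "- (\<phi>1^2 * ?u + G^2) / 2 \<le> - (\<phi>1 * u * G)"
    using zero_le_power2[of "\<phi>1 * u - G"] by (simp add: power2_eq_square algebra_simps)
  have 8: "- (\<phi>^4 * ?u + G^2) / 2 \<le> \<phi>^2 * u * G"
    using zero_le_power2[of "\<phi>^2 * u + G"] by (simp add: power2_eq_square power4_eq_xxxx algebra_simps)
  have e: "(\<phi>1 ^ 2 + \<phi> * \<phi>2) * ?u = \<phi>1^2 * ?u + \<phi> * \<phi>2 * ?u" by (simp add: algebra_simps)
  have 9: "0 \<le> \<phi>1^2 * ?u" by simp
  have f: "6 * C * l^2 * ?u = 6 * (C * l^2 * ?u)" by simp
  have aux: "- (6 * K + 2 * g) \<le> A + B - D + B2 + E - pP - (p1 + pp)"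
    if h: "- K \<le> A" "p1 \<le> K" "p4 \<le> K" "pP \<le> K" "pp \<le> K" "- g \<le> B + B2" "- (p1 + g) / 2 \<le> - D"
      "- (p4 + g) / 2 \<le> E" "0 \<le> p1" for K g A B D B2 E pP p1 pp p4 :: real
  proof -
    have "D \<le> (p1 + g) / 2" using h by simp
    then have 1: "- D \<ge> - (K/2) - g / 2" using h(2) by argo
    have 2: "E \<ge> - (K/2) - g/2" using h(8,3) by argo
    show ?thesis using 1 2 h(1,2,4,5,6,9) by linarith
  qed
  show ?thesis unfolding e f by (rule aux[OF 1 2 3 4 5 6 7 8 9])
qed

lemma power_le_1_plus:
  fixes r :: real assumes "0 \<le> r" "k \<le> n" shows "r ^ k \<le> 1 + r ^ n"
proof (cases "r \<le> 1")
  case True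
  then have "r ^ k \<le> 1" using assms by (simp add: power_le_one)
  then show ?thesis using assms by (simp add: add_increasing2)
next
  case False
  then have "r ^ k \<le> r ^ n" using assms by (intro power_increasing) auto
  then show ?thesis by simp
qed

text \<open>The multiplier \<open>\<phi> = z\<^sup>4 r\<close> as a function of \<open>x\<close>, and its first three derivatives in \<open>x\<close>. The factor
  \<open>r = (x + h)\<^sup>-\<^sup>1\<^sup>/\<^sup>2\<close> is the squared WKB amplitude, regularised at the caustic at the Airy scale \<open>h\<close>, and
  \<open>z = q (x e - x)\<close> is a cutoff which is 1 at \<open>s\<close> and vanishes at \<open>e\<close>.\<close>

definition mf0 :: "real \<Rightarrow> real \<Rightarrow> real \<Rightarrow> real" where "mf0 q z r = z^4 * r"
definition mf1 :: "real \<Rightarrow> real \<Rightarrow> real \<Rightarrow> real" where "mf1 q z r = - 4 * q * z^3 * r - (1/2) * z^4 * r^3"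
definition mf2 :: "real \<Rightarrow> real \<Rightarrow> real \<Rightarrow> real" where "mf2 q z r = 12 * q^2 * z^2 * r + 4 * q * z^3 * r^3 + (3/4) * z^4 * r^5"
definition mf3 :: "real \<Rightarrow> real \<Rightarrow> real \<Rightarrow> real" where
  "mf3 q z r = - 24 * q^3 * z * r - 18 * q^2 * z^2 * r^3 - 9 * q * z^3 * r^5 - (15/8) * z^4 * r^7"

lemma mf_bounds:
  fixes q z r T S :: real
  assumes z: "0 \<le> z" "z \<le> 1" and r: "0 \<le> r" and q: "0 \<le> q" "q \<le> T" and T: "1 \<le> T"
    and S: "\<And>k. k \<le> 6 \<Longrightarrow> r ^ k \<le> S"
  shows "\<bar>mf1 q z r\<bar> \<le> 5 * T * S" "\<bar>mf2 q z r\<bar> \<le> 17 * T^2 * S"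
    "\<bar>mf3 q z r + (15/8) * z^4 * r^7\<bar> \<le> 51 * T^3 * S"
    "(mf1 q z r)^2 \<le> 25 * T^2 * S" "\<bar>mf0 q z r * mf2 q z r\<bar> \<le> 17 * T^2 * S" "mf0 q z r ^ 4 \<le> S"
proof -
  have S0: "0 \<le> S" using S[of 0] by simp
  have t: "0 \<le> q^i * z^j * r^k \<and> q^i * z^j * r^k \<le> T^i * S" if "k \<le> 6" for i j k
  proof -
    have "q^i \<le> T^i" using q by (intro power_mono) auto
    moreover have "z^j \<le> 1" using z by (simp add: power_le_one)
    ultimately have "q^i * z^j \<le> T^i * 1" using q z by (intro mult_mono) (auto intro: order_trans[OF _ q(2)])
    then have "q^i * z^j * r^k \<le> T^i * S" using S[OF that] q z r T by (intro mult_mono) auto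
    then show ?thesis using q z r by simp
  qed
  have TT: "T^i * S \<le> T^j * S" if "i \<le> j" for i j using T S0 that by (intro mult_right_mono power_increasing)
  show "\<bar>mf1 q z r\<bar> \<le> 5 * T * S"
    using t[of 1 1 3] t[of 3 0 4] TT[of 0 1] by (simp add: mf1_def mult.assoc)
  show "\<bar>mf2 q z r\<bar> \<le> 17 * T^2 * S"
    using t[of 1 2 2] t[of 3 1 3] t[of 5 0 4] TT[of 0 2] TT[of 1 2] by (simp add: mf2_def mult.assoc)
  show "\<bar>mf3 q z r + (15/8) * z^4 * r^7\<bar> \<le> 51 * T^3 * S"
    using t[of 1 3 1] t[of 3 2 2] t[of 5 1 3] TT[of 2 3] TT[of 1 3] by (simp add: mf3_def mult.assoc)
  have "(mf1 q z r)^2 = 16 * (q^2 * z^6 * r^2) + 4 * (q^1 * z^7 * r^4) + (1/4) * (q^0 * z^8 * r^6)"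
    by (simp add: mf1_def power2_eq_square algebra_simps power_add[symmetric])
      (simp add: numeral_eq_Suc algebra_simps)
  then show "(mf1 q z r)^2 \<le> 25 * T^2 * S"
    using t[of 2 2 6] t[of 4 1 7] t[of 6 0 8] TT[of 0 2] TT[of 1 2] by simp
  have "mf0 q z r * mf2 q z r = 12 * (q^2 * z^6 * r^2) + 4 * (q^1 * z^7 * r^4) + (3/4) * (q^0 * z^8 * r^6)"
    by (simp add: mf0_def mf2_def algebra_simps) (simp add: numeral_eq_Suc algebra_simps)
  then show "\<bar>mf0 q z r * mf2 q z r\<bar> \<le> 17 * T^2 * S"
    using t[of 2 2 6] t[of 4 1 7] t[of 6 0 8] TT[of 0 2] TT[of 1 2] by simp
  have "mf0 q z r ^ 4 = q^0 * z^16 * r^4" by (simp add: mf0_def power_mult_distrib power_mult[symmetric])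
  then show "mf0 q z r ^ 4 \<le> S" using t[of 4 0 16] by simp
qed

text \<open>The functional \<open>N\<close> of \<open>DD_multiplier\<close> with the multiplier \<open>z\<^sup>4 r\<close> vanishes at the right end, where \<open>z = 0\<close>. Its
  derivative is bounded below by \<open>- C (l\<^sup>2 u\<^sup>2 + G\<^sup>2)\<close>, and at \<open>s\<close> it dominates \<open>l\<^sup>2 u\<^sup>2 / r\<close>. Integration gives
  the bound \<open>u\<^sup>2 \<le> C r\<close> times the mass. The term with \<open>r\<^sup>7\<close> in the third derivative is the only dangerous one
  near the caustic, and it has the favourable sign.\<close>

theorem oscillating_amplitude:
  fixes a x b b1 b2 u U G :: "real \<Rightarrow> real" and l h m T X s e b0 :: real
  assumes se: "s < e" and a: "\<And>t. t \<in> {s..e} \<Longrightarrow> 0 < a t"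
    and dx: "\<And>t. t \<in> {s..e} \<Longrightarrow> DD a t x (b t)" and db: "\<And>t. t \<in> {s..e} \<Longrightarrow> DD a t b (b1 t)"
    and db1: "\<And>t. t \<in> {s..e} \<Longrightarrow> DD a t b1 (b2 t)"
    and du: "\<And>t. t \<in> {s..e} \<Longrightarrow> DD a t u (U t)" and dU: "\<And>t. t \<in> {s..e} \<Longrightarrow> DD a t U (G t - l^2 * x t * u t)"
    and cont: "continuous_on {s..e} G" "continuous_on {s..e} a"
    and b: "\<And>t. t \<in> {s..e} \<Longrightarrow> b0 \<le> b t" "0 < b0" "\<And>t. t \<in> {s..e} \<Longrightarrow> \<bar>b t\<bar> \<le> T"
      "\<And>t. t \<in> {s..e} \<Longrightarrow> \<bar>b1 t\<bar> \<le> T" "\<And>t. t \<in> {s..e} \<Longrightarrow> \<bar>b2 t\<bar> \<le> T"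
    and x: "\<And>t. t \<in> {s..e} \<Longrightarrow> 0 \<le> x t" "\<And>t. t \<in> {s..e} \<Longrightarrow> x s \<le> x t \<and> x t \<le> x e" "x e \<le> X"
    and \<Delta>: "x s < x e" "1 / (x e - x s) \<le> T" and T: "1 \<le> T"
    and h: "0 < h" "h \<le> 1" "l^2 * h^3 = m" and m: "T^2 \<le> m"
    and large: "8 * T^2 * h \<le> min (1/2) (5/16 * b0^2 / (8 * m)) * m"
  shows "u s ^ 2 * (min (1/2) (5/16 * b0^2 / (8 * m)) / 2 * l^2) \<le>
    (1 / sqrt (x s + h)) * integral {s..e} (\<lambda>t. (6 * (1000 * T^6 * (1 + X)) * l^2 * u t ^ 2 + 2 * G t ^ 2) / a t)"
proof -
  define q where "q = 1 / (x e - x s)"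
  have q: "0 \<le> q" "q \<le> T" using \<Delta> by (auto simp: q_def)
  define z where "z t = q * (x e - x t)" for t
  define r where "r t = 1 / sqrt (x t + h)" for t
  define f0 where "f0 t = mf0 q (z t) (r t)" for t
  define f1 where "f1 t = mf1 q (z t) (r t)" for t
  define f2 where "f2 t = mf2 q (z t) (r t)" for t
  define \<phi>1 where "\<phi>1 t = f1 t * b t" for t
  define \<phi>2 where "\<phi>2 t = f2 t * b t ^ 2 + f1 t * b1 t" for t
  define \<phi>3 where "\<phi>3 t = mf3 q (z t) (r t) * b t ^ 3 + 3 * f2 t * b t * b1 t + f1 t * b2 t" for t
  define N where "N t = f0 t * (U t ^ 2 + l^2 * x t * u t ^ 2) - \<phi>1 t * (u t * U t) + (1/2) * (\<phi>2 t * u t ^ 2)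
      + (f0 t ^ 2 * (u t * U t) - f0 t * \<phi>1 t * u t ^ 2)" for t
  \<comment> \<open>A common bound for the coefficients in \<open>multiplier_lower\<close>, from the constants in \<open>mf_bounds\<close>.\<close>
  define C where "C = 1000 * T^6 * (1 + X)"
  have X0: "0 \<le> X" using x(1)[of e] x(3) se by auto
  have l2: "m \<le> l^2" 
  proof -
    have "h^3 \<le> 1" using h by (simp add: power_le_one)
    then have "l^2 * h^3 \<le> l^2 * 1" by (intro mult_left_mono) auto
    then show ?thesis using h by simp
  qed
  have m1: "1 \<le> m" using m T by (meson one_le_power order_trans)
  have l1: "1 \<le> l^2" using l2 m1 by simp
  \<comment> \<open>\<open>h = (m / l\<^sup>2)\<^sup>1\<^sup>/\<^sup>3\<close> gives \<open>r\<^sup>6 \<le> h\<^sup>-\<^sup>3 = l\<^sup>2 / m\<close>, so that up to the sixth power \<open>r\<close> is harmless.\<close>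
  have R: "0 < r t" "r t ^ 2 * (x t + h) = 1" "r t ^ 6 \<le> l^2" "0 \<le> z t" "z t \<le> 1" 
      "(15/16) * T^2 * r t ^ 4 \<le> l^2 * h" "x t * r t \<le> 1 + X" "x t * r t ^ 2 \<le> 1"
      if t: "t \<in> {s..e}" for t
  proof -
    have y: "0 < x t + h" using x(1)[OF t] h by simp
    then show "0 < r t" by (simp add: r_def)
    have ry: "r t ^ 2 = 1 / (x t + h)" using y by (simp add: r_def power_divide)
    then show r2: "r t ^ 2 * (x t + h) = 1" using y by simp
    have rh: "r t ^ 2 \<le> 1 / h" unfolding ry using x(1)[OF t] h y by (intro divide_left_mono) auto
    have "r t ^ 6 = (r t ^ 2) ^ 3" by (simp add: power_mult[symmetric])
    also have "\<dots> \<le> (1 / h) ^ 3" using rh by (intro power_mono) auto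
    also have "\<dots> = l^2 / m" using h m1 by (simp add: power_divide field_simps)
    also have "\<dots> \<le> l^2" using divide_left_mono[of 1 m "l^2"] m1 by simp
    finally show "r t ^ 6 \<le> l^2" .
    show "0 \<le> z t" "z t \<le> 1" using x(2)[OF t] \<Delta> by (auto simp: z_def q_def field_simps)
    have "r t ^ 4 = (r t ^ 2) ^ 2" by (simp add: power_mult[symmetric])
    also have "\<dots> \<le> (1 / h) ^ 2" using rh by (intro power_mono) auto
    finally have r4: "r t ^ 4 \<le> (1 / h) ^ 2" .
    have "(15/16) * T^2 * r t ^ 4 \<le> m * (1 / h) ^ 2"
      using m r4 m1 by (intro mult_mono) auto
    also have "\<dots> = l^2 * h" using h by (simp add: power2_eq_square power3_eq_cube field_simps)
    finally show "(15/16) * T^2 * r t ^ 4 \<le> l^2 * h" .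
    show xr2: "x t * r t ^ 2 \<le> 1" unfolding ry using x(1)[OF t] y h by (simp add: field_simps)
    have "x t \<le> X" using x(2)[OF t] x(3) by simp
    then have "x t * (x t * r t ^ 2) \<le> X * 1"
      using xr2 x(1)[OF t] X0 by (intro mult_mono) auto
    then have "(x t * r t)^2 \<le> X * 1" by (simp add: power2_eq_square mult_ac)
    also have "\<dots> \<le> (1 + X)^2" using X0 by (simp add: power2_eq_square algebra_simps)
    finally show "x t * r t \<le> 1 + X" using X0 by (intro power2_le_imp_le[of "x t * r t"]) auto
  qed
  have S: "r t ^ k \<le> 2 * l^2" if "t \<in> {s..e}" "k \<le> 6" for t k
    using power_le_1_plus[of "r t" k 6] R(1,3)[OF that(1)] that(2) l1 by simp
  have mb: "\<bar>f1 t\<bar> \<le> 5 * T * (2 * l^2)" "\<bar>f2 t\<bar> \<le> 17 * T^2 * (2 * l^2)"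
    "\<bar>mf3 q (z t) (r t) + (15/8) * z t^4 * r t^7\<bar> \<le> 51 * T^3 * (2 * l^2)"
    "(f1 t)^2 \<le> 25 * T^2 * (2 * l^2)" "\<bar>f0 t * f2 t\<bar> \<le> 17 * T^2 * (2 * l^2)" "f0 t ^ 4 \<le> 2 * l^2"
    if t: "t \<in> {s..e}" for t
    unfolding f0_def f1_def f2_def
    using mf_bounds[OF R(4,5)[OF t] less_imp_le[OF R(1)[OF t]] q T S[OF t]] by blast+
  have T6: "T^k \<le> T^6" if "k \<le> 6" for k using T that by (intro power_increasing)
  have CX: "K * T^k * l^2 \<le> C * l^2" if "k \<le> 6" "0 \<le> K" "K \<le> 1000" for K k
  proof -
    have "K * T^k \<le> 1000 * T^6" using that T6 T by (intro mult_mono) auto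
    also have "\<dots> \<le> C" unfolding C_def using X0 T by simp
    finally show ?thesis by (intro mult_right_mono) auto
  qed
  have dN: "DD a t N ((f0 t * (l^2 * b t) + 2 * \<phi>1 t * (l^2 * x t) + \<phi>3 t / 2) * u t ^ 2 + 2 * f0 t * U t * G t - \<phi>1 t * u t * G t
      + f0 t ^ 2 * U t ^ 2 + f0 t ^ 2 * u t * G t - f0 t ^ 2 * (l^2 * x t) * u t ^ 2 - (\<phi>1 t ^ 2 + f0 t * \<phi>2 t) * u t ^ 2)"
    if t: "t \<in> {s..e}" for t
  proof -
    have y: "0 < x t + h" using x(1)[OF t] h by simp
    have dr: "DD a t r (- (1/2) * b t * r t ^ 3)" using DD_inverse_sqrt[OF dx[OF t] y] by (simp add: r_def[abs_def])
    have dz: "DD a t z (- q * b t)" unfolding z_def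
      by (rule DD_cong, rule DD_cmult, rule DD_diff, rule DD_const, rule dx[OF t]) simp
    have d0: "DD a t f0 (\<phi>1 t)"
      unfolding f0_def mf0_def \<phi>1_def f1_def mf1_def
      by (rule DD_cong, (rule DD_add DD_diff DD_cmult DD_mult DD_power dr dz)+) (simp add: numeral_eq_Suc algebra_simps)
    have df1: "DD a t f1 (f2 t * b t)"
      unfolding f1_def mf1_def f2_def mf2_def
      by (rule DD_cong, (rule DD_add DD_diff DD_cmult DD_mult DD_power dr dz)+) (simp add: numeral_eq_Suc algebra_simps)
    have df2: "DD a t f2 (mf3 q (z t) (r t) * b t)"
      unfolding f2_def mf2_def mf3_def
      by (rule DD_cong, (rule DD_add DD_diff DD_cmult DD_mult DD_power dr dz)+) (simp add: numeral_eq_Suc algebra_simps)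
    have d1: "DD a t \<phi>1 (\<phi>2 t)"
      unfolding \<phi>1_def \<phi>2_def
      by (rule DD_cong, rule DD_mult[OF df1 db[OF t]]) (simp add: power2_eq_square algebra_simps)
    have d2: "DD a t \<phi>2 (\<phi>3 t)"
      unfolding \<phi>2_def \<phi>3_def
      by (rule DD_cong, (rule DD_add DD_mult df1 df2 DD_power db[OF t] db1[OF t])+)
        (simp add: power2_eq_square power3_eq_cube algebra_simps)
    have dP: "DD a t (\<lambda>s. l^2 * x s) (l^2 * b t)" by (rule DD_cmult[OF dx[OF t]])
    show ?thesis unfolding N_def
      by (rule DD_multiplier[OF d0 d1 d2 dP du[OF t] dU[OF t]])
  qed
  have low: "- (6 * C * l^2 * u t ^ 2 + 2 * G t ^ 2) \<le> (f0 t * (l^2 * b t) + 2 * \<phi>1 t * (l^2 * x t) + \<phi>3 t / 2) * u t ^ 2 + 2 * f0 t * U t * G t - \<phi>1 t * u t * G t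
      + f0 t ^ 2 * U t ^ 2 + f0 t ^ 2 * u t * G t - f0 t ^ 2 * (l^2 * x t) * u t ^ 2 - (\<phi>1 t ^ 2 + f0 t * \<phi>2 t) * u t ^ 2"
    if t: "t \<in> {s..e}" for t
  proof (rule multiplier_lower)
    have bt: "0 \<le> b t" "b t \<le> T" "\<bar>b1 t\<bar> \<le> T" "\<bar>b2 t\<bar> \<le> T" "b t ^ 2 \<le> T^2" "b t ^ 3 \<le> T^3"
      using b(1)[OF t] b(2) b(3)[OF t] b(4,5)[OF t] by (auto intro!: power_mono)
    have "\<phi>1 t ^ 2 = (f1 t)^2 * b t ^ 2" by (simp add: \<phi>1_def power_mult_distrib)
    also have "\<dots> \<le> 25 * T^2 * (2 * l^2) * T^2" using mb(4)[OF t] bt by (intro mult_mono) auto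
    also have "\<dots> = 50 * T^4 * l^2" by (simp add: numeral_eq_Suc algebra_simps)
    also have "\<dots> \<le> C * l^2" by (rule CX) auto
    finally show "\<phi>1 t ^ 2 \<le> C * l^2" .
    show "f0 t ^ 4 \<le> C * l^2" using mb(6)[OF t] CX[of 0 2] by simp
    have "f0 t ^ 2 * (l^2 * x t) = z t ^ 8 * (l^2 * (x t * r t ^ 2))"
      by (simp add: f0_def mf0_def power_mult_distrib power_mult[symmetric] mult_ac)
    also have "\<dots> \<le> 1 * (l^2 * 1)" using R[OF t] x(1)[OF t] by (intro mult_mono) (auto simp: power_le_one)
    also have "\<dots> \<le> C * l^2" using CX[of 0 1] by simp
    finally show "f0 t ^ 2 * (l^2 * x t) \<le> C * l^2" .
    have f0b: "0 \<le> f0 t" "f0 t ^ 2 \<le> 2 * l^2"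
    proof -
      show "0 \<le> f0 t" using R[OF t] by (simp add: f0_def mf0_def)
      have "f0 t ^ 2 = z t ^ 8 * r t ^ 2" by (simp add: f0_def mf0_def power_mult_distrib power_mult[symmetric])
      also have "\<dots> \<le> 1 * (2 * l^2)" using R[OF t] S[OF t, of 2] by (intro mult_mono) (auto simp: power_le_one)
      finally show "f0 t ^ 2 \<le> 2 * l^2" by simp
    qed
    have "\<bar>f0 t * f1 t\<bar> \<le> (f0 t ^ 2 + f1 t ^ 2) / 2"
      using sum_squares_bound[of "\<bar>f0 t\<bar>" "\<bar>f1 t\<bar>"] by (simp add: abs_mult)
    also have "\<dots> \<le> (2 * l^2 + 25 * T^2 * (2 * l^2)) / 2" using f0b mb(4)[OF t] by simp
    also have "\<dots> \<le> 26 * T^2 * l^2"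
    proof -
      have "1 * l^2 \<le> T^2 * l^2" using T by (intro mult_right_mono one_le_power) auto
      then show ?thesis by (simp add: algebra_simps)
    qed
    finally have f01: "\<bar>f0 t * f1 t\<bar> \<le> 26 * T^2 * l^2" .
    have "\<bar>f0 t * \<phi>2 t\<bar> \<le> \<bar>f0 t * f2 t\<bar> * b t ^ 2 + \<bar>f0 t * f1 t\<bar> * \<bar>b1 t\<bar>"
      unfolding \<phi>2_def using abs_triangle_ineq[of "f0 t * f2 t * b t ^ 2" "f0 t * f1 t * b1 t"]
      by (simp add: abs_mult algebra_simps)
    also have "\<dots> \<le> 17 * T^2 * (2 * l^2) * T^2 + 26 * T^2 * l^2 * T"
      using mb(5)[OF t] f01 bt T by (intro add_mono mult_mono) auto
    also have "\<dots> = 34 * T^4 * l^2 + 26 * T^3 * l^2" by (simp add: numeral_eq_Suc algebra_simps)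
    also have "\<dots> \<le> 60 * T^4 * l^2" 
      using mult_right_mono[OF power_increasing[of 3 4 T], of "l^2"] T by (simp add: mult.commute)
    also have "\<dots> \<le> C * l^2" by (rule CX) auto
    finally show "\<bar>f0 t * \<phi>2 t\<bar> \<le> C * l^2" .
    define E where "E = mf3 q (z t) (r t) + (15/8) * z t^4 * r t^7"
    have f3: "mf3 q (z t) (r t) = E - (15/8) * z t^4 * r t^7" by (simp add: E_def)
    have main: "f0 t * (l^2 * b t) + 2 * \<phi>1 t * (l^2 * x t) =
      z t ^ 4 * r t ^ 3 * b t * (l^2 * h) - 8 * l^2 * q * z t ^ 3 * b t * (x t * r t)"
    proof -
      have "f0 t * (l^2 * b t) + 2 * \<phi>1 t * (l^2 * x t) = 
        z t ^ 4 * r t * b t * l^2 * (1 - x t * r t ^ 2) - 8 * l^2 * q * z t ^ 3 * b t * (x t * r t)"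
        by (simp add: f0_def mf0_def \<phi>1_def f1_def mf1_def numeral_eq_Suc algebra_simps)
      moreover have "1 - x t * r t ^ 2 = h * r t ^ 2" using R(2)[OF t] by (simp add: algebra_simps)
      ultimately have "f0 t * (l^2 * b t) + 2 * \<phi>1 t * (l^2 * x t) = 
        z t ^ 4 * r t * b t * l^2 * (h * r t ^ 2) - 8 * l^2 * q * z t ^ 3 * b t * (x t * r t)" by (simp only:)
      also have "z t ^ 4 * r t * b t * l^2 * (h * r t ^ 2) = z t ^ 4 * r t ^ 3 * b t * (l^2 * h)"
        by (simp add: numeral_eq_Suc)
      finally show ?thesis .
    qed
    have good: "(15/16) * z t^4 * r t^7 * b t ^ 3 \<le> z t ^ 4 * r t ^ 3 * b t * (l^2 * h)"
    proof -
      have "(15/16) * b t ^ 2 * r t ^ 4 \<le> (15/16) * T ^ 2 * r t ^ 4" using bt by (intro mult_right_mono) auto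
      also have "\<dots> \<le> l^2 * h" by (rule R(6)[OF t])
      finally have A: "z t ^ 4 * r t ^ 3 * b t * ((15/16) * b t ^ 2 * r t ^ 4) \<le> z t ^ 4 * r t ^ 3 * b t * (l^2 * h)"
        using R[OF t] bt by (intro mult_left_mono) auto
      have B: "z t ^ 4 * r t ^ 3 * b t * ((15/16) * b t ^ 2 * r t ^ 4) = (15/16) * z t^4 * r t^7 * b t ^ 3"
        by (simp add: numeral_eq_Suc algebra_simps)
      show ?thesis using A unfolding B .
    qed
    have e1: "8 * l^2 * q * z t ^ 3 * b t * (x t * r t) \<le> 8 * T^2 * (1 + X) * l^2"
    proof -
      have "q * z t ^ 3 \<le> T" using mult_mono[of q T "z t ^ 3" 1] q R[OF t] by (auto simp: power_le_one)
      then have "q * z t ^ 3 * b t \<le> T * T" using bt q R[OF t] T by (rule_tac mult_mono) auto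
      then have "q * z t ^ 3 * b t * (x t * r t) \<le> T * T * (1 + X)" 
        using R[OF t] x(1)[OF t] T bt q by (rule_tac mult_mono) auto
      then have "(8 * l^2) * (q * z t ^ 3 * b t * (x t * r t)) \<le> (8 * l^2) * (T * T * (1 + X))"
        by (intro mult_left_mono) auto
      then show ?thesis by (simp add: power2_eq_square mult_ac)
    qed
    have e2: "\<bar>E * b t ^ 3\<bar> \<le> 102 * T^6 * l^2"
    proof -
      have "\<bar>E\<bar> * b t ^ 3 \<le> 51 * T^3 * (2 * l^2) * T^3"
        using mb(3)[OF t] bt T unfolding E_def by (intro mult_mono) auto
      then show ?thesis using bt by (simp add: abs_mult numeral_eq_Suc algebra_simps)
    qed
    have e3: "\<bar>3 * f2 t * b t * b1 t\<bar> \<le> 102 * T^4 * l^2"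
    proof -
      have "\<bar>f2 t\<bar> * b t * \<bar>b1 t\<bar> \<le> 17 * T^2 * (2 * l^2) * T * T"
        using mb(2)[OF t] bt T by (intro mult_mono) auto
      then show ?thesis using bt by (simp add: abs_mult numeral_eq_Suc algebra_simps)
    qed
    have e4: "\<bar>f1 t * b2 t\<bar> \<le> 10 * T^2 * l^2"
    proof -
      have "\<bar>f1 t\<bar> * \<bar>b2 t\<bar> \<le> 5 * T * (2 * l^2) * T"
        using mb(1)[OF t] bt T by (intro mult_mono) auto
      then show ?thesis by (simp add: abs_mult numeral_eq_Suc algebra_simps)
    qed
    have tot: "8 * T^2 * (1 + X) * l^2 + 51 * T^6 * l^2 + 51 * T^4 * l^2 + 5 * T^2 * l^2 \<le> C * l^2"
    proof -
      have "T^6 * 1 \<le> T^6 * (1 + X)" using X0 T by (intro mult_left_mono) auto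
      moreover have "T^4 \<le> T^6" "T^2 \<le> T^6" using T6 by auto
      moreover have "T^2 * (1 + X) \<le> T^6 * (1 + X)" using T6[of 2] X0 by (intro mult_right_mono) auto
      moreover have "0 \<le> T^6 * (1 + X)" using X0 T by simp
      ultimately have "8 * T^2 * (1 + X) + 51 * T^6 + 51 * T^4 + 5 * T^2 \<le> C" unfolding C_def by (simp only: mult.assoc)
      then have "(8 * T^2 * (1 + X) + 51 * T^6 + 51 * T^4 + 5 * T^2) * l^2 \<le> C * l^2" by (intro mult_right_mono) auto
      then show ?thesis by (simp add: algebra_simps)
    qed
    have p3: "\<phi>3 t = E * b t ^ 3 - 2 * ((15/16) * z t^4 * r t^7 * b t ^ 3) + 3 * f2 t * b t * b1 t + f1 t * b2 t"
      unfolding \<phi>3_def f3 by (simp add: algebra_simps)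
    show "- (C * l^2) \<le> f0 t * (l^2 * b t) + 2 * \<phi>1 t * (l^2 * x t) + \<phi>3 t / 2"
    proof -
      have aux: "- K \<le> A - d + (B - 2 * g + F + H) / 2"
        if "g \<le> A" "d \<le> c1" "\<bar>B\<bar> \<le> c2" "\<bar>F\<bar> \<le> c3" "\<bar>H\<bar> \<le> c4" "c1 + c2 / 2 + c3 / 2 + c4 / 2 \<le> K"
        for K A d B g F H c1 c2 c3 c4 :: real
      proof -
        have "(B - 2 * g + F + H) / 2 = B / 2 - g + F / 2 + H / 2" by simp
        then show ?thesis using that by linarith
      qed
      show ?thesis unfolding main p3 by (rule aux[OF good e1 e2 e3 e4]) (use tot in \<open>simp add: mult_ac\<close>)
    qed
  qed
  have contu: "continuous_on {s..e} u"
    by (rule DERIV_continuous_on) (use du in \<open>auto simp: DD_def intro: has_field_derivative_at_within\<close>)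
  have "N s \<le> N e + integral {s..e} (\<lambda>t. (6 * C * l^2 * u t ^ 2 + 2 * G t ^ 2) / a t)"
  proof (rule le_plus_integral)
    show "s \<le> e" using se by simp
    fix t assume t: "t \<in> {s..e}"
    show "(N has_real_derivative ((f0 t * (l^2 * b t) + 2 * \<phi>1 t * (l^2 * x t) + \<phi>3 t / 2) * u t ^ 2 + 2 * f0 t * U t * G t - \<phi>1 t * u t * G t
      + f0 t ^ 2 * U t ^ 2 + f0 t ^ 2 * u t * G t - f0 t ^ 2 * (l^2 * x t) * u t ^ 2 - (\<phi>1 t ^ 2 + f0 t * \<phi>2 t) * u t ^ 2) / a t) (at t)"
      using dN[OF t] unfolding DD_def .
    show "- ((6 * C * l^2 * u t ^ 2 + 2 * G t ^ 2) / a t) \<le> ((f0 t * (l^2 * b t) + 2 * \<phi>1 t * (l^2 * x t) + \<phi>3 t / 2) * u t ^ 2 + 2 * f0 t * U t * G t - \<phi>1 t * u t * G t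
      + f0 t ^ 2 * U t ^ 2 + f0 t ^ 2 * u t * G t - f0 t ^ 2 * (l^2 * x t) * u t ^ 2 - (\<phi>1 t ^ 2 + f0 t * \<phi>2 t) * u t ^ 2) / a t"
      unfolding minus_divide_left by (rule divide_right_mono[OF low[OF t] less_imp_le[OF a[OF t]]])
  next
    show "continuous_on {s..e} (\<lambda>t. (6 * C * l^2 * u t ^ 2 + 2 * G t ^ 2) / a t)"
      using a by (intro continuous_intros contu cont) force
  qed
  moreover have "N e = 0"
    by (simp add: N_def z_def f0_def mf0_def \<phi>1_def \<phi>2_def f1_def mf1_def f2_def mf2_def)
  ultimately have Ns: "N s \<le> integral {s..e} (\<lambda>t. (6 * C * l^2 * u t ^ 2 + 2 * G t ^ 2) / a t)" by simp
  \<comment> \<open>At \<open>s\<close> the form is positive: its part in \<open>U\<close> is completed to a square, and the remaining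
    coefficient of \<open>u\<^sup>2\<close> is bounded below by the potential and by the \<open>r\<^sup>5\<close> term of the second derivative.\<close>
  define c1 where "c1 = min (1/2) (5/16 * b0^2 / (8 * m))"
  have c1: "0 < c1" "c1 \<le> 1/2" "c1 \<le> 5/16 * b0^2 / (8 * m)" unfolding c1_def using b(2) m1 by auto
  have ss: "s \<in> {s..e}" using se by simp
  let ?r = "r s" and ?b = "b s"
  have zs: "z s = 1" using \<Delta> by (simp add: z_def q_def)
  have r0: "0 < ?r" using R(1)[OF ss] .
  have bs: "b0 \<le> ?b" "?b \<le> T" "\<bar>b1 s\<bar> \<le> T" using b(1,3,4)[OF ss] by auto
  have f0s: "f0 s = ?r" by (simp add: f0_def mf0_def zs)
  have f1s: "f1 s = - (4 * q * ?r + (1/2) * ?r^3)" by (simp add: f1_def mf1_def zs)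
  have f2s: "f2 s = 12 * q^2 * ?r + 4 * q * ?r^3 + (3/4) * ?r^5" by (simp add: f2_def mf2_def zs)
  have key: "(l^2 * x s * ?r + (5/16) * b0^2 * ?r^5 - 2 * T^2 * (?r + ?r^3)) * u s ^ 2 \<le> N s"
  proof -
    let ?p = "\<phi>1 s"
    have sq: "?r * U s ^ 2 - ?p * (u s * U s) + ?r^2 * (u s * U s) \<ge> - ((?p - ?r^2)^2 / (4 * ?r)) * u s ^ 2"
    proof -
      have "0 \<le> (2 * ?r * U s - (?p - ?r^2) * u s)^2 / (4 * ?r)" using r0 by simp
      also have "\<dots> = ?r * U s ^ 2 - ?p * (u s * U s) + ?r^2 * (u s * U s) + ((?p - ?r^2)^2 / (4 * ?r)) * u s ^ 2"
        using r0 by (simp add: power2_eq_square field_simps)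
      finally show ?thesis by simp
    qed
    have id: "\<phi>2 s / 2 - ?r * ?p - (?p - ?r^2)^2 / (4 * ?r) =
      ?b^2 * ((5/16) * ?r^5 + 2 * q^2 * ?r + q * ?r^3) + (1/2) * ?b * ?r * (4 * q * ?r + (1/2) * ?r^3)
        - (1/2) * b1 s * (4 * q * ?r + (1/2) * ?r^3) - ?r^3 / 4"
      using r0 unfolding \<phi>2_def \<phi>1_def f1s f2s by (simp add: field_simps numeral_eq_Suc)
    have b1: "(1/2) * b1 s * (4 * q * ?r + (1/2) * ?r^3) \<le> 2 * T^2 * ?r + (1/4) * T^2 * ?r^3"
    proof -
      have "b1 s * (4 * q * ?r + (1/2) * ?r^3) \<le> T * (4 * T * ?r + (1/2) * ?r^3)"
        using bs r0 q T by (intro mult_mono add_mono) auto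
      also have "\<dots> \<le> 4 * T^2 * ?r + (1/2) * T^2 * ?r^3"
      proof -
        have "T * ?r^3 \<le> T^2 * ?r^3" using T r0 by (intro mult_right_mono) (auto simp: power2_eq_square)
        then show ?thesis by (simp add: power2_eq_square algebra_simps)
      qed
      finally show ?thesis by simp
    qed
    have "?r^3 / 4 \<le> (1/4) * T^2 * ?r^3"
      using mult_right_mono[OF one_le_power[OF T, of 2], of "?r^3"] r0 by simp
    moreover have "(5/16) * b0^2 * ?r^5 \<le> ?b^2 * ((5/16) * ?r^5 + 2 * q^2 * ?r + q * ?r^3)"
    proof -
      have "b0^2 * ((5/16) * ?r^5) \<le> ?b^2 * ((5/16) * ?r^5 + 2 * q^2 * ?r + q * ?r^3)"
        using bs b(2) r0 q by (intro mult_mono power_mono) auto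
      then show ?thesis by (simp add: mult_ac)
    qed
    moreover have "0 \<le> (1/2) * ?b * ?r * (4 * q * ?r + (1/2) * ?r^3)" using bs b(2) r0 q by simp
    moreover have "0 \<le> T^2 * ?r^3" using r0 by simp
    ultimately have "(5/16) * b0^2 * ?r^5 - 2 * T^2 * (?r + ?r^3) \<le> \<phi>2 s / 2 - ?r * ?p - (?p - ?r^2)^2 / (4 * ?r)"
      unfolding id using b1 by (simp add: algebra_simps)
    then have "((5/16) * b0^2 * ?r^5 - 2 * T^2 * (?r + ?r^3)) * u s ^ 2 \<le> (\<phi>2 s / 2 - ?r * ?p - (?p - ?r^2)^2 / (4 * ?r)) * u s ^ 2"
      by (intro mult_right_mono) auto
    with sq show ?thesis unfolding N_def f0s by (simp add: algebra_simps)
  qed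
  define \<xi> where "\<xi> = h * ?r^2"
  have xi: "0 < \<xi>" "\<xi> \<le> 1" "x s * ?r^2 = 1 - \<xi>"
    using R(2)[OF ss] mult_nonneg_nonneg[OF x(1)[OF ss], of "?r^2"] h(1) r0 by (auto simp: \<xi>_def algebra_simps)
  have c\<xi>: "c1 \<le> (1 - \<xi>) + (5/16) * b0^2 / m * \<xi>^3"
  proof (cases "\<xi> \<le> 1/2")
    case True
    moreover have "0 \<le> (5/16) * b0^2 / m * \<xi>^3" using m1 xi by simp
    ultimately show ?thesis using c1 by linarith
  next
    case False
    then have "(1/2)^3 \<le> \<xi>^3" by (intro power_mono) auto
    then have "(5/16) * b0^2 / m * (1/2)^3 \<le> (5/16) * b0^2 / m * \<xi>^3" using m1 by (intro mult_left_mono) auto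
    moreover have "(5/16) * b0^2 / m * (1/2)^3 = 5/16 * b0^2 / (8 * m)" by (simp add: power3_eq_cube)
    ultimately show ?thesis using c1 xi by linarith
  qed
  have "c1 / 2 * l^2 \<le> ?r * (l^2 * x s * ?r + (5/16) * b0^2 * ?r^5 - 2 * T^2 * (?r + ?r^3))"
  proof -
    have "?r * (l^2 * x s * ?r + (5/16) * b0^2 * ?r^5 - 2 * T^2 * (?r + ?r^3)) = 
      l^2 * (x s * ?r^2) + (5/16) * b0^2 * ?r^6 - 2 * T^2 * (?r^2 + ?r^4)"
      by (simp add: numeral_eq_Suc algebra_simps)
    also have "?r^6 = l^2 / m * \<xi>^3"
    proof -
      have "\<xi>^3 = h^3 * ?r^6" by (simp add: \<xi>_def power_mult_distrib power_mult[symmetric])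
      then have "l^2 * \<xi>^3 = m * ?r^6" using h by (simp add: mult.assoc[symmetric])
      then show ?thesis using m1 by (simp add: field_simps)
    qed
    also have "?r^2 + ?r^4 = \<xi> / h + \<xi>^2 / h^2"
      using h by (simp add: \<xi>_def power_mult_distrib power_mult[symmetric])
    finally have e: "?r * (l^2 * x s * ?r + (5/16) * b0^2 * ?r^5 - 2 * T^2 * (?r + ?r^3)) =
      l^2 * ((1 - \<xi>) + (5/16) * b0^2 / m * \<xi>^3) - 2 * T^2 * (\<xi> / h + \<xi>^2 / h^2)"
      unfolding xi(3) by (simp add: algebra_simps)
    have "\<xi> / h + \<xi>^2 / h^2 \<le> 2 / h^2"
    proof -
      have "\<xi> / h \<le> 1 / h^2"
      proof -
        have "\<xi> * h \<le> 1" using xi h by (intro mult_le_one) auto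
        then show ?thesis using h by (simp add: power2_eq_square field_simps)
      qed
      moreover have "\<xi>^2 / h^2 \<le> 1 / h^2" using xi h by (intro divide_right_mono) (auto simp: power_le_one)
      ultimately show ?thesis by simp
    qed
    then have "2 * T^2 * (\<xi> / h + \<xi>^2 / h^2) \<le> 2 * T^2 * (2 / h^2)" by (intro mult_left_mono) auto
    also have "\<dots> = (8 * T^2 * h) / (2 * h^3)" using h by (simp add: power2_eq_square power3_eq_cube)
    also have "\<dots> \<le> (c1 * m) / (2 * h^3)" using large h unfolding c1_def by (intro divide_right_mono) auto
    also have "\<dots> = c1 / 2 * l^2" using h by (simp add: field_simps)
    finally have "2 * T^2 * (\<xi> / h + \<xi>^2 / h^2) \<le> c1 / 2 * l^2" .
    moreover have "l^2 * c1 \<le> l^2 * ((1 - \<xi>) + (5/16) * b0^2 / m * \<xi>^3)" using c\<xi> by (intro mult_left_mono) auto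
    ultimately show ?thesis unfolding e by (simp add: mult.commute)
  qed
  then have "u s ^ 2 * (c1 / 2 * l^2) \<le> u s ^ 2 * (?r * (l^2 * x s * ?r + (5/16) * b0^2 * ?r^5 - 2 * T^2 * (?r + ?r^3)))"
    by (intro mult_left_mono) auto
  also have "\<dots> = ?r * ((l^2 * x s * ?r + (5/16) * b0^2 * ?r^5 - 2 * T^2 * (?r + ?r^3)) * u s ^ 2)" by (simp add: mult_ac)
  also have "\<dots> \<le> ?r * N s" using key r0 by (intro mult_left_mono) auto
  also have "\<dots> \<le> ?r * integral {s..e} (\<lambda>t. (6 * C * l^2 * u t ^ 2 + 2 * G t ^ 2) / a t)"
    using Ns r0 by (intro mult_left_mono) auto
  finally show ?thesis unfolding c1_def r_def C_def .
qed


section \<open>The amplitude of a mode: forbidden region\<close>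

text \<open>The flux \<open>u U\<close> tends to zero at the pole, so it is bounded below by the integral of a lower bound of its
  derivative.\<close>

lemma flux_lower_bound:
  fixes a u U f k :: "real \<Rightarrow> real"
  assumes s: "0 < s"
    and dJ: "\<And>t. t \<in> {0<..s} \<Longrightarrow> DD a t (\<lambda>t. u t * U t) (f t)"
    and low: "\<And>t. t \<in> {0<..s} \<Longrightarrow> - k t \<le> f t / a t" and cont: "continuous_on {0<..s} k"
    and K: "\<And>\<tau>. 0 < \<tau> \<Longrightarrow> \<tau> \<le> s \<Longrightarrow> integral {\<tau>..s} k \<le> K"
    and bd: "\<And>t. t \<in> {0<..s} \<Longrightarrow> \<bar>u t\<bar> \<le> B" "\<And>t. t \<in> {0<..s} \<Longrightarrow> \<bar>U t\<bar> \<le> B * a t"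
    and a0: "(a \<longlongrightarrow> 0) (at_right 0)"
  shows "- K \<le> u s * U s"
proof -
  have B0: "0 \<le> B" using bd(1)[of s] s by auto
  have "- (B * (B * a \<tau>)) \<le> u s * U s + K" if t: "0 < \<tau>" "\<tau> \<le> s" for \<tau>
  proof -
    have "u \<tau> * U \<tau> \<le> u s * U s + integral {\<tau>..s} k"
    proof (rule le_plus_integral[OF t(2)])
      show "((\<lambda>t. u t * U t) has_real_derivative f r / a r) (at r)" if "r \<in> {\<tau>..s}" for r
        using dJ[of r] that t unfolding DD_def by simp
      show "- k r \<le> f r / a r" if "r \<in> {\<tau>..s}" for r using low[of r] that t by simp
      show "continuous_on {\<tau>..s} k" by (rule continuous_on_subset[OF cont]) (use t in auto)
    qed
    moreover have "\<bar>u \<tau> * U \<tau>\<bar> \<le> B * (B * a \<tau>)"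
      unfolding abs_mult using bd[of \<tau>] t B0 by (intro mult_mono) auto
    ultimately show ?thesis using K[OF t] by linarith
  qed
  then have "\<forall>\<^sub>F \<tau> in at_right 0. - (B * (B * a \<tau>)) \<le> u s * U s + K"
    unfolding eventually_at_right_field using s by (intro exI[of _ s]) auto
  moreover have "((\<lambda>\<tau>. - (B * (B * a \<tau>))) \<longlongrightarrow> - (B * (B * 0))) (at_right 0)"
    by (intro tendsto_intros a0)
  ultimately have "- (B * (B * 0)) \<le> u s * U s + K"
    using tendsto_upperbound trivial_limit_at_right_real by blast
  then show ?thesis by simp
qed

text \<open>Where \<open>x\<close> is at most \<open>- d / 2\<close>, the function \<open>u\<^sup>2\<close> is convex with respect to \<open>D\<close> up to the source, with a potential term of
  size \<open>l\<^sup>2 d u\<^sup>2\<close>. By \<open>flux_lower_bound\<close> the flux at \<open>s\<close> is not too negative, so \<open>u\<^sup>2\<close> can be large at \<open>s\<close> only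
  if it is large on the whole interval to the right of \<open>s\<close>. The mass there, cut off smoothly at \<open>s + \<rho>\<close>, therefore bounds it.\<close>

lemma deep_forbidden_amplitude:
  fixes a a' x u U \<gamma> :: "real \<Rightarrow> real"
  assumes s: "0 < s" "0 < \<rho>" and l: "0 < l" and d: "0 < d"
    and a: "\<And>t. t \<in> {0<..s+\<rho>} \<Longrightarrow> 0 < a t \<and> a t \<le> A" and da: "\<And>t. t \<in> {s..s+\<rho>} \<Longrightarrow> (a has_real_derivative a' t) (at t)"
    and a': "\<And>t. t \<in> {s..s+\<rho>} \<Longrightarrow> 0 \<le> a' t" and a0: "0 < a0" "\<And>t. t \<in> {s..s+\<rho>} \<Longrightarrow> a0 \<le> a t"
    and lim: "(a \<longlongrightarrow> 0) (at_right 0)" and conta: "continuous_on {0<..s+\<rho>} a"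
    and du: "\<And>t. t \<in> {0<..s+\<rho>} \<Longrightarrow> DD a t u (U t)"
    and dU: "\<And>t. t \<in> {0<..s+\<rho>} \<Longrightarrow> DD a t U (a t ^ 2 * \<gamma> t - l^2 * x t * u t)"
    and x: "\<And>t. t \<in> {0<..s+\<rho>} \<Longrightarrow> x t \<le> - (d / 2)"
    and cont: "continuous_on {0<..s+\<rho>} \<gamma>"
    and bd: "\<And>t. t \<in> {0<..s+\<rho>} \<Longrightarrow> \<bar>u t\<bar> \<le> B" "\<And>t. t \<in> {0<..s+\<rho>} \<Longrightarrow> \<bar>U t\<bar> \<le> B * a t"
    and E: "\<And>p q. 0 < p \<Longrightarrow> p \<le> q \<Longrightarrow> q \<le> s + \<rho> \<Longrightarrow> integral {p..q} (\<lambda>t. u t ^ 2 * a t) \<le> E"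
    and F: "\<And>p q. 0 < p \<Longrightarrow> p \<le> q \<Longrightarrow> q \<le> s + \<rho> \<Longrightarrow> integral {p..q} (\<lambda>t. \<gamma> t ^ 2 * a t) \<le> F"
  shows "4 * a0 / \<rho> * u s ^ 2 \<le> 72 * A^4 / (l^2 * d * \<rho>^4 * a0^2) * E + 3 * A^2 / (l^2 * d) * F"
proof -
  define P where "P = l^2 * d / 2"
  have P: "0 < P" using l d by (simp add: P_def)
  have A0: "0 < A" using a[of s] s by auto
  have xP: "P * u t ^ 2 \<le> - (l^2 * x t * u t ^ 2)" if "t \<in> {0<..s+\<rho>}" for t
  proof -
    have "l^2 * (d / 2) * u t ^ 2 \<le> l^2 * (- x t) * u t ^ 2"
      using x[OF that] by (intro mult_right_mono mult_left_mono) auto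
    then show ?thesis by (simp add: P_def)
  qed
  have dJ: "DD a t (\<lambda>t. u t * U t) (U t ^ 2 + (a t ^ 2 * \<gamma> t) * u t - l^2 * x t * u t ^ 2)" if "t \<in> {0<..s+\<rho>}" for t
    by (rule DD_cong, rule DD_mult[OF du[OF that] dU[OF that]]) (simp add: power2_eq_square algebra_simps)
  have uG: "- (P * u t ^ 2 + (a t ^ 2 * \<gamma> t)^2 / (4 * P)) \<le> (a t ^ 2 * \<gamma> t) * u t" for t
  proof -
    have "0 \<le> (2 * P * u t + a t ^ 2 * \<gamma> t)^2 / (4 * P)" using P by simp
    also have "\<dots> = P * u t ^ 2 + (a t ^ 2 * \<gamma> t) * u t + (a t ^ 2 * \<gamma> t)^2 / (4 * P)"
      using P by (simp add: power2_eq_square field_simps)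
    finally show ?thesis by simp
  qed
  have G4: "(a t ^ 2 * \<gamma> t)^2 / a t \<le> A^2 * (\<gamma> t ^ 2 * a t)" if t: "t \<in> {0<..s+\<rho>}" for t
  proof -
    have "(a t ^ 2 * \<gamma> t)^2 / a t = a t ^ 2 * (\<gamma> t ^ 2 * a t)" using a[OF t] by (simp add: power2_eq_square)
    also have "\<dots> \<le> A^2 * (\<gamma> t ^ 2 * a t)" using a[OF t] by (intro mult_right_mono power_mono) auto
    finally show ?thesis .
  qed
  define K where "K = A^2 / (4 * P) * F"
  have J: "- K \<le> u s * U s"
  proof (rule flux_lower_bound[OF s(1), where k="\<lambda>t. A^2 / (4 * P) * (\<gamma> t ^ 2 * a t)"])
    fix t assume "t \<in> {0<..s}"
    then have t: "t \<in> {0<..s+\<rho>}" using s by auto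
    show "DD a t (\<lambda>t. u t * U t) (U t ^ 2 + (a t ^ 2 * \<gamma> t) * u t - l^2 * x t * u t ^ 2)" by (rule dJ[OF t])
    have "- ((a t ^ 2 * \<gamma> t)^2 / (4 * P)) \<le> U t ^ 2 + (a t ^ 2 * \<gamma> t) * u t - l^2 * x t * u t ^ 2"
      using uG[of t] xP[OF t] zero_le_power2[of "U t"] by linarith
    then have "- ((a t ^ 2 * \<gamma> t)^2 / (4 * P)) / a t \<le> (U t ^ 2 + (a t ^ 2 * \<gamma> t) * u t - l^2 * x t * u t ^ 2) / a t"
      using a[OF t] by (intro divide_right_mono) auto
    moreover have "(a t ^ 2 * \<gamma> t)^2 / (4 * P) / a t \<le> A^2 / (4 * P) * (\<gamma> t ^ 2 * a t)"
      using divide_right_mono[OF G4[OF t], of "4 * P"] P by (simp add: mult_ac)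
    ultimately show "- (A^2 / (4 * P) * (\<gamma> t ^ 2 * a t)) \<le> (U t ^ 2 + (a t ^ 2 * \<gamma> t) * u t - l^2 * x t * u t ^ 2) / a t" by simp
    show "\<bar>u t\<bar> \<le> B" "\<bar>U t\<bar> \<le> B * a t" using bd[OF t] by auto
  next
    show "continuous_on {0<..s} (\<lambda>t. A^2 / (4 * P) * (\<gamma> t ^ 2 * a t))"
      by (intro continuous_intros continuous_on_subset[OF cont] continuous_on_subset[OF conta]) (use s in auto)
    show "integral {\<tau>..s} (\<lambda>t. A^2 / (4 * P) * (\<gamma> t ^ 2 * a t)) \<le> K" if "0 < \<tau>" "\<tau> \<le> s" for \<tau>
      unfolding K_def integral_mult_right using F[OF that] s P by (intro mult_left_mono) auto
  qed (rule lim)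
  define z where "z t = (s + \<rho> - t) / \<rho>" for t
  define \<eta>1 where "\<eta>1 t = - (4 / \<rho>) * (z t ^ 3 * a t)" for t
  define \<eta>2 where "\<eta>2 t = 12 / \<rho>^2 * z t ^ 2 * a t ^ 2 - 4 / \<rho> * z t ^ 3 * a t * a' t" for t
  define Q where "Q = 12 * A^2 / \<rho>^2"
  \<comment> \<open>With \<open>\<eta> = z\<^sup>4\<close> and \<open>w = u\<^sup>2\<close> this is \<open>\<eta> D w - (D \<eta>) w\<close>. It vanishes at \<open>s + \<rho>\<close>, and its derivative is
    \<open>\<eta> D\<^sup>2 w - (D\<^sup>2 \<eta>) w\<close>, in which \<open>D\<^sup>2 w\<close> is bounded below.\<close>
  define N where "N t = 2 * (z t ^ 4 * (u t * U t)) - \<eta>1 t * u t ^ 2" for t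
  let ?k = "\<lambda>t. Q^2 / (4 * P) * (1 / a0^2) * (u t ^ 2 * a t) + A^2 / P * (\<gamma> t ^ 2 * a t)"
  have tI: "t \<in> {0<..s+\<rho>}" if "t \<in> {s..s+\<rho>}" for t using that s by auto
  have contu: "continuous_on {s..s+\<rho>} u"
    by (rule DERIV_continuous_on) (use du tI in \<open>auto simp: DD_def intro: has_field_derivative_at_within\<close>)
  have ca: "continuous_on {s..s+\<rho>} a" "continuous_on {s..s+\<rho>} \<gamma>"
    by (rule continuous_on_subset[OF conta], use s in auto) (rule continuous_on_subset[OF cont], use s in auto)
  have "N s \<le> N (s+\<rho>) + integral {s..s+\<rho>} ?k"
  proof (rule le_plus_integral)
    show "s \<le> s + \<rho>" using s by simp
    show "continuous_on {s..s+\<rho>} ?k" by (intro continuous_intros contu ca)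
    fix t assume t: "t \<in> {s..s+\<rho>}"
    have at: "0 < a t" "a t \<le> A" "a0 \<le> a t" using a[OF tI[OF t]] a0(2)[OF t] by auto
    have zt: "0 \<le> z t" "z t \<le> 1" using t s by (auto simp: z_def field_simps)
    have dz: "DD a t z (- (a t / \<rho>))" unfolding z_def DD_def
      using at s by (auto intro!: derivative_eq_intros)
    have daa: "DD a t a (a t * a' t)" using da[OF t] at unfolding DD_def by simp
    have d1: "DD a t (\<lambda>t. z t ^ 4) (\<eta>1 t)"
      by (rule DD_cong, rule DD_power[OF dz]) (use s in \<open>simp add: \<eta>1_def\<close>)
    have d2: "DD a t \<eta>1 (\<eta>2 t)"
      unfolding \<eta>1_def \<eta>2_def
      by (rule DD_cong, rule DD_cmult, rule DD_mult, rule DD_power, rule dz, rule daa)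
        (use s in \<open>simp add: power2_eq_square field_simps\<close>)
    let ?f = "U t ^ 2 + (a t ^ 2 * \<gamma> t) * u t - l^2 * x t * u t ^ 2"
    have "DD a t N (2 * (z t ^ 4 * ?f) - \<eta>2 t * u t ^ 2)"
      unfolding N_def
      by (rule DD_cong, rule DD_diff, rule DD_cmult, rule DD_mult[OF d1 dJ[OF tI[OF t]]], rule DD_mult[OF d2 DD_power[OF du[OF tI[OF t]], of 2]])
        (simp add: algebra_simps)
    then show "(N has_real_derivative (2 * (z t ^ 4 * ?f) - \<eta>2 t * u t ^ 2) / a t) (at t)" unfolding DD_def .
    have f: "P * u t ^ 2 / 2 - (a t ^ 2 * \<gamma> t)^2 / (2 * P) \<le> ?f"
    proof -
      have "0 \<le> (P * u t + a t ^ 2 * \<gamma> t)^2 / (2 * P)" using P by simp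
      also have "\<dots> = P * u t ^ 2 / 2 + (a t ^ 2 * \<gamma> t) * u t + (a t ^ 2 * \<gamma> t)^2 / (2 * P)"
        using P by (simp add: power2_eq_square field_simps)
      finally show ?thesis using xP[OF tI[OF t]] zero_le_power2[of "U t"] by linarith
    qed
    have "z t ^ 4 * (P * u t ^ 2 / 2 - (a t ^ 2 * \<gamma> t)^2 / (2 * P)) \<le> z t ^ 4 * ?f"
      using f zt by (intro mult_left_mono) auto
    moreover have "z t ^ 4 * ((a t ^ 2 * \<gamma> t)^2 / P) \<le> 1 * ((a t ^ 2 * \<gamma> t)^2 / P)"
      using zt P by (intro mult_right_mono) (auto simp: power_le_one)
    ultimately have 1: "z t ^ 4 * P * u t ^ 2 - (a t ^ 2 * \<gamma> t)^2 / P \<le> 2 * (z t ^ 4 * ?f)"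
      by (simp add: algebra_simps)
    have "\<eta>2 t \<le> Q * z t ^ 2"
    proof -
      have "12 / \<rho>^2 * z t ^ 2 * a t ^ 2 \<le> 12 / \<rho>^2 * z t ^ 2 * A ^ 2" using at by (intro mult_left_mono power_mono) auto
      moreover have "0 \<le> 4 / \<rho> * z t ^ 3 * a t * a' t" using s zt at a'[OF t] by simp
      ultimately show ?thesis unfolding \<eta>2_def Q_def by (simp add: mult_ac)
    qed
    then have 2: "\<eta>2 t * u t ^ 2 \<le> Q * z t ^ 2 * u t ^ 2" by (intro mult_right_mono) auto
    have 3: "- (Q^2 / (4 * P)) \<le> z t ^ 4 * P - Q * z t ^ 2"
    proof -
      have "0 \<le> (2 * P * z t ^ 2 - Q)^2 / (4 * P)" using P by simp
      also have "\<dots> = z t ^ 4 * P - Q * z t ^ 2 + Q^2 / (4 * P)"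
        using P by (simp add: power2_eq_square power4_eq_xxxx field_simps)
      finally show ?thesis by simp
    qed
    have "- (Q^2 / (4 * P)) * u t ^ 2 \<le> (z t ^ 4 * P - Q * z t ^ 2) * u t ^ 2" by (rule mult_right_mono[OF 3]) simp
    then have "- (Q^2 / (4 * P) * u t ^ 2) - (a t ^ 2 * \<gamma> t)^2 / P \<le> 2 * (z t ^ 4 * ?f) - \<eta>2 t * u t ^ 2"
      using 1 2 by (simp add: left_diff_distrib)
    then have "(- (Q^2 / (4 * P) * u t ^ 2) - (a t ^ 2 * \<gamma> t)^2 / P) / a t \<le> (2 * (z t ^ 4 * ?f) - \<eta>2 t * u t ^ 2) / a t"
      using at by (intro divide_right_mono) auto
    moreover have "- ?k t \<le> (- (Q^2 / (4 * P) * u t ^ 2) - (a t ^ 2 * \<gamma> t)^2 / P) / a t"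
    proof -
      have "u t ^ 2 / a t \<le> 1 / a0^2 * (u t ^ 2 * a t)"
      proof -
        have "a0^2 \<le> a t ^ 2" using at a0 by (intro power_mono) auto
        then have "u t ^ 2 * a0^2 \<le> u t ^ 2 * a t ^ 2" by (intro mult_left_mono) auto
        then show ?thesis using at a0(1) by (simp add: field_simps power2_eq_square)
      qed
      then have "Q^2 / (4 * P) * (u t ^ 2 / a t) \<le> Q^2 / (4 * P) * (1 / a0^2 * (u t ^ 2 * a t))"
        using P by (intro mult_left_mono) auto
      moreover have "(a t ^ 2 * \<gamma> t)^2 / a t / P \<le> A^2 * (\<gamma> t ^ 2 * a t) / P"
        using G4[OF tI[OF t]] P by (intro divide_right_mono) auto
      ultimately show ?thesis by (simp add: diff_divide_distrib mult_ac)
    qed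
    ultimately show "- ?k t \<le> (2 * (z t ^ 4 * ?f) - \<eta>2 t * u t ^ 2) / a t" by linarith
  qed
  moreover have "N (s + \<rho>) = 0" by (simp add: N_def \<eta>1_def z_def)
  moreover have "N s = 2 * (u s * U s) + 4 / \<rho> * a s * u s ^ 2" using s by (simp add: N_def \<eta>1_def z_def)
  moreover have "integral {s..s+\<rho>} ?k \<le> Q^2 / (4 * P) * (1 / a0^2) * E + A^2 / P * F"
  proof -
    have "integral {s..s+\<rho>} ?k = Q^2 / (4 * P) * (1 / a0^2) * integral {s..s+\<rho>} (\<lambda>t. u t ^ 2 * a t) + A^2 / P * integral {s..s+\<rho>} (\<lambda>t. \<gamma> t ^ 2 * a t)"
      by (subst Henstock_Kurzweil_Integration.integral_add)
        (use P a0(1) in \<open>auto intro!: integrable_continuous_real continuous_intros contu ca\<close>)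
    also have "\<dots> \<le> Q^2 / (4 * P) * (1 / a0^2) * E + A^2 / P * F"
      using E[of s "s+\<rho>"] F[of s "s+\<rho>"] s P by (intro add_mono mult_left_mono) auto
    finally show ?thesis .
  qed
  moreover have "4 / \<rho> * a0 * u s ^ 2 \<le> 4 / \<rho> * a s * u s ^ 2"
    using a0(2)[of s] s by (intro mult_right_mono mult_left_mono) auto
  ultimately have "4 / \<rho> * a0 * u s ^ 2 \<le> 2 * K + Q^2 / (4 * P) * (1 / a0^2) * E + A^2 / P * F" using J by linarith
  also have "2 * K = A^2 / (l^2 * d) * F" by (simp add: K_def P_def)
  also have "A^2 / P * F = 2 * (A^2 / (l^2 * d) * F)" by (simp add: P_def)
  also have "Q^2 / (4 * P) * (1 / a0^2) * E = 72 * A^4 / (l^2 * d * \<rho>^4 * a0^2) * E"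
    by (simp add: Q_def P_def power_divide power_mult_distrib power_mult[symmetric])
  finally have "4 / \<rho> * a0 * u s ^ 2 \<le> A^2 / (l^2 * d) * F + 72 * A^4 / (l^2 * d * \<rho>^4 * a0^2) * E + 2 * (A^2 / (l^2 * d) * F)" .
  moreover have "4 / \<rho> * a0 * u s ^ 2 = 4 * a0 / \<rho> * u s ^ 2" by simp
  moreover have "3 * A^2 / (l^2 * d) * F = A^2 / (l^2 * d) * F + 2 * (A^2 / (l^2 * d) * F)" by (simp add: mult_ac)
  ultimately show ?thesis by (simp only: add_ac)
qed

section \<open>A uniform bound for modes on an arc of meridian\<close>

text \<open>The size of the square of a normalised mode at a point where \<open>a\<^sup>2 - n\<^sup>2/l\<^sup>2\<close> equals \<open>x\<close>: the WKB value
  \<open>\<bar>x\<bar>\<^sup>-\<^sup>1\<^sup>/\<^sup>2\<close> and, near the caustic, the Airy value \<open>l\<^sup>1\<^sup>/\<^sup>3\<close>. The neighbourhood \<open>\<bar>x\<bar> \<le> l\<^sup>-\<^sup>1\<^sup>/\<^sup>2\<close> is larger than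
  the Airy region \<open>\<bar>x\<bar> \<le> l\<^sup>-\<^sup>2\<^sup>/\<^sup>3\<close>; it contributes at most \<open>l\<^sup>1\<^sup>/\<^sup>2 l\<^sup>1\<^sup>/\<^sup>3 = l\<^sup>5\<^sup>/\<^sup>6\<close> to the sum over the modes, which can be afforded.\<close>

definition mode_bound :: "real \<Rightarrow> real \<Rightarrow> real" where
  "mode_bound l x = (if \<bar>x\<bar> \<le> l powr (-1/2) then l powr (1/3) else 1 + 1 / sqrt \<bar>x\<bar>)"

lemma inverse_sqrt_le_mode_bound:
  assumes l: "1 \<le> l" and x: "0 \<le> x" and h: "l powr (-2/3) \<le> h"
  shows "1 / sqrt (x + h) \<le> mode_bound l x"
proof -
  have h0: "0 < h" using h powr_gt_zero[of l "-2/3"] l by linarith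
  show ?thesis
  proof (cases "x \<le> l powr (-1/2)")
    case True
    have "sqrt (l powr (-2/3)) = l powr (-1/3)" using l by (simp add: powr_half_sqrt[symmetric] powr_powr)
    then have "l powr (-1/3) \<le> sqrt (x + h)" using x h by (metis add_increasing real_sqrt_le_iff)
    then have "1 / sqrt (x + h) \<le> 1 / l powr (-1/3)" using l x h0 by (intro divide_left_mono mult_pos_pos) auto
    also have "\<dots> = l powr (1/3)" using l by (simp add: powr_minus_divide)
    finally show ?thesis using True x by (simp add: mode_bound_def)
  next
    case False
    then have x0: "0 < x" using powr_ge_zero[of l "-1/2"] by linarith
    have "1 / sqrt (x + h) \<le> 1 / sqrt x" using x0 h0 by (intro divide_left_mono) auto
    then show ?thesis using False x by (simp add: mode_bound_def)
  qed
qed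

text \<open>Three cases. For \<open>x \<ge> 0\<close> at \<open>s\<close>, \<open>oscillating_amplitude\<close> applies to an interval to the right of \<open>s\<close>, on which \<open>x\<close>
  increases at a rate bounded from both sides. Slightly inside the forbidden region the flux bound shows that
  \<open>u\<^sup>2\<close> cannot decrease much from \<open>s\<close> to the caustic, where the first case applies. Deep inside it,
  \<open>deep_forbidden_amplitude\<close> applies.\<close>

theorem mode_amplitude:
  fixes a a' b b1 b2 :: "real \<Rightarrow> real"
  assumes \<sigma>: "0 < \<sigma>0" "\<sigma>0 \<le> \<sigma>1" "0 < \<rho>"
    and a: "\<And>t. t \<in> {0<..\<sigma>1+\<rho>} \<Longrightarrow> 0 < a t" "\<And>t. t \<in> {0<..\<sigma>1+\<rho>} \<Longrightarrow> (a has_real_derivative a' t) (at t)"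
      "\<And>t. t \<in> {0<..\<sigma>1+\<rho>} \<Longrightarrow> 0 < a' t" "(a \<longlongrightarrow> 0) (at_right 0)"
    and b: "\<And>t. t \<in> {\<sigma>0..\<sigma>1+\<rho>} \<Longrightarrow> b t = 2 * a t ^ 2 * a' t" 
    and db: "\<And>t. t \<in> {\<sigma>0..\<sigma>1+\<rho>} \<Longrightarrow> DD a t b (b1 t)" "\<And>t. t \<in> {\<sigma>0..\<sigma>1+\<rho>} \<Longrightarrow> DD a t b1 (b2 t)"
    and cb: "continuous_on {\<sigma>0..\<sigma>1+\<rho>} b2"
  shows "\<exists>C l0. 0 \<le> C \<and> 1 \<le> l0 \<and> (\<forall>l \<beta> u U \<gamma> B E. l0 \<le> l \<longrightarrow> 0 \<le> \<beta> \<longrightarrow>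
    (\<forall>t\<in>{0<..\<sigma>1+\<rho>}. DD a t u (U t) \<and> DD a t U (a t ^ 2 * \<gamma> t - l^2 * (a t ^ 2 - \<beta>) * u t)
        \<and> \<bar>u t\<bar> \<le> B \<and> \<bar>U t\<bar> \<le> B * a t) \<longrightarrow>
    continuous_on {0<..\<sigma>1+\<rho>} \<gamma> \<longrightarrow>
    (\<forall>p q. 0 < p \<longrightarrow> p \<le> q \<longrightarrow> q \<le> \<sigma>1+\<rho> \<longrightarrow> integral {p..q} (\<lambda>t. u t ^ 2 * a t) \<le> E
       \<and> integral {p..q} (\<lambda>t. \<gamma> t ^ 2 * a t) \<le> l powr (4/3) * E) \<longrightarrow>
    (\<forall>s\<in>{\<sigma>0..\<sigma>1}. u s ^ 2 \<le> C * E * mode_bound l (a s ^ 2 - \<beta>)))"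
proof -
  let ?e = "\<sigma>1 + \<rho>" let ?I = "{\<sigma>0..\<sigma>1+\<rho>}"
  have I: "t \<in> {0<..?e}" if "t \<in> ?I" for t using that \<sigma> by auto
  have \<sigma>0I: "\<sigma>0 \<in> ?I" using \<sigma> by auto
  have conta: "continuous_on {0<..?e} a"
    by (rule DERIV_continuous_on) (use a(2) in \<open>auto intro: has_field_derivative_at_within\<close>)
  have mono: "a p \<le> a q" if "0 < p" "p \<le> q" "q \<le> ?e" for p q
  proof (rule DERIV_nonneg_imp_nondecreasing[OF that(2)])
    fix r assume "p \<le> r" "r \<le> q"
    then have "r \<in> {0<..?e}" using that by auto
    then have "(a has_real_derivative a' r) (at r)" "0 \<le> a' r" using a(2,3)[of r] by auto
    then show "\<exists>y. (a has_real_derivative y) (at r) \<and> 0 \<le> y" by blast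
  qed
  define a0 where "a0 = a \<sigma>0"
  have a0: "0 < a0" "\<And>t. t \<in> ?I \<Longrightarrow> a0 \<le> a t" using a(1)[of \<sigma>0] mono[of \<sigma>0] \<sigma> by (auto simp: a0_def)
  define A where "A = a ?e"
  have A: "\<And>t. t \<in> {0<..?e} \<Longrightarrow> a t \<le> A" "0 < A" using mono[of _ ?e] a(1)[of ?e] \<sigma> by (auto simp: A_def)
  have cI: "continuous_on ?I b" "continuous_on ?I b1"
    by (rule DERIV_continuous_on, use db in \<open>auto simp: DD_def intro: has_field_derivative_at_within\<close>)+
  have bpos: "0 < b t" if "t \<in> ?I" for t using b[OF that] a(1,3)[OF I[OF that]] by simp
  obtain tm where tm: "tm \<in> ?I" "\<And>t. t \<in> ?I \<Longrightarrow> b tm \<le> b t"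
    using continuous_attains_inf[of ?I b] cI(1) \<sigma>0I by (metis compact_Icc empty_iff)
  define b0 where "b0 = b tm"
  have b0: "0 < b0" "\<And>t. t \<in> ?I \<Longrightarrow> b0 \<le> b t" using tm bpos by (auto simp: b0_def)
  have "\<exists>T. \<forall>t\<in>?I. \<bar>f t\<bar> \<le> T" if f: "continuous_on ?I f" for f :: "real \<Rightarrow> real"
  proof -
    have "bounded (f ` ?I)" by (rule compact_imp_bounded[OF compact_continuous_image[OF f compact_Icc]])
    then show ?thesis by (auto simp: bounded_iff)
  qed
  then obtain T0 T1 T2 where T012: "\<forall>t\<in>?I. \<bar>b t\<bar> \<le> T0" "\<forall>t\<in>?I. \<bar>b1 t\<bar> \<le> T1" "\<forall>t\<in>?I. \<bar>b2 t\<bar> \<le> T2"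
    using cI cb by meson
  define T where "T = 1 + \<bar>T0\<bar> + \<bar>T1\<bar> + \<bar>T2\<bar> + 2 * A / (\<rho> * b0)"
  have TA: "0 \<le> 2 * A / (\<rho> * b0)" using A b0 \<sigma> by simp
  have T: "1 \<le> T" "\<And>t. t \<in> ?I \<Longrightarrow> \<bar>b t\<bar> \<le> T" "\<And>t. t \<in> ?I \<Longrightarrow> \<bar>b1 t\<bar> \<le> T" "\<And>t. t \<in> ?I \<Longrightarrow> \<bar>b2 t\<bar> \<le> T"
      "2 * A / (\<rho> * b0) \<le> T"
    using T012 TA by (force simp: T_def)+
  define X where "X = A^2"
  define m where "m = T^2"
  have m: "1 \<le> m" using T by (simp add: m_def)
  define c1 where "c1 = min (1/2) (5/16 * b0^2 / (8 * m))"
  have c1: "0 < c1" "c1 \<le> 1/2" using b0 m by (auto simp: c1_def)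
  define C1 where "C1 = 2 / c1 * (6 * (1000 * T^6 * (1 + X)) / a0^2 + 2 * A^2)"
  have C1: "0 \<le> C1" using c1 T by (simp add: C1_def X_def)
  define c where "c = min (\<rho> / 2) (a0 / (2 * T))"
  have c: "0 < c" "c \<le> \<rho> / 2" "c \<le> a0 / (2 * T)" using \<sigma> a0 T by (auto simp: c_def)
  define C2 where "C2 = C1 + 2 / a0 * (A / b0)"
  define C3 where "C3 = 18 * A^4 / (a0^3 * c^3) + c * A^2 / a0"
  \<comment> \<open>The second bound makes the Airy scale \<open>h\<close> below small. The third one lets \<open>x\<close> grow by \<open>l\<^sup>-\<^sup>1\<^sup>/\<^sup>2\<close> within the
    distance \<open>\<rho> / 2\<close>, so that the caustic is reached before \<open>\<sigma>1 + \<rho>\<close> from the near part of the forbidden region.\<close>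
  define l0 where "l0 = max 1 (max (m * (8 / c1)^3) ((2 * A / (\<rho> * b0))^2))"
  have C3: "0 \<le> C3" using a0 c by (simp add: C3_def)
  have C2: "C1 \<le> C2" using a0 A b0 by (simp add: C2_def)
  show ?thesis
  proof (rule exI[of _ "C2 + C3"], rule exI[of _ l0], intro conjI allI impI ballI)
    show "0 \<le> C2 + C3" using C1 C2 C3 by simp
    show "1 \<le> l0" by (simp add: l0_def)
    fix l \<beta> u U \<gamma> B E s
    assume l0: "l0 \<le> l" and \<beta>: "0 \<le> \<beta>" and sol: "\<forall>t\<in>{0<..?e}. DD a t u (U t) \<and> DD a t U (a t ^ 2 * \<gamma> t - l^2 * (a t ^ 2 - \<beta>) * u t)
        \<and> \<bar>u t\<bar> \<le> B \<and> \<bar>U t\<bar> \<le> B * a t"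
      and cg: "continuous_on {0<..?e} \<gamma>"
      and EE: "\<forall>p q. 0 < p \<longrightarrow> p \<le> q \<longrightarrow> q \<le> ?e \<longrightarrow> integral {p..q} (\<lambda>t. u t ^ 2 * a t) \<le> E
       \<and> integral {p..q} (\<lambda>t. \<gamma> t ^ 2 * a t) \<le> l powr (4/3) * E"
      and s: "s \<in> {\<sigma>0..\<sigma>1}"
    define x where "x t = a t ^ 2 - \<beta>" for t
    have l: "1 \<le> l" "m * (8 / c1)^3 \<le> l" "(2 * A / (\<rho> * b0))^2 \<le> l" using l0 by (auto simp: l0_def)
    have ll: "l \<le> l^2" using l by (simp add: power2_eq_square)
    have E0: "0 \<le> E" using EE[rule_format, of \<sigma>0 \<sigma>0] \<sigma> by simp
    have contu: "continuous_on {0<..?e} u"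
      by (rule DERIV_continuous_on) (use sol in \<open>auto simp: DD_def intro: has_field_derivative_at_within\<close>)
    have dx: "DD a t x (b t)" if "t \<in> ?I" for t
    proof -
      have "(a has_real_derivative a' t) (at t)" "0 < a t" using a I[OF that] by auto
      then show ?thesis unfolding DD_def x_def
        by (auto intro!: derivative_eq_intros simp: b[OF that] power2_eq_square)
    qed
    have inc: "b0 / A * (q - p) \<le> x q - x p" "x q - x p \<le> T / a0 * (q - p)" if pq: "\<sigma>0 \<le> p" "p \<le> q" "q \<le> ?e" for p q
    proof -
      have "b0 / A * (q - p) \<le> x q - x p \<and> x q - x p \<le> T / a0 * (q - p)"
      proof (cases "p = q")
        case False
        then have "p < q" using pq by simp
        then obtain r where r: "p < r" "r < q" "x q - x p = (q - p) * (b r / a r)"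
          using MVT2[of p q x "\<lambda>t. b t / a t"] dx pq unfolding DD_def by (metis atLeastAtMost_iff order_trans)
        have rI: "r \<in> ?I" using r pq by auto
        have "b0 / A \<le> b r / a r" using b0 A(1)[OF I[OF rI]] a(1)[OF I[OF rI]] rI less_imp_le[OF bpos[OF rI]] by (intro frac_le) auto
        moreover have "b r / a r \<le> T / a0" using T(2)[OF rI] a0 rI T(1) by (intro frac_le) auto
        ultimately have "(q - p) * (b0 / A) \<le> (q - p) * (b r / a r)" "(q - p) * (b r / a r) \<le> (q - p) * (T / a0)"
          using \<open>p < q\<close> by (intro mult_left_mono; simp)+
        then show ?thesis unfolding r(3) by (simp only: mult.commute[of _ "q - p"])
      qed simp
      then show "b0 / A * (q - p) \<le> x q - x p" "x q - x p \<le> T / a0 * (q - p)" by auto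
    qed
    define h where "h = root 3 (m / l^2)"
    have h3: "h^3 = m / l^2" "0 < h" using m l by (auto simp: h_def)
    have hl: "l^2 * h^3 = m" using h3 l by simp
    have hc: "h \<le> c1 / 8"
    proof -
      have "h^3 \<le> (c1 / 8)^3"
      proof -
        have "m * (8 / c1)^3 \<le> l^2" using l ll by linarith
        then have "m * (8 / c1)^3 * (c1 / 8)^3 \<le> l^2 * (c1 / 8)^3" using c1 by (intro mult_right_mono) auto
        then have "m \<le> l^2 * (c1 / 8)^3" using c1 by (simp add: mult.assoc power_mult_distrib[symmetric])
        then show ?thesis unfolding h3 using l by (simp add: field_simps)
      qed
      then show ?thesis using c1 by (intro power_le_imp_le_base[of h 2 "c1/8"]) (auto simp: eval_nat_numeral)
    qed
    have h1: "h \<le> 1" using hc c1 by simp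
    have hp: "l powr (-2/3) \<le> h"
    proof -
      have "(l powr (-2/3))^3 = l powr (-2)" using l by (simp add: powr_power)
      also have "\<dots> = 1 / l^2" using l by (simp add: powr_minus_divide)
      also have "\<dots> \<le> h^3" unfolding h3 using m by (intro divide_right_mono) auto
      finally show ?thesis using h3 by (intro power_le_imp_le_base[of "l powr (-2/3)" 2 h]) (auto simp: eval_nat_numeral)
    qed
    have p43: "l powr (4/3) \<le> l^2"
      using powr_mono[of "4/3" 2 l] l by simp
    have osc: "u r ^ 2 \<le> C1 * E * (1 / sqrt (x r + h))" if r: "r \<in> {\<sigma>0..\<sigma>1+\<rho>/2}" "0 \<le> x r" for r
    proof -
      let ?q = "r + \<rho> / 2"
      have sub: "t \<in> ?I" if "t \<in> {r..?q}" for t using that r \<sigma> by auto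
      have rb: "\<sigma>0 \<le> r" "?q \<le> ?e" "0 < r" using r \<sigma> by auto
      have xm: "x p \<le> x q" if "\<sigma>0 \<le> p" "p \<le> q" "q \<le> ?e" for p q
      proof -
        have "0 \<le> b0 / A * (q - p)" using b0 A that by simp
        then show ?thesis using inc(1)[OF that] by linarith
      qed
      have \<Delta>: "b0 / A * (\<rho> / 2) \<le> x ?q - x r" using inc(1)[of r ?q] rb \<sigma> by simp
      have \<Delta>0: "0 < b0 / A * (\<rho> / 2)" using b0 A \<sigma> by simp
      define KK where "KK = 6 * (1000 * T^6 * (1 + X))"
      have KK: "0 \<le> KK" using T by (simp add: KK_def X_def)
      let ?J = "integral {r..?q} (\<lambda>t. (KK * l^2 * u t ^ 2 + 2 * (a t ^ 2 * \<gamma> t) ^ 2) / a t)"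
      have "u r ^ 2 * (min (1/2) (5/16 * b0^2 / (8 * m)) / 2 * l^2) \<le> (1 / sqrt (x r + h)) * ?J"
        unfolding KK_def
      proof (rule oscillating_amplitude[where T=T and b=b and ?b1.0=b1 and ?b2.0=b2 and U=U])
        fix t assume t: "t \<in> {r..?q}"
        have tI: "t \<in> ?I" "t \<in> {0<..?e}" using sub[OF t] I by auto
        show "0 < a t" "DD a t x (b t)" "DD a t b (b1 t)" "DD a t b1 (b2 t)" "b0 \<le> b t" "\<bar>b t\<bar> \<le> T" "\<bar>b1 t\<bar> \<le> T" "\<bar>b2 t\<bar> \<le> T"
          using a(1)[OF tI(2)] dx[OF tI(1)] db[OF tI(1)] b0(2)[OF tI(1)] T(2-4)[OF tI(1)] by auto
        show "DD a t u (U t)" using sol tI by blast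
        have "DD a t U (a t ^ 2 * \<gamma> t - l^2 * (a t ^ 2 - \<beta>) * u t)" using sol tI by blast
        then show "DD a t U (a t ^ 2 * \<gamma> t - l^2 * x t * u t)" unfolding x_def .
        show "0 \<le> x t" using xm[of r t] t rb r(2) by simp
        show "x r \<le> x t \<and> x t \<le> x ?q" using xm[of r t] xm[of t ?q] t rb by simp
      next
        show "continuous_on {r..?q} (\<lambda>t. a t ^ 2 * \<gamma> t)" "continuous_on {r..?q} a"
          by (intro continuous_intros continuous_on_subset[OF conta] continuous_on_subset[OF cg]; use rb in auto)+
        show "x ?q \<le> X" using A(1)[of ?q] a(1)[of ?q] rb \<sigma> \<beta> by (auto simp: x_def X_def intro!: power_mono add_increasing2 order_trans[OF _ power_mono[of "a ?q" A 2]])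
        show "1 / (x ?q - x r) \<le> T"
        proof -
          have "1 / (x ?q - x r) \<le> 1 / (b0 / A * (\<rho> / 2))" by (rule divide_left_mono[OF \<Delta> zero_le_one mult_pos_pos[OF less_le_trans[OF \<Delta>0 \<Delta>] \<Delta>0]])
          also have "\<dots> = 2 * A / (\<rho> * b0)" using b0 A \<sigma> by (simp add: field_simps)
          also have "\<dots> \<le> T" by (rule T(5))
          finally show ?thesis .
        qed
        show "8 * T^2 * h \<le> min (1/2) (5/16 * b0^2 / (8 * m)) * m"
          using mult_left_mono[of "8 * h" c1 m] hc m unfolding c1_def[symmetric] by (simp add: m_def mult_ac)
      qed (use \<sigma> b0 \<Delta> \<Delta>0 T h3 h1 hl in \<open>auto simp: m_def\<close>)
      moreover have "?J \<le> l^2 * ((KK / a0^2 + 2 * A^2) * E)"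
      proof -
        let ?k = "\<lambda>t. KK * l^2 / a0^2 * (u t ^ 2 * a t) + 2 * A^2 * (\<gamma> t ^ 2 * a t)"
        have cc: "continuous_on {r..?q} u" "continuous_on {r..?q} a" "continuous_on {r..?q} \<gamma>"
          by (rule continuous_on_subset[OF contu] continuous_on_subset[OF conta] continuous_on_subset[OF cg], use rb in auto)+
        have "?J \<le> integral {r..?q} ?k"
        proof (rule integral_le)
          have "\<And>t. t \<in> {r..?q} \<Longrightarrow> a t \<noteq> 0" using a(1) I sub by force
          then show "(\<lambda>t. (KK * l^2 * u t ^ 2 + 2 * (a t ^ 2 * \<gamma> t) ^ 2) / a t) integrable_on {r..?q}"
            by (intro integrable_continuous_real continuous_intros cc) auto
          show "?k integrable_on {r..?q}" using a0(1) by (intro integrable_continuous_real continuous_intros cc) auto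
          fix t assume t: "t \<in> {r..?q}"
          have at: "0 < a t" "a0 \<le> a t" "a t \<le> A" using a(1) a0(2) A(1) I sub[OF t] by auto
          have "a0^2 \<le> a t ^ 2" using at a0 by (intro power_mono) auto
          then have "u t ^ 2 * a0^2 \<le> u t ^ 2 * a t ^ 2" by (intro mult_left_mono) auto
          then have "u t ^ 2 / a t \<le> (u t ^ 2 * a t) / a0^2" using at a0(1) by (simp add: field_simps power2_eq_square)
          then have "(KK * l^2) * (u t ^ 2 / a t) \<le> (KK * l^2) * ((u t ^ 2 * a t) / a0^2)" using KK by (intro mult_left_mono) auto
          moreover have "(a t ^ 2 * \<gamma> t)^2 / a t \<le> A^2 * (\<gamma> t ^ 2 * a t)"
          proof -
            have "(a t ^ 2 * \<gamma> t)^2 / a t = a t ^ 2 * (\<gamma> t ^ 2 * a t)" using at by (simp add: power2_eq_square)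
            also have "\<dots> \<le> A^2 * (\<gamma> t ^ 2 * a t)" using at by (intro mult_right_mono power_mono) auto
            finally show ?thesis .
          qed
          ultimately show "(KK * l^2 * u t ^ 2 + 2 * (a t ^ 2 * \<gamma> t) ^ 2) / a t \<le> ?k t"
            by (simp add: add_divide_distrib)
        qed
        also have "\<dots> = KK * l^2 / a0^2 * integral {r..?q} (\<lambda>t. u t ^ 2 * a t) + 2 * A^2 * integral {r..?q} (\<lambda>t. \<gamma> t ^ 2 * a t)"
          by (subst Henstock_Kurzweil_Integration.integral_add)
            (use a0(1) in \<open>auto intro!: integrable_continuous_real continuous_intros cc\<close>)
        also have "\<dots> \<le> KK * l^2 / a0^2 * E + 2 * A^2 * (l powr (4/3) * E)"
        proof -
          have rq: "0 < r" "r \<le> ?q" "?q \<le> ?e" using rb \<sigma> by auto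
          show ?thesis using EE[rule_format, OF rq] KK by (intro add_mono mult_left_mono) auto
        qed
        also have "\<dots> \<le> KK * l^2 / a0^2 * E + 2 * A^2 * (l^2 * E)"
          using p43 E0 by (intro add_left_mono mult_left_mono mult_right_mono) auto
        finally show ?thesis by (simp add: algebra_simps)
      qed
      ultimately have "u r ^ 2 * (c1 / 2 * l^2) \<le> (1 / sqrt (x r + h)) * (l^2 * ((KK / a0^2 + 2 * A^2) * E))"
        unfolding c1_def[symmetric] using r(2) h3(2) by (elim order_trans) (intro mult_left_mono, auto)
      also have "\<dots> = (C1 * E * (1 / sqrt (x r + h))) * (c1 / 2 * l^2)"
      proof -
        have "C1 = 2 / c1 * (KK / a0^2 + 2 * A^2)" by (simp add: C1_def KK_def)
        moreover have "R * (l^2 * (v * E)) = 2 / c1 * v * E * R * (c1 / 2 * l^2)" for R v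
          using c1 by (simp add: mult_ac)
        ultimately show ?thesis by (simp only:)
      qed
      finally have "u r ^ 2 * (c1 / 2 * l^2) \<le> (C1 * E * (1 / sqrt (x r + h))) * (c1 / 2 * l^2)" .
      moreover have "0 < c1 / 2 * l^2" using c1 l by simp
      ultimately show ?thesis by (rule mult_right_le_imp_le)
    qed
    have sI: "s \<in> ?I" "0 < s" using s \<sigma> by auto
    have xmono: "x p \<le> x q" if "0 < p" "p \<le> q" "q \<le> ?e" for p q
      using mono[OF that] a(1)[of p] that unfolding x_def by (auto intro!: power_mono)
    consider "0 \<le> x s" | "x s < 0" "- x s \<le> l powr (-1/2)" | "l powr (-1/2) < - x s" by linarith
    then have "u s ^ 2 \<le> (C2 + C3) * E * mode_bound l (x s)"
    proof cases
      case 1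
      have "u s ^ 2 \<le> C1 * E * (1 / sqrt (x s + h))" using osc[of s] s \<sigma> 1 by auto
      also have "\<dots> \<le> C1 * E * mode_bound l (x s)"
        using inverse_sqrt_le_mode_bound[OF l(1) 1 hp] C1 E0 by (intro mult_left_mono) auto
      also have "\<dots> \<le> (C2 + C3) * E * mode_bound l (x s)"
        using C2 C3 E0 by (intro mult_right_mono) (auto simp: mode_bound_def)
      finally show ?thesis .
    next
      case 2
      define d where "d = l powr (-1/2)"
      have dl: "d \<le> b0 / A * (\<rho> / 2)"
      proof -
        have "2 * A / (\<rho> * b0) \<le> sqrt l" using l(3) by (rule real_le_rsqrt)
        then have "1 / sqrt l \<le> 1 / (2 * A / (\<rho> * b0))" using A b0 \<sigma> l(1) by (intro divide_left_mono) auto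
        then show ?thesis using l(1) A b0 \<sigma> unfolding d_def by (simp add: powr_minus_divide powr_half_sqrt field_simps)
      qed
      let ?q = "s + \<rho> / 2"
      have "0 \<le> x ?q" using inc(1)[of s ?q] s \<sigma> 2 dl by (auto simp: d_def)
      moreover have "continuous_on {s..?q} x"
        by (rule DERIV_continuous_on, rule has_field_derivative_at_within, rule dx[unfolded DD_def]) (use s \<sigma> in auto)
      ultimately obtain st where st: "s \<le> st" "st \<le> ?q" "x st = 0" using IVT'[of x s 0 ?q] 2 \<sigma> by auto
      have ste: "st \<le> ?e" "\<sigma>0 \<le> st" "0 < st" using st s \<sigma> by auto
      have dist: "st - s \<le> A / b0 * d"
      proof -
        have "b0 / A * (st - s) \<le> d" using inc(1)[of s st] st s ste 2 by (auto simp: d_def)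
        then show ?thesis using b0 A by (simp add: field_simps)
      qed
      define \<kappa> where "\<kappa> = l powr (2/3)"
      have \<kappa>: "0 < \<kappa>" "l powr (4/3) = \<kappa> * \<kappa>" using l by (auto simp: \<kappa>_def powr_add[symmetric])
      have J: "- (\<kappa> * E) \<le> u t * U t" if t: "t \<in> {s..st}" for t
      proof -
        have t0: "0 < t" "t \<le> ?e" using t sI ste by auto
        let ?k = "\<lambda>r. \<kappa> / 2 * (u r ^ 2 * a r) + 1 / (2 * \<kappa>) * (\<gamma> r ^ 2 * a r)"
        show ?thesis
        proof (rule flux_lower_bound[OF t0(1), where k="?k"])
          fix r assume r: "r \<in> {0<..t}"
          then have re: "r \<in> {0<..?e}" using t0 by auto
          have ar: "0 < a r" using a(1)[OF re] .
          have xr: "x r \<le> 0" using xmono[of r st] r t ste st(3) by auto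
          have D: "DD a r u (U r)" "DD a r U (a r ^ 2 * \<gamma> r - l^2 * x r * u r)" using sol re unfolding x_def by auto
          show "DD a r (\<lambda>t. u t * U t) (U r ^ 2 + (a r ^ 2 * \<gamma> r) * u r - l^2 * x r * u r ^ 2)"
            by (rule DD_cong, rule DD_mult[OF D]) (simp add: power2_eq_square algebra_simps)
          have "0 \<le> (\<kappa> * u r + \<gamma> r)^2 / (2 * \<kappa>)" using \<kappa> by simp
          also have "\<dots> = \<kappa> / 2 * u r ^ 2 + \<gamma> r * u r + 1 / (2 * \<kappa>) * \<gamma> r ^ 2"
            using \<kappa> by (simp add: power2_eq_square field_simps)
          finally have "0 \<le> a r * (\<kappa> / 2 * u r ^ 2 + \<gamma> r * u r + 1 / (2 * \<kappa>) * \<gamma> r ^ 2)" using ar by simp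
          then have "- ?k r \<le> (a r ^ 2 * \<gamma> r) * u r / a r" using ar by (simp add: power2_eq_square algebra_simps)
          also have "\<dots> \<le> (U r ^ 2 + (a r ^ 2 * \<gamma> r) * u r - l^2 * x r * u r ^ 2) / a r"
          proof (rule divide_right_mono)
            have "l^2 * x r * u r ^ 2 \<le> 0" using xr by (simp add: mult_nonneg_nonpos mult_nonpos_nonneg)
            then show "(a r ^ 2 * \<gamma> r) * u r \<le> U r ^ 2 + (a r ^ 2 * \<gamma> r) * u r - l^2 * x r * u r ^ 2"
              using zero_le_power2[of "U r"] by linarith
          qed (use ar in simp)
          finally show "- ?k r \<le> (U r ^ 2 + (a r ^ 2 * \<gamma> r) * u r - l^2 * x r * u r ^ 2) / a r" .
          show "\<bar>u r\<bar> \<le> B" "\<bar>U r\<bar> \<le> B * a r" using sol re by auto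
        next
          have cc: "continuous_on {0<..t} u" "continuous_on {0<..t} a" "continuous_on {0<..t} \<gamma>"
            by (rule continuous_on_subset[OF contu] continuous_on_subset[OF conta] continuous_on_subset[OF cg], use t0 in auto)+
          show "continuous_on {0<..t} ?k" using \<kappa> by (intro continuous_intros cc) auto
          fix \<tau> :: real assume \<tau>: "0 < \<tau>" "\<tau> \<le> t"
          have cc: "continuous_on {\<tau>..t} u" "continuous_on {\<tau>..t} a" "continuous_on {\<tau>..t} \<gamma>"
            by (rule continuous_on_subset[OF contu] continuous_on_subset[OF conta] continuous_on_subset[OF cg], use t0 \<tau> in auto)+
          have "integral {\<tau>..t} ?k = \<kappa> / 2 * integral {\<tau>..t} (\<lambda>r. u r ^ 2 * a r) + 1 / (2 * \<kappa>) * integral {\<tau>..t} (\<lambda>r. \<gamma> r ^ 2 * a r)"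
            by (subst Henstock_Kurzweil_Integration.integral_add)
              (use \<kappa> in \<open>auto intro!: integrable_continuous_real continuous_intros cc\<close>)
          also have "\<dots> \<le> \<kappa> / 2 * E + 1 / (2 * \<kappa>) * (\<kappa> * \<kappa> * E)"
            using EE[rule_format, OF \<tau> t0(2)] \<kappa> by (intro add_mono mult_left_mono) auto
          also have "\<dots> = \<kappa> * E" using \<kappa> by simp
          finally show "integral {\<tau>..t} ?k \<le> \<kappa> * E" .
        qed (rule a(4))
      qed
      have "u s ^ 2 \<le> u st ^ 2 + integral {s..st} (\<lambda>t. 2 * (\<kappa> * E) / a0)"
      proof (rule le_plus_integral[OF st(1)])
        fix t assume t: "t \<in> {s..st}"
        then have tI: "t \<in> ?I" "t \<in> {0<..?e}" using s ste \<sigma> by auto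
        have at: "a0 \<le> a t" using a0 tI by auto
        have "DD a t (\<lambda>t. u t ^ 2) (2 * (u t * U t))"
          by (rule DD_cong, rule DD_power[of a t u "U t"]) (use sol tI in auto)
        then show "((\<lambda>t. u t ^ 2) has_real_derivative 2 * (u t * U t) / a t) (at t)" unfolding DD_def .
        have "- (2 * (\<kappa> * E) / a0) \<le> - (2 * (\<kappa> * E) / a t)"
          using at a0 \<kappa> E0 by (simp add: frac_le)
        also have "\<dots> = (2 * - (\<kappa> * E)) / a t" by simp
        also have "\<dots> \<le> 2 * (u t * U t) / a t" 
        proof (rule divide_right_mono)
          show "2 * - (\<kappa> * E) \<le> 2 * (u t * U t)" using J[OF t] by linarith
        qed (use at a0 in linarith)
        finally show "- (2 * (\<kappa> * E) / a0) \<le> 2 * (u t * U t) / a t" .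
      qed simp
      also have "integral {s..st} (\<lambda>t. 2 * (\<kappa> * E) / a0) = (st - s) * (2 * (\<kappa> * E) / a0)" using st by simp
      also have "\<dots> \<le> (A / b0 * d) * (2 * (\<kappa> * E) / a0)" using dist a0 \<kappa> E0 by (intro mult_right_mono) auto
      also have "\<dots> = 2 / a0 * (A / b0) * E * (d * \<kappa>)" by (simp add: mult_ac)
      also have "\<dots> \<le> 2 / a0 * (A / b0) * E * l powr (1/3)"
      proof -
        have "d * \<kappa> = l powr (1/6)" using l by (simp add: d_def \<kappa>_def powr_add[symmetric])
        also have "\<dots> \<le> l powr (1/3)" using l by (intro powr_mono) auto
        finally show ?thesis using a0 A b0 E0 by (intro mult_left_mono) auto
      qed
      also have "u st ^ 2 \<le> C1 * E * l powr (1/3)"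
      proof -
        have "u st ^ 2 \<le> C1 * E * (1 / sqrt (x st + h))" using osc[of st] st s \<sigma> by auto
        also have "\<dots> \<le> C1 * E * mode_bound l (x st)"
          using inverse_sqrt_le_mode_bound[OF l(1) _ hp, of "x st"] st C1 E0 by (intro mult_left_mono) auto
        also have "mode_bound l (x st) = l powr (1/3)" using st(3) by (simp add: mode_bound_def)
        finally show ?thesis .
      qed
      finally have "u s ^ 2 \<le> C1 * E * l powr (1/3) + 2 / a0 * (A / b0) * E * l powr (1/3)" by simp
      also have "\<dots> = C2 * E * l powr (1/3)" by (simp add: C2_def algebra_simps)
      also have "\<dots> \<le> (C2 + C3) * E * l powr (1/3)" using C3 E0 by (intro mult_right_mono) auto
      also have "l powr (1/3) = mode_bound l (x s)" using 2 by (simp add: mode_bound_def)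
      finally show ?thesis .
    next
      case 3
      define d where "d = - x s"
      define d' where "d' = min d 1"
      have d0: "0 < d" "l powr (-1/2) < d" using 3 powr_ge_zero[of l "-1/2"] by (auto simp: d_def simp del: powr_ge_zero)
      have d': "0 < d'" "d' \<le> 1" "d' \<le> d" "1 \<le> l^2 * d'^4"
      proof -
        show "0 < d'" "d' \<le> 1" "d' \<le> d" using d0 by (auto simp: d'_def)
        have "l powr (-1/2) \<le> d'" using d0 l powr_mono[of "-1/2" 0 l] by (auto simp: d'_def)
        then have "(l powr (-1/2))^4 \<le> d'^4" by (intro power_mono) auto
        moreover have "(l powr (-1/2))^4 = l powr (-2)" using l by (simp only: powr_power) simp
        moreover have "l powr (-2) = 1 / l^2" using l by (simp add: powr_minus_divide)
        ultimately have "1 / l^2 \<le> d'^4" by simp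
        then show "1 \<le> l^2 * d'^4" using l by (simp add: field_simps)
      qed
      \<comment> \<open>\<open>x\<close> increases at a rate of at most \<open>T / a0\<close>, so it stays below \<open>- d / 2\<close> on an interval of length \<open>r\<close>.\<close>
      define r where "r = c * d'"
      have r: "0 < r" "r \<le> \<rho> / 2" "r \<le> a0 / (2 * T) * d" 
      proof -
        show "0 < r" using c d' by (simp add: r_def)
        have "c * d' \<le> c" using mult_left_mono[of d' 1 c] c d' by simp
        then show "r \<le> \<rho> / 2" unfolding r_def using c by linarith
        show "r \<le> a0 / (2 * T) * d" unfolding r_def using c d' a0 T by (intro mult_mono) auto
      qed
      have re: "s + r \<le> ?e" using r s \<sigma> by auto
      have sub: "t \<in> {0<..?e}" if "t \<in> {0<..s+r}" for t using that re by auto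
      have sub2: "t \<in> ?I" if "t \<in> {s..s+r}" for t using that re s by auto
      have fe: "4 * a0 / r * u s ^ 2 \<le> 72 * A^4 / (l^2 * d * r^4 * a0^2) * E + 3 * A^2 / (l^2 * d) * (l powr (4/3) * E)"
      proof (rule deep_forbidden_amplitude[where a=a and a'=a' and u=u and x=x and U=U and \<gamma>=\<gamma> and B=B])
        show "0 < a t \<and> a t \<le> A" if "t \<in> {0<..s+r}" for t using a(1) A(1) sub[OF that] by auto
        show "(a has_real_derivative a' t) (at t)" "0 \<le> a' t" "a0 \<le> a t" if "t \<in> {s..s+r}" for t
          using a(2,3) a0(2) I sub2[OF that] less_imp_le by blast+
        show "continuous_on {0<..s+r} a" "continuous_on {0<..s+r} \<gamma>"
          by (rule continuous_on_subset[OF conta] continuous_on_subset[OF cg], use re in auto)+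
        show "DD a t u (U t)" "DD a t U (a t ^ 2 * \<gamma> t - l^2 * x t * u t)" "\<bar>u t\<bar> \<le> B" "\<bar>U t\<bar> \<le> B * a t" if "t \<in> {0<..s+r}" for t
          using sol sub[OF that] unfolding x_def by auto
        show "x t \<le> - (d / 2)" if t: "t \<in> {0<..s+r}" for t
        proof -
          have "x t \<le> x (s + r)" using xmono[of t "s+r"] t re by auto
          also have "\<dots> \<le> x s + T / a0 * r" using inc(2)[of s "s+r"] s r re by auto
          also have "\<dots> \<le> x s + T / a0 * (a0 / (2 * T) * d)" using r T a0 by (intro add_left_mono mult_left_mono) auto
          also have "\<dots> = - (d / 2)" using T a0 by (simp add: d_def)
          finally show ?thesis .
        qed
        show "integral {p..q} (\<lambda>t. u t ^ 2 * a t) \<le> E" "integral {p..q} (\<lambda>t. \<gamma> t ^ 2 * a t) \<le> l powr (4/3) * E"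
          if "0 < p" "p \<le> q" "q \<le> s + r" for p q
          using EE[rule_format, of p q] that re by auto
      qed (use sI r d0 l a0 a(4) in auto)
      have f1: "r / (4 * a0) * (72 * A^4 / (l^2 * d * r^4 * a0^2) * E) \<le> 18 * A^4 / (a0^3 * c^3) * E"
      proof -
        have "r / (4 * a0) * (72 * A^4 / (l^2 * d * r^4 * a0^2) * E) = 18 * A^4 / a0^3 * E * (1 / (l^2 * d * r^3))"
          using r a0 by (simp add: power2_eq_square power3_eq_cube power4_eq_xxxx mult_ac)
        also have "\<dots> \<le> 18 * A^4 / a0^3 * E * (1 / c^3)"
        proof (rule mult_left_mono)
          have "l^2 * d' * d'^3 \<le> l^2 * d * d'^3" using d' by (intro mult_right_mono mult_left_mono) auto
          then have "1 \<le> l^2 * d * d'^3" using d'(4) by (simp add: power3_eq_cube power4_eq_xxxx mult.assoc)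
          then have "c^3 * 1 \<le> c^3 * (l^2 * d * d'^3)" using c by (intro mult_left_mono) auto
          then have "c^3 \<le> l^2 * d * r^3" by (simp add: r_def power_mult_distrib mult_ac)
          then show "1 / (l^2 * d * r^3) \<le> 1 / c^3" using c r d0 l by (intro divide_left_mono) auto
        qed (use a0 E0 in simp)
        finally show ?thesis by simp
      qed
      have f2: "r / (4 * a0) * (3 * A^2 / (l^2 * d) * (l powr (4/3) * E)) \<le> c * A^2 / a0 * E"
      proof -
        have "r / d \<le> c" using d' d0 c unfolding r_def by (simp add: field_simps)
        moreover have "l powr (4/3) / l^2 \<le> 1" using p43 l by simp
        ultimately have "(r / d) * (l powr (4/3) / l^2) \<le> c * 1" using c by (intro mult_mono) auto
        then have "(3/4) * (A^2 / a0 * E) * ((r / d) * (l powr (4/3) / l^2)) \<le> (3/4) * (A^2 / a0 * E) * (c * 1)"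
          using a0 E0 by (intro mult_left_mono) auto
        also have "\<dots> = (3/4) * (c * A^2 / a0 * E)" by simp
        also have "\<dots> \<le> c * A^2 / a0 * E"
        proof -
          have "0 \<le> c * A^2 / a0 * E" using a0 E0 c by simp
          then show ?thesis using mult_right_mono[of "3/4" 1 "c * A^2 / a0 * E"] by simp
        qed
        also have "(3/4) * (A^2 / a0 * E) * ((r / d) * (l powr (4/3) / l^2)) = r / (4 * a0) * (3 * A^2 / (l^2 * d) * (l powr (4/3) * E))"
          by (simp add: mult_ac)
        finally show ?thesis .
      qed
      have "u s ^ 2 = r / (4 * a0) * (4 * a0 / r * u s ^ 2)" using r a0 by simp
      also have "\<dots> \<le> r / (4 * a0) * (72 * A^4 / (l^2 * d * r^4 * a0^2) * E + 3 * A^2 / (l^2 * d) * (l powr (4/3) * E))"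
        using fe r a0 by (intro mult_left_mono) auto
      also have "\<dots> \<le> 18 * A^4 / (a0^3 * c^3) * E + c * A^2 / a0 * E"
        unfolding distrib_left using f1 f2 by (rule add_mono)
      also have "\<dots> = C3 * E * 1" by (simp add: C3_def algebra_simps)
      also have "\<dots> \<le> (C2 + C3) * E * mode_bound l (x s)"
      proof (rule mult_mono)
        show "C3 * E \<le> (C2 + C3) * E" using C1 C2 E0 by (intro mult_right_mono) auto
        show "1 \<le> mode_bound l (x s)" using 3 d0 by (auto simp: mode_bound_def d_def)
      qed (use C1 C2 C3 E0 in auto)
      finally show ?thesis .
    qed
    then show "u s ^ 2 \<le> (C2 + C3) * E * mode_bound l (a s ^ 2 - \<beta>)" unfolding x_def .
  qed
qed


section \<open>Counting\<close>

text \<open>Orthogonal vectors are linearly independent. With the vectors normalised, Bessel's inequality for each of the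
  unit vectors of the coordinate space, summed over these unit vectors, counts both sides.\<close>

lemma card_orthogonal_le:
  fixes d :: "'n \<Rightarrow> 'w \<Rightarrow> complex"
  assumes W: "finite W" and S: "finite S"
    and nz: "\<And>n. n \<in> S \<Longrightarrow> \<exists>j\<in>W. d n j \<noteq> 0"
    and orth: "\<And>n m. n \<in> S \<Longrightarrow> m \<in> S \<Longrightarrow> n \<noteq> m \<Longrightarrow> (\<Sum>j\<in>W. d n j * cnj (d m j)) = 0"
  shows "card S \<le> card W"
proof -
  define N where "N n = (\<Sum>j\<in>W. (cmod (d n j))\<^sup>2)" for n
  have N: "0 < N n" if n: "n \<in> S" for n
  proof -
    obtain j where j: "j \<in> W" "d n j \<noteq> 0" using nz[OF n] by blast
    have "0 < (cmod (d n j))\<^sup>2" using j by simp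
    also have "\<dots> \<le> N n" unfolding N_def using W j by (intro member_le_sum) auto
    finally show ?thesis .
  qed
  have cz: "of_real ((cmod z)\<^sup>2) = z * cnj z" for z by (rule complex_norm_square)
  have NN: "(\<Sum>j\<in>W. d n j * cnj (d n j)) = of_real (N n)" for n
    unfolding N_def of_real_sum cz ..
  have bessel: "(\<Sum>n\<in>S. (cmod (d n j))\<^sup>2 / N n) \<le> 1" if j: "j \<in> W" for j
  proof -
    define p where "p i = (\<Sum>n\<in>S. cnj (d n j) / of_real (N n) * d n i)" for i
    define t where "t = (\<Sum>n\<in>S. (cmod (d n j))\<^sup>2 / N n)"
    have pj: "p j = of_real t"
      unfolding p_def t_def of_real_sum by (intro sum.cong refl) (simp add: cz mult.commute del: of_real_power)
    have pp: "(\<Sum>i\<in>W. p i * cnj (p i)) = of_real t"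
    proof -
      have "(\<Sum>i\<in>W. p i * cnj (p i)) = (\<Sum>i\<in>W. \<Sum>n\<in>S. \<Sum>m\<in>S. (cnj (d n j) / of_real (N n) * d n i) * (d m j / of_real (N m) * cnj (d m i)))"
        by (simp add: p_def sum_product)
      also have "\<dots> = (\<Sum>n\<in>S. \<Sum>m\<in>S. \<Sum>i\<in>W. (cnj (d n j) / of_real (N n) * d n i) * (d m j / of_real (N m) * cnj (d m i)))"
        by (subst sum.swap, intro sum.cong refl, subst sum.swap, rule refl)
      also have "\<dots> = (\<Sum>n\<in>S. \<Sum>m\<in>S. (cnj (d n j) / of_real (N n) * (d m j / of_real (N m))) * (\<Sum>i\<in>W. d n i * cnj (d m i)))"
        by (simp add: sum_distrib_left sum_divide_distrib mult_ac)
      also have "\<dots> = (\<Sum>n\<in>S. \<Sum>m\<in>S. if m = n then (cnj (d n j) / of_real (N n) * (d n j / of_real (N n))) * of_real (N n) else 0)"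
        by (intro sum.cong refl) (auto simp: orth NN)
      also have "\<dots> = (\<Sum>n\<in>S. (cnj (d n j) / of_real (N n) * (d n j / of_real (N n))) * of_real (N n))"
        using S by simp
      also have "\<dots> = of_real t"
        unfolding t_def of_real_sum
        by (intro sum.cong refl) (use N in \<open>simp add: cz mult_ac less_imp_neq[symmetric] del: of_real_power\<close>)
      finally show ?thesis .
    qed
    have "t * t \<le> t"
    proof -
      have "of_real (\<Sum>i\<in>W. (cmod (p i))\<^sup>2) = (\<Sum>i\<in>W. p i * cnj (p i))" by (simp only: of_real_sum cz)
      then have s: "(\<Sum>i\<in>W. (cmod (p i))\<^sup>2) = t" unfolding pp of_real_eq_iff .
      have "(cmod (p j))\<^sup>2 \<le> (\<Sum>i\<in>W. (cmod (p i))\<^sup>2)" using W j by (intro member_le_sum) auto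
      then show ?thesis unfolding s pj by (simp add: power2_eq_square)
    qed
    then have "t \<le> 1" by (cases "0 < t") (auto simp: mult_le_cancel_right1 mult_le_cancel_left2)
    then show ?thesis by (simp add: t_def)
  qed
  have "real (card S) = (\<Sum>n\<in>S. (\<Sum>j\<in>W. (cmod (d n j))\<^sup>2) / N n)"
    using N by (simp add: N_def[symmetric] less_imp_neq[symmetric])
  also have "\<dots> = (\<Sum>j\<in>W. \<Sum>n\<in>S. (cmod (d n j))\<^sup>2 / N n)"
    unfolding sum_divide_distrib by (rule sum.swap)
  also have "\<dots> \<le> (\<Sum>j\<in>W. 1)" by (intro sum_mono bessel)
  finally show ?thesis by simp
qed

text \<open>The distance of \<open>\<bar>n\<bar>\<close> from \<open>\<nu>\<close>, rounded down. Each value is taken by a bounded number of integers \<open>n\<close>.\<close>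

definition lvl :: "real \<Rightarrow> int \<Rightarrow> nat" where "lvl \<nu> n = nat \<lfloor>\<bar>\<bar>of_int n\<bar> - \<nu>\<bar>\<rfloor>"

lemma lvl_bounds: "real (lvl \<nu> n) \<le> \<bar>\<bar>of_int n\<bar> - \<nu>\<bar>" "\<bar>\<bar>of_int n\<bar> - \<nu>\<bar> < real (lvl \<nu> n) + 1"
  unfolding lvl_def by (simp_all add: of_nat_nat)

lemma card_lvl: "card {n \<in> S. lvl \<nu> n = k} \<le> 6"
proof -
  let ?F = "(\<lambda>(e, j). e * (\<lfloor>\<nu>\<rfloor> + j)) ` ({1, -1} \<times> {int k, int k + 1, - int k})"
  have "{n \<in> S. lvl \<nu> n = k} \<subseteq> ?F"
  proof
    fix n assume "n \<in> {n \<in> S. lvl \<nu> n = k}"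
    then have b: "real k \<le> \<bar>\<bar>of_int n\<bar> - \<nu>\<bar>" "\<bar>\<bar>of_int n\<bar> - \<nu>\<bar> < real k + 1" using lvl_bounds[where \<nu>=\<nu> and n=n] by auto
    define j where "j = \<bar>n\<bar> - \<lfloor>\<nu>\<rfloor>"
    have "of_int \<bar>n\<bar> = (\<bar>of_int n\<bar> :: real)" by simp
    then have "j = int k \<or> j = int k + 1 \<or> j = - int k" using b unfolding j_def by linarith
    moreover have "n = 1 * (\<lfloor>\<nu>\<rfloor> + j) \<or> n = (-1) * (\<lfloor>\<nu>\<rfloor> + j)" unfolding j_def by (cases "0 \<le> n") auto
    ultimately show "n \<in> ?F" by (auto simp: image_iff)
  qed
  then have "card {n \<in> S. lvl \<nu> n = k} \<le> card ?F" by (intro card_mono) auto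
  also have "\<dots> \<le> card ({1, -1::int} \<times> {int k, int k + 1, - int k})" by (intro card_image_le) auto
  also have "\<dots> \<le> 2 * 3" unfolding card_cartesian_product
    by (intro mult_mono) (auto intro: order_trans[OF card_insert_le_m1])
  finally show ?thesis by simp
qed

lemma sum_lvl_le:
  assumes S: "finite S" and f: "\<And>k. 0 \<le> f k"
  shows "(\<Sum>n\<in>{n \<in> S. lvl \<nu> n < m}. f (lvl \<nu> n)) \<le> 6 * (\<Sum>k<m. f k :: real)"
proof -
  have "(\<Sum>n\<in>{n \<in> S. lvl \<nu> n < m}. f (lvl \<nu> n)) = (\<Sum>k<m. \<Sum>n\<in>{n \<in> {n \<in> S. lvl \<nu> n < m}. lvl \<nu> n = k}. f (lvl \<nu> n))"
    by (rule sum.group[symmetric]) (use S in auto)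
  also have "\<dots> = (\<Sum>k<m. real (card {n \<in> {n \<in> S. lvl \<nu> n < m}. lvl \<nu> n = k}) * f k)"
    by (intro sum.cong refl) simp
  also have "\<dots> \<le> (\<Sum>k<m. 6 * f k)"
  proof (intro sum_mono mult_right_mono f)
    fix k
    have "card {n \<in> {n \<in> S. lvl \<nu> n < m}. lvl \<nu> n = k} \<le> 6" by (rule card_lvl)
    then show "real (card {n \<in> {n \<in> S. lvl \<nu> n < m}. lvl \<nu> n = k}) \<le> 6" by simp
  qed
  finally show ?thesis by (simp add: sum_distrib_left)
qed

lemma sum_inverse_sqrt: "(\<Sum>k<m. 1 / sqrt (real (max 1 k))) \<le> 1 + 2 * sqrt (real m)"
proof -
  have "(\<Sum>k<Suc m. 1 / sqrt (real (max 1 k))) \<le> 1 + 2 * sqrt (real m)" for m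
  proof (induction m)
    case (Suc m)
    let ?p = "sqrt (real (Suc m))" and ?q = "sqrt (real m)"
    have pq: "0 < ?p" "0 \<le> ?q" "?q \<le> ?p" by auto
    have prod: "(?p - ?q) * (?p + ?q) = 1" by (simp add: algebra_simps)
    have nz: "?p + ?q \<noteq> 0" using pq by linarith
    have d: "?p - ?q = 1 / (?p + ?q)" by (rule iffD2[OF nonzero_eq_divide_eq[OF nz] prod])
    have "1 / (2 * ?p) \<le> 1 / (?p + ?q)" using pq by (intro divide_left_mono) (auto intro!: mult_pos_pos add_pos_nonneg)
    then have "1 / ?p \<le> 2 * (?p - ?q)" unfolding d by simp
    then show ?case using Suc by simp
  qed simp
  note * = this
  show ?thesis
  proof (cases m)
    case (Suc k)
    have "sqrt (real k) \<le> sqrt (real m)" using Suc by simp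
    then show ?thesis using *[of k] unfolding Suc by linarith
  qed simp
qed

lemma mode_bound_far:
  assumes l: "1 \<le> l" and A: "0 < a0" "a0 \<le> A" and far: "l powr (-1/2) < \<bar>A\<^sup>2 - (of_int n)\<^sup>2 / l\<^sup>2\<bar>"
  shows "mode_bound l (A\<^sup>2 - (of_int n)\<^sup>2 / l\<^sup>2) \<le> 1 + sqrt (l / a0) * (1 / sqrt (real (max 1 (lvl (A * l) n))))
     + (if lvl (A * l) n = 0 then l powr (1/4) else 0)"
proof -
  let ?x = "A\<^sup>2 - (of_int n)\<^sup>2 / l\<^sup>2" and ?k = "lvl (A * l) n"
  have x0: "0 < \<bar>?x\<bar>" using far powr_gt_zero[of l "-1/2"] l by linarith
  have mb: "mode_bound l ?x = 1 + 1 / sqrt \<bar>?x\<bar>" using far by (simp add: mode_bound_def)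
  show ?thesis
  proof (cases "?k = 0")
    case True
    have "sqrt (l powr (-1/2)) = l powr (-1/4)" using l by (simp add: powr_half_sqrt[symmetric] powr_powr)
    then have "l powr (-1/4) \<le> sqrt \<bar>?x\<bar>" using far by (metis less_imp_le real_sqrt_le_iff)
    then have "1 / sqrt \<bar>?x\<bar> \<le> 1 / l powr (-1/4)" using l x0 by (intro divide_left_mono mult_pos_pos) auto
    also have "\<dots> = l powr (1/4)" using l by (simp add: powr_minus_divide)
    finally have "1 / sqrt \<bar>?x\<bar> \<le> l powr (1/4)" .
    moreover have "0 \<le> sqrt (l / a0) * (1 / sqrt (real (max 1 ?k)))" using l A by simp
    ultimately show ?thesis unfolding mb if_P[OF True] by linarith
  next
    case False
    have k: "1 \<le> ?k" using False by simp
    let ?D = "\<bar>\<bar>of_int n\<bar> - A * l\<bar> :: real"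
    have "\<bar>?x\<bar> * l\<^sup>2 = \<bar>(A * l)\<^sup>2 - (of_int n)\<^sup>2\<bar>"
    proof -
      have "\<bar>?x\<bar> * l\<^sup>2 = \<bar>?x * l\<^sup>2\<bar>" by (simp add: abs_mult)
      also have "?x * l\<^sup>2 = (A * l)\<^sup>2 - (of_int n)\<^sup>2" using l by (simp add: field_simps power2_eq_square)
      finally show ?thesis .
    qed
    also have "\<dots> = ?D * (\<bar>of_int n\<bar> + A * l)"
    proof -
      have "(A * l)\<^sup>2 - (of_int n)\<^sup>2 = (A * l - \<bar>of_int n\<bar>) * (A * l + \<bar>of_int n\<bar>)"
        by (simp add: power2_eq_square algebra_simps)
      then show ?thesis using A l by (simp add: abs_mult abs_minus_commute add.commute)
    qed
    also have "\<dots> \<ge> real ?k * (a0 * l)"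
      using lvl_bounds(1)[where \<nu>="A * l" and n=n] A l by (intro mult_mono) (auto intro!: add_increasing mult_right_mono)
    finally have "real ?k * (a0 * l) \<le> \<bar>?x\<bar> * l\<^sup>2" .
    then have "real ?k * a0 / l \<le> \<bar>?x\<bar>" using l by (simp add: field_simps power2_eq_square)
    then have "sqrt (real ?k * a0 / l) \<le> sqrt \<bar>?x\<bar>" by simp
    moreover have pos: "0 < sqrt (real ?k * a0 / l)" using k A l by simp
    ultimately have "1 / sqrt \<bar>?x\<bar> \<le> 1 / sqrt (real ?k * a0 / l)" using x0 by (intro divide_left_mono mult_pos_pos) auto
    also have "\<dots> = sqrt (l / a0) * (1 / sqrt (real (max 1 ?k)))"
      using k A l by (simp add: real_sqrt_divide real_sqrt_mult max_def)
    finally show ?thesis unfolding mb using False by simp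
  qed
qed

lemma mode_bound_near:
  assumes l: "1 \<le> l" and A: "0 < a0" "a0 \<le> A" and near: "\<bar>A\<^sup>2 - (of_int n)\<^sup>2 / l\<^sup>2\<bar> \<le> l powr (-1/2)"
  shows "real (lvl (A * l) n) \<le> sqrt l / a0"
proof -
  let ?x = "A\<^sup>2 - (of_int n)\<^sup>2 / l\<^sup>2"
  let ?D = "\<bar>\<bar>of_int n\<bar> - A * l\<bar> :: real"
  have "?D * (a0 * l) \<le> ?D * (\<bar>of_int n\<bar> + A * l)"
    using A l by (intro mult_left_mono) (auto intro!: add_increasing mult_right_mono)
  also have "\<dots> = \<bar>(A * l)\<^sup>2 - (of_int n)\<^sup>2\<bar>"
  proof -
    have "(A * l)\<^sup>2 - (of_int n)\<^sup>2 = (A * l - \<bar>of_int n\<bar>) * (A * l + \<bar>of_int n\<bar>)"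
      by (simp add: power2_eq_square algebra_simps)
    then show ?thesis using A l by (simp add: abs_mult abs_minus_commute add.commute)
  qed
  also have "\<dots> = \<bar>?x\<bar> * l\<^sup>2"
  proof -
    have "(A * l)\<^sup>2 - (of_int n)\<^sup>2 = ?x * l\<^sup>2" using l by (simp add: field_simps power2_eq_square)
    then show ?thesis by (simp add: abs_mult)
  qed
  also have "\<dots> \<le> l powr (-1/2) * l\<^sup>2" using near by (intro mult_right_mono) auto
  also have "\<dots> = sqrt l * l" 
  proof -
    have "l powr (-1/2) * l powr 2 = l powr (1/2) * l powr 1" using l by (simp only: powr_add[symmetric]) simp
    then show ?thesis using l by (simp add: powr_half_sqrt)
  qed
  finally have "?D * a0 \<le> sqrt l" using l by (simp add: mult.assoc[symmetric])
  then have "?D \<le> sqrt l / a0" using A by (simp add: field_simps)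
  then show ?thesis using lvl_bounds(1)[where \<nu>="A * l" and n=n] by linarith
qed

text \<open>With \<open>\<nu> = A l\<close> and \<open>k\<close> the distance of \<open>\<bar>n\<bar>\<close> from \<open>\<nu>\<close>, \<open>\<bar>x\<bar>\<close> is at least \<open>a0 k / l\<close>. The \<open>O (l\<^sup>1\<^sup>/\<^sup>2)\<close> integers near the
  caustic contribute \<open>l\<^sup>1\<^sup>/\<^sup>3\<close> each. For the others \<open>\<bar>x\<bar>\<^sup>-\<^sup>1\<^sup>/\<^sup>2\<close> is at most a multiple of \<open>(l / k)\<^sup>1\<^sup>/\<^sup>2\<close>; summed over the
  \<open>O (l\<^sup>2\<^sup>/\<^sup>3)\<close> smallest \<open>k\<close>, which is the worst case, this is \<open>l\<^sup>1\<^sup>/\<^sup>2 l\<^sup>1\<^sup>/\<^sup>3\<close>.\<close>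

theorem sum_mode_bound:
  fixes a0 c :: real
  assumes a0: "0 < a0" and c: "0 \<le> c"
  obtains C where "0 \<le> C" "\<And>l A (S :: int set). 1 \<le> l \<Longrightarrow> a0 \<le> A \<Longrightarrow> finite S \<Longrightarrow> real (card S) \<le> c * l powr (2/3) \<Longrightarrow>
    (\<Sum>n\<in>S. mode_bound l (A\<^sup>2 - (of_int n)\<^sup>2 / l\<^sup>2)) \<le> C * l powr (5/6)"
proof -
  define C where "C = (6 * (2 / a0 + 3)) + (c + sqrt (1 / a0) * (c + 42)) + 6"
  have C0: "0 \<le> C" using a0 c by (simp add: C_def)
  have main: "(\<Sum>n\<in>S. mode_bound l (A\<^sup>2 - (of_int n)\<^sup>2 / l\<^sup>2)) \<le> C * l powr (5/6)"
    if l: "1 \<le> l" and A: "a0 \<le> A" and S: "finite S" and cS: "real (card S) \<le> c * l powr (2/3)" for l A and S :: "int set"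
  proof -
    let ?x = "\<lambda>n. A\<^sup>2 - (of_int n)\<^sup>2 / l\<^sup>2" and ?k = "lvl (A * l)"
    have pw: "l powr p \<le> l powr (5/6)" if "p \<le> 5/6" for p using l that by (intro powr_mono) auto
    have one: "1 \<le> l powr (5/6)" using l by (simp add: ge_one_powr_ge_zero)
    define m1 where "m1 = nat \<lceil>sqrt l / a0\<rceil> + 1"
    \<comment> \<open>As \<open>S\<close> has at most \<open>c m\<close> elements, those of level \<open>m\<close> or more contribute at most \<open>c m\<^sup>1\<^sup>/\<^sup>2\<close>.\<close>
    define m where "m = nat \<lceil>l powr (2/3)\<rceil>"
    have m: "l powr (2/3) \<le> real m" "real m \<le> 2 * l powr (2/3)" "1 \<le> m"
    proof -
      have g: "1 \<le> l powr (2/3)" using l by (simp add: ge_one_powr_ge_zero)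
      show 1: "l powr (2/3) \<le> real m" unfolding m_def by linarith
      have "real m \<le> l powr (2/3) + 1" unfolding m_def using g by linarith
      then show "real m \<le> 2 * l powr (2/3)" using g by simp
      show "1 \<le> m" using 1 g by linarith
    qed
    define near where "near = {n \<in> S. \<bar>?x n\<bar> \<le> l powr (-1/2)}"
    define far where "far = {n \<in> S. \<not> \<bar>?x n\<bar> \<le> l powr (-1/2)}"
    have "(\<Sum>n\<in>S. mode_bound l (?x n)) = (\<Sum>n\<in>near. mode_bound l (?x n)) + (\<Sum>n\<in>far. mode_bound l (?x n))"
    proof -
      have "S = near \<union> far" "near \<inter> far = {}" "finite near" "finite far" using S by (auto simp: near_def far_def)
      then show ?thesis by (metis sum.union_disjoint)
    qed
    also have "(\<Sum>n\<in>near. mode_bound l (?x n)) \<le> (6 * (2 / a0 + 3)) * l powr (5/6)"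
    proof -
      have "(\<Sum>n\<in>near. mode_bound l (?x n)) = (\<Sum>n\<in>near. l powr (1/3))"
        by (intro sum.cong refl) (simp add: near_def mode_bound_def)
      also have "\<dots> \<le> (\<Sum>n\<in>{n \<in> S. ?k n < m1}. l powr (1/3))"
      proof (rule sum_mono2)
        show "near \<subseteq> {n \<in> S. ?k n < m1}"
        proof
          fix n assume n: "n \<in> near"
          then have "real (?k n) \<le> sqrt l / a0" using mode_bound_near[OF l a0 A] by (simp add: near_def)
          then have "?k n < m1" unfolding m1_def by linarith
          then show "n \<in> {n \<in> S. ?k n < m1}" using n by (simp add: near_def)
        qed
      qed (use S in auto)
      also have "\<dots> \<le> 6 * (\<Sum>k<m1. l powr (1/3))" using sum_lvl_le[OF S, of "\<lambda>_. l powr (1/3)"] by simp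
      also have "\<dots> = 6 * (real m1 * l powr (1/3))" by simp
      also have "\<dots> \<le> 6 * (((2 / a0 + 3) * l powr (1/2)) * l powr (1/3))"
      proof (intro mult_left_mono mult_right_mono)
        have s: "sqrt l = l powr (1/2)" "1 \<le> l powr (1/2)" using l by (simp_all add: powr_half_sqrt)
        have "real m1 \<le> sqrt l / a0 + 2" unfolding m1_def using a0 l by (simp add: of_nat_nat) linarith
        also have "\<dots> \<le> (2 / a0) * l powr (1/2) + 3 * l powr (1/2)" using s a0 by (intro add_mono) (auto simp: field_simps)
        finally show "real m1 \<le> (2 / a0 + 3) * l powr (1/2)" by (simp add: distrib_right)
      qed auto
      also have "\<dots> = (6 * (2 / a0 + 3)) * (l powr (1/2) * l powr (1/3))" by (simp only: mult_ac)
      also have "l powr (1/2) * l powr (1/3) = l powr (5/6)" by (simp add: powr_add[symmetric])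
      finally show ?thesis .
    qed
    also have "(\<Sum>n\<in>far. mode_bound l (?x n)) \<le> (c + sqrt (1 / a0) * (c + 42) + 6) * l powr (5/6)"
    proof -
      let ?g = "\<lambda>k. 1 / sqrt (real (max 1 k))" and ?h = "\<lambda>k::nat. if k = 0 then l powr (1/4) else 0"
      have "(\<Sum>n\<in>far. mode_bound l (?x n)) \<le> (\<Sum>n\<in>far. 1 + sqrt (l / a0) * ?g (?k n) + ?h (?k n))"
        using mode_bound_far[OF l a0 A] by (intro sum_mono) (auto simp: far_def not_le)
      also have "\<dots> \<le> (\<Sum>n\<in>S. 1 + sqrt (l / a0) * ?g (?k n) + ?h (?k n))"
        by (rule sum_mono2) (use S l a0 in \<open>auto simp: far_def\<close>)
      also have "\<dots> = real (card S) + sqrt (l / a0) * (\<Sum>n\<in>S. ?g (?k n)) + (\<Sum>n\<in>S. ?h (?k n))"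
        by (simp add: sum.distrib sum_distrib_left)
      also have "(\<Sum>n\<in>S. ?h (?k n)) \<le> 6 * l powr (5/6)"
      proof -
        have "(\<Sum>n\<in>S. ?h (?k n)) = (\<Sum>n\<in>{n \<in> S. ?k n < 1}. ?h (?k n))"
          by (rule sum.mono_neutral_right) (use S in auto)
        also have "\<dots> \<le> 6 * (\<Sum>k<(1::nat). ?h k)" by (rule sum_lvl_le[OF S]) simp
        also have "\<dots> \<le> 6 * l powr (5/6)" using pw[of "1/4"] by simp
        finally show ?thesis .
      qed
      also have "(\<Sum>n\<in>S. ?g (?k n)) \<le> (c + 42) * l powr (1/3)"
      proof -
        have "(\<Sum>n\<in>S. ?g (?k n)) \<le> (\<Sum>n\<in>S. 1 / sqrt (real m) + (if ?k n < m then ?g (?k n) else 0))"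
        proof (rule sum_mono)
          fix n
          show "?g (?k n) \<le> 1 / sqrt (real m) + (if ?k n < m then ?g (?k n) else 0)"
          proof (cases "?k n < m")
            case False
            then have "1 / sqrt (real (max 1 (?k n))) \<le> 1 / sqrt (real m)"
              using m by (intro divide_left_mono mult_pos_pos) auto
            then show ?thesis using False by simp
          qed simp
        qed
        also have "\<dots> = real (card S) / sqrt (real m) + (\<Sum>n\<in>{n \<in> S. ?k n < m}. ?g (?k n))"
          by (simp add: sum.distrib sum.inter_filter[OF S] del: One_nat_def)
        also have "(\<Sum>n\<in>{n \<in> S. ?k n < m}. ?g (?k n)) \<le> 6 * (1 + 2 * sqrt (real m))"
          using sum_lvl_le[OF S, of ?g "A * l" m] sum_inverse_sqrt[of m] by simp
        also have "real (card S) / sqrt (real m) \<le> c * l powr (1/3)"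
        proof -
          have s: "l powr (1/3) = sqrt (l powr (2/3))" using l by (simp add: powr_half_sqrt[symmetric] powr_powr)
          have "real (card S) / sqrt (real m) \<le> c * l powr (2/3) / sqrt (l powr (2/3))"
            using cS m l c by (intro frac_le) auto
          also have "\<dots> = c * l powr (1/3)" unfolding s[symmetric] using l by (simp add: powr_diff[symmetric] times_divide_eq_right[symmetric] del: times_divide_eq_right)
          finally show ?thesis .
        qed
        also have "6 * (1 + 2 * sqrt (real m)) \<le> 42 * l powr (1/3)"
        proof -
          have "sqrt (real m) \<le> sqrt (4 * l powr (2/3))" using m(2) powr_ge_zero[of l "2/3"] by (intro real_sqrt_le_mono) linarith
          also have "\<dots> = 2 * l powr (1/3)" using l by (simp add: real_sqrt_mult powr_half_sqrt[symmetric] powr_powr)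
          finally have "sqrt (real m) \<le> 2 * l powr (1/3)" .
          moreover have "1 \<le> l powr (1/3)" using l by (simp add: ge_one_powr_ge_zero)
          moreover have "6 * (1 + 2 * x) \<le> 42 * y" if "x \<le> 2 * y" "1 \<le> y" for x y :: real
          proof -
            have "6 * (1 + 2 * x) \<le> 6 * (y + 2 * (2 * y))"
              by (rule mult_left_mono[OF add_mono[OF that(2) mult_left_mono[OF that(1)]]]) simp_all
            also have "\<dots> \<le> 42 * y" using that(2) by simp
            finally show ?thesis .
          qed
          ultimately show ?thesis by blast
        qed
        finally show ?thesis by (simp add: distrib_right)
      qed
      also have "sqrt (l / a0) * ((c + 42) * l powr (1/3)) = sqrt (1 / a0) * (c + 42) * l powr (5/6)"
      proof -
        have "sqrt (l / a0) = l powr (1/2) * sqrt (1 / a0)" using l by (simp add: real_sqrt_divide powr_half_sqrt)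
        moreover have "l powr (1/2) * l powr (1/3) = l powr (5/6)" by (simp add: powr_add[symmetric])
        ultimately show ?thesis by (metis (no_types, lifting) mult.assoc mult.commute)
      qed
      also have "real (card S) \<le> c * l powr (5/6)"
        using cS mult_left_mono[OF pw[of "2/3"] c] by simp
      finally show ?thesis using l a0 by (simp add: algebra_simps)
    qed
    finally show ?thesis by (simp add: C_def algebra_simps)
  qed
  show ?thesis using that[OF C0 main] by blast
qed


section \<open>Angular modes of functions on the sphere\<close>

lemma periodic_int:
  assumes p: "\<And>t. f (t + 2 * pi) = f t" shows "f (t + 2 * pi * of_int k) = f t"
proof -
  interpret periodic_fun_simple f "2 * pi" by unfold_locales (rule p)
  show ?thesis using plus_of_int[of t k] by (simp add: mult.commute)
qed

lemma integral_periodic_shift: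
  fixes f :: "real \<Rightarrow> complex"
  assumes c: "continuous_on UNIV f" and p: "\<And>t. f (t + 2 * pi) = f t"
  shows "integral {0..2 * pi} (\<lambda>\<tau>. f (\<tau> + t)) = integral {0..2 * pi} f"
proof -
  have *: "integral {0..2 * pi} (\<lambda>\<tau>. f (\<tau> + s)) = integral {0..2 * pi} f" if s: "0 \<le> s" "s \<le> 2 * pi" for s
  proof -
    have i: "f integrable_on {x..y}" for x y
      by (intro integrable_continuous_real continuous_on_subset[OF c]) auto
    have sh: "integral {x..y} (\<lambda>\<tau>. f (\<tau> + d)) = integral {x + d..y + d} f" for x y d
      using integral_shift_Icc_real[of x y f d] by (simp add: comp_def add.commute)
    have "integral {0..2 * pi} (\<lambda>\<tau>. f (\<tau> + s)) = integral {s..2 * pi + s} f" using sh[of 0 "2 * pi" s] by simp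
    also have "\<dots> = integral {s..2 * pi} f + integral {2 * pi..2 * pi + s} f"
      by (rule Henstock_Kurzweil_Integration.integral_combine[symmetric]) (use s i in auto)
    also have "integral {2 * pi..2 * pi + s} f = integral {0..s} f"
      using sh[of 0 s "2 * pi"] by (simp add: p add.commute)
    also have "integral {s..2 * pi} f + integral {0..s} f = integral {0..2 * pi} f"
      using Henstock_Kurzweil_Integration.integral_combine[OF s i] by (simp add: add.commute)
    finally show ?thesis .
  qed
  define k where "k = \<lfloor>t / (2 * pi)\<rfloor>"
  define s where "s = t - 2 * pi * of_int k"
  have "of_int k \<le> t / (2 * pi)" "t / (2 * pi) < of_int k + 1" unfolding k_def by linarith+
  then have s: "0 \<le> s" "s \<le> 2 * pi" by (auto simp: s_def field_simps)
  have "f (\<tau> + t) = f (\<tau> + s)" for \<tau>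
    using periodic_int[of f "\<tau> + s" k, OF p] by (simp add: s_def)
  then show ?thesis using *[OF s] by simp
qed

lemma fourier_shift:
  assumes c: "continuous_on UNIV f" and p: "\<And>t. f (t + 2 * pi) = f t"
  shows "fourier (\<lambda>\<tau>. f (\<tau> + t)) n = cis (of_int n * t) * fourier f n"
proof -
  let ?g = "\<lambda>\<tau>. f \<tau> * cis (- (of_int n * \<tau>))"
  have per: "?g (\<tau> + 2 * pi) = ?g \<tau>" for \<tau>
  proof -
    have "cis (- (of_int n * (\<tau> + 2 * pi))) = cis (- (of_int n * \<tau>)) * cis (2 * pi * of_int (- n))"
      unfolding cis_mult by (simp add: algebra_simps)
    also have "cis (2 * pi * of_int (- n)) = 1" by (rule cis_multiple_2pi) simp
    finally show ?thesis by (simp add: p)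
  qed
  have eq: "f (\<tau> + t) * cis (- (of_int n * \<tau>)) = cis (of_int n * t) * ?g (\<tau> + t)" for \<tau>
  proof -
    have "cis (of_int n * t) * cis (- (of_int n * (\<tau> + t))) = cis (- (of_int n * \<tau>))"
      unfolding cis_mult by (simp add: algebra_simps)
    then show ?thesis by (simp add: mult_ac)
  qed
  have "integral {0..2 * pi} (\<lambda>\<tau>. f (\<tau> + t) * cis (- (of_int n * \<tau>))) =
      integral {0..2 * pi} (\<lambda>\<tau>. cis (of_int n * t) * ?g (\<tau> + t))"
    by (rule Henstock_Kurzweil_Integration.integral_cong) (rule eq)
  also have "\<dots> = cis (of_int n * t) * integral {0..2 * pi} (\<lambda>\<tau>. ?g (\<tau> + t))"
    by (rule Henstock_Kurzweil_Integration.integral_mult_right)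
  also have "integral {0..2 * pi} (\<lambda>\<tau>. ?g (\<tau> + t)) = integral {0..2 * pi} ?g"
    by (rule integral_periodic_shift[OF cont_fourier_integrand[OF c] per])
  finally show ?thesis by (simp add: fourier_def)
qed

lemma fourier_lincomb:
  assumes "finite I" "\<And>i. i \<in> I \<Longrightarrow> continuous_on {0..2 * pi} (h i)"
  shows "fourier (\<lambda>t. \<Sum>i\<in>I. c i * h i t) n = (\<Sum>i\<in>I. c i * fourier (h i) n)"
proof -
  have "(\<lambda>t. (\<Sum>i\<in>I. c i * h i t) * cis (- (of_int n * t))) = (\<lambda>t. \<Sum>i\<in>I. c i * (h i t * cis (- (of_int n * t))))"
    by (simp add: fun_eq_iff sum_distrib_right mult.assoc)
  then show ?thesis
    unfolding fourier_def by (simp add: integral_lincomb[OF assms(1) cont_fourier_integrand[OF assms(2)]] sum_divide_distrib)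
qed

lemma continuous_on_pt [continuous_intros]:
  assumes "continuous_on A u" "continuous_on A v" shows "continuous_on A (\<lambda>x. pt (u x) (v x))"
proof -
  have lin: "bounded_linear (\<lambda>z::real \<times> real. pt (fst z) (snd z))"
    unfolding linear_conv_bounded_linear[symmetric]
    by (auto intro!: linearI simp: vec_eq_iff forall_2)
  have "continuous_on A (\<lambda>x. pt (fst (u x, v x)) (snd (u x, v x)))"
    by (rule continuous_on_compose2[OF linear_continuous_on[OF lin, of UNIV]]) (auto intro!: continuous_intros assms)
  then show ?thesis by simp
qed

context revolution
begin

lemma pt_cstrip: "s \<in> {0..L} \<Longrightarrow> pt s \<theta> \<in> cstrip" by (simp add: cstrip_def)

lemma Phi_pt_rot: "s \<in> {0..L} \<Longrightarrow> \<Phi> (pt s \<theta>) = rot \<theta> (\<Phi> (pt s 0))"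
proof -
  assume s: "s \<in> {0..L}"
  have "pt s 0 + axis 2 \<theta> = pt s \<theta>" by (simp add: vec_eq_iff forall_2 axis_def)
  then show ?thesis using rot_Phi[OF pt_cstrip[OF s], of \<theta> 0] by simp
qed

lemma Phi_pt_S2: "s \<in> {0..L} \<Longrightarrow> \<Phi> (pt s \<theta>) \<in> S2"
  using Phi_S2 pt_cstrip by blast

text \<open>Eigenfunctions are extended by 0 to 3-space, where they are discontinuous. What survives of their continuity still
  makes them Borel measurable and integrable for the measure on 3-space.\<close>

definition tame :: "(real^3 \<Rightarrow> complex) \<Rightarrow> bool" where
  "tame u \<longleftrightarrow> continuous_on S2 u \<and> (\<forall>P. P \<notin> S2 \<longrightarrow> u P = 0)"

lemma tame_measurable: assumes "tame u" shows "u \<in> borel_measurable borel"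
proof -
  have "(\<lambda>x. indicator S2 x *\<^sub>R u x) \<in> borel_measurable borel"
    by (rule borel_measurable_continuous_on_indicator) (use assms in \<open>auto simp: tame_def\<close>)
  moreover have "(\<lambda>x. indicator S2 x *\<^sub>R u x) = u"
    using assms by (auto simp: tame_def fun_eq_iff indicator_def)
  ultimately show ?thesis by simp
qed

lemma eigenspace_tame: assumes "u \<in> eigenspace g \<mu>" shows "tame u"
proof -
  obtain W F where W: "open W" "S2 \<subseteq> W" "\<And>k. times_differentiable k W F" "\<And>x. x \<in> S2 \<Longrightarrow> F x = u x"
    using assms unfolding eigenspace_def smooth_on_def by blast
  have "continuous_on S2 F"
    using times_differentiable_imp_continuous_on[OF W(3)] W(2) by (rule continuous_on_subset)
  then have "continuous_on S2 u" using W(4) by (rule continuous_on_eq)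
  then show ?thesis using assms unfolding eigenspace_def tame_def by simp
qed

lemma tame_lincomb:
  assumes "finite I" "\<And>i. i \<in> I \<Longrightarrow> tame (h i)" shows "tame (\<lambda>P. \<Sum>i\<in>I. c i * h i P)"
  using assms unfolding tame_def by (auto intro!: continuous_intros sum.neutral)

lemma tame_mult_cnj: assumes "tame u" "tame v" shows "tame (\<lambda>P. u P * cnj (v P))"
  using assms unfolding tame_def by (auto intro!: continuous_intros)

lemma tame_integrable: "tame u \<Longrightarrow> integrable MM u"
  using surface_integral(1)[OF tame_measurable] by (simp add: tame_def)

lemma L2_inner_tame:
  assumes "tame u" "tame v"
  shows "L2_inner MM u v = integral {0..L} (\<lambda>s. a s *\<^sub>R integral {0..2 * pi} (\<lambda>\<theta>. u (\<Phi> (pt s \<theta>)) * cnj (v (\<Phi> (pt s \<theta>)))))"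
  unfolding L2_inner_def using tame_mult_cnj[OF assms]
  by (intro surface_integral(2) tame_measurable) (simp_all add: tame_def)

lemma L2_inner_lincomb:
  assumes "finite I" "\<And>i. i \<in> I \<Longrightarrow> tame (h i)" "tame v"
  shows "L2_inner MM (\<lambda>P. \<Sum>i\<in>I. c i * h i P) v = (\<Sum>i\<in>I. c i * L2_inner MM (h i) v)"
proof -
  have "L2_inner MM (\<lambda>P. \<Sum>i\<in>I. c i * h i P) v = (LINT P|MM. (\<Sum>i\<in>I. c i * (h i P * cnj (v P))))"
    unfolding L2_inner_def by (simp add: sum_distrib_right mult.assoc)
  also have "\<dots> = (\<Sum>i\<in>I. (LINT P|MM. c i * (h i P * cnj (v P))))"
    by (intro Bochner_Integration.integral_sum integrable_mult_right tame_integrable tame_mult_cnj assms)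
  finally show ?thesis unfolding L2_inner_def by simp
qed

lemma L2_inner_cnj: "L2_inner MM u v = cnj (L2_inner MM v u)"
proof -
  have "(\<lambda>P. u P * cnj (v P)) = (\<lambda>P. cnj (v P * cnj (u P)))" by (simp add: mult.commute)
  then show ?thesis unfolding L2_inner_def by (simp only: Bochner_Integration.integral_cnj)
qed

lemma orbit_continuous:
  assumes "continuous_on S2 u" "P \<in> S2" shows "continuous_on UNIV (\<lambda>t. u (rot t P))"
proof -
  obtain x where x: "x \<in> cstrip" "\<Phi> x = P" using Phi_surj[OF assms(2)] by blast
  have e: "x + axis 2 t = pt (x $ 1) (x $ 2 + t)" for t by (simp add: vec_eq_iff forall_2 axis_def)
  have "continuous_on UNIV (\<lambda>t. u (\<Phi> (x + axis 2 t)))"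
    unfolding e
    by (rule continuous_on_compose2[OF cont_coords[OF assms(1)]])
      (use x in \<open>auto simp: cstrip_def intro!: continuous_intros\<close>)
  then show ?thesis using rot_Phi[OF x(1)] x(2) by simp
qed

lemma orbit_periodic: assumes "P \<in> S2" shows "rot (t + 2 * pi) P = rot t P"
proof -
  obtain x where x: "x \<in> cstrip" "\<Phi> x = P" using Phi_surj[OF assms] by blast
  show ?thesis unfolding x(2)[symmetric] rot_Phi[OF x(1)] axis2_add[symmetric]
    using coords unfolding revolution_coordinates_def by blast
qed

text \<open>The isotypic component on which the rotation by \<open>t\<close> acts as multiplication by \<open>exp (i n t)\<close>, as
  \<open>mode_rot\<close> shows.\<close>

definition mode :: "int \<Rightarrow> (real^3 \<Rightarrow> complex) \<Rightarrow> real^3 \<Rightarrow> complex" where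
  "mode n u P = (if P \<in> S2 then fourier (\<lambda>t. u (rot t P)) n else 0)"

lemma mode_rot:
  assumes "continuous_on S2 u" "P \<in> S2" shows "mode n u (rot t P) = cis (of_int n * t) * mode n u P"
proof -
  have "(\<lambda>\<tau>. u (rot \<tau> (rot t P))) = (\<lambda>\<tau>. u (rot (\<tau> + t) P))"
    by (simp add: rot_add[OF assms(2)] add.commute)
  moreover have "fourier (\<lambda>\<tau>. u (rot (\<tau> + t) P)) n = cis (of_int n * t) * fourier (\<lambda>\<tau>. u (rot \<tau> P)) n"
    by (rule fourier_shift[OF orbit_continuous[OF assms]]) (simp add: orbit_periodic[OF assms(2)])
  ultimately show ?thesis using assms(2) rot_S2[OF assms(2)] by (simp add: mode_def)
qed

lemma mode_lincomb:
  assumes "finite I" "\<And>i. i \<in> I \<Longrightarrow> tame (h i)"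
  shows "mode n (\<lambda>P. \<Sum>i\<in>I. c i * h i P) P = (\<Sum>i\<in>I. c i * mode n (h i) P)"
proof (cases "P \<in> S2")
  case True
  have "fourier (\<lambda>t. \<Sum>i\<in>I. c i * h i (rot t P)) n = (\<Sum>i\<in>I. c i * fourier (\<lambda>t. h i (rot t P)) n)"
    by (rule fourier_lincomb[OF assms(1)])
      (use assms(2) True in \<open>auto intro!: continuous_on_subset[OF orbit_continuous] simp: tame_def\<close>)
  then show ?thesis using True by (simp add: mode_def)
qed (simp add: mode_def)

text \<open>A continuous function on an orbit is determined by its Fourier coefficients, so a function with finitely many
  modes is their sum.\<close>

lemma mode_reconstruction:
  assumes u: "tame u" and P: "P \<in> S2" and S: "finite S" and z: "\<And>n. n \<notin> S \<Longrightarrow> mode n u P = 0"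
  shows "u P = (\<Sum>n\<in>S. mode n u P)"
proof -
  have cu: "continuous_on UNIV (\<lambda>t. u (rot t P))"
    using u P by (intro orbit_continuous) (simp_all add: tame_def)
  have cc: "continuous_on A (\<lambda>t. cis (of_int n * t))" for n A unfolding cis_conv_exp by (intro continuous_intros)
  define f where "f t = u (rot t P) - (\<Sum>n\<in>S. mode n u P * cis (of_int n * t))" for t
  have "f 0 = 0"
  proof (rule fourier_unique_periodic)
    show "continuous_on UNIV f" unfolding f_def by (intro continuous_intros cu cc)
    show "f (t + 2 * pi) = f t" for t
    proof -
      have "cis (of_int n * (t + 2 * pi)) = cis (of_int n * t)" for n
      proof -
        have "cis (of_int n * (t + 2 * pi)) = cis (of_int n * t) * cis (2 * pi * of_int n)"
          unfolding cis_mult by (simp add: algebra_simps)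
        also have "cis (2 * pi * of_int n) = 1" by (rule cis_multiple_2pi) simp
        finally show ?thesis by simp
      qed
      then show ?thesis by (simp add: f_def orbit_periodic[OF P])
    qed
    show "fourier f n = 0" for n
    proof -
      have "fourier f n = fourier (\<lambda>t. u (rot t P)) n - (\<Sum>m\<in>S. mode m u P * fourier (\<lambda>t. cis (of_int m * t)) n)"
        unfolding f_def by (rule fourier_add_scale) (auto intro: continuous_on_subset[OF cu] cc S)
      also have "(\<Sum>m\<in>S. mode m u P * fourier (\<lambda>t. cis (of_int m * t)) n) = (if n \<in> S then mode n u P else 0)"
        by (simp add: fourier_cis if_distrib[of "\<lambda>x. _ * x"] S cong: if_cong)
      finally show ?thesis using z[of n] P by (auto simp: mode_def split: if_splits)
    qed
  qed
  then show ?thesis by (simp add: f_def rot_0[OF P])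
qed

lemma mode_orthogonal:
  assumes "tame v" "tame w" "n \<noteq> m"
    and v: "\<And>P t. P \<in> S2 \<Longrightarrow> v (rot t P) = cis (of_int n * t) * v P"
    and w: "\<And>P t. P \<in> S2 \<Longrightarrow> w (rot t P) = cis (of_int m * t) * w P"
  shows "L2_inner MM v w = 0"
proof -
  have "integral {0..2 * pi} (\<lambda>\<theta>. v (\<Phi> (pt s \<theta>)) * cnj (w (\<Phi> (pt s \<theta>)))) = 0" if s: "s \<in> {0..L}" for s
  proof -
    have eq: "v (\<Phi> (pt s \<theta>)) * cnj (w (\<Phi> (pt s \<theta>))) = v (\<Phi> (pt s 0)) * cnj (w (\<Phi> (pt s 0))) * cis (of_int (n - m) * \<theta>)" for \<theta>
    proof -
      have "cis (of_int n * \<theta>) * cnj (cis (of_int m * \<theta>)) = cis (of_int (n - m) * \<theta>)"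
        unfolding cis_cnj cis_mult by (simp add: algebra_simps)
      moreover have "v (\<Phi> (pt s \<theta>)) = cis (of_int n * \<theta>) * v (\<Phi> (pt s 0))" "w (\<Phi> (pt s \<theta>)) = cis (of_int m * \<theta>) * w (\<Phi> (pt s 0))"
        using v[OF Phi_pt_S2[OF s]] w[OF Phi_pt_S2[OF s]] Phi_pt_rot[OF s, of \<theta>] by simp_all
      ultimately show ?thesis by (simp add: mult_ac)
    qed
    have "integral {0..2 * pi} (\<lambda>\<theta>. v (\<Phi> (pt s \<theta>)) * cnj (w (\<Phi> (pt s \<theta>)))) =
      integral {0..2 * pi} (\<lambda>\<theta>. v (\<Phi> (pt s 0)) * cnj (w (\<Phi> (pt s 0))) * cis (of_int (n - m) * \<theta>))"
      by (rule Henstock_Kurzweil_Integration.integral_cong) (rule eq)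
    also have "\<dots> = v (\<Phi> (pt s 0)) * cnj (w (\<Phi> (pt s 0))) * integral {0..2 * pi} (\<lambda>\<theta>. cis (of_int (n - m) * \<theta>))"
      by (rule Henstock_Kurzweil_Integration.integral_mult_right)
    finally show ?thesis unfolding integral_cis using assms(3) by simp
  qed
  then have "integral {0..L} (\<lambda>s. a s *\<^sub>R integral {0..2 * pi} (\<lambda>\<theta>. v (\<Phi> (pt s \<theta>)) * cnj (w (\<Phi> (pt s \<theta>))))) = integral {0..L} (\<lambda>s. 0)"
    by (intro Henstock_Kurzweil_Integration.integral_cong) simp
  then show ?thesis by (simp add: L2_inner_tame[OF assms(1,2)])
qed

lemma continuous_surface_integral:
  fixes H :: "real \<Rightarrow> real^2 \<Rightarrow> complex"
  assumes H: "continuous_on (UNIV \<times> cstrip) (\<lambda>z. H (fst z) (snd z))"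
  shows "continuous_on UNIV (\<lambda>t. integral {0..L} (\<lambda>s. a s *\<^sub>R integral {0..2 * pi} (\<lambda>\<theta>. H t (pt s \<theta>))))"
proof -
  have 1: "continuous_on ((UNIV \<times> {0..L}) \<times> cbox 0 (2 * pi)) (\<lambda>(z, \<theta>). H (fst z) (pt (snd z) \<theta>))"
    unfolding case_prod_beta
    by (rule continuous_on_compose2[OF H, where f = "\<lambda>z. (fst (fst z), pt (snd (fst z)) (snd z))", simplified])
      (auto intro!: continuous_intros simp: cstrip_def)
  have 2: "continuous_on (UNIV \<times> {0..L}) (\<lambda>z. integral (cbox 0 (2 * pi)) (\<lambda>\<theta>. H (fst z) (pt (snd z) \<theta>)))"
    by (rule integral_continuous_on_param[OF 1])
  have "continuous_on (UNIV \<times> {0..L}) (\<lambda>z. a (snd z))"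
    by (rule continuous_on_compose2[OF continuous_a]) (auto intro!: continuous_intros)
  then have "continuous_on (UNIV \<times> cbox 0 L) (\<lambda>(t, s). a s *\<^sub>R integral (cbox 0 (2 * pi)) (\<lambda>\<theta>. H t (pt s \<theta>)))"
    unfolding case_prod_beta cbox_interval by (intro continuous_on_scaleR 2[unfolded cbox_interval])
  from integral_continuous_on_param[OF this] show ?thesis by simp
qed

text \<open>Bessel's inequality on each circle of latitude, integrated over the latitudes.\<close>

lemma mode_mass:
  assumes u: "tame u" and m: "\<And>n. n \<in> S \<Longrightarrow> tame (mode n u)" and S: "finite S"
  shows "(\<Sum>n\<in>S. 2 * pi * integral {0..L} (\<lambda>s. a s * (cmod (mode n u (\<Phi> (pt s 0))))\<^sup>2)) \<le> Re (L2_inner MM u u)"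
proof -
  have cu: "continuous_on cstrip (\<lambda>x. u (\<Phi> x))" by (rule cont_coords) (use u in \<open>simp add: tame_def\<close>)
  have cs: "continuous_on {0..2 * pi} (\<lambda>\<theta>. u (\<Phi> (pt s \<theta>)))" if "s \<in> {0..L}" for s
    by (rule continuous_on_compose2[OF cu]) (use that in \<open>auto intro!: continuous_intros pt_cstrip\<close>)
  have cm: "continuous_on {0..L} (\<lambda>s. mode n u (\<Phi> (pt s 0)))" if "n \<in> S" for n
    by (rule continuous_on_compose2[OF cont_coords]) (use m[OF that] in \<open>auto simp: tame_def intro!: continuous_intros pt_cstrip\<close>)
  define J where "J s = integral {0..2 * pi} (\<lambda>\<theta>. (cmod (u (\<Phi> (pt s \<theta>))))\<^sup>2)" for s
  have cJ: "continuous_on {0..L} J"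
  proof -
    have "continuous_on ({0..L} \<times> cbox 0 (2 * pi)) (\<lambda>(s, \<theta>). (cmod (u (\<Phi> (pt s \<theta>))))\<^sup>2)"
      unfolding case_prod_beta
      by (intro continuous_intros continuous_on_compose2[OF cu]) (auto intro!: continuous_intros pt_cstrip)
    from integral_continuous_on_param[OF this] show ?thesis by (simp add: J_def[abs_def])
  qed
  have bes: "(\<Sum>n\<in>S. 2 * pi * (cmod (mode n u (\<Phi> (pt s 0))))\<^sup>2) \<le> J s" if s: "s \<in> {0..L}" for s
  proof -
    have "(\<lambda>\<theta>. u (rot \<theta> (\<Phi> (pt s 0)))) = (\<lambda>\<theta>. u (\<Phi> (pt s \<theta>)))"
      by (rule ext) (rule arg_cong[where f=u, OF Phi_pt_rot[OF s, symmetric]])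
    then have "mode n u (\<Phi> (pt s 0)) = fourier (\<lambda>\<theta>. u (\<Phi> (pt s \<theta>))) n" for n
      by (simp only: mode_def Phi_pt_S2[OF s] if_True)
    then show ?thesis using bessel_fourier[OF cs[OF s] S] by (simp only: J_def)
  qed
  have "(\<Sum>n\<in>S. 2 * pi * integral {0..L} (\<lambda>s. a s * (cmod (mode n u (\<Phi> (pt s 0))))\<^sup>2)) =
    (\<Sum>n\<in>S. integral {0..L} (\<lambda>s. a s * (2 * pi * (cmod (mode n u (\<Phi> (pt s 0))))\<^sup>2)))"
    by (intro sum.cong refl trans[OF Henstock_Kurzweil_Integration.integral_mult_right[symmetric]]
      Henstock_Kurzweil_Integration.integral_cong) (simp only: mult_ac)
  also have "\<dots> = integral {0..L} (\<lambda>s. \<Sum>n\<in>S. a s * (2 * pi * (cmod (mode n u (\<Phi> (pt s 0))))\<^sup>2))"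
    by (intro Henstock_Kurzweil_Integration.integral_sum[symmetric] S integrable_continuous_real continuous_intros continuous_a cm)
  also have "\<dots> \<le> integral {0..L} (\<lambda>s. a s * J s)"
  proof (rule integral_le)
    show "(\<lambda>s. \<Sum>n\<in>S. a s * (2 * pi * (cmod (mode n u (\<Phi> (pt s 0))))\<^sup>2)) integrable_on {0..L}"
      by (intro integrable_continuous_real continuous_intros continuous_a cm)
    show "(\<lambda>s. a s * J s) integrable_on {0..L}"
      by (intro integrable_continuous_real continuous_intros continuous_a cJ)
    show "(\<Sum>n\<in>S. a s * (2 * pi * (cmod (mode n u (\<Phi> (pt s 0))))\<^sup>2)) \<le> a s * J s" if "s \<in> {0..L}" for s
      by (subst sum_distrib_left[symmetric], rule mult_left_mono[OF bes[OF that]]) (use a_nonneg[of s] that in auto)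
  qed
  also have "\<dots> = Re (L2_inner MM u u)"
  proof -
    have "of_real (J s) = integral {0..2 * pi} (\<lambda>\<theta>. u (\<Phi> (pt s \<theta>)) * cnj (u (\<Phi> (pt s \<theta>))))" if s: "s \<in> {0..L}" for s
    proof -
      have "(\<lambda>\<theta>. (cmod (u (\<Phi> (pt s \<theta>))))\<^sup>2) integrable_on {0..2 * pi}"
        by (intro integrable_continuous_real continuous_intros cs s)
      then have "of_real (J s) = integral {0..2 * pi} (\<lambda>\<theta>. of_real ((cmod (u (\<Phi> (pt s \<theta>))))\<^sup>2) :: complex)"
        unfolding J_def by (rule integral_linear[OF _ bounded_linear_of_real, unfolded comp_def, symmetric])
      then show ?thesis by (simp only: complex_norm_square)
    qed
    then have "L2_inner MM u u = integral {0..L} (\<lambda>s. a s *\<^sub>R of_real (J s))"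
      unfolding L2_inner_tame[OF u u] by (intro Henstock_Kurzweil_Integration.integral_cong) simp
    also have "\<dots> = of_real (integral {0..L} (\<lambda>s. a s * J s))"
    proof -
      have "(\<lambda>s. a s * J s) integrable_on {0..L}"
        by (intro integrable_continuous_real continuous_intros continuous_a cJ)
      then have "integral {0..L} (\<lambda>s. of_real (a s * J s) :: complex) = of_real (integral {0..L} (\<lambda>s. a s * J s))"
        by (rule integral_linear[OF _ bounded_linear_of_real, unfolded comp_def])
      then show ?thesis by (simp add: scaleR_conv_of_real)
    qed
    finally show ?thesis by simp
  qed
  finally show ?thesis .
qed

end

locale revolution_basis = revolution +
  fixes ev :: "nat \<Rightarrow> real" and e :: "nat \<Rightarrow> real^3 \<Rightarrow> complex"
  assumes basis: "laplace_eigenbasis g (riemannian_measure g L \<Phi>) ev e"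
begin

lemma ev_nonneg: "0 \<le> ev j" and finite_ev: "finite {j. ev j \<le> x}"
  and orthonormal: "L2_inner MM (e i) (e j) = (if i = j then 1 else 0)"
  using basis unfolding laplace_eigenbasis_def by auto

lemma eigenspace_range: "0 \<le> \<mu> \<Longrightarrow> eigenspace g \<mu> = range (\<lambda>c p. \<Sum>j | ev j = \<mu>. c j * e j p)"
  using basis unfolding laplace_eigenbasis_def by blast

lemma finite_level: "finite {j. ev j = \<mu>}"
  by (rule finite_subset[OF _ finite_ev[of \<mu>]]) auto

lemma e_eigenspace: "e j \<in> eigenspace g (ev j)"
proof -
  have "e j = (\<lambda>p. \<Sum>i | ev i = ev j. (if i = j then 1 else 0) * e i p)"
    by (simp add: fun_eq_iff if_distrib[of "\<lambda>x. x * _"] finite_level cong: if_cong)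
  then show ?thesis unfolding eigenspace_range[OF ev_nonneg]
    by (rule range_eqI[where x = "\<lambda>i. if i = j then 1 else 0"])
qed

lemma e_tame: "tame (e j)" by (rule eigenspace_tame[OF e_eigenspace])

lemma L2_inner_e:
  assumes "finite I" shows "L2_inner MM (\<lambda>P. \<Sum>i\<in>I. c i * e i P) (e j) = (if j \<in> I then c j else 0)"
  by (simp add: L2_inner_lincomb[OF assms e_tame e_tame] orthonormal if_distrib[of "\<lambda>x. _ * x"] assms cong: if_cong)

lemma eigenspace_expansion:
  assumes "u \<in> eigenspace g \<mu>" "0 \<le> \<mu>"
  shows "u = (\<lambda>P. \<Sum>j | ev j = \<mu>. L2_inner MM u (e j) * e j P)"
proof -
  obtain c where c: "u = (\<lambda>P. \<Sum>j | ev j = \<mu>. c j * e j P)" using assms eigenspace_range by blast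
  have "L2_inner MM u (e j) = c j" if "ev j = \<mu>" for j
    unfolding c L2_inner_e[OF finite_level] using that by simp
  then show ?thesis unfolding c by (intro ext sum.cong) (auto simp: c[symmetric])
qed

text \<open>The coefficients \<open>C t j\<close> of the rotated eigenfunction in the basis of its eigenspace are continuous in \<open>t\<close>, so the Fourier
  integral over \<open>t\<close> stays in the finite-dimensional eigenspace.\<close>

theorem mode_eigenspace:
  assumes u: "u \<in> eigenspace g \<mu>" and \<mu>: "0 \<le> \<mu>"
  shows "mode n u \<in> eigenspace g \<mu>"
proof -
  have tu: "tame u" by (rule eigenspace_tame[OF u])
  define C where "C t j = L2_inner MM (rotf t u) (e j)" for t j
  have ex: "rotf t u P = (\<Sum>j | ev j = \<mu>. C t j * e j P)" for t P
    using fun_cong[OF eigenspace_expansion[OF eigenspace_rotf[OF u] \<mu>]] unfolding C_def .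
  have cC: "continuous_on UNIV (\<lambda>t. C t j)" for j
  proof -
    have cu: "continuous_on cstrip (\<lambda>x. u (\<Phi> x))" by (rule cont_coords) (use tu in \<open>simp add: tame_def\<close>)
    have ce: "continuous_on cstrip (\<lambda>x. e j (\<Phi> x))" by (rule cont_coords) (use e_tame[of j] in \<open>simp add: tame_def\<close>)
    define H where "H t x = u (\<Phi> (pt (x $ 1) (x $ 2 + t))) * cnj (e j (\<Phi> x))" for t x
    have "continuous_on (UNIV \<times> cstrip) (\<lambda>z. H (fst z) (snd z))"
      unfolding H_def
      by (intro continuous_intros continuous_on_compose2[OF cu] continuous_on_compose2[OF ce])
        (auto intro!: continuous_intros simp: cstrip_def)
    from continuous_surface_integral[OF this]
    have c: "continuous_on UNIV (\<lambda>t. integral {0..L} (\<lambda>s. a s *\<^sub>R integral {0..2 * pi} (\<lambda>\<theta>. H t (pt s \<theta>))))" .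
    have "C t j = integral {0..L} (\<lambda>s. a s *\<^sub>R integral {0..2 * pi} (\<lambda>\<theta>. H t (pt s \<theta>)))" for t
    proof -
      have "rotf t u (\<Phi> (pt s \<theta>)) * cnj (e j (\<Phi> (pt s \<theta>))) = H t (pt s \<theta>)" if s: "s \<in> {0..L}" for s \<theta>
      proof -
        have "pt s \<theta> + axis 2 t = pt s (\<theta> + t)" by (simp add: vec_eq_iff forall_2 axis_def)
        then have "rotf t u (\<Phi> (pt s \<theta>)) = u (\<Phi> (pt s (\<theta> + t)))"
          using Phi_pt_S2[OF s, of \<theta>] rot_Phi[OF pt_cstrip[OF s], of t \<theta>] by (simp add: rotf_def)
        then show ?thesis by (simp add: H_def)
      qed
      then show ?thesis
        unfolding C_def L2_inner_tame[OF eigenspace_tame[OF eigenspace_rotf[OF u]] e_tame]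
        by (intro Henstock_Kurzweil_Integration.integral_cong) simp
    qed
    then show ?thesis using c by simp
  qed
  have "mode n u = (\<lambda>P. \<Sum>j | ev j = \<mu>. fourier (\<lambda>t. C t j) n * e j P)"
  proof
    fix P
    show "mode n u P = (\<Sum>j | ev j = \<mu>. fourier (\<lambda>t. C t j) n * e j P)"
    proof (cases "P \<in> S2")
      case True
      have "(\<lambda>t. u (rot t P)) = (\<lambda>t. \<Sum>j | ev j = \<mu>. e j P * C t j)"
        using ex[of _ P] True by (simp add: rotf_def fun_eq_iff mult.commute)
      then have "mode n u P = fourier (\<lambda>t. \<Sum>j | ev j = \<mu>. e j P * C t j) n" using True by (simp add: mode_def)
      also have "\<dots> = (\<Sum>j | ev j = \<mu>. e j P * fourier (\<lambda>t. C t j) n)"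
        by (rule fourier_lincomb[OF finite_level]) (rule continuous_on_subset[OF cC], simp)
      finally show ?thesis by (simp add: mult.commute)
    next
      case False
      then show ?thesis using e_tame by (simp add: mode_def tame_def)
    qed
  qed
  then show ?thesis unfolding eigenspace_range[OF \<mu>]
    by (rule range_eqI[where x = "\<lambda>j. fourier (\<lambda>t. C t j) n"])
qed

text \<open>Distinct modes are orthogonal and each lies in the span of the same eigenfunctions, so
  only as many modes can occur as there are eigenfunctions.\<close>

lemma active_modes:
  assumes W: "finite W" "\<And>j i. j \<in> W \<Longrightarrow> ev i = ev j \<Longrightarrow> i \<in> W"
  shows "finite {n. \<exists>j\<in>W. mode n (e j) \<noteq> (\<lambda>_. 0)}" "card {n. \<exists>j\<in>W. mode n (e j) \<noteq> (\<lambda>_. 0)} \<le> card W"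
proof -
  let ?S = "{n. \<exists>j\<in>W. mode n (e j) \<noteq> (\<lambda>_. 0)}"
  have le: "card T \<le> card W" if T: "finite T" "T \<subseteq> ?S" for T
  proof -
    have "\<exists>j\<in>W. mode n (e j) \<noteq> (\<lambda>_. 0)" if "n \<in> T" for n using that T by blast
    then obtain J where J: "J n \<in> W" "mode n (e (J n)) \<noteq> (\<lambda>_. 0)" if "n \<in> T" for n by metis
    define m where "m n = mode n (e (J n))" for n
    define d where "d n j = L2_inner MM (m n) (e j)" for n j
    have me: "m n \<in> eigenspace g (ev (J n))" for n
      unfolding m_def by (rule mode_eigenspace[OF e_eigenspace ev_nonneg])
    have tm: "tame (m n)" for n by (rule eigenspace_tame[OF me])
    have exp: "m n P = (\<Sum>j\<in>W. d n j * e j P)" if n: "n \<in> T" for n P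
    proof -
      have z: "d n j = 0" if "ev j \<noteq> ev (J n)" for j
      proof -
        have "d n j = L2_inner MM (\<lambda>P. \<Sum>i | ev i = ev (J n). L2_inner MM (m n) (e i) * e i P) (e j)"
          unfolding d_def using eigenspace_expansion[OF me ev_nonneg] by simp
        also have "\<dots> = 0" unfolding L2_inner_e[OF finite_level] using that by simp
        finally show ?thesis .
      qed
      have "m n P = (\<Sum>j | ev j = ev (J n). d n j * e j P)"
        using fun_cong[OF eigenspace_expansion[OF me ev_nonneg]] unfolding d_def .
      also have "\<dots> = (\<Sum>j\<in>W. d n j * e j P)"
        by (rule sum.mono_neutral_left) (use W J(1)[OF n] z in auto)
      finally show ?thesis .
    qed
    have rotm: "m n (rot t P) = cis (of_int n * t) * m n P" if "P \<in> S2" for n t P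
      unfolding m_def by (rule mode_rot) (use e_tame that in \<open>auto simp: tame_def\<close>)
    show ?thesis
    proof (rule card_orthogonal_le[OF W(1) T(1)])
      fix n assume n: "n \<in> T"
      show "\<exists>j\<in>W. d n j \<noteq> 0"
      proof (rule ccontr)
        assume "\<not> ?thesis"
        then have "m n = (\<lambda>_. 0)" using exp[OF n] by (auto simp: fun_eq_iff)
        then show False using J(2)[OF n] by (simp add: m_def)
      qed
    next
      fix n k assume n: "n \<in> T" and k: "k \<in> T" and ne: "n \<noteq> k"
      have "0 = L2_inner MM (m n) (m k)"
        by (rule mode_orthogonal[symmetric, OF tm tm ne]) (use rotm in auto)
      also have "m n = (\<lambda>P. \<Sum>j\<in>W. d n j * e j P)" using exp[OF n] by (rule ext)
      also have "L2_inner MM (\<lambda>P. \<Sum>j\<in>W. d n j * e j P) (m k) = (\<Sum>j\<in>W. d n j * L2_inner MM (e j) (m k))"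
        by (rule L2_inner_lincomb[OF W(1) e_tame tm])
      also have "\<dots> = (\<Sum>j\<in>W. d n j * cnj (d k j))"
        unfolding d_def[of k] by (intro sum.cong refl arg_cong[of _ _ "\<lambda>x. _ * x"] L2_inner_cnj)
      finally show "(\<Sum>j\<in>W. d n j * cnj (d k j)) = 0" by simp
    qed
  qed
  show fin: "finite ?S"
  proof (rule ccontr)
    assume "infinite ?S"
    then obtain T where "finite T" "card T = Suc (card W)" "T \<subseteq> ?S" using infinite_arbitrarily_large by blast
    then show False using le[of T] by simp
  qed
  show "card ?S \<le> card W" by (rule le[OF fin]) simp
qed

end


section \<open>Amplitude of the modes on each hemisphere\<close>

lemma smooth_real_derivative:
  fixes f :: "real \<Rightarrow> real"
  assumes o: "open A" and f: "\<And>k. times_differentiable k A f"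
  defines "f' \<equiv> \<lambda>x. frechet_derivative f (at x) 1"
  shows "times_differentiable k A f'" and "x \<in> A \<Longrightarrow> (f has_real_derivative f' x) (at x)" and "continuous_on A f'"
proof -
  show 1: "times_differentiable k A f'" for k unfolding f'_def by (rule times_differentiable_derivI(1)[OF o f])
  show "continuous_on A f'" using 1[of 0] by simp
  assume "x \<in> A"
  then have d: "(f has_derivative frechet_derivative f (at x)) (at x)" by (rule times_differentiable_derivI(2)[OF o f])
  then have l: "linear (frechet_derivative f (at x))" by (rule has_derivative_linear)
  have "y * f' x = frechet_derivative f (at x) y" for y
  proof -
    have "frechet_derivative f (at x) (y *\<^sub>R 1) = y *\<^sub>R frechet_derivative f (at x) 1" by (rule linear_scale[OF l])
    then show ?thesis unfolding f'_def by (simp only: real_scaleR_def mult_1_right)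
  qed
  then show "(f has_real_derivative f' x) (at x)" by (rule has_derivative_imp_has_field_derivative[OF d])
qed

lemma DD_square_slope:
  assumes f: "0 < f t" "(f has_real_derivative f1 t) (at t)" "(f1 has_real_derivative f2 t) (at t)"
    "(f2 has_real_derivative f3 t) (at t)"
  shows "DD f t (\<lambda>t. 2 * f t ^ 2 * f1 t) (4 * f t ^ 2 * f1 t ^ 2 + 2 * f t ^ 3 * f2 t)"
    and "DD f t (\<lambda>t. 4 * f t ^ 2 * f1 t ^ 2 + 2 * f t ^ 3 * f2 t)
      (8 * f t ^ 2 * f1 t ^ 3 + 14 * f t ^ 3 * f1 t * f2 t + 2 * f t ^ 4 * f3 t)"
  unfolding DD_def
  by ((rule derivative_eq_intros refl f(2-4))+, use f(1) in \<open>simp add: field_simps eval_nat_numeral\<close>)+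

lemma integral_reflected:
  fixes F :: "real \<Rightarrow> real"
  assumes c: "(c = 0 \<and> \<sigma> = 1) \<or> (c = L \<and> \<sigma> = -1)" and i: "F integrable_on {0..L}" and L: "0 \<le> L"
  shows "((\<lambda>t. F (c + \<sigma> * t)) has_integral integral {0..L} F) {0..L}"
proof -
  have "(F has_integral integral {0..L} F) (cbox 0 L)" using integrable_integral[OF i] by simp
  from has_integral_affinity[OF this, of \<sigma> c] c
  have "((\<lambda>t. F (\<sigma> * t + c)) has_integral integral {0..L} F) ((\<lambda>x. (1 / \<sigma>) * x + - ((1 / \<sigma>) * c)) ` {0..L})" by auto
  moreover have "(\<lambda>x. (1 / \<sigma>) * x + - ((1 / \<sigma>) * c)) ` {0..L} = {0..L}"
    using c
  proof
    assume "c = L \<and> \<sigma> = -1"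
    moreover have "(\<lambda>x. L - x) ` {0..L} = {0..L}"
    proof -
      have "x \<in> (\<lambda>x. L - x) ` {0..L}" if "x \<in> {0..L}" for x by (rule image_eqI[of _ _ "L - x"]) (use that in auto)
      then show ?thesis by auto
    qed
    ultimately show ?thesis by simp
  qed simp
  ultimately show ?thesis by (simp add: add.commute)
qed

context revolution
begin

abbreviation "a1 \<equiv> \<lambda>s. frechet_derivative a (at s) 1"

lemma a_deriv: "s \<in> {0<..<L} \<Longrightarrow> (a has_real_derivative a1 s) (at s)" and cont_a1: "continuous_on {0<..<L} a1"
  by (rule smooth_real_derivative[OF open_greaterThanLessThan smooth_a]; assumption)+

text \<open>The derivative of the profile is positive somewhere to the left of every point before the maximum by the mean value theorem, and it
  has no other zero than the maximum; so it cannot change its sign.\<close>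

lemma profile_shape:
  obtains s0 where "0 < s0" "s0 < L" "critical_point L a s0"
    "\<And>s. s \<in> {0<..<s0} \<Longrightarrow> 0 < a1 s" "\<And>s. s \<in> {s0<..<L} \<Longrightarrow> a1 s < 0"
proof -
  obtain s0 where s0: "s0 \<in> {0<..<L}" "\<And>s. critical_point L a s \<longleftrightarrow> s = s0"
    using profile unfolding simple_profile_def by blast
  have aL: "a 0 = 0" "a L = 0" using profile unfolding simple_profile_def by auto
  have nz: "s = s0" if "s \<in> {0<..<L}" "a1 s = 0" for s
  proof -
    have "critical_point L a s"
      using a_deriv[OF that(1)] that unfolding critical_point_def by (auto intro: has_field_derivative_at_within)
    then show ?thesis using s0(2) by simp
  qed
  have cont: "continuous_on {p..q} a1" if "0 < p" "q < L" for p q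
    by (rule continuous_on_subset[OF cont_a1]) (use that in auto)
  have mvt: thesis if pq: "0 \<le> p" "p < q" "q \<le> L"
    and th: "\<And>z. p < z \<Longrightarrow> z < q \<Longrightarrow> a q - a p = (q - p) * a1 z \<Longrightarrow> thesis" for p q thesis
  proof -
    have "a differentiable (at x)" if "p < x" "x < q" for x
      using a_deriv[of x] pq that unfolding real_differentiable_def by auto
    moreover have "continuous_on {p..q} a" by (rule continuous_on_subset[OF continuous_a]) (use pq in auto)
    ultimately obtain d z where z: "p < z" "z < q" "(a has_real_derivative d) (at z)" "a q - a p = (q - p) * d"
      using MVT[OF pq(2), of a] by blast
    have "d = a1 z" by (rule DERIV_unique[OF z(3) a_deriv]) (use z pq in auto)
    then show thesis using th z by blast
  qed
  have 1: "0 < a1 s" if s: "s \<in> {0<..<s0}" for s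
  proof (rule ccontr)
    assume n: "\<not> 0 < a1 s"
    obtain z where z: "0 < z" "z < s" "a s - a 0 = (s - 0) * a1 z" by (rule mvt[of 0 s]) (use s s0 in auto)
    have "0 < s * a1 z" using z aL a_pos[of s] s s0 by auto
    then have "0 < a1 z" using s by (simp add: zero_less_mult_iff)
    then obtain y where "z \<le> y" "y \<le> s" "a1 y = 0"
      using IVT2'[of a1 s 0 z] n z cont[of z s] s s0 by auto
    then show False using nz[of y] z s s0 by auto
  qed
  have 2: "a1 s < 0" if s: "s \<in> {s0<..<L}" for s
  proof (rule ccontr)
    assume n: "\<not> a1 s < 0"
    obtain z where z: "s < z" "z < L" "a L - a s = (L - s) * a1 z" by (rule mvt[of s L]) (use s s0 in auto)
    have "(L - s) * a1 z < 0" using z aL a_pos[of s] s s0 by auto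
    then have "a1 z < 0" using s by (simp add: mult_less_0_iff)
    then obtain y where "s \<le> y" "y \<le> z" "a1 y = 0"
      using IVT2'[of a1 z 0 s] n z cont[of s z] s s0 by auto
    then show False using nz[of y] z s s0 by auto
  qed
  show ?thesis using that[of s0] s0 1 2 by auto
qed

end

context revolution_basis
begin

text \<open>The two hemispheres are treated at once: \<open>s = c + \<sigma> * t\<close> runs through the northern one for
  \<open>(c, \<sigma>) = (0, 1)\<close> and, backwards, through the southern one for \<open>(c, \<sigma>) = (L, -1)\<close>, so that the
  profile increases with \<open>t\<close> in both cases.\<close>

theorem hemisphere_amplitude:
  assumes c\<sigma>: "(c = 0 \<and> \<sigma> = 1) \<or> (c = L \<and> \<sigma> = -1)"
    and \<eta>: "0 < \<eta>" "\<eta> \<le> H / 2" and H: "H < L"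
    and pos: "\<And>t. t \<in> {0<..<H} \<Longrightarrow> 0 < \<sigma> * a1 (c + \<sigma> * t)"
  shows "\<exists>C l0. 0 \<le> C \<and> 1 \<le> l0 \<and> (\<forall>l W d n. l0 \<le> l \<longrightarrow> finite W \<longrightarrow> (\<forall>t\<in>{\<eta>..H - \<eta>}.
    (cmod (mode n (\<lambda>P. \<Sum>j\<in>W. d j * e j P) (\<Phi> (pt (c + \<sigma> * t) 0))))\<^sup>2 \<le>
     C * (integral {0..L} (\<lambda>s. a s * (cmod (mode n (\<lambda>P. \<Sum>j\<in>W. d j * e j P) (\<Phi> (pt s 0))))\<^sup>2)
       + l powr (-4/3) * integral {0..L} (\<lambda>s. a s * (cmod (mode n (\<lambda>P. \<Sum>j\<in>W. (of_real (l\<^sup>2 - (ev j)\<^sup>2) * d j) * e j P) (\<Phi> (pt s 0))))\<^sup>2))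
     * mode_bound l ((a (c + \<sigma> * t))\<^sup>2 - (of_int n)\<^sup>2 / l\<^sup>2)))"
proof -
  let ?s = "\<lambda>t. c + \<sigma> * t"
  have \<sigma>1: "\<sigma> * \<sigma> = 1" "\<sigma>\<^sup>2 = 1" "\<bar>\<sigma>\<bar> = 1" using c\<sigma> by auto
  have s: "?s t \<in> {0<..<L}" if "t \<in> {0<..<L}" for t using c\<sigma> that by auto
  have s': "?s t \<in> {0..L}" if "t \<in> {0..L}" for t using c\<sigma> that by auto
  note sm1 = smooth_real_derivative[OF open_greaterThanLessThan smooth_a]
  define a2 where "a2 s = frechet_derivative a1 (at s) 1" for s
  define a3 where "a3 s = frechet_derivative a2 (at s) 1" for s
  note sm2 = smooth_real_derivative[OF open_greaterThanLessThan sm1(1), folded a2_def]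
  note sm3 = smooth_real_derivative[OF open_greaterThanLessThan sm2(1), folded a3_def]
  let ?a = "\<lambda>t. a (?s t)" and ?a1 = "\<lambda>t. \<sigma> * a1 (?s t)" and ?a2 = "\<lambda>t. a2 (?s t)" and ?a3 = "\<lambda>t. \<sigma> * a3 (?s t)"
  have ds: "(?s has_real_derivative \<sigma>) (at t)" for t by (auto intro!: derivative_eq_intros)
  have chain: "((\<lambda>t. f (?s t)) has_real_derivative f' (?s t) * \<sigma>) (at t)"
    if "(f has_real_derivative f' (?s t)) (at (?s t))" for f f' t
    using DERIV_chain2[where f=f and g="?s" and x=t, OF that ds] .
  have d0: "(?a has_real_derivative ?a1 t) (at t)" if "t \<in> {0<..<L}" for t
    using chain[of a a1, OF sm1(2)[OF s[OF that]]] by (simp add: mult.commute)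
  have d1: "(?a1 has_real_derivative ?a2 t) (at t)" if "t \<in> {0<..<L}" for t
    by (rule DERIV_cong[OF DERIV_cmult[OF chain[of a1 a2, OF sm2(2)[OF s[OF that]]], of \<sigma>]]) (use c\<sigma> in auto)
  have d2: "(?a2 has_real_derivative ?a3 t) (at t)" if "t \<in> {0<..<L}" for t
    using chain[of a2 a3, OF sm3(2)[OF s[OF that]]] by (simp add: mult.commute)
  have cs: "continuous_on {0<..<L} (\<lambda>t. f (?s t))" if "continuous_on {0<..<L} f" for f :: "real \<Rightarrow> real"
    by (rule continuous_on_compose2[OF that]) (use s in \<open>auto intro!: continuous_intros\<close>)
  \<comment> \<open>\<open>b\<close>, \<open>b1\<close>, \<open>b2\<close> are the first three iterated \<open>D\<close>-derivatives of \<open>x = a\<^sup>2 - n\<^sup>2/l\<^sup>2\<close>.\<close>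
  define b where "b t = 2 * ?a t ^ 2 * ?a1 t" for t
  define b1 where "b1 t = 4 * ?a t ^ 2 * ?a1 t ^ 2 + 2 * ?a t ^ 3 * ?a2 t" for t
  define b2 where "b2 t = 8 * ?a t ^ 2 * ?a1 t ^ 3 + 14 * ?a t ^ 3 * ?a1 t * ?a2 t + 2 * ?a t ^ 4 * ?a3 t" for t
  have ap: "0 < ?a t" if "t \<in> {0<..<L}" for t using s[OF that] a_pos by auto
  have db: "DD ?a t b (b1 t)" "DD ?a t b1 (b2 t)" if t: "t \<in> {0<..<L}" for t
  proof -
    note D = DD_square_slope[where f = "?a" and ?f1.0 = "?a1" and ?f2.0 = "?a2" and ?f3.0 = "?a3", OF ap[OF t] d0[OF t] d1[OF t] d2[OF t]]
    show "DD ?a t b (b1 t)" unfolding b_def[abs_def] b1_def by (rule D(1))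
    show "DD ?a t b1 (b2 t)" unfolding b1_def[abs_def] b2_def by (rule D(2))
  qed
  have cb2: "continuous_on {0<..<L} b2"
    unfolding b2_def
    by (intro continuous_intros cs sm1(3) sm2(3) sm3(3) continuous_on_subset[OF continuous_a]) auto
  have lim: "(?a \<longlongrightarrow> 0) (at_right 0)"
  proof -
    have "continuous_on {0..L} ?a"
      by (rule continuous_on_compose2[OF continuous_a]) (use s' in \<open>auto intro!: continuous_intros\<close>)
    then have "(?a \<longlongrightarrow> ?a 0) (at 0 within {0..L})"
      unfolding continuous_on_def by (rule bspec) (use L_pos in simp)
    moreover have "?a 0 = 0" using c\<sigma> profile unfolding simple_profile_def by auto
    moreover have "at 0 within {0..L} = at_right 0" using L_pos by (rule at_within_Icc_at_right)
    ultimately show ?thesis by simp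
  qed
  have e: "H - \<eta> + \<eta> / 2 < H" using \<eta> by simp
  have "\<exists>C l0. 0 \<le> C \<and> 1 \<le> l0 \<and> (\<forall>l \<beta> u U \<gamma> B E. l0 \<le> l \<longrightarrow> 0 \<le> \<beta> \<longrightarrow>
    (\<forall>t\<in>{0<..H - \<eta> + \<eta> / 2}. DD ?a t u (U t) \<and> DD ?a t U (?a t ^ 2 * \<gamma> t - l^2 * (?a t ^ 2 - \<beta>) * u t)
        \<and> \<bar>u t\<bar> \<le> B \<and> \<bar>U t\<bar> \<le> B * ?a t) \<longrightarrow>
    continuous_on {0<..H - \<eta> + \<eta> / 2} \<gamma> \<longrightarrow>
    (\<forall>p q. 0 < p \<longrightarrow> p \<le> q \<longrightarrow> q \<le> H - \<eta> + \<eta> / 2 \<longrightarrow> integral {p..q} (\<lambda>t. u t ^ 2 * ?a t) \<le> E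
       \<and> integral {p..q} (\<lambda>t. \<gamma> t ^ 2 * ?a t) \<le> l powr (4/3) * E) \<longrightarrow>
    (\<forall>s\<in>{\<eta>..H - \<eta>}. u s ^ 2 \<le> C * E * mode_bound l (?a s ^ 2 - \<beta>)))"
  proof (rule mode_amplitude[where a' = ?a1 and b = b and ?b1.0 = b1 and ?b2.0 = b2])
    show "continuous_on {\<eta>..H - \<eta> + \<eta> / 2} b2" by (rule continuous_on_subset[OF cb2]) (use \<eta> H in auto)
  qed (use \<eta> H e ap d0 pos lim db in \<open>auto simp: b_def\<close>)
  then obtain C l0 where C: "0 \<le> C" "1 \<le> l0" and amp: "\<And>l \<beta> u U \<gamma> B E t. l0 \<le> l \<Longrightarrow> 0 \<le> \<beta> \<Longrightarrow>
    (\<forall>t\<in>{0<..H - \<eta> + \<eta> / 2}. DD ?a t u (U t) \<and> DD ?a t U (?a t ^ 2 * \<gamma> t - l^2 * (?a t ^ 2 - \<beta>) * u t)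
        \<and> \<bar>u t\<bar> \<le> B \<and> \<bar>U t\<bar> \<le> B * ?a t) \<Longrightarrow>
    continuous_on {0<..H - \<eta> + \<eta> / 2} \<gamma> \<Longrightarrow>
    (\<forall>p q. 0 < p \<longrightarrow> p \<le> q \<longrightarrow> q \<le> H - \<eta> + \<eta> / 2 \<longrightarrow> integral {p..q} (\<lambda>t. u t ^ 2 * ?a t) \<le> E
       \<and> integral {p..q} (\<lambda>t. \<gamma> t ^ 2 * ?a t) \<le> l powr (4/3) * E) \<Longrightarrow>
    t \<in> {\<eta>..H - \<eta>} \<Longrightarrow> u t ^ 2 \<le> C * E * mode_bound l (?a t ^ 2 - \<beta>)"
    by (elim exE conjE) (rule that, assumption+, blast)
  show ?thesis
  proof (rule exI[of _ "2 * C"], rule exI[of _ l0], intro conjI allI impI ballI)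
    fix l :: real and W :: "nat set" and d :: "nat \<Rightarrow> complex" and n :: int and t :: real
    assume l: "l0 \<le> l" and W: "finite W" and t: "t \<in> {\<eta>..H - \<eta>}"
    let ?l2 = "\<lambda>j. of_real (l\<^sup>2 - (ev j)\<^sup>2) :: complex"
    define u where "u s = mode n (\<lambda>P. \<Sum>j\<in>W. d j * e j P) (\<Phi> (pt s 0))" for s
    define \<gamma> where "\<gamma> s = mode n (\<lambda>P. \<Sum>j\<in>W. (?l2 j * d j) * e j P) (\<Phi> (pt s 0))" for s
    define w where "w j s = mode n (e j) (\<Phi> (pt s 0))" for j s
    have uw: "u s = (\<Sum>j\<in>W. d j * w j s)" and \<gamma>w: "\<gamma> s = (\<Sum>j\<in>W. (?l2 j * d j) * w j s)" for s
      unfolding u_def \<gamma>_def w_def by (rule mode_lincomb[OF W e_tame])+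
    have "\<exists>V B. (\<forall>s\<in>{0<..<L}. (w j has_vector_derivative V s /\<^sub>R a s) (at s) \<and>
      (V has_vector_derivative (((of_int n)\<^sup>2 - (ev j)\<^sup>2 * (a s)\<^sup>2) / a s) *\<^sub>R w j s) (at s) \<and>
      norm (w j s) \<le> B \<and> norm (V s) \<le> B * a s) \<and> 0 \<le> B" for j
    proof -
      have ce: "continuous_on S2 (e j)" using e_tame[of j] by (simp add: tame_def)
      show ?thesis
        unfolding w_def[abs_def]
        by (rule mode_ode[OF mode_eigenspace[OF e_eigenspace[of j] ev_nonneg, of n] mode_rot[OF ce]]) (assumption, blast)
    qed
    then obtain V B where VB: "\<And>j s. s \<in> {0<..<L} \<Longrightarrow> (w j has_vector_derivative V j s /\<^sub>R a s) (at s)"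
      "\<And>j s. s \<in> {0<..<L} \<Longrightarrow> (V j has_vector_derivative (((of_int n)\<^sup>2 - (ev j)\<^sup>2 * (a s)\<^sup>2) / a s) *\<^sub>R w j s) (at s)"
      "\<And>j s. s \<in> {0<..<L} \<Longrightarrow> norm (w j s) \<le> B j" "\<And>j s. s \<in> {0<..<L} \<Longrightarrow> norm (V j s) \<le> B j * a s" "\<And>j. 0 \<le> B j"
      by metis
    define U where "U s = (\<Sum>j\<in>W. d j * V j s)" for s
    define BB where "BB = (\<Sum>j\<in>W. cmod (d j) * B j)"
    have du: "(u has_vector_derivative U s /\<^sub>R a s) (at s)" if "s \<in> {0<..<L}" for s
    proof -
      have "((\<lambda>s. \<Sum>j\<in>W. d j * w j s) has_vector_derivative (\<Sum>j\<in>W. d j * (V j s /\<^sub>R a s))) (at s)"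
        by (intro has_vector_derivative_sum has_vector_derivative_mult_right VB(1)[OF that])
      then show ?thesis by (simp add: uw[abs_def] U_def scaleR_sum_right)
    qed
    have dU: "(U has_vector_derivative ((a s)\<^sup>2 *\<^sub>R \<gamma> s - (l\<^sup>2 * ((a s)\<^sup>2 - (of_int n)\<^sup>2 / l\<^sup>2)) *\<^sub>R u s) /\<^sub>R a s) (at s)"
      if s: "s \<in> {0<..<L}" for s
    proof -
      have l0: "l \<noteq> 0" "a s \<noteq> 0" using l C s a_pos[of s] by auto
      have "((\<lambda>s. \<Sum>j\<in>W. d j * V j s) has_vector_derivative
        (\<Sum>j\<in>W. d j * ((((of_int n)\<^sup>2 - (ev j)\<^sup>2 * (a s)\<^sup>2) / a s) *\<^sub>R w j s))) (at s)"
        by (intro has_vector_derivative_sum has_vector_derivative_mult_right VB(2)[OF s])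
      moreover have "(\<Sum>j\<in>W. d j * ((((of_int n)\<^sup>2 - (ev j)\<^sup>2 * (a s)\<^sup>2) / a s) *\<^sub>R w j s)) =
        ((a s)\<^sup>2 *\<^sub>R \<gamma> s - (l\<^sup>2 * ((a s)\<^sup>2 - (of_int n)\<^sup>2 / l\<^sup>2)) *\<^sub>R u s) /\<^sub>R a s"
        unfolding uw \<gamma>w scaleR_sum_right sum_subtractf[symmetric]
      proof (intro sum.cong refl)
        fix j
        have "((of_int n)\<^sup>2 - (ev j)\<^sup>2 * (a s)\<^sup>2) / a s =
          inverse (a s) * ((a s)\<^sup>2 * (l\<^sup>2 - (ev j)\<^sup>2) - l\<^sup>2 * ((a s)\<^sup>2 - (of_int n)\<^sup>2 / l\<^sup>2))"
          using l0 by (simp add: field_simps)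
        then have "d j * ((((of_int n)\<^sup>2 - (ev j)\<^sup>2 * (a s)\<^sup>2) / a s) *\<^sub>R w j s) =
          (inverse (a s) * ((a s)\<^sup>2 * (l\<^sup>2 - (ev j)\<^sup>2) - l\<^sup>2 * ((a s)\<^sup>2 - (of_int n)\<^sup>2 / l\<^sup>2))) *\<^sub>R (d j * w j s)" by simp
        also have "\<dots> = ((a s)\<^sup>2 *\<^sub>R (?l2 j * d j * w j s) - (l\<^sup>2 * ((a s)\<^sup>2 - (of_int n)\<^sup>2 / l\<^sup>2)) *\<^sub>R (d j * w j s)) /\<^sub>R a s"
        proof -
          have "?l2 j * d j * w j s = (l\<^sup>2 - (ev j)\<^sup>2) *\<^sub>R (d j * w j s)" by (simp only: scaleR_conv_of_real mult.assoc)
          then show ?thesis by (simp only: scaleR_scaleR scaleR_left_diff_distrib[symmetric])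
        qed
        finally show "d j * ((((of_int n)\<^sup>2 - (ev j)\<^sup>2 * (a s)\<^sup>2) / a s) *\<^sub>R w j s) =
          ((a s)\<^sup>2 *\<^sub>R (?l2 j * d j * w j s) - (l\<^sup>2 * ((a s)\<^sup>2 - (of_int n)\<^sup>2 / l\<^sup>2)) *\<^sub>R (d j * w j s)) /\<^sub>R a s" .
      qed
      ultimately show ?thesis by (simp only: U_def[abs_def])
    qed
    have bu: "cmod (u s) \<le> BB" "cmod (U s) \<le> BB * a s" if s: "s \<in> {0<..<L}" for s
      unfolding uw U_def BB_def sum_distrib_right
      by (rule sum_norm_le, use VB(3,4)[OF s] in \<open>auto simp: norm_mult mult.assoc intro!: mult_left_mono\<close>)+
    have ch: "continuous_on {0..L} (\<lambda>s. mode n (\<lambda>P. \<Sum>j\<in>W. D j * e j P) (\<Phi> (pt s 0)))" for D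
    proof -
      have "continuous_on {0..L} (\<lambda>s. mode n (e j) (\<Phi> (pt s 0)))" for j
        by (rule continuous_on_compose2[OF cont_coords])
          (use eigenspace_tame[OF mode_eigenspace[OF e_eigenspace ev_nonneg]] in \<open>auto simp: tame_def intro!: continuous_intros pt_cstrip\<close>)
      then show ?thesis unfolding mode_lincomb[OF W e_tame] by (intro continuous_intros)
    qed
    have cu: "continuous_on {0..L} u" and c\<gamma>: "continuous_on {0..L} \<gamma>" unfolding u_def[abs_def] \<gamma>_def[abs_def] by (rule ch)+
    define E where "E = integral {0..L} (\<lambda>s. a s * (cmod (u s))\<^sup>2) + l powr (-4/3) * integral {0..L} (\<lambda>s. a s * (cmod (\<gamma> s))\<^sup>2)"
    have nn: "0 \<le> integral {0..L} (\<lambda>s. a s * (cmod (f s))\<^sup>2)" if "continuous_on {0..L} f" for f :: "real \<Rightarrow> complex"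
      by (rule integral_nonneg) (auto intro!: integrable_continuous_real continuous_intros mult_nonneg_nonneg continuous_a that a_nonneg)
    have lp: "l powr (4/3) * l powr (-4/3) = 1" using l C by (simp add: powr_add[symmetric])
    have key: "(Q (u (?s t)))\<^sup>2 \<le> C * E * mode_bound l (?a t ^ 2 - (of_int n)\<^sup>2 / l\<^sup>2)"
      if Q: "bounded_linear Q" "\<And>z. \<bar>Q z\<bar> \<le> cmod z" for Q :: "complex \<Rightarrow> real"
    proof (rule amp[where U = "\<lambda>t. \<sigma> * Q (U (?s t))" and \<gamma> = "\<lambda>t. Q (\<gamma> (?s t))" and B = BB, OF l _ _ _ _ t])
      have lin: "linear Q" by (rule bounded_linear.linear[OF Q(1)])
      have vd: "((\<lambda>t. Q (f (?s t))) has_real_derivative \<sigma> * Q f') (at r)"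
        if "(f has_vector_derivative f') (at (?s r))" for f f' r
      proof -
        have "((f \<circ> ?s) has_vector_derivative \<sigma> *\<^sub>R f') (at r)"
          using vector_diff_chain_at[OF ds[of r, unfolded has_real_derivative_iff_has_vector_derivative] that] .
        from bounded_linear.has_vector_derivative[OF Q(1) this]
        show ?thesis unfolding has_real_derivative_iff_has_vector_derivative by (simp add: linear_scale[OF lin] comp_def)
      qed
      show "0 \<le> (of_int n)\<^sup>2 / l\<^sup>2" by simp
      show "\<forall>r\<in>{0<..H - \<eta> + \<eta> / 2}. DD ?a r (\<lambda>t. Q (u (?s t))) (\<sigma> * Q (U (?s r))) \<and>
        DD ?a r (\<lambda>t. \<sigma> * Q (U (?s t))) (?a r ^ 2 * Q (\<gamma> (?s r)) - l^2 * (?a r ^ 2 - (of_int n)\<^sup>2 / l\<^sup>2) * Q (u (?s r)))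
        \<and> \<bar>Q (u (?s r))\<bar> \<le> BB \<and> \<bar>\<sigma> * Q (U (?s r))\<bar> \<le> BB * ?a r"
      proof (intro ballI conjI)
        fix r assume "r \<in> {0<..H - \<eta> + \<eta> / 2}"
        then have sr: "?s r \<in> {0<..<L}" using e H by (intro s) auto
        show "DD ?a r (\<lambda>t. Q (u (?s t))) (\<sigma> * Q (U (?s r)))"
          using vd[OF du[OF sr]] unfolding DD_def by (simp add: linear_scale[OF lin] divide_inverse mult_ac)
        show "DD ?a r (\<lambda>t. \<sigma> * Q (U (?s t))) (?a r ^ 2 * Q (\<gamma> (?s r)) - l^2 * (?a r ^ 2 - (of_int n)\<^sup>2 / l\<^sup>2) * Q (u (?s r)))"
          using DERIV_cmult[OF vd[OF dU[OF sr]], of \<sigma>] \<sigma>1(1) unfolding DD_def mult.assoc[symmetric] 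
          by (simp add: linear_scale[OF lin] linear_diff[OF lin] divide_inverse mult.commute)
        show "\<bar>Q (u (?s r))\<bar> \<le> BB" using Q(2)[of "u (?s r)"] bu(1)[OF sr] by linarith
        show "\<bar>\<sigma> * Q (U (?s r))\<bar> \<le> BB * ?a r" using Q(2)[of "U (?s r)"] bu(2)[OF sr] \<sigma>1(3) by (simp add: abs_mult)
      qed
      have cQ: "continuous_on {0..L} (\<lambda>t. Q (f (?s t)))" if "continuous_on {0..L} f" for f
        by (intro bounded_linear.continuous_on[OF Q(1)] continuous_on_compose2[OF that]) (use s' in \<open>auto intro!: continuous_intros\<close>)
      show "continuous_on {0<..H - \<eta> + \<eta> / 2} (\<lambda>t. Q (\<gamma> (?s t)))"
        by (rule continuous_on_subset[OF cQ[OF c\<gamma>]]) (use e H in auto)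
      have mass: "integral {p..q} (\<lambda>t. (Q (f (?s t)))\<^sup>2 * ?a t) \<le> integral {0..L} (\<lambda>s. a s * (cmod (f s))\<^sup>2)"
        if f: "continuous_on {0..L} f" and pq: "0 < p" "p \<le> q" "q \<le> H - \<eta> + \<eta> / 2" for f p q
      proof -
        have sub: "{p..q} \<subseteq> {0..L}" using pq e H by auto
        have ca: "continuous_on {0..L} ?a"
          by (rule continuous_on_compose2[OF continuous_a]) (use s' in \<open>auto intro!: continuous_intros\<close>)
        have i: "(\<lambda>t. (Q (f (?s t)))\<^sup>2 * ?a t) integrable_on {0..L}"
          by (intro integrable_continuous_real continuous_intros cQ f ca)
        have hi: "((\<lambda>t. a (?s t) * (cmod (f (?s t)))\<^sup>2) has_integral integral {0..L} (\<lambda>s. a s * (cmod (f s))\<^sup>2)) {0..L}"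
          by (rule integral_reflected[OF c\<sigma>]) (use L_pos in \<open>auto intro!: integrable_continuous_real continuous_intros continuous_a f\<close>)
        have "integral {p..q} (\<lambda>t. (Q (f (?s t)))\<^sup>2 * ?a t) \<le> integral {0..L} (\<lambda>t. (Q (f (?s t)))\<^sup>2 * ?a t)"
          by (rule integral_subset_le[OF sub integrable_on_subinterval[OF i sub] i]) (use s' a_nonneg in auto)
        also have "\<dots> \<le> integral {0..L} (\<lambda>t. a (?s t) * (cmod (f (?s t)))\<^sup>2)"
        proof (rule integral_le[OF i has_integral_integrable[OF hi]])
          fix r assume "r \<in> {0..L}"
          have "(Q (f (?s r)))\<^sup>2 \<le> (cmod (f (?s r)))\<^sup>2" using power_mono[OF Q(2)[of "f (?s r)"], of 2] by simp
          then show "(Q (f (?s r)))\<^sup>2 * ?a r \<le> a (?s r) * (cmod (f (?s r)))\<^sup>2"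
            using a_nonneg[of "?s r"] s'[OF \<open>r \<in> {0..L}\<close>] by (subst mult.commute) (intro mult_left_mono, auto)
        qed
        also have "\<dots> = integral {0..L} (\<lambda>s. a s * (cmod (f s))\<^sup>2)" by (rule integral_unique[OF hi])
        finally show ?thesis .
      qed
      show "\<forall>p q. 0 < p \<longrightarrow> p \<le> q \<longrightarrow> q \<le> H - \<eta> + \<eta> / 2 \<longrightarrow> integral {p..q} (\<lambda>t. (Q (u (?s t)))\<^sup>2 * ?a t) \<le> E
       \<and> integral {p..q} (\<lambda>t. (Q (\<gamma> (?s t)))\<^sup>2 * ?a t) \<le> l powr (4/3) * E"
      proof (intro allI impI conjI)
        fix p q assume pq: "0 < p" "p \<le> q" "q \<le> H - \<eta> + \<eta> / 2"
        show "integral {p..q} (\<lambda>t. (Q (u (?s t)))\<^sup>2 * ?a t) \<le> E"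
          using mass[OF cu pq] nn[OF c\<gamma>] unfolding E_def by (simp add: add_increasing2)
        have "integral {p..q} (\<lambda>t. (Q (\<gamma> (?s t)))\<^sup>2 * ?a t) \<le> (l powr (4/3) * l powr (-4/3)) * integral {0..L} (\<lambda>s. a s * (cmod (\<gamma> s))\<^sup>2)"
          unfolding lp using mass[OF c\<gamma> pq] by simp
        also have "\<dots> \<le> l powr (4/3) * E"
          unfolding E_def mult.assoc using nn[OF cu] by (intro mult_left_mono) auto
        finally show "integral {p..q} (\<lambda>t. (Q (\<gamma> (?s t)))\<^sup>2 * ?a t) \<le> l powr (4/3) * E" .
      qed
    qed
    have "(cmod (u (?s t)))\<^sup>2 = (Re (u (?s t)))\<^sup>2 + (Im (u (?s t)))\<^sup>2" by (rule cmod_power2)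
    also have "\<dots> \<le> 2 * (C * E * mode_bound l (?a t ^ 2 - (of_int n)\<^sup>2 / l\<^sup>2))"
      using key[OF bounded_linear_Re abs_Re_le_cmod] key[OF bounded_linear_Im abs_Im_le_cmod] by simp
    finally show "(cmod (mode n (\<lambda>P. \<Sum>j\<in>W. d j * e j P) (\<Phi> (pt (?s t) 0))))\<^sup>2 \<le> 2 * C * 
       (integral {0..L} (\<lambda>s. a s * (cmod (mode n (\<lambda>P. \<Sum>j\<in>W. d j * e j P) (\<Phi> (pt s 0))))\<^sup>2)
       + l powr (-4/3) * integral {0..L} (\<lambda>s. a s * (cmod (mode n (\<lambda>P. \<Sum>j\<in>W. (?l2 j * d j) * e j P) (\<Phi> (pt s 0))))\<^sup>2))
       * mode_bound l ((a (?s t))\<^sup>2 - (of_int n)\<^sup>2 / l\<^sup>2)"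
      unfolding E_def u_def \<gamma>_def by (simp only: mult.assoc)
  qed (use C in auto)
qed

end


section \<open>The spectral projector\<close>

context revolution
begin

text \<open>The coordinates of the points of \<open>K\<close> form a compact set on which the distance of \<open>s\<close> to the poles and the
  equator is positive.\<close>

lemma compact_interior_coordinates:
  assumes K: "compact K" "K \<subseteq> S2 - (poles L \<Phi> \<union> equator L a \<Phi>)" and s0: "critical_point L a s0"
  obtains \<eta> where "0 < \<eta>" "\<And>P. P \<in> K \<Longrightarrow> \<exists>s \<theta>. P = \<Phi> (pt s \<theta>) \<and> \<eta> \<le> s \<and> s \<le> L - \<eta> \<and> \<eta> \<le> \<bar>s - s0\<bar>"
proof -
  define T where "T = {x \<in> cbox (pt 0 0) (pt L (2 * pi)). \<Phi> x \<in> K}"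
  have sub: "cbox (pt 0 0) (pt L (2 * pi)) \<subseteq> cstrip" by (auto simp: mem_box_cart forall_2 cstrip_def)
  have "closed T"
  proof -
    have "closed (cbox (pt 0 0) (pt L (2 * pi)) \<inter> \<Phi> -` K)"
      by (rule continuous_closed_preimage[OF continuous_on_subset[OF cont_Phi sub] closed_cbox compact_imp_closed[OF K(1)]])
    moreover have "T = cbox (pt 0 0) (pt L (2 * pi)) \<inter> \<Phi> -` K" by (auto simp: T_def)
    ultimately show ?thesis by simp
  qed
  then have cT: "compact T" using compact_Int_closed[OF compact_cbox] unfolding T_def
    by (metis (no_types, lifting) Int_absorb1 mem_Collect_eq subsetI)
  define d where "d x = min (x $ 1) (min (L - x $ 1) \<bar>x $ 1 - s0\<bar>)" for x :: "real^2"
  have d0: "0 < d x" if "x \<in> T" for x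
  proof -
    have x: "x \<in> cstrip" "\<Phi> x \<in> K" using that sub by (auto simp: T_def)
    have "x $ 1 \<noteq> 0" "x $ 1 \<noteq> L" using K(2) x(2) unfolding poles_def by blast+
    moreover have "x $ 1 \<noteq> s0" using K(2) x(2) s0 unfolding equator_def by blast
    ultimately show ?thesis using x(1) by (auto simp: d_def cstrip_def)
  qed
  have "\<exists>\<eta>>0. \<forall>x\<in>T. \<eta> \<le> d x"
  proof (cases "T = {}")
    case False
    have "continuous_on T d" unfolding d_def by (intro continuous_intros)
    then obtain x where "x \<in> T" "\<forall>y\<in>T. d x \<le> d y" using continuous_attains_inf[OF cT False] by blast
    then show ?thesis using d0 by blast
  qed (auto intro: exI[of _ 1])
  then obtain \<eta> where \<eta>: "0 < \<eta>" "\<And>x. x \<in> T \<Longrightarrow> \<eta> \<le> d x" by blast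
  show ?thesis
  proof (rule that[OF \<eta>(1)])
    fix P assume P: "P \<in> K"
    then have "P \<in> S2" using K by blast
    then obtain x where x: "x \<in> cstrip" "0 \<le> x $ 2" "x $ 2 \<le> 2 * pi" "\<Phi> x = P" using Phi_surj by blast
    then have "x \<in> T" using P by (auto simp: T_def mem_box_cart forall_2 cstrip_def)
    then have "\<eta> \<le> d x" by (rule \<eta>(2))
    then show "\<exists>s \<theta>. P = \<Phi> (pt s \<theta>) \<and> \<eta> \<le> s \<and> s \<le> L - \<eta> \<and> \<eta> \<le> \<bar>s - s0\<bar>"
      using x(4) pt_eta[of x] by (intro exI[of _ "x $ 1"] exI[of _ "x $ 2"]) (auto simp: d_def)
  qed
qed

end

context revolution_basis
begin

lemma norm_lincomb:
  assumes "finite W" shows "Re (L2_inner MM (\<lambda>P. \<Sum>j\<in>W. d j * e j P) (\<lambda>P. \<Sum>j\<in>W. d j * e j P)) = (\<Sum>j\<in>W. (cmod (d j))\<^sup>2)"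
proof -
  let ?h = "\<lambda>P. \<Sum>j\<in>W. d j * e j P"
  have th: "tame ?h" by (rule tame_lincomb[OF assms e_tame])
  have "L2_inner MM ?h ?h = (\<Sum>j\<in>W. d j * L2_inner MM (e j) ?h)" by (rule L2_inner_lincomb[OF assms e_tame th])
  also have "\<dots> = (\<Sum>j\<in>W. of_real ((cmod (d j))\<^sup>2))"
  proof (intro sum.cong refl)
    fix j assume "j \<in> W"
    then have "L2_inner MM (e j) ?h = cnj (d j)"
      by (subst L2_inner_cnj) (simp add: L2_inner_e[OF assms])
    then show "d j * L2_inner MM (e j) ?h = of_real ((cmod (d j))\<^sup>2)" by (simp only: complex_norm_square)
  qed
  finally show ?thesis by (simp flip: of_real_sum)
qed

lemma bessel_basis:
  assumes f: "square_integrable MM f" and W: "finite W"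
  shows "(\<Sum>j\<in>W. (cmod (L2_inner MM f (e j)))\<^sup>2) \<le> (LINT P|MM. (cmod (f P))\<^sup>2)"
proof -
  let ?d = "\<lambda>j. L2_inner MM f (e j)"
  let ?h = "\<lambda>P. \<Sum>j\<in>W. ?d j * e j P"
  have th: "tame ?h" by (rule tame_lincomb[OF W e_tame])
  have sets: "sets MM = sets borel" by (simp add: riemannian_measure_def)
  have mf: "f \<in> borel_measurable MM" and i2: "integrable MM (\<lambda>P. (cmod (f P))\<^sup>2)"
    using f by (auto simp: square_integrable_def)
  have mt: "u \<in> borel_measurable MM" if "tame u" for u
    using tame_measurable[OF that] measurable_cong_sets[OF sets refl] by blast
  have i3: "integrable MM (\<lambda>P. (cmod (u P))\<^sup>2)" if "tame u" for u
  proof -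
    have "integrable MM (\<lambda>P. Re (u P * cnj (u P)))" by (rule integrable_Re[OF tame_integrable[OF tame_mult_cnj[OF that that]]])
    then show ?thesis by (simp only: complex_norm_square[symmetric] Re_complex_of_real)
  qed
  have ifu: "integrable MM (\<lambda>P. f P * cnj (u P))" if u: "tame u" for u
  proof (rule Bochner_Integration.integrable_bound)
    show "integrable MM (\<lambda>P. (cmod (f P))\<^sup>2 + (cmod (u P))\<^sup>2)" by (intro Bochner_Integration.integrable_add i2 i3 u)
    show "(\<lambda>P. f P * cnj (u P)) \<in> borel_measurable MM"
    proof -
      have "(\<lambda>P. cnj (u P)) \<in> borel_measurable MM"
        by (rule mt) (use u in \<open>auto simp: tame_def intro!: continuous_intros\<close>)
      then show ?thesis by (intro borel_measurable_times mf)
    qed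
    have "x * y \<le> x\<^sup>2 + y\<^sup>2" if "0 \<le> x" "0 \<le> y" for x y :: real
      using sum_squares_bound[of x y] that mult_nonneg_nonneg[OF that] by linarith
    then show "AE P in MM. norm (f P * cnj (u P)) \<le> norm ((cmod (f P))\<^sup>2 + (cmod (u P))\<^sup>2)"
      by (intro AE_I2) (simp add: norm_mult)
  qed
  have "L2_inner MM f ?h = (LINT P|MM. (\<Sum>j\<in>W. cnj (?d j) * (f P * cnj (e j P))))"
    unfolding L2_inner_def[of MM f ?h] by (simp add: sum_distrib_left mult_ac)
  also have "\<dots> = (\<Sum>j\<in>W. (LINT P|MM. cnj (?d j) * (f P * cnj (e j P))))"
    by (intro Bochner_Integration.integral_sum integrable_mult_right ifu e_tame)
  also have "\<dots> = (\<Sum>j\<in>W. cnj (?d j) * ?d j)" by (simp add: L2_inner_def)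
  also have "\<dots> = (\<Sum>j\<in>W. of_real ((cmod (?d j))\<^sup>2))"
    by (intro sum.cong refl) (simp only: complex_norm_square mult.commute)
  finally have fh: "Re (L2_inner MM f ?h) = (\<Sum>j\<in>W. (cmod (?d j))\<^sup>2)" by (simp flip: of_real_sum)
  have fh': "(LINT P|MM. Re (f P * cnj (?h P))) = (\<Sum>j\<in>W. (cmod (?d j))\<^sup>2)"
    using fh integral_Re[OF ifu[OF th]] by (simp add: L2_inner_def)
  have hh: "(LINT P|MM. (cmod (?h P))\<^sup>2) = (\<Sum>j\<in>W. (cmod (?d j))\<^sup>2)"
  proof -
    have "(LINT P|MM. (cmod (?h P))\<^sup>2) = (LINT P|MM. Re (?h P * cnj (?h P)))"
      by (simp only: complex_norm_square[symmetric] Re_complex_of_real)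
    also have "\<dots> = Re (L2_inner MM ?h ?h)"
      unfolding L2_inner_def[of MM ?h ?h] by (rule integral_Re[OF tame_integrable[OF tame_mult_cnj[OF th th]]])
    finally show ?thesis using norm_lincomb[OF W] by simp
  qed
  have iR: "integrable MM (\<lambda>P. Re (f P * cnj (?h P)))" by (rule integrable_Re[OF ifu[OF th]])
  have "0 \<le> (LINT P|MM. (cmod (f P - ?h P))\<^sup>2)" by (rule Bochner_Integration.integral_nonneg) simp
  also have "\<dots> = (LINT P|MM. ((cmod (f P))\<^sup>2 - 2 * Re (f P * cnj (?h P)) + (cmod (?h P))\<^sup>2))"
    by (simp only: cmod_diff_square)
  also have "\<dots> = (LINT P|MM. (cmod (f P))\<^sup>2) - 2 * (LINT P|MM. Re (f P * cnj (?h P))) + (LINT P|MM. (cmod (?h P))\<^sup>2)"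
    using i2 iR i3[OF th] by (simp only: Bochner_Integration.integral_add Bochner_Integration.integral_diff
        Bochner_Integration.integrable_diff integrable_mult_right integral_mult_right_zero)
  finally show ?thesis unfolding fh' hh by simp
qed

definition band :: "real \<Rightarrow> nat set" where
  "band l = {j. ev j \<in> {l - l powr (-1/3)..l + l powr (-1/3)}}"

lemma finite_band: "finite (band l)"
  by (rule finite_subset[OF _ finite_ev[of "l + l powr (-1/3)"]]) (auto simp: band_def)

text \<open>The Weyl remainder is taken at both ends of the window; the main terms differ by \<open>O (l \<delta>) = O (l\<^sup>2\<^sup>/\<^sup>3)\<close>. The
  left end is moved to \<open>l - 2 \<delta>\<close> because \<open>weyl_count\<close> includes the eigenvalue at the end point.\<close>

lemma card_band:
  assumes "\<exists>c::real. (\<lambda>x::real. real (weyl_count ev x) - c * x\<^sup>2) \<in> O(\<lambda>x. x powr (2/3))"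
  obtains C l0 where "0 \<le> C" "1 \<le> l0" "\<And>l. l0 \<le> l \<Longrightarrow> real (card (band l)) \<le> C * l powr (2/3)"
proof -
  obtain c where "(\<lambda>x::real. real (weyl_count ev x) - c * x\<^sup>2) \<in> O(\<lambda>x. x powr (2/3))" using assms by blast
  then obtain k where k: "0 < k" "eventually (\<lambda>x. norm (real (weyl_count ev x) - c * x\<^sup>2) \<le> k * norm (x powr (2/3))) at_top"
    by (rule landau_o.bigE)
  then obtain x0 where x0: "\<And>x. x0 \<le> x \<Longrightarrow> \<bar>real (weyl_count ev x) - c * x\<^sup>2\<bar> \<le> k * x powr (2/3)"
    unfolding eventually_at_top_linorder by auto
  show ?thesis
  proof (rule that[of "9 * \<bar>c\<bar> + 4 * k" "max 2 (x0 + 2)"])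
    fix l assume l: "max 2 (x0 + 2) \<le> l"
    define \<delta> where "\<delta> = l powr (-1/3)"
    have \<delta>: "0 < \<delta>" "\<delta> \<le> 1" using l powr_mono[of "-1/3" 0 l] by (auto simp: \<delta>_def)
    have ld1: "l * \<delta> = l powr (2/3)" using l powr_add[of l 1 "-1/3"] by (simp add: \<delta>_def)
    have ld2: "1 \<le> l powr (2/3)" using l by (simp add: ge_one_powr_ge_zero)
    note ld = ld1 ld2
    have band: "band l = {j. l - \<delta> \<le> ev j \<and> ev j \<le> l + \<delta>}" unfolding band_def \<delta>_def by auto
    let ?N = "\<lambda>x. real (weyl_count ev x)"
    have "card (band l) + weyl_count ev (l - 2 * \<delta>) \<le> weyl_count ev (l + \<delta>)"
    proof -
      have "card (band l) + weyl_count ev (l - 2 * \<delta>) = card (band l \<union> {j. ev j \<le> l - 2 * \<delta>})"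
        unfolding weyl_count_def by (rule card_Un_disjoint[symmetric, OF finite_band finite_ev]) (use \<delta> in \<open>auto simp: band\<close>)
      also have "\<dots> \<le> weyl_count ev (l + \<delta>)"
        unfolding weyl_count_def by (rule card_mono[OF finite_ev]) (use \<delta> in \<open>auto simp: band\<close>)
      finally show ?thesis .
    qed
    then have "real (card (band l)) \<le> ?N (l + \<delta>) - ?N (l - 2 * \<delta>)" by linarith
    also have "\<dots> \<le> (c * (l + \<delta>)\<^sup>2 + k * (l + \<delta>) powr (2/3)) - (c * (l - 2 * \<delta>)\<^sup>2 - k * (l - 2 * \<delta>) powr (2/3))"
      using x0[of "l + \<delta>"] x0[of "l - 2 * \<delta>"] l \<delta> by linarith
    also have "\<dots> = c * (6 * (l * \<delta>) - 3 * \<delta>\<^sup>2) + k * ((l + \<delta>) powr (2/3) + (l - 2 * \<delta>) powr (2/3))"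
      by (simp add: power2_eq_square algebra_simps)
    also have "\<dots> \<le> \<bar>c\<bar> * (9 * l powr (2/3)) + k * (2 * l powr (2/3) + 2 * l powr (2/3))"
    proof (intro add_mono mult_left_mono)
      have d2: "\<delta>\<^sup>2 \<le> 1" using \<delta> by (simp add: power_le_one)
      have "\<bar>6 * x - 3 * y\<bar> \<le> 9 * x" if "1 \<le> x" "0 \<le> y" "y \<le> 1" for x y :: real
        using that by (auto simp: abs_if)
      then have "\<bar>6 * (l * \<delta>) - 3 * \<delta>\<^sup>2\<bar> \<le> 9 * l powr (2/3)"
        unfolding ld(1) using d2 ld(2) zero_le_power2[of \<delta>] by blast
      then have "\<bar>c\<bar> * \<bar>6 * (l * \<delta>) - 3 * \<delta>\<^sup>2\<bar> \<le> \<bar>c\<bar> * (9 * l powr (2/3))" by (rule mult_left_mono) simp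
      then show "c * (6 * (l * \<delta>) - 3 * \<delta>\<^sup>2) \<le> \<bar>c\<bar> * (9 * l powr (2/3))" unfolding abs_mult[symmetric] by linarith
      have "(l + \<delta>) powr (2/3) \<le> (2 * l) powr (2/3)" using l \<delta> by (intro powr_mono2) auto
      also have "\<dots> \<le> 2 * l powr (2/3)"
        using powr_mono[of "2/3" 1 2] l by (simp add: powr_mult mult_right_mono)
      finally show "(l + \<delta>) powr (2/3) \<le> 2 * l powr (2/3)" .
      have "(l - 2 * \<delta>) powr (2/3) \<le> l powr (2/3)" using l \<delta> by (intro powr_mono2) auto
      then show "(l - 2 * \<delta>) powr (2/3) \<le> 2 * l powr (2/3)" using ld(2) by linarith
      show "0 \<le> k" using k by simp
    qed
    finally show "real (card (band l)) \<le> (9 * \<bar>c\<bar> + 4 * k) * l powr (2/3)" by (simp add: algebra_simps)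
  qed (use k in auto)
qed

text \<open>Cauchy-Schwarz over the modes, between the masses (with total at most \<open>(1 + 9) / 2\<pi>\<close>, the 9 from
  \<open>\<bar>l\<^sup>2 - ev\<^sub>j\<^sup>2\<bar> \<le> 3 l\<^sup>2\<^sup>/\<^sup>3\<close>) and the values of \<open>mode_bound\<close>.\<close>

theorem band_estimate:
  assumes weyl: "\<exists>c::real. (\<lambda>x::real. real (weyl_count ev x) - c * x\<^sup>2) \<in> O(\<lambda>x. x powr (2/3))"
    and K: "compact K" "K \<subseteq> S2 - (poles L \<Phi> \<union> equator L a \<Phi>)"
  obtains C l0 where "0 \<le> C" "1 \<le> l0" "\<And>l d P. l0 \<le> l \<Longrightarrow> (\<Sum>j\<in>band l. (cmod (d j))\<^sup>2) \<le> 1 \<Longrightarrow> P \<in> K \<Longrightarrow>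
    cmod (\<Sum>j\<in>band l. d j * e j P) \<le> C * l powr (5/12)"
proof -
  obtain s0 where s0: "0 < s0" "s0 < L" "critical_point L a s0"
    "\<And>s. s \<in> {0<..<s0} \<Longrightarrow> 0 < a1 s" "\<And>s. s \<in> {s0<..<L} \<Longrightarrow> a1 s < 0"
    using profile_shape by blast
  obtain \<eta>0 where \<eta>0: "0 < \<eta>0" "\<And>P. P \<in> K \<Longrightarrow> \<exists>s \<theta>. P = \<Phi> (pt s \<theta>) \<and> \<eta>0 \<le> s \<and> s \<le> L - \<eta>0 \<and> \<eta>0 \<le> \<bar>s - s0\<bar>"
    using compact_interior_coordinates[OF K s0(3)] by blast
  define \<eta> where "\<eta> = min \<eta>0 (min (s0 / 2) ((L - s0) / 2))"
  have \<eta>1: "0 < \<eta>" unfolding \<eta>_def using \<eta>0(1) s0(1,2) by simp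
  have \<eta>2: "\<eta> \<le> \<eta>0" unfolding \<eta>_def by linarith
  have \<eta>3: "\<eta> \<le> s0 / 2" unfolding \<eta>_def by linarith
  have \<eta>4: "\<eta> \<le> (L - s0) / 2" unfolding \<eta>_def by linarith
  note \<eta> = \<eta>1 \<eta>2 \<eta>3 \<eta>4
  let ?h = "\<lambda>W d P. \<Sum>j\<in>W. d j * e j P" and ?k = "\<lambda>l W d P. \<Sum>j\<in>W. (of_real (l\<^sup>2 - (ev j)\<^sup>2) * d j) * e j P"
  let ?m = "\<lambda>n h. integral {0..L} (\<lambda>s. a s * (cmod (mode n h (\<Phi> (pt s 0))))\<^sup>2)"
  let ?E = "\<lambda>l W d n. ?m n (?h W d) + l powr (-4/3) * ?m n (?k l W d)"
  have "\<exists>C l0. 0 \<le> C \<and> 1 \<le> l0 \<and> (\<forall>l W d n. l0 \<le> l \<longrightarrow> finite W \<longrightarrow> (\<forall>t\<in>{\<eta>..s0 - \<eta>}.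
    (cmod (mode n (?h W d) (\<Phi> (pt (0 + 1 * t) 0))))\<^sup>2 \<le> C * ?E l W d n * mode_bound l ((a (0 + 1 * t))\<^sup>2 - (of_int n)\<^sup>2 / l\<^sup>2)))"
    by (rule hemisphere_amplitude) (use s0 \<eta> in auto)
  then obtain C1 l1 where C1: "0 \<le> C1" "1 \<le> l1" and h1: "\<And>l W d n t. l1 \<le> l \<Longrightarrow> finite W \<Longrightarrow> t \<in> {\<eta>..s0 - \<eta>} \<Longrightarrow>
    (cmod (mode n (?h W d) (\<Phi> (pt t 0))))\<^sup>2 \<le> C1 * ?E l W d n * mode_bound l ((a t)\<^sup>2 - (of_int n)\<^sup>2 / l\<^sup>2)"
    by (elim exE conjE) (rule that, assumption+, simp)
  have "\<exists>C l0. 0 \<le> C \<and> 1 \<le> l0 \<and> (\<forall>l W d n. l0 \<le> l \<longrightarrow> finite W \<longrightarrow> (\<forall>t\<in>{\<eta>..(L - s0) - \<eta>}.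
    (cmod (mode n (?h W d) (\<Phi> (pt (L + - 1 * t) 0))))\<^sup>2 \<le> C * ?E l W d n * mode_bound l ((a (L + - 1 * t))\<^sup>2 - (of_int n)\<^sup>2 / l\<^sup>2)))"
    by (rule hemisphere_amplitude) (use s0 \<eta> in auto)
  then obtain C2 l2 where C2: "0 \<le> C2" "1 \<le> l2" and h2': "\<And>l W d n t. l2 \<le> l \<Longrightarrow> finite W \<Longrightarrow> t \<in> {\<eta>..(L - s0) - \<eta>} \<Longrightarrow>
    (cmod (mode n (?h W d) (\<Phi> (pt (L - t) 0))))\<^sup>2 \<le> C2 * ?E l W d n * mode_bound l ((a (L - t))\<^sup>2 - (of_int n)\<^sup>2 / l\<^sup>2)"
    by (elim exE conjE) (rule that, assumption+, simp)
  have h2: "(cmod (mode n (?h W d) (\<Phi> (pt s 0))))\<^sup>2 \<le> C2 * ?E l W d n * mode_bound l ((a s)\<^sup>2 - (of_int n)\<^sup>2 / l\<^sup>2)"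
    if "l2 \<le> l" "finite W" "s \<in> {s0 + \<eta>..L - \<eta>}" for l W d n s
    using h2'[OF that(1,2), of "L - s" n d] that(3) by simp
  obtain a0 where a0: "0 < a0" "\<And>s. s \<in> {\<eta>..L - \<eta>} \<Longrightarrow> a0 \<le> a s"
  proof -
    have ne: "{\<eta>..L - \<eta>} \<noteq> {}" using \<eta> s0 by auto
    have "continuous_on {\<eta>..L - \<eta>} a" by (rule continuous_on_subset[OF continuous_a]) (use \<eta> in auto)
    then obtain x where x: "x \<in> {\<eta>..L - \<eta>}" "\<forall>y\<in>{\<eta>..L - \<eta>}. a x \<le> a y"
      using continuous_attains_inf[OF compact_Icc ne] by blast
    show ?thesis by (rule that[of "a x"]) (use x \<eta> a_pos[of x] in auto)
  qed
  obtain Cw lw where Cw: "0 \<le> Cw" "1 \<le> lw" "\<And>l. lw \<le> l \<Longrightarrow> real (card (band l)) \<le> Cw * l powr (2/3)"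
    using card_band[OF weyl] by blast
  obtain C3 where C3: "0 \<le> C3" and sb: "\<And>l A (S :: int set). 1 \<le> l \<Longrightarrow> a0 \<le> A \<Longrightarrow> finite S \<Longrightarrow> real (card S) \<le> Cw * l powr (2/3) \<Longrightarrow>
    (\<Sum>n\<in>S. mode_bound l (A\<^sup>2 - (of_int n)\<^sup>2 / l\<^sup>2)) \<le> C3 * l powr (5/6)"
    using sum_mode_bound[OF a0(1) Cw(1)] by blast
  define C where "C = C1 + C2"
  define l0 where "l0 = max l1 (max l2 lw)"
  show ?thesis
  proof (rule that[of "sqrt (C * 2 * C3)" l0])
    show "0 \<le> sqrt (C * 2 * C3)" using C1 C2 C3 by (simp add: C_def)
    show "1 \<le> l0" using C1 by (simp add: l0_def)
    fix l d P assume l: "l0 \<le> l" and d: "(\<Sum>j\<in>band l. (cmod (d j))\<^sup>2) \<le> 1" and P: "P \<in> K"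
    have ls: "l1 \<le> l" "l2 \<le> l" "lw \<le> l" "1 \<le> l" using l C1 by (auto simp: l0_def)
    let ?W = "band l"
    let ?H = "?h ?W d" and ?K = "?k l ?W d"
    define S where "S = {n. \<exists>j\<in>?W. mode n (e j) \<noteq> (\<lambda>_. 0)}"
    have cl: "i \<in> ?W" if "j \<in> ?W" "ev i = ev j" for i j using that by (simp add: band_def)
    have am1: "finite S" unfolding S_def by (rule active_modes(1)[OF finite_band]) (erule cl, assumption)
    have am2: "card S \<le> card ?W" unfolding S_def by (rule active_modes(2)[OF finite_band]) (erule cl, assumption)
    note am = am1 am2
    have cS: "real (card S) \<le> Cw * l powr (2/3)" using am(2) Cw(3)[OF ls(3)] by linarith
    obtain s \<theta> where P\<theta>: "P = \<Phi> (pt s \<theta>)" and s: "\<eta>0 \<le> s" "s \<le> L - \<eta>0" "\<eta>0 \<le> \<bar>s - s0\<bar>" using \<eta>0(2)[OF P] by blast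
    have sL: "s \<in> {0..L}" and s\<eta>: "s \<in> {\<eta>..L - \<eta>}" using s \<eta> by auto
    have PS: "P \<in> S2" using K P by blast
    let ?mb = "\<lambda>n. mode_bound l ((a s)\<^sup>2 - (of_int n)\<^sup>2 / l\<^sup>2)"
    have tH: "tame ?H" and tK: "tame ?K" by (rule tame_lincomb[OF finite_band e_tame])+
    have tm: "tame (mode n (?h ?W D))" for n D
    proof -
      have "mode n (?h ?W D) = (\<lambda>P. \<Sum>j\<in>?W. D j * mode n (e j) P)"
        by (rule ext) (rule mode_lincomb[OF finite_band e_tame])
      then show ?thesis
        using tame_lincomb[OF finite_band eigenspace_tame[OF mode_eigenspace[OF e_eigenspace ev_nonneg]]] by simp
    qed
    have nn: "0 \<le> ?m n (?h ?W D)" for n D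
    proof (rule integral_nonneg)
      have "continuous_on {0..L} (\<lambda>s. mode n (?h ?W D) (\<Phi> (pt s 0)))"
        by (rule continuous_on_compose2[OF cont_coords]) (use tm[of n D] in \<open>auto simp: tame_def intro!: continuous_intros pt_cstrip\<close>)
      then show "(\<lambda>s. a s * (cmod (mode n (?h ?W D) (\<Phi> (pt s 0))))\<^sup>2) integrable_on {0..L}"
        by (intro integrable_continuous_real continuous_intros continuous_a)
    qed (auto intro!: mult_nonneg_nonneg a_nonneg)
    have E0: "0 \<le> ?E l ?W d n" for n
      by (intro add_nonneg_nonneg mult_nonneg_nonneg) (rule nn, simp, rule nn)
    have mb0: "0 \<le> ?mb n" for n by (auto simp: mode_bound_def)
    have amp: "(cmod (mode n ?H P))\<^sup>2 \<le> (C * ?E l ?W d n) * ?mb n" for n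
    proof -
      have "mode n ?H P = cis (of_int n * \<theta>) * mode n ?H (\<Phi> (pt s 0))"
        unfolding P\<theta> Phi_pt_rot[OF sL, of \<theta>] by (rule mode_rot) (use tH Phi_pt_S2[OF sL] in \<open>auto simp: tame_def\<close>)
      then have "cmod (mode n ?H P) = cmod (mode n ?H (\<Phi> (pt s 0)))" by (simp add: norm_mult)
      moreover have "(cmod (mode n ?H (\<Phi> (pt s 0))))\<^sup>2 \<le> C * ?E l ?W d n * ?mb n"
      proof (cases "s < s0")
        case True
        have "(cmod (mode n ?H (\<Phi> (pt s 0))))\<^sup>2 \<le> C1 * ?E l ?W d n * ?mb n"
          by (rule h1[OF ls(1) finite_band]) (use True s \<eta> in auto)
        also have "\<dots> \<le> C * ?E l ?W d n * ?mb n"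
          by (rule mult_right_mono[OF mult_right_mono[OF _ E0] mb0]) (use C2 in \<open>simp add: C_def\<close>)
        finally show ?thesis .
      next
        case False
        have "(cmod (mode n ?H (\<Phi> (pt s 0))))\<^sup>2 \<le> C2 * ?E l ?W d n * ?mb n"
          by (rule h2[OF ls(2) finite_band]) (use False s \<eta> in auto)
        also have "\<dots> \<le> C * ?E l ?W d n * ?mb n"
          by (rule mult_right_mono[OF mult_right_mono[OF _ E0] mb0]) (use C1 in \<open>simp add: C_def\<close>)
        finally show ?thesis .
      qed
      ultimately show ?thesis by simp
    qed
    have sumE: "(\<Sum>n\<in>S. ?E l ?W d n) \<le> 2"
    proof -
      have mass: "(\<Sum>n\<in>S. ?m n (?h ?W D)) \<le> (\<Sum>j\<in>?W. (cmod (D j))\<^sup>2) / (2 * pi)" for D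
      proof -
        have "(\<Sum>n\<in>S. 2 * pi * ?m n (?h ?W D)) \<le> Re (L2_inner MM (?h ?W D) (?h ?W D))"
          by (rule mode_mass[OF tame_lincomb[OF finite_band e_tame] tm am(1)])
        then have "2 * pi * (\<Sum>n\<in>S. ?m n (?h ?W D)) \<le> (\<Sum>j\<in>?W. (cmod (D j))\<^sup>2)"
          unfolding norm_lincomb[OF finite_band] sum_distrib_left .
        then show ?thesis by (simp add: pos_le_divide_eq mult.commute)
      qed
      have kk: "(\<Sum>j\<in>?W. (cmod (of_real (l\<^sup>2 - (ev j)\<^sup>2) * d j))\<^sup>2) \<le> 9 * l powr (4/3)"
      proof -
        have "(cmod (of_real (l\<^sup>2 - (ev j)\<^sup>2) * d j))\<^sup>2 \<le> 9 * l powr (4/3) * (cmod (d j))\<^sup>2" if j: "j \<in> ?W" for j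
        proof -
          define \<delta> where "\<delta> = l powr (-1/3)"
          have \<delta>: "0 < \<delta>" "\<delta> \<le> l" using ls(4) powr_mono[of "-1/3" 1 l] by (auto simp: \<delta>_def)
          have dj: "\<bar>l - ev j\<bar> \<le> \<delta>" using j by (auto simp: band_def \<delta>_def abs_le_iff)
          have "\<bar>l\<^sup>2 - (ev j)\<^sup>2\<bar> = \<bar>l - ev j\<bar> * (l + ev j)"
          proof -
            have "l\<^sup>2 - (ev j)\<^sup>2 = (l - ev j) * (l + ev j)" by (simp add: power2_eq_square algebra_simps)
            then show ?thesis using ls(4) ev_nonneg[of j] by (simp add: abs_mult)
          qed
          also have "\<dots> \<le> \<delta> * (3 * l)" using dj \<delta> ls(4) ev_nonneg[of j] by (intro mult_mono) auto
          also have "\<dots> = 3 * l powr (2/3)"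
            using ls(4) powr_add[of l 1 "-1/3"] by (simp add: \<delta>_def mult.commute)
          finally have "\<bar>l\<^sup>2 - (ev j)\<^sup>2\<bar>\<^sup>2 \<le> (3 * l powr (2/3))\<^sup>2" by (rule power_mono) simp
          also have "\<dots> = 9 * l powr (4/3)"
            using powr_add[of l "2/3" "2/3"] by (simp add: power_mult_distrib power2_eq_square)
          finally have "\<bar>l\<^sup>2 - (ev j)\<^sup>2\<bar>\<^sup>2 * (cmod (d j))\<^sup>2 \<le> 9 * l powr (4/3) * (cmod (d j))\<^sup>2" by (rule mult_right_mono) simp
          then show ?thesis by (simp only: norm_mult norm_of_real power_mult_distrib)
        qed
        then have "(\<Sum>j\<in>?W. (cmod (of_real (l\<^sup>2 - (ev j)\<^sup>2) * d j))\<^sup>2) \<le> (\<Sum>j\<in>?W. 9 * l powr (4/3) * (cmod (d j))\<^sup>2)" by (rule sum_mono)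
        also have "\<dots> = 9 * l powr (4/3) * (\<Sum>j\<in>?W. (cmod (d j))\<^sup>2)" by (simp only: sum_distrib_left)
        also have "\<dots> \<le> 9 * l powr (4/3) * 1" using d by (intro mult_left_mono) auto
        finally show ?thesis by simp
      qed
      have "(\<Sum>n\<in>S. ?E l ?W d n) = (\<Sum>n\<in>S. ?m n ?H) + l powr (-4/3) * (\<Sum>n\<in>S. ?m n ?K)"
        by (simp only: sum.distrib sum_distrib_left)
      also have "\<dots> \<le> 1 / (2 * pi) + l powr (-4/3) * (9 * l powr (4/3) / (2 * pi))"
      proof (intro add_mono mult_left_mono)
        show "(\<Sum>n\<in>S. ?m n ?H) \<le> 1 / (2 * pi)" using mass[of d] divide_right_mono[OF d, of "2 * pi"] by simp
        show "(\<Sum>n\<in>S. ?m n ?K) \<le> 9 * l powr (4/3) / (2 * pi)"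
          by (rule order_trans[OF mass divide_right_mono[OF kk]]) simp
      qed simp
      also have "l powr (-4/3) * (9 * l powr (4/3) / (2 * pi)) = 9 / (2 * pi)"
        using ls(4) powr_add[of l "-4/3" "4/3"] by (simp add: mult.left_commute)
      also have "1 / (2 * pi) + 9 / (2 * pi) \<le> 2" using pi_gt3 by (simp add: add_divide_distrib[symmetric] divide_le_eq)
      finally show ?thesis by simp
    qed
    have "cmod (?H P) \<le> (\<Sum>n\<in>S. cmod (mode n ?H P))"
    proof -
      have "mode n ?H P = 0" if "n \<notin> S" for n
        unfolding mode_lincomb[OF finite_band e_tame] using that by (auto simp: S_def intro!: sum.neutral)
      then show ?thesis using mode_reconstruction[OF tH PS am(1)] norm_sum[of "\<lambda>n. mode n ?H P" S] by simp
    qed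
    also have "\<dots> \<le> (\<Sum>n\<in>S. sqrt (C * ?E l ?W d n) * sqrt (?mb n))"
      unfolding real_sqrt_mult[symmetric] by (intro sum_mono real_le_rsqrt amp)
    finally have "(cmod (?H P))\<^sup>2 \<le> (\<Sum>n\<in>S. sqrt (C * ?E l ?W d n) * sqrt (?mb n))\<^sup>2" by (rule power_mono) simp
    also have "\<dots> \<le> (\<Sum>n\<in>S. (sqrt (C * ?E l ?W d n))\<^sup>2) * (\<Sum>n\<in>S. (sqrt (?mb n))\<^sup>2)"
      by (rule Cauchy_Schwarz_ineq_sum)
    also have "\<dots> = (C * (\<Sum>n\<in>S. ?E l ?W d n)) * (\<Sum>n\<in>S. ?mb n)"
    proof -
      have "0 \<le> C * ?E l ?W d n" for n using E0[of n] C1 C2 by (simp add: C_def)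
      then show ?thesis using mb0 by (simp only: real_sqrt_pow2 sum_distrib_left)
    qed
    also have "\<dots> \<le> (C * 2) * (C3 * l powr (5/6))"
    proof (rule mult_mono[OF mult_left_mono[OF sumE] sb])
      show "1 \<le> l" by (rule ls(4))
      show "a0 \<le> a s" by (rule a0(2)[OF s\<eta>])
      show "finite S" by (rule am(1))
      show "real (card S) \<le> Cw * l powr (2/3)" by (rule cS)
      show "0 \<le> C" "0 \<le> C * 2" using C1 C2 by (simp_all add: C_def)
      show "0 \<le> (\<Sum>n\<in>S. ?mb n)" by (rule sum_nonneg) (rule mb0)
    qed
    also have "\<dots> = (sqrt (C * 2 * C3) * l powr (5/12))\<^sup>2"
    proof -
      have "(l powr (5/12))\<^sup>2 = l powr (5/6)" using powr_add[of l "5/12" "5/12"] by (simp add: power2_eq_square)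
      moreover have "(sqrt (C * 2 * C3))\<^sup>2 = C * 2 * C3" using C1 C2 C3 by (simp add: C_def)
      ultimately show ?thesis by (simp only: power_mult_distrib mult.assoc)
    qed
    finally show "cmod (?H P) \<le> sqrt (C * 2 * C3) * l powr (5/12)"
      by (rule power2_le_imp_le) (use C1 C2 C3 in \<open>simp add: C_def\<close>)
  qed
qed

text \<open>For large \<open>l\<close> this is \<open>band_estimate\<close>, applied to the coefficients of \<open>f\<close>, which satisfy Bessel's
  inequality. On a bounded range of \<open>l\<close> only finitely many eigenfunctions occur, and \<open>l\<close> is bounded below.\<close>

theorem projector_bound:
  assumes weyl: "\<exists>c::real. (\<lambda>x::real. real (weyl_count ev x) - c * x\<^sup>2) \<in> O(\<lambda>x. x powr (2/3))"
    and K: "compact K" "K \<subseteq> S2 - (poles L \<Phi> \<union> equator L a \<Phi>)" and \<Lambda>0: "0 < \<Lambda>0"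
  shows "\<exists>C::real. \<forall>l\<ge>\<Lambda>0. norm_L2_to_Linf MM K (spectral_projector MM ev e l (l powr (-1/3))) \<le> ennreal (C * l powr (1/2 - 1/12))"
proof -
  obtain C l0 where C: "0 \<le> C" "1 \<le> l0" "\<And>l d P. l0 \<le> l \<Longrightarrow> (\<Sum>j\<in>band l. (cmod (d j))\<^sup>2) \<le> 1 \<Longrightarrow> P \<in> K \<Longrightarrow>
    cmod (\<Sum>j\<in>band l. d j * e j P) \<le> C * l powr (5/12)"
    using band_estimate[OF weyl K] by blast
  define J where "J = {j. ev j \<le> l0 + \<Lambda>0 powr (-1/3)}"
  have fJ: "finite J" unfolding J_def by (rule finite_ev)
  have "\<exists>B\<ge>0. \<forall>P\<in>S2. cmod (e j P) \<le> B" for j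
  proof -
    have "smooth_on S2 (e j)" using e_eigenspace[of j] by (simp add: eigenspace_def)
    then show ?thesis by (rule smooth_on_S2_bounded) blast
  qed
  then obtain B where B: "\<And>j. 0 \<le> B j" "\<And>j P. P \<in> S2 \<Longrightarrow> cmod (e j P) \<le> B j" by metis
  define D where "D = (\<Sum>j\<in>J. B j) / \<Lambda>0 powr (5/12)"
  have D0: "0 \<le> D" unfolding D_def using B(1) by (intro divide_nonneg_nonneg sum_nonneg) auto
  have pw: "cmod (\<Sum>j\<in>band l. d j * e j P) \<le> (C + D) * l powr (5/12)"
    if l: "\<Lambda>0 \<le> l" and d: "(\<Sum>j\<in>band l. (cmod (d j))\<^sup>2) \<le> 1" and P: "P \<in> K" for l d P
  proof (cases "l0 \<le> l")
    case True
    have "cmod (\<Sum>j\<in>band l. d j * e j P) \<le> C * l powr (5/12)" by (rule C(3)[OF True d P])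
    also have "\<dots> \<le> (C + D) * l powr (5/12)" using D0 by (intro mult_right_mono) auto
    finally show ?thesis .
  next
    case False
    have "l powr (-1/3) \<le> \<Lambda>0 powr (-1/3)" using l \<Lambda>0 by (intro powr_mono2') auto
    then have sub: "band l \<subseteq> J" using False by (auto simp: band_def J_def)
    have PS: "P \<in> S2" using P K by blast
    have "cmod (d j * e j P) \<le> B j" if j: "j \<in> band l" for j
    proof -
      have "(cmod (d j))\<^sup>2 \<le> (\<Sum>j\<in>band l. (cmod (d j))\<^sup>2)" by (rule member_le_sum[OF j]) (auto simp: finite_band)
      then have "(cmod (d j))\<^sup>2 \<le> 1\<^sup>2" using d by simp
      then have "cmod (d j) \<le> 1" by (rule power2_le_imp_le) simp
      then have "cmod (d j) * cmod (e j P) \<le> 1 * B j" using B(2)[OF PS] by (intro mult_mono) auto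
      then show ?thesis by (simp add: norm_mult)
    qed
    then have "cmod (\<Sum>j\<in>band l. d j * e j P) \<le> (\<Sum>j\<in>band l. B j)" by (rule sum_norm_le)
    also have "\<dots> \<le> (\<Sum>j\<in>J. B j)" by (rule sum_mono2[OF fJ sub]) (rule B(1))
    also have "\<dots> = D * \<Lambda>0 powr (5/12)" using \<Lambda>0 by (simp add: D_def)
    also have "\<dots> \<le> D * l powr (5/12)" using l \<Lambda>0 D0 by (intro mult_left_mono powr_mono2) auto
    also have "\<dots> \<le> (C + D) * l powr (5/12)" using C(1) by (intro mult_right_mono) auto
    finally show ?thesis .
  qed
  show ?thesis
  proof (rule exI[of _ "C + D"], intro allI impI)
    fix l assume l: "\<Lambda>0 \<le> l"
    show "norm_L2_to_Linf MM K (spectral_projector MM ev e l (l powr (-1/3))) \<le> ennreal ((C + D) * l powr (1/2 - 1/12))"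
      unfolding norm_L2_to_Linf_def
    proof (intro SUP_least ennreal_leI)
      fix f P assume f: "f \<in> {f. square_integrable MM f \<and> (LINT x|MM. (norm (f x))\<^sup>2) \<le> 1}" and P: "P \<in> K"
      have "(\<Sum>j\<in>band l. (cmod (L2_inner MM f (e j)))\<^sup>2) \<le> 1"
        using bessel_basis[OF _ finite_band, of f l] f by simp
      from pw[OF l this P]
      show "norm (spectral_projector MM ev e l (l powr (-1/3)) f P) \<le> (C + D) * l powr (1/2 - 1/12)"
        by (simp add: spectral_projector_def band_def)
    qed
  qed
qed

end

section \<open>The estimate on compact sets away from the poles and the equator\<close>

theorem theorem1p1:
  fixes g :: metric and L :: real and a :: "real \<Rightarrow> real" and \<Phi> :: "real^2 \<Rightarrow> real^3"
    and ev :: "nat \<Rightarrow> real" and e :: "nat \<Rightarrow> real^3 \<Rightarrow> complex"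
    and K :: "(real^3) set" and \<Lambda>\<^sub>0 :: real
  defines "M \<equiv> riemannian_measure g L \<Phi>"
  assumes "simple_metric_of_revolution g L a \<Phi>"
    and "laplace_eigenbasis g M ev e"
    and "\<exists>c::real. (\<lambda>x::real. real (weyl_count ev x) - c * x\<^sup>2) \<in> O(\<lambda>x. x powr (2/3))"
    and "compact K" and "K \<subseteq> S2 - (poles L \<Phi> \<union> equator L a \<Phi>)"
    and "\<Lambda>\<^sub>0 > 0"
  shows "\<exists>C::real. \<forall>\<Lambda>\<ge>\<Lambda>\<^sub>0.
     norm_L2_to_Linf M K (spectral_projector M ev e \<Lambda> (\<Lambda> powr (-1/3)))
       \<le> ennreal (C * \<Lambda> powr (1/2 - 1/12))"
proof -
  interpret revolution_basis g L a \<Phi> ev e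
    by unfold_locales (use assms(2,3) in \<open>simp_all add: M_def\<close>)
  show ?thesis
    unfolding M_def using assms(4) assms(5) assms(6) assms(7) by (rule projector_bound)
qed

end
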